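(* Let $\Omega$ be an open, connected, proper subset of $\mathbb{R}^n$, $n\ge3$. Assume that (A1)--(A7) as well as properties (BB) and (H) (all stated in the context) hold. Then the continuous Green matrix $\mathbf{G}$ of $\mathcal{L}$ in $\Omega$ satisfies the following global estimates: $$\|\mathbf{G}(\cdot,y)\|_{Y^{1,2}(\Omega\setminus B_r(y))}+\|\mathbf{G}(x,\cdot)\|_{Y^{1,2}(\Omega\setminus B_r(x))}\le Cr^{1-n/2},\quad\forall r>0,$$ $$\|\mathbf{G}(\cdot,y)\|_{L^q(\Omega_r(y))}+\|\mathbf{G}(x,\cdot)\|_{L^q(\Omega_r(x))}\le C_qr^{2-n+\frac nq},\quad\forall r>0,\ \forall q\in[1,\tfrac n{n-2}),$$ $$\|D\mathbf{G}(\cdot,y)\|_{L^q(\Omega_r(y))}+\|D\mathbf{G}(x,\cdot)\|_{L^q(\Omega_r(x))}\le C_qr^{1-n+\frac nq},\quad\forall r>0,\ \forall q\in[1,\tfrac n{n-1}),$$ $$|\{x\in\Omega:|\mathbf{G}(x,y)|>\tau\}|+|\{y\in\Omega:|\mathbf{G}(x,y)|>\tau\}|\le C\tau^{-\frac n{n-2}},\quad\forall\tau>0,$$ $$|\{x\in\Omega:|D_x\mathbf{G}(x,y)|>\tau\}|+|\{y\in\Omega:|D_y\mathbf{G}(x,y)|>\tau\}|\le C\tau^{-\frac n{n-1}},\quad\forall\tau>0,$$ $$|\mathbf{G}(x,y)|\le C|x-y|^{2-n}\quad\forall x\ne y,$$ where the constants depend on $n,N,c_0,\Gamma,\gamma$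 and the constants from the Caccioppoli inequality in (A7) and from (BB), and each $C_q$ depends additionally on $q$. The following H\"older continuity estimates also hold: with $d_{x,y}=\min(d_x,d_y,|x-y|)$, $d_x=\operatorname{dist}(x,\partial\Omega)$, for any $0<R\le R_0<\frac12d_{x,y}$, $$|\mathbf{G}(x,y)-\mathbf{G}(z,y)|\le C_{R_0}C\Big(\frac{|x-z|}R\Big)^\eta R^{2-n}\ \text{ whenever }|x-z|<\tfrac R2,\qquad|\mathbf{G}(x,y)-\mathbf{G}(x,z)|\le C_{R_0}C\Big(\frac{|y-z|}R\Big)^\eta R^{2-n}\ \text{ whenever }|y-z|<\tfrac R2,$$ where $C_{R_0}$ and $\eta=\eta(R_0)$ are the same as in (H).
   Context: Conventions. Repeated indices are summed ($\alpha,\beta\in\{1,\dots,n\}$, $i,j\in\{1,\dots,N\}$); $n\ge3$, $N\ge1$; all functions are real valued; $B_r(x)$ is the ball of radius $r$ centered at $x$ (written $B_r$ when the center is understood; balls $B_r$, $B_{2r}$ etc. in one formula are concentric); $\Omega\subset\mathbb{R}^n$ is open and connected, $\Omega_r(x)=\Omega\cap B_r(x)$ (written $\Omega_r$ when the center $x\in\Omega$ is understood); $2^*=\frac{2n}{n-2}$; ⨍ denotes the average; $\frac1\ell=0$ if $\ell=\infty$; $L^\infty_c$ denotes bounded compactly supported functions. $Y^{1,2}(\Omega)$ is the space of weakly differentiable $u\in L^{2^*}(\Omega)$ with $Du\in L^2(\Omega)$, with norm $\|u\|^2_{Y^{1,2}(\Omega)}=\|u\|^2_{L^{2^*}(\Omega)}+\|Du\|^2_{L^2(\Omega)}$;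 $Y^{1,2}_0(\Omega)$ is the closure of $C_c^\infty(\Omega)$ in it, and $\|\mathbf{u}\|_{Y_0^{1,2}(\Omega)^N}=\|D\mathbf{u}\|_{L^2(\Omega)}$. Operator. $\mathbf{A}^{\alpha\beta}=(A^{\alpha\beta}_{ij})$ are bounded measurable $N\times N$ matrices on $\Omega$ with $A^{\alpha\beta}_{ij}(x)\xi^j_\beta\xi^i_\alpha\ge\lambda\sum_{i,\alpha}|\xi^i_\alpha|^2$ and $\sum_{i,j,\alpha,\beta}|A^{\alpha\beta}_{ij}(x)|^2\le\Lambda^2$, $0<\lambda,\Lambda<\infty$. The lower order coefficients satisfy $\mathbf{V}\in L^p_{\rm loc}(\Omega)^{N\times N}$, $\mathbf{b}\in L^s_{\rm loc}(\Omega)^{n\times N\times N}$, $\mathbf{d}\in L^t_{\rm loc}(\Omega)^{n\times N\times N}$ for some $p\in(\frac n2,\infty]$, $s,t\in(n,\infty]$. Put $\mathcal{L}\mathbf{u}=-D_\alpha(\mathbf{A}^{\alpha\beta}D_\beta\mathbf{u}+\mathbf{b}^\alpha\mathbf{u})+\mathbf{d}^\beta D_\beta\mathbf{u}+\mathbf{V}\mathbf{u}$, with bilinear form $$\mathcal{B}[\mathbf{u},\mathbf{v}]=\int_\Omega A_{ij}^{\alpha\beta}D_\beta u^jD_\alpha v^i+b_{ij}^\alpha u^jD_\alpha v^i+d_{ij}^\beta D_\beta u^j v^i+V_{ij}u^jv^i,$$ and $\mathcal{L}^*\mathbf{u}=-D_\alpha[(\mathbf{A}^{\beta\alpha})^TD_\beta\mathbf{u}+(\mathbf{d}^\alpha)^T\mathbf{u}]+(\mathbf{b}^\beta)^TD_\beta\mathbf{u}+\mathbf{V}^T\mathbf{u}$,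 with form $\mathcal{B}^*[\mathbf{u},\mathbf{v}]=\mathcal{B}[\mathbf{v},\mathbf{u}]$. $\mathcal{L}\mathbf{u}=\mathbf{f}$ in $U$ is understood weakly: $\mathcal{B}[\mathbf{u},\mathbf{v}]=\int\mathbf{f}\cdot\mathbf{v}$ for all $\mathbf{v}\in C_c^\infty(U)^N$; likewise for $\mathcal{L}^*$ with $\mathcal{B}^*$. Function spaces. To every open set $\Omega\subset\mathbb{R}^n$ under consideration there is associated a Banach space $\mathbf{F}(\Omega)$ of weakly differentiable, $\mathbb{R}^N$-valued $L^1_{\rm loc}(\Omega)$ functions; $\mathbf{F}_0(\Omega)$ is the closure of $C_c^\infty(\Omega)^N$ in $\mathbf{F}(\Omega)$. Assumptions (for these spaces and for $\mathcal{L},\mathcal{L}^*$): (A1) If $U\subset\Omega$ and $\mathbf{u}\in\mathbf{F}(\Omega)$ then $\mathbf{u}|_U\in\mathbf{F}(U)$ and $\|\mathbf{u}|_U\|_{\mathbf{F}(U)}\le\|\mathbf{u}\|_{\mathbf{F}(\Omega)}$. (A2) $C_c^\infty(\Omega)^N\subset\mathbf{F}(\Omega)$, and $\mathbf{F}_0(\Omega)$ is a Hilbert space with respect to some norm equivalent to $\|\cdot\|_{\mathbf{F}(\Omega)}$. (A3) $\mathbf{F}_0(\Omega)$ embeds continuously into $Y^{1,2}_0(\Omega)^N$: $\|\mathbf{u}\|_{Y_0^{1,2}(\Omega)^N}\le c_0\|\mathbf{u}\|_{\mathbf{F}(\Omega)}$ for $\mathbf{u}\in\mathbf{F}_0(\Omega)$.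 (A4) For any open connected $U\subset\mathbb{R}^n$ and $\mathbf{u}\in\mathbf{F}(\Omega)$: if $\xi\in C_c^\infty(U)$ then $\mathbf{u}\xi\in\mathbf{F}(\Omega\cap U)$; if $\xi\in C_c^\infty(\Omega\cap U)$ then $\mathbf{u}\xi\in\mathbf{F}_0(\Omega\cap U)$; and $\|\mathbf{u}\xi\|_{\mathbf{F}(\Omega\cap U)}\le C_\xi\|\mathbf{u}\|_{\mathbf{F}(\Omega)}$. (A5) $\mathcal{B}$ extends to $\mathbf{F}_0(\Omega)\times\mathbf{F}_0(\Omega)$ with $\mathcal{B}[\mathbf{u},\mathbf{v}]\le\Gamma\|\mathbf{u}\|_{\mathbf{F}}\|\mathbf{v}\|_{\mathbf{F}}$ for a constant $\Gamma>0$. (A6) There is $\gamma>0$ with $\gamma\|\mathbf{u}\|_{\mathbf{F}}^2\le\mathcal{B}[\mathbf{u},\mathbf{u}]$ for all $\mathbf{u}\in\mathbf{F}_0(\Omega)$. (A7) (Caccioppoli inequality, for $\mathcal{L}$ and for $\mathcal{L}^*$) If $U\subset\Omega$ is open, $\mathbf{u}\in\mathbf{F}(U)$ is a weak solution of $\mathcal{L}\mathbf{u}=\mathbf{0}$ in $U$, $\zeta\in C^\infty(\mathbb{R}^n)$ with $D\zeta\in C_c^\infty(\mathbb{R}^n)$, $\zeta\mathbf{u}\in\mathbf{F}_0(U)$ and $\partial^i\zeta\,\mathbf{u}\in L^2(U)^N$, $i=1,\dots,n$, then $\int|D\mathbf{u}|^2\zeta^2\le C\int|\mathbf{u}|^2|D\zeta|^2$,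 where $C$ depends on $n,s,t,\gamma,\Gamma,\|\mathbf{b}\|_{L^s(\Omega)},\|\mathbf{d}\|_{L^t(\Omega)}$ but not on $U$ nor on the sets where $\zeta$, $D\zeta$ are supported. Vanishing on the boundary. For $\mathbf{u}\in\mathbf{F}(\Omega)$ and $U$ open, "$\mathbf{u}=\mathbf{0}$ on $U\cap\partial\Omega$" means $\mathbf{u}\xi\in\mathbf{F}_0(\Omega)$ for every $\xi\in C_c^\infty(U)$; similarly, for $\mathbf{u}\in\mathbf{F}(\Omega_{2R})$, "$\mathbf{u}=\mathbf 0$ on $\partial\Omega\cap B_R$" means $\mathbf{u}\xi\in\mathbf{F}_0(\Omega_{2R})$ for every $\xi\in C_c^\infty(B_R)$. Local properties. (BB) holds in $\Omega$ if whenever $\mathbf{u}\in\mathbf{F}(\Omega_{2R})$ is a weak solution to $\mathcal{L}\mathbf{u}=\mathbf{f}$ or $\mathcal{L}^*\mathbf{u}=\mathbf{f}$ in $\Omega_R$, for some $R>0$, where $\mathbf{f}\in L^\ell(\Omega_R)^N$ for some $\ell\in(\frac n2,\infty]$, and $\mathbf{u}\equiv\mathbf{0}$ on $\partial\Omega\cap B_R$, then $\mathbf{u}$ is a bounded function and for any $q>0$, $\|\mathbf{u}\|_{L^\infty(\Omega_{R/2})}\le C[R^{-\frac nq}\|\mathbf{u}\|_{L^q(\Omega_R)}+R^{2-\frac n\ell}\|\mathbf{f}\|_{L^\ell(\Omega_R)}]$, where $C$ is independent of $R$. (H) holds in $\Omega$ if whenever $\mathbf{u}\in\mathbf{F}(B_{2R_0})$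 is a weak solution to $\mathcal{L}\mathbf{u}=\mathbf{0}$ or $\mathcal{L}^*\mathbf{u}=\mathbf{0}$ in $B_{R_0}$ for some $B_{2R_0}\subset\Omega$, $R_0>0$, then there exist $\eta\in(0,1)$, depending on $R_0$, and $C_{R_0}>0$ so that whenever $0<R\le R_0$, $\sup_{x,y\in B_{R/2},x\ne y}\frac{|\mathbf{u}(x)-\mathbf{u}(y)|}{|x-y|^\eta}\le C_{R_0}R^{-\eta}\big(⨍_{B_R}|\mathbf{u}|^{2^*}\big)^{1/2^*}$. Green matrix. A matrix function $\mathbf{G}(x,y)=(G_{ij}(x,y))_{i,j=1}^N$ on $\{(x,y)\in\Omega\times\Omega:x\ne y\}$ is the Green matrix of $\mathcal{L}$ if: 1) $\mathbf{G}(\cdot,y)$ is locally integrable and for all $y\in\Omega$, $k$ and $\phi\in C_c^\infty(\Omega)^N$, $\int_\Omega A_{ij}^{\alpha\beta}D_\beta G_{jk}(\cdot,y)D_\alpha\phi^i+b_{ij}^\alpha G_{jk}(\cdot,y)D_\alpha\phi^i+d_{ij}^\beta D_\beta G_{jk}(\cdot,y)\phi^i+V_{ij}G_{jk}(\cdot,y)\phi^i=\phi^k(y)$; 2) for all $y\in\Omega$ and $r>0$, $\mathbf{G}(\cdot,y)\in Y^{1,2}(\Omega\setminus\Omega_r(y))^{N\times N}$; in addition $\mathbf{G}(\cdot,y)$ vanishes on $\partial\Omega$ in the sense that for every $\zeta\in C_c^\infty(\Omega)$ with $\zeta\equiv1$ on $B_r(y)$ for some $r>0$, $(1-\zeta)\mathbf{G}(\cdot,y)\in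 Y_0^{1,2}(\Omega\setminus\Omega_r(y))^{N\times N}$; 3) for any $\mathbf{f}\in L_c^\infty(\Omega)^N$, the function $\mathbf{u}$ given by $u^k(y)=\int_\Omega G_{jk}(x,y)f^j(x)\,dx$ belongs to $\mathbf{F}_0(\Omega)$ and satisfies $\mathcal{L}^*\mathbf{u}=\mathbf{f}$ weakly, i.e. $\int_\Omega A_{ij}^{\alpha\beta}D_\alpha u^iD_\beta\phi^j+b_{ij}^\alpha D_\alpha u^i\phi^j+d_{ij}^\beta u^iD_\beta\phi^j+V_{ij}u^i\phi^j=\int_\Omega f^j\phi^j$ for all $\phi\in C_c^\infty(\Omega)^N$. It is the continuous Green matrix if it is moreover continuous on $\{x\ne y\}$; there is at most one, and it exists under the present hypotheses. *)

theory Defs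
  imports "HOL-Analysis.Analysis" "HOL-Probability.Essential_Supremum"
begin

section \<open>Test functions and weak derivatives\<close>

text \<open>
  Functions on an open set \<open>U\<close> are represented by total functions; only their values on \<open>U\<close>
  (and, for elements of function spaces, only their class modulo equality almost everywhere
  on \<open>U\<close>) are meaningful. Restriction to a smaller set is therefore the identity on representatives.
\<close>

definition partial_deriv :: "'n::finite \<Rightarrow> (real^'n \<Rightarrow> real) \<Rightarrow> real^'n \<Rightarrow> real" where
  "partial_deriv i f x = frechet_derivative f (at x) (axis i 1)"

primrec Ck :: "nat \<Rightarrow> (real^'n::finite \<Rightarrow> real) \<Rightarrow> bool" where
  "Ck 0 = (\<lambda>f. continuous_on UNIV f)"
| "Ck (Suc k) = (\<lambda>f. (\<forall>x. f differentiable (at x)) \<and> (\<forall>i. Ck k (partial_deriv i f)))"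

definition smooth_fun :: "(real^'n::finite \<Rightarrow> real) \<Rightarrow> bool" where
  "smooth_fun f \<longleftrightarrow> (\<forall>k. Ck k f)"

definition test_fun :: "(real^'n::finite) set \<Rightarrow> (real^'n \<Rightarrow> real) set" where
  "test_fun U = {f. smooth_fun f \<and> compact (closure {x. f x \<noteq> 0}) \<and> closure {x. f x \<noteq> 0} \<subseteq> U}"

definition test_vec :: "(real^'n::finite) set \<Rightarrow> (real^'n \<Rightarrow> 'b::euclidean_space) set" where
  "test_vec U = {f. \<forall>e\<in>Basis. (\<lambda>x. f x \<bullet> e) \<in> test_fun U}"

definition locally_integrable ::
    "(real^'n::finite) set \<Rightarrow> (real^'n \<Rightarrow> 'b::euclidean_space) \<Rightarrow> bool" where
  "locally_integrable U f \<longleftrightarrow> (\<forall>K. compact K \<and> K \<subseteq> U \<longrightarrow> f absolutely_integrable_on K)"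

text \<open>The component \<open>Du x $ \<alpha>\<close> is \<open>D\<^sub>\<alpha> u(x)\<close>; the norm of \<open>Du x\<close> is the Euclidean one.\<close>

definition has_weak_deriv :: "(real^'n::finite) set \<Rightarrow> (real^'n \<Rightarrow> 'b::euclidean_space)
    \<Rightarrow> (real^'n \<Rightarrow> 'b^'n) \<Rightarrow> bool" where
  "has_weak_deriv U u Du \<longleftrightarrow>
     locally_integrable U u \<and> locally_integrable U Du \<and>
     (\<forall>\<phi>\<in>test_fun U. \<forall>\<alpha>.
        (LINT x:U|lebesgue. partial_deriv \<alpha> \<phi> x *\<^sub>R u x) = - (LINT x:U|lebesgue. \<phi> x *\<^sub>R (Du x $ \<alpha>)))"

definition weakly_diff :: "(real^'n::finite) set \<Rightarrow> (real^'n \<Rightarrow> 'b::euclidean_space) \<Rightarrow> bool" where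
  "weakly_diff U u \<longleftrightarrow> (\<exists>Du. has_weak_deriv U u Du)"

text \<open>Determined almost everywhere on \<open>U\<close> as soon as \<open>u\<close> is weakly differentiable on \<open>U\<close>.\<close>

definition wD :: "(real^'n::finite) set \<Rightarrow> (real^'n \<Rightarrow> 'b::euclidean_space) \<Rightarrow> real^'n \<Rightarrow> 'b^'n" where
  "wD U u = (SOME Du. has_weak_deriv U u Du)"

section \<open>Lebesgue and Sobolev spaces\<close>

text \<open>
  All norms take values in \<open>[0,\<infinity>]\<close>; membership in the space is finiteness of the norm.
  The power below is only used with exponent \<open>a > 0\<close>.
\<close>

definition ennpowr :: "ennreal \<Rightarrow> real \<Rightarrow> ennreal" where
  "ennpowr x a = (if x = \<infinity> then \<infinity> else ennreal (enn2real x powr a))"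

definition Lp_norm :: "ennreal \<Rightarrow> (real^'n::finite) set \<Rightarrow> (real^'n \<Rightarrow> 'b::euclidean_space) \<Rightarrow> ennreal" where
  "Lp_norm p U f =
    (if f \<notin> borel_measurable (lebesgue_on U) then \<infinity>
     else if p = \<infinity> then esssup (lebesgue_on U) (\<lambda>x. ennreal (norm (f x)))
     else ennpowr (\<integral>\<^sup>+x. ennreal (norm (f x) powr enn2real p) \<partial>lebesgue_on U) (1 / enn2real p))"

definition Lp_loc :: "ennreal \<Rightarrow> (real^'n::finite) set \<Rightarrow> (real^'n \<Rightarrow> 'b::euclidean_space) \<Rightarrow> bool" where
  "Lp_loc p U f \<longleftrightarrow> (\<forall>K. compact K \<and> K \<subseteq> U \<longrightarrow> Lp_norm p K f < \<infinity>)"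

definition Linf_c :: "(real^'n::finite) set \<Rightarrow> (real^'n \<Rightarrow> 'b::euclidean_space) set" where
  "Linf_c U = {f. Lp_norm \<infinity> U f < \<infinity> \<and> (\<exists>K. compact K \<and> K \<subseteq> U \<and> (\<forall>x\<in>U - K. f x = 0))}"

definition two_star :: "'n::finite itself \<Rightarrow> real" where
  "two_star _ = 2 * real CARD('n) / (real CARD('n) - 2)"

definition Y_norm :: "(real^'n::finite) set \<Rightarrow> (real^'n \<Rightarrow> 'b::euclidean_space) \<Rightarrow> ennreal" where
  "Y_norm U u =
    (if weakly_diff U u
     then ennpowr ((Lp_norm (ennreal (two_star TYPE('n))) U u)\<^sup>2 + (Lp_norm 2 U (wD U u))\<^sup>2) (1/2)
     else \<infinity>)"

definition Y_space :: "(real^'n::finite) set \<Rightarrow> (real^'n \<Rightarrow> 'b::euclidean_space) set" where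
  "Y_space U = {u. Y_norm U u < \<infinity>}"

definition Y0_space :: "(real^'n::finite) set \<Rightarrow> (real^'n \<Rightarrow> 'b::euclidean_space) set" where
  "Y0_space U =
    {u\<in>Y_space U. \<forall>\<epsilon>>0. \<exists>\<phi>\<in>test_vec U. Y_norm U (\<lambda>x. u x - \<phi> x) < ennreal \<epsilon>}"

section \<open>The operator\<close>

text \<open>
  Index conventions: \<open>cA L x $ \<alpha> $ \<beta> $ i $ j\<close> is \<open>A\<^sup>\<alpha>\<^sup>\<beta>\<^sub>i\<^sub>j(x)\<close>, \<open>cb L x $ \<alpha> $ i $ j\<close> is
  \<open>b\<^sup>\<alpha>\<^sub>i\<^sub>j(x)\<close>, and similarly for \<open>d\<close> and \<open>V\<close>.
\<close>

record ('n, 'N) operator =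
  cA :: "real^('n::finite) \<Rightarrow> real^('N::finite)^'N^'n^'n"
  cb :: "real^'n \<Rightarrow> real^'N^'N^'n"
  cd :: "real^'n \<Rightarrow> real^'N^'N^'n"
  cV :: "real^'n \<Rightarrow> real^'N^'N"

definition admissible_coeffs ::
    "(real^'n::finite) set \<Rightarrow> ('n, 'N::finite) operator \<Rightarrow> bool" where
  "admissible_coeffs \<Omega> L \<longleftrightarrow>
     cA L \<in> borel_measurable (lebesgue_on \<Omega>) \<and>
     (\<exists>lam>0. \<forall>x\<in>\<Omega>. \<forall>\<xi>::real^'N^'n.
        (\<Sum>\<alpha>\<in>UNIV. \<Sum>\<beta>\<in>UNIV. \<Sum>i\<in>UNIV. \<Sum>j\<in>UNIV. cA L x $ \<alpha> $ \<beta> $ i $ j * \<xi> $ \<beta> $ j * \<xi> $ \<alpha> $ i)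
          \<ge> lam * (\<Sum>\<alpha>\<in>UNIV. \<Sum>i\<in>UNIV. (\<xi> $ \<alpha> $ i)\<^sup>2)) \<and>
     (\<exists>Lam>0. \<forall>x\<in>\<Omega>.
        (\<Sum>\<alpha>\<in>UNIV. \<Sum>\<beta>\<in>UNIV. \<Sum>i\<in>UNIV. \<Sum>j\<in>UNIV. (cA L x $ \<alpha> $ \<beta> $ i $ j)\<^sup>2) \<le> Lam\<^sup>2) \<and>
     (\<exists>p > ennreal (real CARD('n) / 2). Lp_loc p \<Omega> (cV L)) \<and>
     (\<exists>s > ennreal (real CARD('n)). Lp_loc s \<Omega> (cb L)) \<and>
     (\<exists>t > ennreal (real CARD('n)). Lp_loc t \<Omega> (cd L))"

definition form_integrand :: "('n::finite, 'N::finite) operator \<Rightarrow> (real^'n) set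
    \<Rightarrow> (real^'n \<Rightarrow> real^'N) \<Rightarrow> (real^'n \<Rightarrow> real^'N) \<Rightarrow> real^'n \<Rightarrow> real" where
  "form_integrand L U u v x =
     (\<Sum>\<alpha>\<in>UNIV. \<Sum>\<beta>\<in>UNIV. \<Sum>i\<in>UNIV. \<Sum>j\<in>UNIV.
        cA L x $ \<alpha> $ \<beta> $ i $ j * wD U u x $ \<beta> $ j * wD U v x $ \<alpha> $ i)
   + (\<Sum>\<alpha>\<in>UNIV. \<Sum>i\<in>UNIV. \<Sum>j\<in>UNIV. cb L x $ \<alpha> $ i $ j * u x $ j * wD U v x $ \<alpha> $ i)
   + (\<Sum>\<beta>\<in>UNIV. \<Sum>i\<in>UNIV. \<Sum>j\<in>UNIV. cd L x $ \<beta> $ i $ j * wD U u x $ \<beta> $ j * v x $ i)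
   + (\<Sum>i\<in>UNIV. \<Sum>j\<in>UNIV. cV L x $ i $ j * u x $ j * v x $ i)"

definition form :: "('n::finite, 'N::finite) operator \<Rightarrow> (real^'n) set
    \<Rightarrow> (real^'n \<Rightarrow> real^'N) \<Rightarrow> (real^'n \<Rightarrow> real^'N) \<Rightarrow> real" where
  "form L U u v = (LINT x:U|lebesgue. form_integrand L U u v x)"

text \<open>
  The equations \<open>L u = f\<close> and \<open>L\<^sup>* u = f\<close> in \<open>U\<close>. Since the integral of a non-integrable function
  is \<open>0\<close> by convention, convergence of the integrals is made explicit.
\<close>

definition weak_solution :: "('n::finite, 'N::finite) operator \<Rightarrow> (real^'n) set
    \<Rightarrow> (real^'n \<Rightarrow> real^'N) \<Rightarrow> (real^'n \<Rightarrow> real^'N) \<Rightarrow> bool" where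
  "weak_solution L U u f \<longleftrightarrow>
     (\<forall>v\<in>test_vec U.
        form_integrand L U u v absolutely_integrable_on U \<and>
        (\<lambda>x. f x \<bullet> v x) absolutely_integrable_on U \<and>
        form L U u v = (LINT x:U|lebesgue. f x \<bullet> v x))"

definition adjoint_weak_solution :: "('n::finite, 'N::finite) operator \<Rightarrow> (real^'n) set
    \<Rightarrow> (real^'n \<Rightarrow> real^'N) \<Rightarrow> (real^'n \<Rightarrow> real^'N) \<Rightarrow> bool" where
  "adjoint_weak_solution L U u f \<longleftrightarrow>
     (\<forall>v\<in>test_vec U.
        form_integrand L U v u absolutely_integrable_on U \<and>
        (\<lambda>x. f x \<bullet> v x) absolutely_integrable_on U \<and>
        form L U v u = (LINT x:U|lebesgue. f x \<bullet> v x))"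

section \<open>The abstract function spaces\<close>

text \<open>
  A family of spaces is given by \<open>F U\<close> (the elements, a set of functions saturated under almost
  everywhere equality on \<open>U\<close>) and \<open>nF U\<close> (the norm on \<open>F U\<close>).
\<close>

type_synonym ('n, 'N) family = "(real^'n) set \<Rightarrow> (real^'n \<Rightarrow> real^'N) set"
type_synonym ('n, 'N) family_norm = "(real^'n) set \<Rightarrow> (real^'n \<Rightarrow> real^'N) \<Rightarrow> real"

definition complete_wrt :: "('a \<Rightarrow> 'b::real_vector) set \<Rightarrow> (('a \<Rightarrow> 'b) \<Rightarrow> real) \<Rightarrow> bool" where
  "complete_wrt S nrm \<longleftrightarrow>
     (\<forall>X::nat \<Rightarrow> 'a \<Rightarrow> 'b. (\<forall>k. X k \<in> S) \<and>
        (\<forall>\<epsilon>>0. \<exists>M. \<forall>k\<ge>M. \<forall>m\<ge>M. nrm (\<lambda>x. X k x - X m x) < \<epsilon>) \<longrightarrow>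
        (\<exists>u\<in>S. (\<lambda>k. nrm (\<lambda>x. X k x - u x)) \<longlonglongrightarrow> 0))"

definition banach_function_space :: "(real^'n::finite) set \<Rightarrow> (real^'n \<Rightarrow> real^'N::finite) set
    \<Rightarrow> ((real^'n \<Rightarrow> real^'N) \<Rightarrow> real) \<Rightarrow> bool" where
  "banach_function_space U S nrm \<longleftrightarrow>
     (\<forall>u\<in>S. weakly_diff U u) \<and>
     (\<forall>u\<in>S. \<forall>v. (AE x in lebesgue_on U. v x = u x) \<longrightarrow> v \<in> S \<and> nrm v = nrm u) \<and>
     (\<lambda>x. 0) \<in> S \<and>
     (\<forall>u\<in>S. \<forall>v\<in>S. (\<lambda>x. u x + v x) \<in> S \<and> nrm (\<lambda>x. u x + v x) \<le> nrm u + nrm v) \<and>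
     (\<forall>c. \<forall>u\<in>S. (\<lambda>x. c *\<^sub>R u x) \<in> S \<and> nrm (\<lambda>x. c *\<^sub>R u x) = \<bar>c\<bar> * nrm u) \<and>
     (\<forall>u\<in>S. 0 \<le> nrm u \<and> (nrm u = 0 \<longleftrightarrow> (AE x in lebesgue_on U. u x = 0))) \<and>
     complete_wrt S nrm"

definition F0 :: "('n::finite, 'N::finite) family \<Rightarrow> ('n, 'N) family_norm \<Rightarrow> ('n, 'N) family" where
  "F0 F nF U = {u\<in>F U. \<forall>\<epsilon>>0. \<exists>\<phi>\<in>test_vec U. nF U (\<lambda>x. u x - \<phi> x) < \<epsilon>}"

definition bilinear_form_on ::
    "('a \<Rightarrow> 'b::real_vector) set \<Rightarrow> (('a \<Rightarrow> 'b) \<Rightarrow> ('a \<Rightarrow> 'b) \<Rightarrow> real) \<Rightarrow> bool" where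
  "bilinear_form_on S B \<longleftrightarrow>
     (\<forall>u\<in>S. \<forall>v\<in>S. \<forall>w\<in>S.
        B (\<lambda>x. u x + v x) w = B u w + B v w \<and> B w (\<lambda>x. u x + v x) = B w u + B w v) \<and>
     (\<forall>c. \<forall>u\<in>S. \<forall>v\<in>S. B (\<lambda>x. c *\<^sub>R u x) v = c * B u v \<and> B u (\<lambda>x. c *\<^sub>R v x) = c * B u v)"

definition restriction_property :: "('n::finite, 'N::finite) family \<Rightarrow> ('n, 'N) family_norm
    \<Rightarrow> (real^'n) set \<Rightarrow> bool" where
  "restriction_property F nF W \<longleftrightarrow>
     (\<forall>U. open U \<and> U \<subseteq> W \<longrightarrow> (\<forall>u\<in>F W. u \<in> F U \<and> nF U u \<le> nF W u))"

definition hilbert_property :: "('n::finite, 'N::finite) family \<Rightarrow> ('n, 'N) family_norm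
    \<Rightarrow> (real^'n) set \<Rightarrow> bool" where
  "hilbert_property F nF W \<longleftrightarrow>
     test_vec W \<subseteq> F W \<and>
     (\<exists>ip. bilinear_form_on (F0 F nF W) ip \<and>
        (\<forall>u\<in>F0 F nF W. \<forall>v\<in>F0 F nF W. ip u v = ip v u) \<and>
        (\<forall>u\<in>F0 F nF W. 0 \<le> ip u u) \<and>
        complete_wrt (F0 F nF W) (\<lambda>u. sqrt (ip u u)) \<and>
        (\<exists>c>0. \<exists>c'>0. \<forall>u\<in>F0 F nF W. c * nF W u \<le> sqrt (ip u u) \<and> sqrt (ip u u) \<le> c' * nF W u))"

definition embedding_property :: "('n::finite, 'N::finite) family \<Rightarrow> ('n, 'N) family_norm
    \<Rightarrow> real \<Rightarrow> (real^'n) set \<Rightarrow> bool" where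
  "embedding_property F nF c W \<longleftrightarrow>
     (\<forall>u\<in>F0 F nF W. u \<in> Y0_space W \<and> Lp_norm 2 W (wD W u) \<le> ennreal (c * nF W u))"

definition multiplier_property :: "('n::finite, 'N::finite) family \<Rightarrow> ('n, 'N) family_norm
    \<Rightarrow> (real^'n) set \<Rightarrow> bool" where
  "multiplier_property F nF W \<longleftrightarrow>
     (\<forall>U. open U \<and> connected U \<longrightarrow>
        (\<forall>\<xi>\<in>test_fun U. \<exists>C. \<forall>u\<in>F W.
           (\<lambda>x. \<xi> x *\<^sub>R u x) \<in> F (W \<inter> U) \<and> nF (W \<inter> U) (\<lambda>x. \<xi> x *\<^sub>R u x) \<le> C * nF W u) \<and>
        (\<forall>\<xi>\<in>test_fun (W \<inter> U). \<forall>u\<in>F W. (\<lambda>x. \<xi> x *\<^sub>R u x) \<in> F0 F nF (W \<inter> U)))"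

text \<open>
  For \<open>u, v\<close> in \<open>F\<^sub>0(\<Omega>)\<close> the integral defining the form need not converge absolutely; \<open>B\<close> is its
  bounded bilinear extension from test functions (unique, as these are dense in \<open>F\<^sub>0(\<Omega>)\<close>).
\<close>

definition bounded_form_extension :: "('n::finite, 'N::finite) family \<Rightarrow> ('n, 'N) family_norm
    \<Rightarrow> ('n, 'N) operator \<Rightarrow> (real^'n) set \<Rightarrow> real
    \<Rightarrow> ((real^'n \<Rightarrow> real^'N) \<Rightarrow> (real^'n \<Rightarrow> real^'N) \<Rightarrow> real) \<Rightarrow> bool" where
  "bounded_form_extension F nF L \<Omega> \<Gamma> B \<longleftrightarrow>
     \<Gamma> > 0 \<and>
     bilinear_form_on (F0 F nF \<Omega>) B \<and>
     (\<forall>u\<in>test_vec \<Omega>. \<forall>v\<in>test_vec \<Omega>. B u v = form L \<Omega> u v) \<and>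
     (\<forall>u\<in>F0 F nF \<Omega>. \<forall>v\<in>F0 F nF \<Omega>. B u v \<le> \<Gamma> * nF \<Omega> u * nF \<Omega> v)"

definition coercive_form :: "('n::finite, 'N::finite) family \<Rightarrow> ('n, 'N) family_norm
    \<Rightarrow> (real^'n) set \<Rightarrow> real
    \<Rightarrow> ((real^'n \<Rightarrow> real^'N) \<Rightarrow> (real^'n \<Rightarrow> real^'N) \<Rightarrow> real) \<Rightarrow> bool" where
  "coercive_form F nF \<Omega> \<gamma> B \<longleftrightarrow> \<gamma> > 0 \<and> (\<forall>u\<in>F0 F nF \<Omega>. \<gamma> * (nF \<Omega> u)\<^sup>2 \<le> B u u)"

definition caccioppoli :: "('n::finite, 'N::finite) family \<Rightarrow> ('n, 'N) family_norm
    \<Rightarrow> ('n, 'N) operator \<Rightarrow> (real^'n) set \<Rightarrow> real \<Rightarrow> bool" where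
  "caccioppoli F nF L \<Omega> C \<longleftrightarrow>
     (\<forall>U u \<zeta>. open U \<and> U \<subseteq> \<Omega> \<and> u \<in> F U \<and>
        (weak_solution L U u (\<lambda>x. 0) \<or> adjoint_weak_solution L U u (\<lambda>x. 0)) \<and>
        smooth_fun \<zeta> \<and> (\<forall>i. partial_deriv i \<zeta> \<in> test_fun UNIV) \<and>
        (\<lambda>x. \<zeta> x *\<^sub>R u x) \<in> F0 F nF U \<and>
        (\<forall>i. Lp_norm 2 U (\<lambda>x. partial_deriv i \<zeta> x *\<^sub>R u x) < \<infinity>) \<longrightarrow>
        (\<integral>\<^sup>+x. ennreal ((norm (wD U u x))\<^sup>2 * (\<zeta> x)\<^sup>2) \<partial>lebesgue_on U)
          \<le> ennreal C *
             (\<integral>\<^sup>+x. ennreal ((norm (u x))\<^sup>2 * (\<Sum>i\<in>UNIV. (partial_deriv i \<zeta> x)\<^sup>2)) \<partial>lebesgue_on U))"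

text \<open>\<open>u = 0\<close> on the part of the boundary of the domain inside \<open>U\<close>, for \<open>u\<close> in \<open>F W\<close>.\<close>

definition vanishes_in :: "('n::finite, 'N::finite) family \<Rightarrow> ('n, 'N) family_norm
    \<Rightarrow> (real^'n) set \<Rightarrow> (real^'n) set \<Rightarrow> (real^'n \<Rightarrow> real^'N) \<Rightarrow> bool" where
  "vanishes_in F nF W U u \<longleftrightarrow> (\<forall>\<xi>\<in>test_fun U. (\<lambda>x. \<xi> x *\<^sub>R u x) \<in> F0 F nF W)"

text \<open>The constant in the local boundedness estimate may depend on the exponents \<open>q\<close> and \<open>l\<close>.\<close>

definition local_boundedness :: "('n::finite, 'N::finite) family \<Rightarrow> ('n, 'N) family_norm
    \<Rightarrow> ('n, 'N) operator \<Rightarrow> (real^'n) set \<Rightarrow> (real \<Rightarrow> ennreal \<Rightarrow> real) \<Rightarrow> bool" where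
  "local_boundedness F nF L \<Omega> C \<longleftrightarrow>
     (\<forall>x\<^sub>0\<in>\<Omega>. \<forall>R>0. \<forall>u f. \<forall>l > ennreal (real CARD('n) / 2).
        u \<in> F (\<Omega> \<inter> ball x\<^sub>0 (2 * R)) \<and>
        Lp_norm l (\<Omega> \<inter> ball x\<^sub>0 R) f < \<infinity> \<and>
        (weak_solution L (\<Omega> \<inter> ball x\<^sub>0 R) u f \<or> adjoint_weak_solution L (\<Omega> \<inter> ball x\<^sub>0 R) u f) \<and>
        vanishes_in F nF (\<Omega> \<inter> ball x\<^sub>0 (2 * R)) (ball x\<^sub>0 R) u \<longrightarrow>
        Lp_norm \<infinity> (\<Omega> \<inter> ball x\<^sub>0 (R / 2)) u < \<infinity> \<and>
        (\<forall>q>0. Lp_norm \<infinity> (\<Omega> \<inter> ball x\<^sub>0 (R / 2)) u \<le>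
           ennreal (C q l) *
           (ennreal (R powr (- real CARD('n) / q)) * Lp_norm (ennreal q) (\<Omega> \<inter> ball x\<^sub>0 R) u
            + ennreal (R powr (2 - real CARD('n) * enn2real (1 / l))) * Lp_norm l (\<Omega> \<inter> ball x\<^sub>0 R) f)))"

text \<open>
  Elements of \<open>F\<close> are only defined almost everywhere, so the pointwise estimate is about a
  representative \<open>w\<close> of \<open>u\<close>.
\<close>

definition hoelder_property :: "('n::finite, 'N::finite) family
    \<Rightarrow> ('n, 'N) operator \<Rightarrow> (real^'n) set \<Rightarrow> (real \<Rightarrow> real) \<Rightarrow> (real \<Rightarrow> real) \<Rightarrow> bool" where
  "hoelder_property F L \<Omega> \<eta> C \<longleftrightarrow>
     (\<forall>R\<^sub>0>0. 0 < \<eta> R\<^sub>0 \<and> \<eta> R\<^sub>0 < 1 \<and> 0 < C R\<^sub>0 \<and>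
       (\<forall>x\<^sub>0 u. ball x\<^sub>0 (2 * R\<^sub>0) \<subseteq> \<Omega> \<and> u \<in> F (ball x\<^sub>0 (2 * R\<^sub>0)) \<and>
          (weak_solution L (ball x\<^sub>0 R\<^sub>0) u (\<lambda>x. 0) \<or> adjoint_weak_solution L (ball x\<^sub>0 R\<^sub>0) u (\<lambda>x. 0)) \<longrightarrow>
          (\<exists>w. (AE x in lebesgue_on (ball x\<^sub>0 R\<^sub>0). w x = u x) \<and>
             (\<forall>R. 0 < R \<and> R \<le> R\<^sub>0 \<longrightarrow>
                (\<forall>x\<in>ball x\<^sub>0 (R / 2). \<forall>y\<in>ball x\<^sub>0 (R / 2). x \<noteq> y \<longrightarrow>
                   ennreal (norm (w x - w y) / norm (x - y) powr \<eta> R\<^sub>0) \<le>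
                   ennreal (C R\<^sub>0 * R powr (- \<eta> R\<^sub>0)) *
                   ennpowr ((\<integral>\<^sup>+z. ennreal (norm (u z) powr two_star TYPE('n)) \<partial>lebesgue_on (ball x\<^sub>0 R))
                             / emeasure lebesgue (ball x\<^sub>0 R)) (1 / two_star TYPE('n)))))))"

section \<open>The Green matrix\<close>

text \<open>
  \<open>G x y $ i $ j\<close> is \<open>G\<^sub>i\<^sub>j(x,y)\<close>; values on the diagonal are irrelevant. Weak differentiability of
  \<open>G(\<cdot>,y)\<close> on \<open>\<Omega>\<close> (which includes local integrability) is needed for the derivatives in the first
  clause to make sense. Spaces over the complement of a ball are taken over its interior.
\<close>

definition green_matrix :: "('n::finite, 'N::finite) family \<Rightarrow> ('n, 'N) family_norm
    \<Rightarrow> ('n, 'N) operator \<Rightarrow> (real^'n) set \<Rightarrow> (real^'n \<Rightarrow> real^'n \<Rightarrow> real^'N^'N) \<Rightarrow> bool" where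
  "green_matrix F nF L \<Omega> G \<longleftrightarrow>
     (\<forall>y\<in>\<Omega>. weakly_diff \<Omega> (\<lambda>x. G x y) \<and>
        (\<forall>k. \<forall>\<phi>\<in>test_vec \<Omega>.
           form_integrand L \<Omega> (\<lambda>x. column k (G x y)) \<phi> absolutely_integrable_on \<Omega> \<and>
           form L \<Omega> (\<lambda>x. column k (G x y)) \<phi> = \<phi> y $ k)) \<and>
     (\<forall>y\<in>\<Omega>. \<forall>r>0. (\<lambda>x. G x y) \<in> Y_space (\<Omega> - cball y r) \<and>
        (\<forall>\<zeta>\<in>test_fun \<Omega>. (\<forall>x\<in>ball y r. \<zeta> x = 1) \<longrightarrow>
           (\<lambda>x. (1 - \<zeta> x) *\<^sub>R G x y) \<in> Y0_space (\<Omega> - cball y r))) \<and>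
     (\<forall>f\<in>Linf_c \<Omega>.
        (\<lambda>y. \<chi> k. LINT x:\<Omega>|lebesgue. (\<Sum>j\<in>UNIV. G x y $ j $ k * f x $ j)) \<in> F0 F nF \<Omega> \<and>
        adjoint_weak_solution L \<Omega>
          (\<lambda>y. \<chi> k. LINT x:\<Omega>|lebesgue. (\<Sum>j\<in>UNIV. G x y $ j $ k * f x $ j)) f)"

definition continuous_green_matrix :: "('n::finite, 'N::finite) family \<Rightarrow> ('n, 'N) family_norm
    \<Rightarrow> ('n, 'N) operator \<Rightarrow> (real^'n) set \<Rightarrow> (real^'n \<Rightarrow> real^'n \<Rightarrow> real^'N^'N) \<Rightarrow> bool" where
  "continuous_green_matrix F nF L \<Omega> G \<longleftrightarrow>
     green_matrix F nF L \<Omega> G \<and>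
     continuous_on {(x, y). x \<in> \<Omega> \<and> y \<in> \<Omega> \<and> x \<noteq> y} (\<lambda>(x, y). G x y)"

end

theory Submission
  imports Defs "HOL-Computational_Algebra.Polynomial" "HOL-Library.Function_Algebras"
begin

text \<open>
  A solution with datum \<open>f\<close> supported in a ball of radius \<open>R\<close> has energy at most \<open>C R |f|\<close> in \<open>L\<^sup>2\<close> terms,
  by coercivity and Hardy's inequality. Pairing the averaged Green function of a small ball at \<open>x\<close> with
  solutions whose datum lives near \<open>y\<close> and applying local boundedness to both factors gives
  \<open>|G(x,y)| \<le> C |x - y|\<^sup>2\<^sup>-\<^sup>n\<close>. The averaged Green functions solve the homogeneous equation off their pole, so
  Caccioppoli's inequality on annuli turns this bound into \<open>\<integral> |D G(x,\<cdot>)|\<^sup>2 \<le> C r\<^sup>2\<^sup>-\<^sup>n\<close> outside the ball of radius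
  \<open>r\<close>, which passes to the limit; the remaining bounds follow by integration over dyadic shells, and the
  Hoelder bounds from (H). By Fubini's theorem the transposed kernel represents the solutions of the
  adjoint problem, so the same applies to the other variable.
\<close>

text \<open>The constants have to be fixed before the domain, the spaces and the operator. Hence
  every estimate stays quantitative in the dimensions, the embedding and coercivity constants and
  those of (A7) and (BB), while merely existential data (the equivalent Hilbert norm, multiplier
  constants, local norms of the coefficients) may enter only qualitative steps such as existence and
  density. The Green matrix need not have finite energy at its pole; its averages do, but their
  bounds must not depend on the averaging radius. Hardy's inequality does the work usually given to
  Sobolev's: it turns energy into L2 norms on balls with the right power of R, which is the input of
  local boundedness with q = 2. By hypothesis B agrees with the integral only on pairs of test
  fields. As V lies just in L^p with p > n/2, continuity of the integral against a fixed test field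
  has to be proved first; only then do identities in the Hilbert space become weak equations on
  subdomains, to which the local hypotheses apply.\<close>

abbreviation meas_on :: "(real^'n) set \<Rightarrow> (real^'n \<Rightarrow> 'b::topological_space) set" where
  "meas_on S \<equiv> borel_measurable (lebesgue_on S)"

abbreviation meas_L :: "(real^'n \<Rightarrow> 'b::topological_space) set" where
  "meas_L \<equiv> borel_measurable lebesgue"

subsection \<open>Smooth functions\<close>

lemma partial_deriv_eq:
 assumes "(f has_derivative f') (at x)"
 shows "partial_deriv i f x = f' (axis i 1)"
 using frechet_derivative_at[OF assms] by (simp add: partial_deriv_def)

lemma Ck_continuous: "Ck k f \<Longrightarrow> continuous_on UNIV f"
 by (cases k) (auto intro!: differentiable_imp_continuous_on simp: differentiable_on_def differentiable_at_withinI)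

lemma Ck_SucD: "Ck (Suc k) f \<Longrightarrow> Ck k f"
proof (induction k arbitrary: f)
 case 0 then show ?case using Ck_continuous[of "Suc 0" f] by simp
next
 case (Suc k) then show ?case by (metis Ck.simps(2))
qed

lemma Ck_const [simp]: "Ck k (\<lambda>x. c)"
proof (induction k arbitrary: c)
 case (Suc k)
 have "partial_deriv i (\<lambda>x::real^'a. c) = (\<lambda>x. 0)" for i :: 'a by (rule ext, subst partial_deriv_eq[OF has_derivative_const]) simp
 with Suc show ?case by simp
qed simp

lemma partial_deriv_add:
 assumes "f differentiable (at x)" "g differentiable (at x)"
 shows "partial_deriv i (\<lambda>x. f x + g x) x = partial_deriv i f x + partial_deriv i g x"
proof -
 obtain f' g' where d: "(f has_derivative f') (at x)" "(g has_derivative g') (at x)" using assms by (auto simp: differentiable_def)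
 show ?thesis
  using partial_deriv_eq[OF has_derivative_add[OF d], of i] partial_deriv_eq[OF d(1), of i]
   partial_deriv_eq[OF d(2), of i] by simp
qed

lemma partial_deriv_mult:
 assumes "f differentiable (at x)" "g differentiable (at x)"
 shows "partial_deriv i (\<lambda>x. f x * g x) x = f x * partial_deriv i g x + partial_deriv i f x * g x"
proof -
 obtain f' g' where d: "(f has_derivative f') (at x)" "(g has_derivative g') (at x)" using assms by (auto simp: differentiable_def)
 show ?thesis
  using partial_deriv_eq[OF has_derivative_mult[OF d], of i] partial_deriv_eq[OF d(1), of i]
   partial_deriv_eq[OF d(2), of i] by simp
qed

lemma Ck_add: "Ck k f \<Longrightarrow> Ck k g \<Longrightarrow> Ck k (\<lambda>x. f x + g x)"
proof (induction k arbitrary: f g)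
 case 0 then show ?case by (auto intro: continuous_intros)
next
 case (Suc k)
 have "partial_deriv i (\<lambda>x. f x + g x) = (\<lambda>x. partial_deriv i f x + partial_deriv i g x)" for i
  using Suc.prems by (intro ext partial_deriv_add) auto
 with Suc show ?case by auto
qed

lemma Ck_mult: "Ck k f \<Longrightarrow> Ck k g \<Longrightarrow> Ck k (\<lambda>x. f x * g x)"
proof (induction k arbitrary: f g)
 case 0 then show ?case by (auto intro: continuous_intros)
next
 case (Suc k)
 have "partial_deriv i (\<lambda>x. f x * g x) = (\<lambda>x. f x * partial_deriv i g x + partial_deriv i f x * g x)" for i
  using Suc.prems by (intro ext partial_deriv_mult) auto
 moreover have "Ck k f" "Ck k g" using Suc.prems by (auto intro: Ck_SucD simp del: Ck.simps)
 ultimately show ?case using Suc by (auto intro!: Ck_add)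
qed

lemma partial_deriv_inner: "partial_deriv i (\<lambda>x. x \<bullet> c) x = c $ i"
 by (subst partial_deriv_eq[of _ "\<lambda>h. h \<bullet> c"])
  (auto intro!: derivative_eq_intros simp: inner_axis' )

lemma Ck_inner: "Ck k (\<lambda>x. x \<bullet> c)"
proof (cases k)
 case 0 then show ?thesis by (auto intro: continuous_intros)
next
 case (Suc k)
 have "partial_deriv i (\<lambda>x. x \<bullet> c) = (\<lambda>x. c $ i)" for i by (intro ext partial_deriv_inner)
 with Suc show ?thesis by simp
qed

text \<open>The derivative is written as a product of copies of the inverse itself, so that the
  induction hypothesis and closure under products suffice.\<close>

lemma Ck_inverse: "Ck k g \<Longrightarrow> (\<And>x. g x \<noteq> 0) \<Longrightarrow> Ck k (\<lambda>x. inverse (g x))"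
proof (induction k arbitrary: g)
 case 0 then show ?case by (auto intro!: continuous_intros)
next
 case (Suc k)
 have "partial_deriv i (\<lambda>x. inverse (g x)) = (\<lambda>x. - 1 * (inverse (g x) * partial_deriv i g x * inverse (g x)))" for i
 proof
  fix x
  obtain g' where d: "(g has_derivative g') (at x)" using Suc.prems(1) unfolding differentiable_def Ck.simps by blast
  show "partial_deriv i (\<lambda>x. inverse (g x)) x = - 1 * (inverse (g x) * partial_deriv i g x * inverse (g x))"
   using partial_deriv_eq[OF Deriv.has_derivative_inverse[OF Suc.prems(2) d], of i] partial_deriv_eq[OF d, of i] by simp
 qed
 moreover have "Ck k (\<lambda>x. inverse (g x))" using Suc Ck_SucD by blast
 then have "Ck k (\<lambda>x. - 1 * (inverse (g x) * partial_deriv i g x * inverse (g x)))" for i using Suc.prems by (intro Ck_mult Ck_const) auto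
 ultimately show ?case using Suc.prems by (auto intro!: differentiable_inverse)
qed

text \<open>The class of these functions is closed under differentiation, which is what makes
 \<open>exp (-1/t)\<close> smooth at \<open>0\<close>.\<close>

definition flat :: "real poly \<Rightarrow> real \<Rightarrow> real" where
 "flat p t = (if t > 0 then poly p (1 / t) * exp (- (1 / t)) else 0)"

text \<open>The chain rule for p(1/t) exp(-1/t) produces the factor 1/t^2 and the difference p - p',
  both evaluated at 1/t; multiplication by \<open>[:0, 0, 1:]\<close> encodes 1/t^2.\<close>

definition dflat :: "real poly \<Rightarrow> real poly" where
 "dflat p = [:0, 0, 1:] * (p - pderiv p)"

lemma poly_exp_tendsto_0: "((\<lambda>s. poly (p :: real poly) s * exp (- s)) \<longlongrightarrow> 0) at_top"
proof -
 have "((\<lambda>s. \<Sum>i\<le>degree p. coeff p i * (s ^ i / exp s)) \<longlongrightarrow> (\<Sum>i\<le>degree p. coeff p i * 0)) at_top"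
  by (intro tendsto_intros tendsto_power_div_exp_0)
 then show ?thesis by (simp add: poly_altdef exp_minus divide_inverse sum_distrib_right mult.assoc)
qed

lemma flat_tendsto_0: "(flat p \<longlongrightarrow> 0) (at 0)"
proof -
 have "((\<lambda>t. poly p (inverse t) * exp (- inverse t)) \<longlongrightarrow> 0) (at_right 0)"
  using filterlim_compose[OF poly_exp_tendsto_0 filterlim_inverse_at_top_right] .
 then have "(flat p \<longlongrightarrow> 0) (at_right 0)" by (rule Lim_transform_eventually)
    (auto simp: flat_def eventually_at_right_field inverse_eq_divide intro!: exI[of _ 1])
 moreover have "(flat p \<longlongrightarrow> 0) (at_left 0)" by (rule Lim_transform_eventually[OF tendsto_const])
    (auto simp: flat_def eventually_at_left_field intro!: exI[of _ "-1"])
 ultimately show ?thesis by (rule filterlim_split_at[rotated])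
qed

lemma flat_deriv: "(flat p has_real_derivative flat (dflat p) t) (at t)"
proof -
 consider "t > 0" | "t < 0" | "t = 0" by linarith
 then show ?thesis
 proof cases
  case 1
  have "((\<lambda>t. poly p (1 / t) * exp (- (1 / t))) has_real_derivative flat (dflat p) t) (at t)"
   using 1 by (auto intro!: derivative_eq_intros DERIV_chain2[OF poly_DERIV]
     simp: flat_def dflat_def field_simps power2_eq_square)
  then show ?thesis by (rule has_field_derivative_transform_within_open[of _ _ _ "{0<..}"]) (use 1 in \<open>auto simp: flat_def\<close>)
 next
  case 2
  have "((\<lambda>t. 0) has_real_derivative flat (dflat p) t) (at t)" using 2 by (simp add: flat_def)
  then show ?thesis by (rule has_field_derivative_transform_within_open[of _ _ _ "{..<0}"]) (use 2 in \<open>auto simp: flat_def\<close>)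
 next
  case 3
  \<comment> \<open>At the origin the difference quotient of \<open>flat p\<close> is again of the
    class: dividing by h multiplies the polynomial by \<open>[:0, 1:]\<close>.\<close>
  have "((\<lambda>h. flat ([:0, 1:] * p) h) \<longlongrightarrow> 0) (at 0)" by (rule flat_tendsto_0)
  then have "((\<lambda>h. (flat p (0 + h) - flat p 0) / h) \<longlongrightarrow> 0) (at 0)"
   by (rule Lim_transform_eventually) (auto simp: flat_def field_simps intro!: always_eventually)
  then show ?thesis using 3 by (simp add: DERIV_def flat_def)
 qed
qed

lemma Ck_flat: "Ck k g \<Longrightarrow> Ck k (\<lambda>x. flat p (g x))"
proof (induction k arbitrary: p g)
 case 0
 have "continuous_on UNIV (flat p)" by (intro continuous_at_imp_continuous_on ballI DERIV_isCont[OF flat_deriv])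
 with 0 show ?case using continuous_on_compose2[of UNIV "flat p" UNIV g] by simp
next
 case (Suc k)
 have d: "((\<lambda>x. flat p (g x)) has_derivative (\<lambda>h. flat (dflat p) (g x) * g' h)) (at x)"
  if "(g has_derivative g') (at x)" for g' x using has_derivative_compose[OF that flat_deriv[unfolded has_field_derivative_def]] by simp
 have "partial_deriv i (\<lambda>x. flat p (g x)) = (\<lambda>x. flat (dflat p) (g x) * partial_deriv i g x)" for i
 proof
  fix x
  obtain g' where g': "(g has_derivative g') (at x)" using Suc.prems unfolding differentiable_def Ck.simps by blast
  show "partial_deriv i (\<lambda>x. flat p (g x)) x = flat (dflat p) (g x) * partial_deriv i g x"
   using partial_deriv_eq[OF d[OF g']] partial_deriv_eq[OF g'] by simp
 qed
 moreover have "Ck k g" by (rule Ck_SucD[OF Suc.prems])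
 ultimately show ?case using Suc d by (auto intro!: Ck_mult) (metis differentiable_def)
qed

text \<open>The usual quotient construction: t and 1 - t are never both nonpositive, so the
  denominator stays positive, and one of its two terms vanishes outside the open unit
  interval.\<close>

definition smooth_step :: "real \<Rightarrow> real" where
 "smooth_step t = flat 1 t * inverse (flat 1 t + flat 1 (1 - t))"

lemma flat_1_nonneg: "flat 1 t \<ge> 0" by (simp add: flat_def)

lemma flat_1_pos: "flat 1 t + flat 1 (1 - t) > 0"
 by (cases "t > 0") (auto simp: flat_def add_pos_nonneg)

lemma smooth_step_0 [simp]: "t \<le> 0 \<Longrightarrow> smooth_step t = 0"
 by (simp add: smooth_step_def flat_def)

lemma smooth_step_1 [simp]: "t \<ge> 1 \<Longrightarrow> smooth_step t = 1"
 by (simp add: smooth_step_def flat_def)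

lemma smooth_step_nonneg: "smooth_step t \<ge> 0"
 using flat_1_nonneg[of t] flat_1_pos[of t] by (simp add: smooth_step_def)

lemma smooth_step_le_1: "smooth_step t \<le> 1"
 using flat_1_nonneg[of "1 - t"] flat_1_pos[of t] by (simp add: smooth_step_def field_simps)

lemma Ck_smooth_step: "Ck k g \<Longrightarrow> Ck k (\<lambda>x. smooth_step (g x))"
 unfolding smooth_step_def diff_conv_add_uminus
proof (intro Ck_mult Ck_inverse Ck_add Ck_flat Ck_const)
 assume g: "Ck k g"
 show "Ck k (\<lambda>x. - g x)" using Ck_mult[OF Ck_const g, of "-1"] by simp
 show "flat 1 (g x) + flat 1 (1 + - g x) \<noteq> 0" for x
  using flat_1_pos[of "g x"] by simp
qed

text \<open>The derivative is continuous and vanishes outside the unit interval, so compactness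
  bounds it. The bound is universal and becomes the constant of all cutoffs.\<close>

lemma smooth_step_deriv_bound:
 obtains s' M where "\<And>t. (smooth_step has_real_derivative s' t) (at t)" "\<And>t. \<bar>s' t\<bar> \<le> M" "M > 0"
proof -
 define p where "p = dflat 1"
 define s' where "s' = (\<lambda>t. (flat p t * flat 1 (1 - t) + flat 1 t * flat p (1 - t)) * inverse ((flat 1 t + flat 1 (1 - t)) ^ 2))"
 have d: "(smooth_step has_real_derivative s' t) (at t)" for t
 proof -
  have a: "(flat 1 has_real_derivative flat p t) (at t)" unfolding p_def by (rule flat_deriv)
  have b: "((\<lambda>t. flat 1 (1 - t)) has_real_derivative - flat p (1 - t)) (at t)"
  proof -
   have "((\<lambda>t. 1 - t) has_real_derivative -1) (at t)" by (auto intro!: derivative_eq_intros)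
   from DERIV_chain2[OF flat_deriv this] show ?thesis by (simp add: p_def)
  qed
  show ?thesis unfolding smooth_step_def [abs_def]
   apply (rule DERIV_cong[OF DERIV_mult[OF a DERIV_inverse_fun[OF DERIV_add[OF a b]]]])
   using flat_1_pos[of t] by (auto simp: s'_def divide_simps power2_eq_square) (auto simp: algebra_simps)?
 qed
 have c: "continuous_on UNIV (flat q)" for q by (intro continuous_at_imp_continuous_on ballI DERIV_isCont[OF flat_deriv])
 have c': "continuous_on A (\<lambda>t. flat q (1 - t))" for q A by (rule continuous_on_compose2[OF c]) (auto intro: continuous_intros)
 have "continuous_on {0..1} s'" unfolding s'_def using flat_1_pos by (intro continuous_intros c' continuous_on_subset[OF c]) (auto simp: less_le)
 then have "bounded (s' ` {0..1})" by (intro compact_imp_bounded compact_continuous_image) auto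
 then obtain M where M: "\<And>t. t \<in> {0..1} \<Longrightarrow> \<bar>s' t\<bar> \<le> M" unfolding bounded_iff by (metis imageI real_norm_def)
 have "\<bar>s' t\<bar> \<le> max M 1" for t
 proof (cases "t \<in> {0..1}")
  case True then show ?thesis using M[of t] by simp
 next
  \<comment> \<open>Off the unit interval both products in the numerator contain \<open>flat\<close>
    at a nonpositive argument.\<close>
  case False then show ?thesis by (auto simp: s'_def flat_def)
 qed
 with d show ?thesis by (intro that[of s' "max M 1"]) auto
qed

subsection \<open>Test functions\<close>

lemma test_funI:
 assumes "smooth_fun f" "compact K" "K \<subseteq> U" "\<And>x. x \<notin> K \<Longrightarrow> f x = 0"
 shows "f \<in> test_fun U"
proof -
 have "closure {x. f x \<noteq> 0} \<subseteq> K" using assms by (intro closure_minimal compact_imp_closed) auto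
 then show ?thesis using assms by (auto simp: test_fun_def compact_eq_bounded_closed intro: bounded_subset)
qed

lemma test_fun_support:
 assumes "f \<in> test_fun U"
 obtains K where "compact K" "K \<subseteq> U" "\<And>x. x \<notin> K \<Longrightarrow> f x = 0"
 using assms closure_subset[of "{x. f x \<noteq> 0}"] unfolding test_fun_def by (auto intro!: that[of "closure {x. f x \<noteq> 0}"])

lemma smooth_fun_add: "smooth_fun f \<Longrightarrow> smooth_fun g \<Longrightarrow> smooth_fun (\<lambda>x. f x + g x)"
 by (simp add: smooth_fun_def Ck_add)

lemma smooth_fun_mult: "smooth_fun f \<Longrightarrow> smooth_fun g \<Longrightarrow> smooth_fun (\<lambda>x. f x * g x)"
 by (simp add: smooth_fun_def Ck_mult)

lemma smooth_fun_const [simp]: "smooth_fun (\<lambda>x. c)"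
 by (simp add: smooth_fun_def)

lemma smooth_fun_diff: "smooth_fun f \<Longrightarrow> smooth_fun g \<Longrightarrow> smooth_fun (\<lambda>x. f x - g x)"
 using smooth_fun_add[OF _ smooth_fun_mult[OF smooth_fun_const], of f g "-1"] by simp

lemma smooth_fun_inner: "smooth_fun (\<lambda>x. x \<bullet> c)"
 by (simp add: smooth_fun_def Ck_inner)

lemma smooth_fun_sum: "(\<And>i. i \<in> I \<Longrightarrow> smooth_fun (f i)) \<Longrightarrow> smooth_fun (\<lambda>x. \<Sum>i\<in>I. f i x)"
 by (induction I rule: infinite_finite_induct) (auto intro: smooth_fun_add)

lemma smooth_fun_prod: "(\<And>i. i \<in> I \<Longrightarrow> smooth_fun (f i)) \<Longrightarrow> smooth_fun (\<lambda>x. \<Prod>i\<in>I. f i x)"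
 by (induction I rule: infinite_finite_induct) (auto intro: smooth_fun_mult)

lemma smooth_fun_smooth_step: "smooth_fun f \<Longrightarrow> smooth_fun (\<lambda>x. smooth_step (f x))"
 by (simp add: smooth_fun_def Ck_smooth_step)

lemma smooth_fun_inverse: "smooth_fun f \<Longrightarrow> (\<And>x. f x \<noteq> 0) \<Longrightarrow> smooth_fun (\<lambda>x. inverse (f x))"
 by (simp add: smooth_fun_def Ck_inverse)

lemma smooth_fun_differentiable: "smooth_fun f \<Longrightarrow> f differentiable (at x)"
 unfolding smooth_fun_def by (metis Ck.simps(2))

lemma smooth_fun_continuous: "smooth_fun f \<Longrightarrow> continuous_on A f"
 unfolding smooth_fun_def by (metis Ck_continuous continuous_on_subset subset_UNIV)

lemma smooth_fun_partial_deriv: "smooth_fun f \<Longrightarrow> smooth_fun (partial_deriv i f)"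
 unfolding smooth_fun_def by (metis Ck.simps(2))

lemma smooth_fun_norm_square: "smooth_fun (\<lambda>x. (norm (x - a))^2)"
proof -
 have "smooth_fun (\<lambda>x. \<Sum>i\<in>Basis. (x \<bullet> i - a \<bullet> i) * (x \<bullet> i - a \<bullet> i))"
  by (intro smooth_fun_sum smooth_fun_mult smooth_fun_diff smooth_fun_inner smooth_fun_const)
 moreover have "(norm (x - a))^2 = (\<Sum>i\<in>Basis. (x \<bullet> i - a \<bullet> i) * (x \<bullet> i - a \<bullet> i))" for x
  unfolding power2_norm_eq_inner by (subst euclidean_inner) (simp add: inner_diff_left)
 ultimately show ?thesis by simp
qed

lemma test_fun_smooth: "f \<in> test_fun U \<Longrightarrow> smooth_fun f"
 by (simp add: test_fun_def)

lemma test_fun_mono: "U \<subseteq> V \<Longrightarrow> test_fun U \<subseteq> test_fun V"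
 by (auto simp: test_fun_def)

lemma test_fun_add: "f \<in> test_fun U \<Longrightarrow> g \<in> test_fun U \<Longrightarrow> (\<lambda>x. f x + g x) \<in> test_fun U"
proof -
 assume a: "f \<in> test_fun U" "g \<in> test_fun U"
 obtain K K' where "compact K" "K \<subseteq> U" "\<And>x. x \<notin> K \<Longrightarrow> f x = 0" "compact K'" "K' \<subseteq> U" "\<And>x. x \<notin> K' \<Longrightarrow> g x = 0"
  using a by (metis test_fun_support)
 then show ?thesis using a by (intro test_funI[of _ "K \<union> K'"]) (auto intro: smooth_fun_add test_fun_smooth)
qed

lemma test_fun_mult: "f \<in> test_fun U \<Longrightarrow> smooth_fun g \<Longrightarrow> (\<lambda>x. f x * g x) \<in> test_fun U"
proof -
 assume a: "f \<in> test_fun U" "smooth_fun g"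
 obtain K where "compact K" "K \<subseteq> U" "\<And>x. x \<notin> K \<Longrightarrow> f x = 0" using test_fun_support[OF a(1)] by metis
 then show ?thesis by (intro test_funI[of _ K] smooth_fun_mult test_fun_smooth[OF a(1)] a(2)) auto
qed

lemma test_fun_mult_left: "f \<in> test_fun U \<Longrightarrow> smooth_fun g \<Longrightarrow> (\<lambda>x. g x * f x) \<in> test_fun U"
 using test_fun_mult[of f U g] by (simp add: mult.commute)

lemma test_fun_0: "(\<lambda>x. 0) \<in> test_fun U"
 by (rule test_funI[of _ "{}"]) auto

lemma test_fun_sum: "(\<And>i. i \<in> I \<Longrightarrow> f i \<in> test_fun U) \<Longrightarrow> (\<lambda>x. \<Sum>i\<in>I. f i x) \<in> test_fun U"
 by (induction I rule: infinite_finite_induct) (auto intro: test_fun_add test_fun_0)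

lemma partial_deriv_support:
 assumes "compact K" "\<And>x. x \<notin> K \<Longrightarrow> f x = 0" "x \<notin> K"
 shows "partial_deriv i f x = 0"
proof -
 have "((\<lambda>x. 0) has_derivative (\<lambda>h. 0)) (at x)" by simp
 then have "(f has_derivative (\<lambda>h. 0)) (at x)" by (rule has_derivative_transform_within_open[of _ _ _ _ "- K"])
    (use assms in \<open>auto simp: compact_imp_closed\<close>)
 from partial_deriv_eq[OF this] show ?thesis .
qed

lemma test_fun_partial_deriv:
 assumes "f \<in> test_fun U" shows "partial_deriv i f \<in> test_fun U"
proof -
 obtain K where K: "compact K" "K \<subseteq> U" "\<And>x. x \<notin> K \<Longrightarrow> f x = 0" using test_fun_support[OF assms] by metis
 show ?thesis
  using K(1,2) smooth_fun_partial_deriv[OF test_fun_smooth[OF assms]] partial_deriv_support[OF K(1,3)] by (intro test_funI[of _ K]) auto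
qed

lemma test_fun_bounded:
 assumes "f \<in> test_fun U" obtains M where "M > 0" "\<And>x. \<bar>f x\<bar> \<le> M"
proof -
 obtain K where K: "compact K" "K \<subseteq> U" "\<And>x. x \<notin> K \<Longrightarrow> f x = 0" using test_fun_support[OF assms] by metis
 have "bounded (f ` K)" by (intro compact_imp_bounded compact_continuous_image smooth_fun_continuous test_fun_smooth[OF assms] K)
 then obtain M where "\<And>x. x \<in> K \<Longrightarrow> \<bar>f x\<bar> \<le> M" by (auto simp: bounded_iff)
 with K(3) show ?thesis by (intro that[of "max M 1"]) (force intro: order_trans[OF _ max.cobounded1])+
qed

text \<open>By scaling, one constant M serves all centres and radii; it enters the Caccioppoli
  constant later. The plateau has radius 3/4 r so that the cutoff is constant on a neighbourhood of
  the closed ball of radius r/2, the inner edge of the annulus on which it is used.\<close>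

lemma cutoff_exists:
 obtains M :: real where "M > 0" "\<And>(y::real^'n::finite) r. r > 0 \<Longrightarrow> \<exists>\<psi>\<in>test_fun UNIV.
   (\<forall>x\<in>ball y (3/4*r). \<psi> x = 1) \<and> (\<forall>x. x \<notin> ball y r \<longrightarrow> \<psi> x = 0) \<and> (\<forall>x. 0 \<le> \<psi> x \<and> \<psi> x \<le> 1) \<and>
   (\<forall>i x. \<bar>partial_deriv i \<psi> x\<bar> \<le> M / r)"
proof -
 obtain s' M where s: "\<And>t. (smooth_step has_real_derivative s' t) (at t)" "\<And>t. \<bar>s' t\<bar> \<le> M" "M > 0"
  using smooth_step_deriv_bound by metis
 have "\<exists>\<psi>\<in>test_fun UNIV. (\<forall>x\<in>ball y (3/4*r). \<psi> x = 1) \<and> (\<forall>x. x \<notin> ball y r \<longrightarrow> \<psi> x = 0) \<and> (\<forall>x. 0 \<le> \<psi> x \<and> \<psi> x \<le> 1) \<and>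
   (\<forall>i x. \<bar>partial_deriv i \<psi> x\<bar> \<le> (6 * M) / r)" if r: "r > 0" for y :: "real^'n" and r
 proof -
  \<comment> \<open>Since 1 - (3/4)^2 = 7/16, this function reaches 1 exactly at radius 3/4 r and 0
    at radius r; being quadratic it is smooth at the centre. On the ball its partial derivatives are
    at most (32/7)/r, whence the factor 6 below.\<close>
  define g where "g = (\<lambda>x. 16/7 * (1 - (norm (x - y))^2 * inverse (r^2)))"
  define \<psi> where "\<psi> = (\<lambda>x. smooth_step (g x))"
  have sm: "smooth_fun \<psi>" unfolding \<psi>_def g_def
   by (intro smooth_fun_smooth_step smooth_fun_mult smooth_fun_diff smooth_fun_const smooth_fun_norm_square)
  have out: "\<psi> x = 0" if "x \<notin> ball y r" for x
  proof -
   have "r^2 \<le> (norm (x - y))^2" using that r by (intro power_mono) (auto simp: dist_norm norm_minus_commute)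
   then have "g x \<le> 0" using r by (auto simp: g_def field_simps)
   then show ?thesis by (simp add: \<psi>_def)
  qed
  have inn: "\<psi> x = 1" if "x \<in> ball y (3/4*r)" for x
  proof -
   have "(norm (x - y))^2 \<le> (3/4*r)^2" using that r by (intro power_mono) (auto simp: dist_norm norm_minus_commute)
   then have "g x \<ge> 1" using r by (auto simp: g_def field_simps power2_eq_square)
   then show ?thesis by (simp add: \<psi>_def)
  qed
  have tf: "\<psi> \<in> test_fun UNIV" using out by (intro test_funI[OF sm, of "cball y r"]) auto
  have d: "(\<psi> has_derivative (\<lambda>h. s' (g x) * (- (16/7) * (2 * ((x - y) \<bullet> h)) * inverse (r^2)))) (at x)" for x
  proof -
   have "(g has_derivative (\<lambda>h. - (16/7) * (2 * ((x - y) \<bullet> h)) * inverse (r^2))) (at x)"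
    unfolding g_def power2_norm_eq_inner by (auto intro!: derivative_eq_intros simp: inner_commute algebra_simps)
   from has_derivative_compose[OF this s(1)[unfolded has_field_derivative_def]] show ?thesis by (simp add: \<psi>_def)
  qed
  have "\<bar>partial_deriv i \<psi> x\<bar> \<le> (6 * M) / r" for i x
  proof (cases "x \<in> cball y r")
   case True
   have "\<bar>partial_deriv i \<psi> x\<bar> = \<bar>s' (g x)\<bar> * (32/7 * \<bar>(x - y) $ i\<bar> / r^2)"
   proof -
    have "partial_deriv i \<psi> x = s' (g x) * (- (32/7) * ((x - y) $ i) * inverse (r^2))"
     using partial_deriv_eq[OF d, of i x] by (simp add: inner_axis)
    also have "\<bar>...\<bar> = \<bar>s' (g x)\<bar> * (32/7 * \<bar>(x - y) $ i\<bar> * inverse (r^2))"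
     by (simp add: abs_mult del: vector_minus_component)
    finally show ?thesis by (simp only: divide_inverse)
   qed
   also have "... \<le> M * (32/7 * r / r^2)" using s(2)[of "g x"] True component_le_norm_cart[of "x - y" i]
    by (intro mult_mono divide_right_mono) (auto simp: dist_norm norm_minus_commute)
   also have "... \<le> 6 * M / r" using r s(3) by (simp add: power2_eq_square field_simps)
   finally show ?thesis .
  next
   case False
   then have "partial_deriv i \<psi> x = 0" using out by (intro partial_deriv_support[of "cball y r"]) auto
   then show ?thesis using r s(3) by simp
  qed
  then show ?thesis using tf out inn smooth_step_nonneg smooth_step_le_1 by (intro bexI[of _ \<psi>]) (auto simp: \<psi>_def)
 qed
 with s(3) show ?thesis by (intro that[of "6 * M"]) auto
qed

text \<open>Products of one-dimensional steps that steepen with j: they vanish off the open box and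
  are eventually 1 at each of its points. This lets tests against smooth functions become tests
  against boxes.\<close>

lemma box_approx:
 fixes a b :: "real^'n::finite"
 assumes "cbox a b \<subseteq> U"
 obtains f where "\<And>j::nat. f j \<in> test_fun U" "\<And>j x. 0 \<le> f j x \<and> f j x \<le> 1"
  "\<And>j x. x \<notin> cbox a b \<Longrightarrow> f j x = 0"
  "\<And>x. (\<lambda>j. f j x) \<longlonglongrightarrow> indicator (box a b) x"
proof -
 define f where "f = (\<lambda>(j::nat) x. \<Prod>i\<in>Basis. smooth_step (real j * (x \<bullet> i - a \<bullet> i)) * smooth_step (real j * (b \<bullet> i - x \<bullet> i)))"
 have sm: "smooth_fun (f j)" for j unfolding f_def
  by (intro smooth_fun_prod smooth_fun_mult smooth_fun_smooth_step smooth_fun_diff smooth_fun_inner smooth_fun_const)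
 have out: "f j x = 0" if nb: "x \<notin> box a b" for j x
 proof -
  obtain i where "i \<in> Basis" "x \<bullet> i \<le> a \<bullet> i \<or> b \<bullet> i \<le> x \<bullet> i" using nb unfolding mem_box by (meson not_less)
  then have "smooth_step (real j * (x \<bullet> i - a \<bullet> i)) * smooth_step (real j * (b \<bullet> i - x \<bullet> i)) = 0"
   by (auto simp: mult_nonneg_nonpos)
  then show ?thesis using \<open>i \<in> Basis\<close> by (auto simp: f_def intro!: prod_zero)
 qed
 have le1: "0 \<le> f j x \<and> f j x \<le> 1" for j x unfolding f_def by (auto intro!: prod_nonneg prod_le_1 mult_nonneg_nonneg mult_le_one
    simp: smooth_step_nonneg smooth_step_le_1)
 have lim: "(\<lambda>j. f j x) \<longlonglongrightarrow> indicator (box a b) x" for x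
 proof (cases "x \<in> box a b")
  case False then show ?thesis by (simp add: out)
 next
  case True
  have step1: "(\<lambda>j. smooth_step (real j * c)) \<longlonglongrightarrow> 1" if "c > 0" for c
  proof (rule tendsto_eventually)
   have "\<forall>\<^sub>F j in sequentially. real j \<ge> 1 / c" using filterlim_real_sequentially by (simp add: filterlim_at_top)
   then show "\<forall>\<^sub>F j in sequentially. smooth_step (real j * c) = 1"
    by eventually_elim (use that in \<open>simp add: field_simps\<close>)
  qed
  have "(\<lambda>j. f j x) \<longlonglongrightarrow> (\<Prod>i\<in>(Basis::(real^'n) set). 1 * 1)"
   unfolding f_def using True by (intro tendsto_intros step1) (auto simp: mem_box)
  then show ?thesis using True by simp
 qed
 have out': "f j x = 0" if "x \<notin> cbox a b" for j x using that out box_subset_cbox by blast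
 show ?thesis
  by (rule that[of f]) (use out' le1 lim sm assms box_subset_cbox in \<open>auto intro!: test_funI[of _ "cbox a b"]\<close>)
qed

subsection \<open>Integration against test functions\<close>

lemma borel_measurable_lebesgue_continuous:
 fixes f :: "real^'n::finite \<Rightarrow> 'b::real_normed_vector"
 shows "continuous_on UNIV f \<Longrightarrow> f \<in> meas_L"
 by (intro measurable_completion) (simp add: borel_measurable_continuous_onI)

lemma locally_integrable_mono: "locally_integrable U f \<Longrightarrow> V \<subseteq> U \<Longrightarrow> locally_integrable V f"
 by (auto simp: locally_integrable_def)

lemma integrable_bounded_support:
 fixes h :: "real^'n::finite \<Rightarrow> 'b::euclidean_space" and g :: "real^'n \<Rightarrow> real"
 assumes g: "g \<in> meas_L" "\<And>x. \<bar>g x\<bar> \<le> M" "\<And>x. x \<notin> K \<Longrightarrow> g x = 0"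
  and h: "h absolutely_integrable_on K"
 shows "integrable lebesgue (\<lambda>x. g x *\<^sub>R h x)"
proof -
 have i: "integrable lebesgue (\<lambda>x. indicator K x *\<^sub>R h x)" using h by (simp add: set_integrable_def)
 have "integrable lebesgue (\<lambda>x. g x *\<^sub>R (indicator K x *\<^sub>R h x))"
 proof (rule Bochner_Integration.integrable_bound)
  show "integrable lebesgue (\<lambda>x. M *\<^sub>R (indicator K x *\<^sub>R h x))" by (intro integrable_scaleR_right i)
  show "(\<lambda>x. g x *\<^sub>R (indicator K x *\<^sub>R h x)) \<in> meas_L"
   by (intro borel_measurable_scaleR[OF g(1)] borel_measurable_integrable[OF i])
  show "AE x in lebesgue. norm (g x *\<^sub>R indicator K x *\<^sub>R h x) \<le> norm (M *\<^sub>R indicator K x *\<^sub>R h x)"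
   using g(2) by (intro AE_I2) (auto simp only: norm_scaleR intro!: mult_nonneg_nonneg abs_ge_zero norm_ge_zero mult_right_mono order_trans[OF _ abs_ge_self])
 qed
 moreover have "g x *\<^sub>R (indicator K x *\<^sub>R h x) = g x *\<^sub>R h x" for x using g(3)[of x] by (cases "x \<in> K") auto
 ultimately show ?thesis by (simp only:)
qed

lemma test_fun_measurable: "f \<in> test_fun U \<Longrightarrow> f \<in> meas_L"
 by (intro borel_measurable_lebesgue_continuous smooth_fun_continuous test_fun_smooth)

lemma test_fun_integrable_scaleR:
 assumes "\<phi> \<in> test_fun U" "locally_integrable U h"
 shows "integrable lebesgue (\<lambda>x. \<phi> x *\<^sub>R h x)"
proof -
 obtain K where K: "compact K" "K \<subseteq> U" "\<And>x. x \<notin> K \<Longrightarrow> \<phi> x = 0" using test_fun_support[OF assms(1)] by metis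
 obtain M where "\<And>x. \<bar>\<phi> x\<bar> \<le> M" using test_fun_bounded[OF assms(1)] by metis
 then show ?thesis using assms(2) K test_fun_measurable[OF assms(1)]
  by (intro integrable_bounded_support[of \<phi> M K]) (auto simp: locally_integrable_def)
qed

lemma test_fun_set_integral:
 assumes "\<phi> \<in> test_fun U"
 shows "(LINT x:U|lebesgue. \<phi> x *\<^sub>R h x) = (\<integral>x. \<phi> x *\<^sub>R h x \<partial>lebesgue)"
proof -
 obtain K where K: "compact K" "K \<subseteq> U" "\<And>x. x \<notin> K \<Longrightarrow> \<phi> x = 0" using test_fun_support[OF assms(1)] by metis
 then have "indicator U x *\<^sub>R \<phi> x *\<^sub>R h x = \<phi> x *\<^sub>R h x" for x by (cases "x \<in> U") auto
 then show ?thesis by (simp only: set_lebesgue_integral_def)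
qed

section \<open>Local integrability and the calculus of weak derivatives\<close>

lemma locally_integrable_continuous:
 fixes f :: "real^'n::finite \<Rightarrow> 'b::euclidean_space"
 assumes "open U" "continuous_on U f"
 shows "locally_integrable U f"
 unfolding locally_integrable_def
proof (intro allI impI)
 fix K assume K: "compact K \<and> K \<subseteq> U"
 then have "integrable lborel (\<lambda>x. indicator K x *\<^sub>R f x)"
  using assms by (intro borel_integrable_compact) (auto intro: continuous_on_subset)
 then show "f absolutely_integrable_on K" by (simp add: set_integrable_def integrable_completion)
qed

text \<open>Test functions vanish off U, so the integrals can be taken over the whole space.\<close>

lemma has_weak_deriv_alt:
 "has_weak_deriv U u D \<longleftrightarrow> locally_integrable U u \<and> locally_integrable U D \<and>
  (\<forall>\<phi>\<in>test_fun U. \<forall>\<alpha>. (\<integral>x. partial_deriv \<alpha> \<phi> x *\<^sub>R u x \<partial>lebesgue) = - (\<integral>x. \<phi> x *\<^sub>R (D x $ \<alpha>) \<partial>lebesgue))"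
 by (auto simp: has_weak_deriv_def test_fun_set_integral test_fun_partial_deriv)

lemma has_weak_deriv_restrict: "has_weak_deriv U u D \<Longrightarrow> V \<subseteq> U \<Longrightarrow> has_weak_deriv V u D"
 unfolding has_weak_deriv_alt using locally_integrable_mono[of U _ V] subsetD[OF test_fun_mono[of V U]] by meson

lemma locally_integrable_linear:
 fixes T :: "'b::euclidean_space \<Rightarrow> 'c::euclidean_space"
 assumes "locally_integrable U f" "bounded_linear T"
 shows "locally_integrable U (\<lambda>x. T (f x))"
 unfolding locally_integrable_def
proof (intro allI impI)
 fix K assume "compact K \<and> K \<subseteq> U"
 then have "f absolutely_integrable_on K" using assms(1) by (simp add: locally_integrable_def)
 then show "(\<lambda>x. T (f x)) absolutely_integrable_on K" using absolutely_integrable_linear[OF _ assms(2)] by (simp only: o_def)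
qed

lemma locally_integrable_add:
 "locally_integrable U f \<Longrightarrow> locally_integrable U g \<Longrightarrow> locally_integrable U (\<lambda>x. f x + g x)"
 unfolding locally_integrable_def by (blast intro: set_integral_add(1))

lemma has_weak_deriv_linear:
 fixes T :: "'b::euclidean_space \<Rightarrow> 'c::euclidean_space"
 assumes u: "has_weak_deriv U u D" and T: "bounded_linear T"
 shows "has_weak_deriv U (\<lambda>x. T (u x)) (\<lambda>x. \<chi> \<alpha>. T (D x $ \<alpha>))"
 unfolding has_weak_deriv_alt
proof (intro conjI ballI allI)
 interpret T: bounded_linear T by fact
 have lu: "locally_integrable U u" and lD: "locally_integrable U D" using u by (auto simp: has_weak_deriv_alt)
 show "locally_integrable U (\<lambda>x. T (u x))" by (rule locally_integrable_linear[OF lu T])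
 have "linear (\<lambda>v. \<chi> \<alpha>. T (v $ \<alpha>))" by (rule linearI) (auto simp: vec_eq_iff T.add T.scaleR)
 then show "locally_integrable U (\<lambda>x. \<chi> \<alpha>. T (D x $ \<alpha>))"
  by (intro locally_integrable_linear[OF lD]) (simp add: linear_conv_bounded_linear)
 fix \<phi> \<alpha> assume \<phi>: "\<phi> \<in> test_fun U"
 have lDa: "locally_integrable U (\<lambda>x. D x $ \<alpha>)" by (rule locally_integrable_linear[OF lD bounded_linear_vec_nth])
 have "(\<integral>x. partial_deriv \<alpha> \<phi> x *\<^sub>R T (u x) \<partial>lebesgue) = T (\<integral>x. partial_deriv \<alpha> \<phi> x *\<^sub>R u x \<partial>lebesgue)"
  using integral_bounded_linear[OF T test_fun_integrable_scaleR[OF test_fun_partial_deriv[OF \<phi>] lu]] by (simp add: T.scaleR)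
 also have "... = - T (\<integral>x. \<phi> x *\<^sub>R (D x $ \<alpha>) \<partial>lebesgue)"
  using u \<phi> by (simp add: has_weak_deriv_alt linear_neg[OF T.linear_axioms])
 also have "T (\<integral>x. \<phi> x *\<^sub>R (D x $ \<alpha>) \<partial>lebesgue) = (\<integral>x. \<phi> x *\<^sub>R T (D x $ \<alpha>) \<partial>lebesgue)"
  using integral_bounded_linear[OF T test_fun_integrable_scaleR[OF \<phi> lDa]] by (simp add: T.scaleR)
 finally show "(\<integral>x. partial_deriv \<alpha> \<phi> x *\<^sub>R T (u x) \<partial>lebesgue) = - (\<integral>x. \<phi> x *\<^sub>R (\<chi> \<alpha>. T (D x $ \<alpha>)) $ \<alpha> \<partial>lebesgue)"
  by simp
qed

lemma has_weak_deriv_add: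
 assumes "has_weak_deriv U u D" "has_weak_deriv U v E"
 shows "has_weak_deriv U (\<lambda>x. u x + v x) (\<lambda>x. D x + E x)"
 unfolding has_weak_deriv_alt
proof (intro conjI ballI allI)
 have l: "locally_integrable U u" "locally_integrable U D" "locally_integrable U v" "locally_integrable U E"
  using assms by (auto simp: has_weak_deriv_alt)
 show "locally_integrable U (\<lambda>x. u x + v x)" "locally_integrable U (\<lambda>x. D x + E x)"
  by (intro locally_integrable_add l)+
 fix \<phi> \<alpha> assume \<phi>: "\<phi> \<in> test_fun U"
 note i = test_fun_integrable_scaleR[OF test_fun_partial_deriv[OF \<phi>] l(1)] test_fun_integrable_scaleR[OF test_fun_partial_deriv[OF \<phi>] l(3)]
  test_fun_integrable_scaleR[OF \<phi> locally_integrable_linear[OF l(2) bounded_linear_vec_nth]]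
  test_fun_integrable_scaleR[OF \<phi> locally_integrable_linear[OF l(4) bounded_linear_vec_nth]]
 show "(\<integral>x. partial_deriv \<alpha> \<phi> x *\<^sub>R (u x + v x) \<partial>lebesgue) = - (\<integral>x. \<phi> x *\<^sub>R (D x + E x) $ \<alpha> \<partial>lebesgue)"
  using assms \<phi> i by (simp add: has_weak_deriv_alt scaleR_add_right)
qed

lemma has_weak_deriv_scaleR:
 fixes u :: "real^'n::finite \<Rightarrow> 'b::euclidean_space"
 assumes "has_weak_deriv U u D"
 shows "has_weak_deriv U (\<lambda>x. c *\<^sub>R u x) (\<lambda>x. c *\<^sub>R D x)"
 using has_weak_deriv_linear[OF assms bounded_linear_scaleR_right[of c]] by (simp add: scaleR_vec_def)

lemma has_weak_deriv_diff:
 assumes "has_weak_deriv U u D" "has_weak_deriv U v E"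
 shows "has_weak_deriv U (\<lambda>x. u x - v x) (\<lambda>x. D x - E x)"
 using has_weak_deriv_add[OF assms(1) has_weak_deriv_scaleR[OF assms(2), of "-1"]] by simp

lemma has_weak_deriv_sum:
 assumes "finite I" "\<And>i. i \<in> I \<Longrightarrow> has_weak_deriv U (u i) (D i)"
 shows "has_weak_deriv U (\<lambda>x. \<Sum>i\<in>I. u i x) (\<lambda>x. \<Sum>i\<in>I. D i x)"
 using assms
proof (induction I)
 case empty
 have "locally_integrable U (\<lambda>x. 0)" by (simp add: locally_integrable_def set_integrable_def)
 then show ?case by (simp add: has_weak_deriv_alt locally_integrable_def set_integrable_def)
next
 case (insert i I)
 then show ?case by (auto intro!: has_weak_deriv_add)
qed

text \<open>Translation invariance makes the integral of every difference quotient vanish.\<close>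

lemma integral_partial_deriv:
 fixes \<phi> :: "real^'n::finite \<Rightarrow> real"
 assumes \<phi>: "\<phi> \<in> test_fun UNIV"
 shows "(\<integral>x. partial_deriv i \<phi> x \<partial>lebesgue) = 0"
proof -
 let ?e = "axis i 1 :: real^'n"
 obtain K where K: "compact K" "\<And>x. x \<notin> K \<Longrightarrow> \<phi> x = 0" using test_fun_support[OF \<phi>] by metis
 obtain M where M: "\<And>x. \<bar>partial_deriv i \<phi> x\<bar> \<le> M" "M > 0"
  using test_fun_bounded[OF test_fun_partial_deriv[OF \<phi>]] by metis
 obtain R where R: "K \<subseteq> cball 0 R" using compact_imp_bounded[OF K(1)] unfolding bounded_iff subset_iff mem_cball_0 by blast
 have cont: "continuous_on UNIV \<phi>" by (intro smooth_fun_continuous test_fun_smooth[OF \<phi>])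
 have mb [measurable]: "\<phi> \<in> borel_measurable borel" using cont by (rule borel_measurable_continuous_onI)
 have ip: "integrable lborel \<phi>"
 proof -
  have "integrable lborel (\<lambda>x. indicator K x *\<^sub>R \<phi> x)" by (intro borel_integrable_compact K continuous_on_subset[OF cont]) auto
  moreover have "(\<lambda>x. indicator K x *\<^sub>R \<phi> x) = \<phi>" using K(2) by (auto simp: indicator_def fun_eq_iff)
  ultimately show ?thesis by simp
 qed
 have ft: "\<phi> = (\<lambda>x. \<phi> x)" ..
 have sh: "integrable lborel (\<lambda>x. \<phi> (c + x))" "(\<integral>x. \<phi> (c + x) \<partial>lborel) = (\<integral>x. \<phi> x \<partial>lborel)" for c
 proof -
  have d: "distr lborel borel ((+) c) = (lborel :: (real^'n) measure)" by (rule lborel_distr_plus)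
  show "integrable lborel (\<lambda>x. \<phi> (c + x))"
   using ip integrable_distr_eq[of "(+) c" lborel borel \<phi>] by (simp add: d)
  show "(\<integral>x. \<phi> (c + x) \<partial>lborel) = (\<integral>x. \<phi> x \<partial>lborel)"
   using integral_distr[of "(+) c" lborel borel \<phi>] by (simp add: d)
 qed
 have line: "((\<lambda>t. \<phi> (t *\<^sub>R ?e + x)) has_real_derivative partial_deriv i \<phi> (t *\<^sub>R ?e + x)) (at t)" for t x
 proof -
  obtain f' where f': "(\<phi> has_derivative f') (at (t *\<^sub>R ?e + x))"
   using smooth_fun_differentiable[OF test_fun_smooth[OF \<phi>]] by (auto simp: differentiable_def)
  have "((\<lambda>t. t *\<^sub>R ?e + x) has_derivative (\<lambda>h. h *\<^sub>R ?e)) (at t)" by (auto intro!: derivative_eq_intros)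
  from has_derivative_compose[OF this f'] show ?thesis using partial_deriv_eq[OF f', of i] linear_cmul[OF has_derivative_linear[OF f']]
   by (auto simp: has_field_derivative_def mult_commute_abs fun_eq_iff elim!: back_subst)
 qed
 define h where "h = (\<lambda>k::nat. inverse (real (Suc k)))"
 have h: "0 < h k" "h k \<le> 1" for k by (auto simp: h_def divide_simps)
 have h0: "h \<longlonglongrightarrow> 0" unfolding h_def by (rule LIMSEQ_inverse_real_of_nat)
 define q where "q = (\<lambda>k x. (\<phi> (h k *\<^sub>R ?e + x) - \<phi> x) / h k)"
 have q0: "(\<integral>x. q k x \<partial>lborel) = 0" for k using sh[of "h k *\<^sub>R ?e"] ip by (simp add: q_def)
 have "(\<lambda>k. \<integral>x. q k x \<partial>lborel) \<longlonglongrightarrow> (\<integral>x. partial_deriv i \<phi> x \<partial>lborel)"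
 proof (rule integral_dominated_convergence)
  show "partial_deriv i \<phi> \<in> borel_measurable lborel"
   using smooth_fun_continuous[OF smooth_fun_partial_deriv[OF test_fun_smooth[OF \<phi>]]] by (simp add: borel_measurable_continuous_onI)
  show "q k \<in> borel_measurable lborel" for k unfolding q_def by measurable
  \<comment> \<open>Dominating function: by the mean value theorem the quotients are bounded by M,
    and since the increments are at most 1 they vanish outside the ball of radius R + 1.\<close>
  show "integrable lborel (\<lambda>x. indicator (cball 0 (R + 1)) x *\<^sub>R M :: real)"
   by (intro borel_integrable_compact) auto
  show "AE x in lborel. (\<lambda>k. q k x) \<longlonglongrightarrow> partial_deriv i \<phi> x"
  proof (intro AE_I2)
   fix x
   have "((\<lambda>t. (\<phi> (t *\<^sub>R ?e + x) - \<phi> x) / t) \<longlongrightarrow> partial_deriv i \<phi> x) (at 0)"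
    using line[of x 0] by (simp add: DERIV_def)
   then show "(\<lambda>k. q k x) \<longlonglongrightarrow> partial_deriv i \<phi> x" unfolding q_def
   proof (rule filterlim_compose)
    show "filterlim h (at 0) sequentially"
     using h(1) h0 by (auto simp: filterlim_at less_imp_neq[symmetric] intro!: always_eventually)
   qed
  qed
  show "AE x in lborel. norm (q k x) \<le> indicator (cball 0 (R + 1)) x *\<^sub>R M" for k
  proof (intro AE_I2)
   fix x
   show "norm (q k x) \<le> indicator (cball 0 (R + 1)) x *\<^sub>R M"
   proof (cases "x \<in> cball 0 (R + 1)")
    case True
    obtain z where "\<phi> (h k *\<^sub>R ?e + x) - \<phi> (0 *\<^sub>R ?e + x) = (h k - 0) * partial_deriv i \<phi> (z *\<^sub>R ?e + x)"
     using MVT2[OF h(1)[of k] line[of x]] by blast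
    then have "q k x = partial_deriv i \<phi> (z *\<^sub>R ?e + x)" using h(1)[of k] by (simp add: q_def)
    with M True show ?thesis by simp
   next
    case False
    then have "norm x > R + 1" by auto
    moreover have "norm x \<le> norm (h k *\<^sub>R ?e + x) + norm (h k *\<^sub>R ?e)"
     by (metis add.commute norm_triangle_sub norm_minus_commute add_diff_cancel_left' norm_triangle_ineq4 add_diff_cancel)
    moreover have "norm (h k *\<^sub>R ?e) \<le> 1" using h[of k] by (simp add: norm_axis_1)
    ultimately have "norm (h k *\<^sub>R ?e + x) > R" "norm x > R" by linarith+
    then have "h k *\<^sub>R ?e + x \<notin> K" "x \<notin> K" using R by auto
    then show ?thesis using False by (simp add: q_def K(2))
   qed
  qed
 qed
 then have "(\<integral>x. partial_deriv i \<phi> x \<partial>lborel) = 0" using q0 by (simp add: LIMSEQ_const_iff)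
 then show ?thesis using smooth_fun_continuous[OF smooth_fun_partial_deriv[OF test_fun_smooth[OF \<phi>]]]
  by (subst integral_completion) (simp_all add: borel_measurable_continuous_onI)
qed

subsection \<open>Uniqueness of weak derivatives\<close>

text \<open>Boxes form an intersection-stable generator of the Borel sets, so by Dynkin's argument
  the integral vanishes over every Borel set, as it does for the function 0. Vanishing outside a box
  makes the integral over the whole space a box integral, which the complement step
  requires.\<close>

lemma box_integrals_zero_imp_AE:
 fixes h :: "real^'n::finite \<Rightarrow> real"
 assumes h: "integrable lborel h" and bd: "\<And>x. x \<notin> box a b \<Longrightarrow> h x = 0"
  and z: "\<And>c d. (LINT x:box c d|lborel. h x) = 0"
 shows "AE x in lborel. h x = 0"
proof (rule density_unique_real[OF h])
 show "integrable lborel (\<lambda>x::real^'n. 0::real)" by simp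
 fix A :: "(real^'n) set" assume "A \<in> sets lborel"
 then have A: "A \<in> sigma_sets UNIV (range (\<lambda>(a, b). box a b))" by (simp add: borel_eq_box)
 have si: "set_integrable lborel A h" if "A \<in> sets borel" for A
  using h that by (simp only: set_integrable_def integrable_mult_indicator sets_lborel)
 have sets: "sigma_sets UNIV (range (\<lambda>(a, b). box a b)) = sets (borel :: (real^'n) measure)" by (simp add: borel_eq_box)
 have "(LINT x:A|lborel. h x) = 0"
 proof (rule sigma_sets_induct_disjoint[OF _ _ A])
  show "Int_stable (range (\<lambda>(a, b). box a b :: (real^'n) set))"
   by (auto simp: Int_stable_def box_Int_box)
  show "range (\<lambda>(a, b). box a b :: (real^'n) set) \<subseteq> Pow UNIV" by auto
  show "(LINT x:B|lborel. h x) = 0" if "B \<in> range (\<lambda>(a, b). box a b)" for B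
   using that z by auto
  show "(LINT x:{}|lborel. h x) = 0" by (simp add: set_lebesgue_integral_def)
  have "(LINT x:UNIV|lborel. h x) = (LINT x:box a b|lborel. h x)"
   unfolding set_lebesgue_integral_def using bd by (intro Bochner_Integration.integral_cong) (auto simp: indicator_def)
  then have u: "(LINT x:UNIV|lborel. h x) = 0" using z by simp
  show "(LINT x:UNIV - B|lborel. h x) = 0"
   if "B \<in> sigma_sets UNIV (range (\<lambda>(a, b). box a b))" "(LINT x:B|lborel. h x) = 0" for B
  proof -
   have "(LINT x:B \<union> (UNIV - B)|lborel. h x) = (LINT x:B|lborel. h x) + (LINT x:UNIV - B|lborel. h x)"
    using that(1) by (intro set_integral_Un si) (auto simp: sets)
   with u that(2) show ?thesis by simp
  qed
  show "(LINT x:(\<Union>i. B i)|lborel. h x) = 0"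
   if "disjoint_family B" "range B \<subseteq> sigma_sets UNIV (range (\<lambda>(a, b). box a b))"
    "\<And>i. (LINT x:B i|lborel. h x) = 0" for B :: "nat \<Rightarrow> (real^'n) set"
  proof -
   have "(LINT x:(\<Union>i. B i)|lborel. h x) = (\<Sum>i. (LINT x:B i|lborel. h x))"
    using that by (intro lebesgue_integral_countable_add si) (auto simp: sets disjoint_family_on_def)
   with that(3) show ?thesis by simp
  qed
 qed
 then show "(LINT x:A|lborel. h x) = (LINT x:A|lborel. 0)" by simp
qed

text \<open>Box cutoffs turn the hypothesis into vanishing integrals over boxes whose closure lies
  in U; this makes h vanish almost everywhere on each such box, and countably many of them exhaust
  U.\<close>

lemma fundamental_lemma:
 fixes h :: "real^'n::finite \<Rightarrow> real"
 assumes U: "open U" and h: "locally_integrable U h"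
  and z: "\<And>\<phi>. \<phi> \<in> test_fun U \<Longrightarrow> (\<integral>x. \<phi> x * h x \<partial>lebesgue) = 0"
 shows "AE x in lebesgue_on U. h x = 0"
proof -
 have box0: "(\<integral>x. indicator (box a b) x *\<^sub>R h x \<partial>lebesgue) = 0" if ab: "cbox a b \<subseteq> U" for a b
 proof -
  obtain f where f: "\<And>j::nat. f j \<in> test_fun U" "\<And>j x. 0 \<le> f j x \<and> f j x \<le> 1"
   "\<And>j x. x \<notin> cbox a b \<Longrightarrow> f j x = 0" "\<And>x. (\<lambda>j. f j x) \<longlonglongrightarrow> indicator (box a b) x"
   using box_approx[OF ab] by metis
  have ic: "integrable lebesgue (\<lambda>x. indicator (cbox a b) x *\<^sub>R h x)"
   using h ab by (auto simp: locally_integrable_def set_integrable_def)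
  have eq: "f j x * h x = f j x * (indicator (cbox a b) x *\<^sub>R h x)" for j x using f(3)[of x j] by (cases "x \<in> cbox a b") auto
  have "(\<lambda>j. \<integral>x. f j x * h x \<partial>lebesgue) \<longlonglongrightarrow> (\<integral>x. indicator (box a b) x *\<^sub>R h x \<partial>lebesgue)"
  proof (rule integral_dominated_convergence)
   show "integrable lebesgue (\<lambda>x. norm (indicator (cbox a b) x *\<^sub>R h x))" using ic by (rule integrable_norm)
   show m: "(\<lambda>x. f j x * h x) \<in> meas_L" for j
    unfolding eq using ic test_fun_measurable[OF f(1)] by (intro borel_measurable_times) auto
   show lim: "AE x in lebesgue. (\<lambda>j. f j x * h x) \<longlonglongrightarrow> indicator (box a b) x *\<^sub>R h x"
    using f(4) by (auto intro!: tendsto_mult AE_I2)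
   show "(\<lambda>x. indicator (box a b) x *\<^sub>R h x) \<in> meas_L"
    by (rule borel_measurable_LIMSEQ_real[OF _ m]) (use f(4) in \<open>auto intro!: tendsto_mult\<close>)
   show "AE x in lebesgue. norm (f j x * h x) \<le> norm (indicator (cbox a b) x *\<^sub>R h x)" for j
    unfolding eq using f(2) by (intro AE_I2) (auto simp: abs_mult intro!: mult_left_le_one_le)
  qed
  then show ?thesis using z[OF f(1)] by (simp add: LIMSEQ_const_iff)
 qed
 have AEbox: "AE x in lebesgue. x \<in> cbox a b \<longrightarrow> h x = 0" if ab: "cbox a b \<subseteq> U" for a b
 proof -
  define g where "g = (\<lambda>x. indicator (box a b) x *\<^sub>R h x)"
  have "h absolutely_integrable_on cbox a b" using h ab by (auto simp: locally_integrable_def)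
  then have "set_integrable lebesgue (box a b) h" by (rule set_integrable_subset) (auto simp: box_subset_cbox)
  then have ig: "integrable lebesgue g" by (simp add: set_integrable_def g_def)
  \<comment> \<open>Integrals over Borel sets are compared below, so the Lebesgue measurable g is
    exchanged for a Borel representative.\<close>
  then obtain g' where g': "g' \<in> borel_measurable lborel" "AE x in lborel. g x = g' x"
   using completion_ex_borel_measurable_real[of g lborel] by auto
  define k where "k = (\<lambda>x. indicator (box a b) x *\<^sub>R g' x)"
  have k[measurable]: "k \<in> borel_measurable lborel" unfolding k_def using g'(1) by measurable
  have gk: "AE x in lebesgue. g x = k x" using AE_completion[OF g'(2)] by eventually_elim (auto simp: g_def k_def indicator_def split: if_splits)
  have ik: "integrable lebesgue k" using ig gk k by (subst integrable_cong_AE[of _ _ g]) (auto simp: measurable_completion)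
  have "AE x in lborel. k x = 0"
  proof (rule box_integrals_zero_imp_AE)
   show "integrable lborel k" using ik by (simp add: integrable_completion)
   show "x \<notin> box a b \<Longrightarrow> k x = 0" for x by (simp add: k_def)
   show "(LINT x:box c d|lborel. k x) = 0" for c d
   proof (cases "box c d \<inter> box a b = {}")
    case True
    then have "indicator (box c d) x *\<^sub>R k x = 0" for x by (auto simp: k_def indicator_def)
    then show ?thesis by (simp only: set_lebesgue_integral_def Bochner_Integration.integral_zero)
   next
    case False
    \<comment> \<open>The box from c to d is arbitrary and may leave U; only its part inside
      \<open>box a b\<close> matters, which is again a box with closure in U.\<close>
    obtain p q where pq: "box c d \<inter> box a b = box p q" using box_Int_box[of c d a b] by blast
    then have ne: "box p q \<noteq> {}" using False by simp
    then have "cbox p q = closure (box p q)" by (simp add: closure_box)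
    also have "... \<subseteq> closure (box a b)" using pq by (intro closure_mono) blast
    also have "... \<subseteq> cbox a b" by (intro closure_minimal box_subset_cbox) auto
    finally have pU: "cbox p q \<subseteq> U" using ab by blast
    have "(LINT x:box c d|lborel. k x) = (\<integral>x. indicator (box c d) x *\<^sub>R k x \<partial>lebesgue)"
     unfolding set_lebesgue_integral_def by (subst integral_completion) auto
    also have "... = (\<integral>x. indicator (box p q) x *\<^sub>R h x \<partial>lebesgue)"
    proof (rule integral_cong_AE)
     show "(\<lambda>x. indicator (box c d) x *\<^sub>R k x) \<in> meas_L"
      by (intro measurable_completion) auto
     have "h absolutely_integrable_on cbox p q" using h pU by (auto simp: locally_integrable_def)
     then have "set_integrable lebesgue (box p q) h" by (rule set_integrable_subset) (auto simp: box_subset_cbox)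
     then show "(\<lambda>x. indicator (box p q) x *\<^sub>R h x) \<in> meas_L" by (auto simp: set_integrable_def)
     show "AE x in lebesgue. indicator (box c d) x *\<^sub>R k x = indicator (box p q) x *\<^sub>R h x"
      using gk by eventually_elim (auto simp: g_def indicator_def pq[symmetric])
    qed
    also have "... = 0" by (rule box0[OF pU])
    finally show ?thesis .
   qed
  qed
  then have "AE x in lebesgue. k x = 0" by (rule AE_completion)
  moreover have "AE x in lebesgue. x \<notin> cbox a b - box a b"
   using negligible_frontier_interval[of a b] by (intro AE_not_in) (simp only: negligible_iff_null_sets)
  ultimately show ?thesis using gk by eventually_elim (auto simp: g_def)
 qed
 obtain \<D> where D: "countable \<D>" "\<D> \<subseteq> Pow U" "\<And>X. X \<in> \<D> \<Longrightarrow> \<exists>a b. X = cbox a b" "\<Union>\<D> = U"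
  using open_countable_Union_open_cbox[OF U] by metis
 have "AE x in lebesgue. \<forall>X\<in>\<D>. x \<in> X \<longrightarrow> h x = 0" unfolding AE_ball_countable[OF D(1)]
 proof
  fix X assume "X \<in> \<D>"
  then obtain a b where "X = cbox a b" "cbox a b \<subseteq> U" using D by blast
  then show "AE x in lebesgue. x \<in> X \<longrightarrow> h x = 0" using AEbox by simp
 qed
 then have "AE x in lebesgue. x \<in> U \<longrightarrow> h x = 0" by eventually_elim (use D(4) in blast)
 then show ?thesis using U by (subst AE_restrict_space_iff) auto
qed

lemma fundamental_lemma_vec:
 fixes h :: "real^'n::finite \<Rightarrow> 'b::euclidean_space"
 assumes U: "open U" and h: "locally_integrable U h"
  and z: "\<And>\<phi>. \<phi> \<in> test_fun U \<Longrightarrow> (\<integral>x. \<phi> x *\<^sub>R h x \<partial>lebesgue) = 0"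
 shows "AE x in lebesgue_on U. h x = 0"
proof -
 have "AE x in lebesgue_on U. h x \<bullet> e = 0" if "e \<in> Basis" for e
 proof (rule fundamental_lemma[OF U])
  show "locally_integrable U (\<lambda>x. h x \<bullet> e)"
   by (rule locally_integrable_linear[OF h bounded_linear_inner_left])
  fix \<phi> assume \<phi>: "\<phi> \<in> test_fun U"
  have "(\<integral>x. \<phi> x * (h x \<bullet> e) \<partial>lebesgue) = (\<integral>x. (\<phi> x *\<^sub>R h x) \<bullet> e \<partial>lebesgue)" by simp
  also have "... = (\<integral>x. \<phi> x *\<^sub>R h x \<partial>lebesgue) \<bullet> e"
   by (rule integral_inner_left) (auto intro: test_fun_integrable_scaleR[OF \<phi> h])
  finally show "(\<integral>x. \<phi> x * (h x \<bullet> e) \<partial>lebesgue) = 0" using z[OF \<phi>] by simp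
 qed
 then have "AE x in lebesgue_on U. \<forall>e\<in>Basis. h x \<bullet> e = 0"
  by (subst AE_ball_countable[OF countable_finite[OF finite_Basis]]) blast
 then show ?thesis by eventually_elim (simp only: euclidean_all_zero_iff)
qed

lemma has_weak_deriv_unique:
 fixes u :: "real^'n::finite \<Rightarrow> 'b::euclidean_space"
 assumes U: "open U" and "has_weak_deriv U u D" "has_weak_deriv U u E"
 shows "AE x in lebesgue_on U. D x = E x"
proof -
 have "has_weak_deriv U (\<lambda>x. u x - u x) (\<lambda>x. D x - E x)" by (rule has_weak_deriv_diff[OF assms(2,3)])
 then have l: "locally_integrable U (\<lambda>x. D x - E x)"
  and z: "\<And>\<phi> \<alpha>. \<phi> \<in> test_fun U \<Longrightarrow> (\<integral>x. \<phi> x *\<^sub>R ((D x - E x) $ \<alpha>) \<partial>lebesgue) = 0"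
  by (auto simp: has_weak_deriv_alt)
 have "AE x in lebesgue_on U. (D x - E x) $ \<alpha> = 0" for \<alpha>
  by (rule fundamental_lemma_vec[OF U locally_integrable_linear[OF l bounded_linear_vec_nth] z])
 then have "AE x in lebesgue_on U. \<forall>\<alpha>\<in>UNIV. (D x - E x) $ \<alpha> = 0" by (subst AE_ball_countable) auto
 then show ?thesis by eventually_elim (simp add: vec_eq_iff)
qed

lemma wD_has_weak_deriv: "weakly_diff U u \<Longrightarrow> has_weak_deriv U u (wD U u)"
 unfolding weakly_diff_def by (metis wD_def someI_ex)

lemma wD_AE:
 assumes "open U" "has_weak_deriv U u D"
 shows "AE x in lebesgue_on U. wD U u x = D x"
 using assms by (intro has_weak_deriv_unique[OF _ wD_has_weak_deriv]) (auto simp: weakly_diff_def)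

subsection \<open>Square integrals and Lebesgue norms\<close>

text \<open>Kept without the root and without the measurability test of \<open>Lp_norm\<close>, so
  that estimates can be added and chained in the extended reals before finiteness or measurability
  is known.\<close>

definition L2sq :: "(real^'n::finite) set \<Rightarrow> (real^'n \<Rightarrow> 'b::euclidean_space) \<Rightarrow> ennreal" where
 "L2sq S f = (\<integral>\<^sup>+x\<in>S. ennreal ((norm (f x))^2) \<partial>lebesgue)"

lemma ennpowr_le_iff:
 assumes "a > 0" "c \<ge> 0"
 shows "ennpowr x a \<le> ennreal c \<longleftrightarrow> x \<le> ennreal (c powr (1 / a))"
proof (cases x)
 case (real r)
 have "r powr a \<le> c \<longleftrightarrow> r \<le> c powr (1 / a)"
 proof
  assume "r powr a \<le> c"
  then have "(r powr a) powr (1 / a) \<le> c powr (1 / a)" using assms by (intro powr_mono2) auto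
  then show "r \<le> c powr (1 / a)" using real assms by (simp add: powr_powr)
 next
  assume "r \<le> c powr (1 / a)"
  then have "r powr a \<le> (c powr (1 / a)) powr a" using assms real by (intro powr_mono2) auto
  then show "r powr a \<le> c" using assms by (simp add: powr_powr)
 qed
 with real assms show ?thesis by (simp add: ennpowr_def ennreal_le_iff)
qed (use assms in \<open>auto simp: ennpowr_def top_unique\<close>)

lemma ennpowr_less_top_iff: "ennpowr x a < \<infinity> \<longleftrightarrow> x < \<infinity>"
 by (auto simp: ennpowr_def top.not_eq_extremum)

lemma Lp_norm_le_iff:
 assumes "q > 0" "c \<ge> 0" "U \<in> sets lebesgue"
 shows "Lp_norm (ennreal q) U f \<le> ennreal c \<longleftrightarrow> f \<in> meas_on U \<and>
  (\<integral>\<^sup>+x\<in>U. ennreal (norm (f x) powr q) \<partial>lebesgue) \<le> ennreal (c powr q)"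
 using assms by (auto simp: Lp_norm_def ennpowr_le_iff nn_integral_restrict_space top_unique)

lemma Lp_norm_finite_iff:
 assumes "q > 0" "U \<in> sets lebesgue"
 shows "Lp_norm (ennreal q) U f < \<infinity> \<longleftrightarrow> f \<in> meas_on U \<and>
  (\<integral>\<^sup>+x\<in>U. ennreal (norm (f x) powr q) \<partial>lebesgue) < \<infinity>"
 using assms ennpowr_less_top_iff by (auto simp: Lp_norm_def nn_integral_restrict_space)

lemma L2sq_powr: "(\<integral>\<^sup>+x\<in>U. ennreal (norm (f x) powr 2) \<partial>lebesgue) = L2sq U f"
 by (simp add: L2sq_def)

lemma Lp_norm_2_le_iff:
 assumes "c \<ge> 0" "U \<in> sets lebesgue"
 shows "Lp_norm 2 U f \<le> ennreal c \<longleftrightarrow> f \<in> meas_on U \<and> L2sq U f \<le> ennreal (c^2)"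
 using Lp_norm_le_iff[of 2 c U f] assms by (simp add: L2sq_powr L2sq_def)

lemma Lp_norm_2_finite_iff:
 assumes "U \<in> sets lebesgue"
 shows "Lp_norm 2 U f < \<infinity> \<longleftrightarrow> f \<in> meas_on U \<and> L2sq U f < \<infinity>"
 using Lp_norm_finite_iff[of 2 U f] assms by (simp add: L2sq_powr L2sq_def)

lemma locally_integrable_measurable:
 assumes "open U" "locally_integrable U f"
 shows "f \<in> meas_on U"
proof -
 obtain \<D> where D: "countable \<D>" "\<D> \<subseteq> Pow U" "\<And>X. X \<in> \<D> \<Longrightarrow> \<exists>a b. X = cbox a b" "\<Union>\<D> = U"
  using open_countable_Union_open_cbox[OF assms(1)] by metis
 have m: "f \<in> meas_on X" if X: "X \<in> \<D>" for X
 proof -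
  obtain a b where "X = cbox a b" "cbox a b \<subseteq> U" using D X by blast
  then show ?thesis using assms(2) absolutely_integrable_measurable[of "cbox a b" f] by (simp add: locally_integrable_def)
 qed
 show ?thesis
 proof (rule measurable_piecewise_restrict)
  show "countable ((\<lambda>X. X) ` \<D>)" using D by simp
  show "space (lebesgue_on U) \<subseteq> \<Union>((\<lambda>X. X) ` \<D>)" using D by simp
  fix X assume "X \<in> (\<lambda>X. X) ` \<D>"
  then have X: "X \<in> \<D>" by simp
  then have "X \<in> sets lebesgue" using D(3)[OF X] by auto
  have "X \<subseteq> U" using X D(2) by auto
  with \<open>X \<in> sets lebesgue\<close> show "X \<inter> space (lebesgue_on U) \<in> sets (lebesgue_on U)"
   using assms(1) by (simp add: sets_restrict_space_iff Int_absorb2)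
  have "restrict_space (lebesgue_on U) X = lebesgue_on X" using \<open>X \<subseteq> U\<close> \<open>X \<in> sets lebesgue\<close> assms(1)
   by (subst restrict_restrict_space) (auto simp: Int_absorb1)
  then show "f \<in> borel_measurable (restrict_space (lebesgue_on U) X)" using m[OF X] by simp
 qed
qed

lemma has_weak_deriv_measurable:
 assumes "open U" "has_weak_deriv U u D"
 shows "u \<in> meas_on U" "D \<in> meas_on U"
 using assms locally_integrable_measurable by (auto simp: has_weak_deriv_def)

lemma indicator_measurable_on:
 fixes f :: "_ \<Rightarrow> 'b::real_normed_vector"
 assumes "U \<in> sets lebesgue" "f \<in> meas_on U"
 shows "(\<lambda>x. indicator U x *\<^sub>R f x) \<in> meas_L"
 using assms borel_measurable_restrict_space_iff[of U lebesgue f] by simp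

text \<open>Elements of the spaces are measurable only relative to U; the indicator removes their
  arbitrary values elsewhere before g is composed.\<close>

lemma measurable_indicator_comp:
 fixes f :: "_ \<Rightarrow> 'b::euclidean_space" and g :: "'b \<Rightarrow> ennreal"
 assumes "U \<in> sets lebesgue" "f \<in> meas_on U" "g \<in> borel_measurable borel" "S \<in> sets lebesgue" "S \<subseteq> U"
 shows "(\<lambda>x. g (f x) * indicator S x) \<in> meas_L"
proof -
 have "(\<lambda>x. g (indicator U x *\<^sub>R f x) * indicator S x) \<in> meas_L"
  using measurable_compose[OF indicator_measurable_on[OF assms(1,2)] assms(3)] assms(4)
  by (intro borel_measurable_times_ennreal borel_measurable_indicator) auto
 moreover have "g (indicator U x *\<^sub>R f x) * indicator S x = g (f x) * indicator S x" for x using assms(5) by (auto simp: indicator_def)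
 ultimately show ?thesis by simp
qed

lemma L2sq_mono_set: "S \<subseteq> T \<Longrightarrow> L2sq S f \<le> L2sq T f"
 unfolding L2sq_def by (intro nn_integral_mono) (auto simp: indicator_def)

lemma L2sq_cong_AE:
 assumes "U \<in> sets lebesgue" "AE x in lebesgue_on U. f x = g x" "S \<subseteq> U"
 shows "L2sq S f = L2sq S g"
proof -
 have "AE x in lebesgue. x \<in> U \<longrightarrow> f x = g x" using assms by (simp add: AE_restrict_space_iff)
 then have "AE x in lebesgue. ennreal ((norm (f x))^2) * indicator S x = ennreal ((norm (g x))^2) * indicator S x"
  by eventually_elim (use assms(3) in \<open>auto simp: indicator_def\<close>)
 then show ?thesis unfolding L2sq_def by (rule nn_integral_cong_AE)
qed

lemma norm_add_square_le: "(norm (a + b))^2 \<le> 2 * (norm a)^2 + 2 * (norm (b::'a::real_normed_vector))^2"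
proof -
 have "(norm (a + b))^2 \<le> (norm a + norm b)^2" by (intro power_mono norm_triangle_ineq) auto
 also have "... \<le> 2 * (norm a)^2 + 2 * (norm b)^2" using sum_squares_bound[of "norm a" "norm b"] by (simp add: power2_sum)
 finally show ?thesis .
qed

lemma L2sq_add_le:
 assumes "U \<in> sets lebesgue" "f \<in> meas_on U" "g \<in> meas_on U"
  "S \<in> sets lebesgue" "S \<subseteq> U"
 shows "L2sq S (\<lambda>x. f x + g x) \<le> 2 * L2sq S f + 2 * L2sq S g"
proof -
 have m: "(\<lambda>x. ennreal ((norm (h x))^2) * indicator S x) \<in> meas_L"
  if "h \<in> meas_on U" for h :: "real^'a \<Rightarrow> 'b"
  by (rule measurable_indicator_comp[OF assms(1) that _ assms(4,5), of "\<lambda>v. ennreal ((norm v)^2)"]) measurable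
 have "L2sq S (\<lambda>x. f x + g x) \<le> (\<integral>\<^sup>+x. 2 * (ennreal ((norm (f x))^2) * indicator S x) + 2 * (ennreal ((norm (g x))^2) * indicator S x) \<partial>lebesgue)"
  unfolding L2sq_def
 proof (intro nn_integral_mono)
  fix x
  have "ennreal ((norm (f x + g x))^2) \<le> ennreal (2 * (norm (f x))^2 + 2 * (norm (g x))^2)" by (intro ennreal_leI norm_add_square_le)
  also have "... = 2 * ennreal ((norm (f x))^2) + 2 * ennreal ((norm (g x))^2)" by (simp add: ennreal_plus ennreal_mult)
  finally show "ennreal ((norm (f x + g x))^2) * indicator S x \<le> 2 * (ennreal ((norm (f x))^2) * indicator S x) + 2 * (ennreal ((norm (g x))^2) * indicator S x)"
   by (auto simp: indicator_def)
 qed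
 also have "... = 2 * L2sq S f + 2 * L2sq S g" unfolding L2sq_def using m[OF assms(2)] m[OF assms(3)]
  by (subst nn_integral_add) (auto simp: nn_integral_cmult)
 finally show ?thesis .
qed

subsection \<open>Classical derivatives of test fields and a Hardy inequality\<close>

lemma test_fun_integrable: "\<phi> \<in> test_fun U \<Longrightarrow> integrable lebesgue \<phi>"
 using test_fun_integrable_scaleR[of \<phi> UNIV "\<lambda>x. 1::real"] test_fun_mono[of U UNIV]
 by (auto intro!: locally_integrable_continuous continuous_intros)

lemma integration_by_parts:
 assumes "\<phi> \<in> test_fun UNIV" "smooth_fun \<psi>"
 shows "(\<integral>x. partial_deriv i \<psi> x * \<phi> x \<partial>lebesgue) = - (\<integral>x. \<psi> x * partial_deriv i \<phi> x \<partial>lebesgue)"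
proof -
 have d: "partial_deriv i (\<lambda>x. \<psi> x * \<phi> x) x = \<psi> x * partial_deriv i \<phi> x + partial_deriv i \<psi> x * \<phi> x" for x
  using assms by (intro partial_deriv_mult smooth_fun_differentiable test_fun_smooth[of \<phi> UNIV])
 have "0 = (\<integral>x. \<psi> x * partial_deriv i \<phi> x + partial_deriv i \<psi> x * \<phi> x \<partial>lebesgue)"
  using integral_partial_deriv[OF test_fun_mult_left[OF assms], of i] by (simp add: d)
 also have "... = (\<integral>x. \<psi> x * partial_deriv i \<phi> x \<partial>lebesgue) + (\<integral>x. partial_deriv i \<psi> x * \<phi> x \<partial>lebesgue)"
  using test_fun_integrable[OF test_fun_mult_left[OF test_fun_partial_deriv[OF assms(1)] assms(2)]]
   test_fun_integrable[OF test_fun_mult_left[OF assms(1) smooth_fun_partial_deriv[OF assms(2)]]] by (rule Bochner_Integration.integral_add)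
 finally show ?thesis by simp
qed

text \<open>The classical gradient, assembled from components because \<open>partial_deriv\<close>
  is defined for real functions only. Unlike \<open>wD\<close> it is a definite function and not a
  choice among representatives.\<close>

definition grad :: "(real^'n::finite \<Rightarrow> 'b::euclidean_space) \<Rightarrow> real^'n \<Rightarrow> 'b^'n" where
 "grad \<phi> x = (\<chi> \<alpha>. \<Sum>e\<in>Basis. partial_deriv \<alpha> (\<lambda>x. \<phi> x \<bullet> e) x *\<^sub>R e)"

lemma test_vecD: "\<phi> \<in> test_vec U \<Longrightarrow> e \<in> Basis \<Longrightarrow> (\<lambda>x. \<phi> x \<bullet> e) \<in> test_fun U"
 by (auto simp: test_vec_def)

lemma test_vec_continuous:
 fixes \<phi> :: "real^'n::finite \<Rightarrow> 'b::euclidean_space"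
 assumes "\<phi> \<in> test_vec U" shows "continuous_on A \<phi>"
proof -
 have "continuous_on A (\<lambda>x. \<Sum>e\<in>Basis. (\<phi> x \<bullet> e) *\<^sub>R e)" using test_vecD[OF assms]
  by (intro continuous_on_sum continuous_on_scaleR smooth_fun_continuous test_fun_smooth continuous_on_const) auto
 then show ?thesis by (simp only: euclidean_representation)
qed

lemma grad_continuous:
 fixes \<phi> :: "real^'n::finite \<Rightarrow> 'b::euclidean_space"
 assumes "\<phi> \<in> test_vec U" shows "continuous_on A (grad \<phi>)"
 unfolding grad_def[abs_def] using test_vecD[OF assms]
 by (intro continuous_on_vec_lambda continuous_on_sum continuous_on_scaleR smooth_fun_continuous
   test_fun_smooth test_fun_partial_deriv continuous_on_const)

lemma test_vec_mono: "U \<subseteq> V \<Longrightarrow> test_vec U \<subseteq> test_vec V"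
 using test_fun_mono[of U V] unfolding test_vec_def by blast

lemma test_vec_support:
 fixes \<phi> :: "real^'n::finite \<Rightarrow> 'b::euclidean_space"
 assumes "\<phi> \<in> test_vec U"
 obtains K where "compact K" "K \<subseteq> U" "\<And>x. x \<notin> K \<Longrightarrow> \<phi> x = 0" "\<And>x. x \<notin> K \<Longrightarrow> grad \<phi> x = 0"
proof -
 have "\<exists>K. compact K \<and> K \<subseteq> U \<and> (\<forall>x. x \<notin> K \<longrightarrow> \<phi> x \<bullet> e = 0)" if "e \<in> Basis" for e
  using test_fun_support[OF test_vecD[OF assms that]] by metis
 then obtain K where K: "\<And>e. e \<in> Basis \<Longrightarrow> compact (K e) \<and> K e \<subseteq> U \<and> (\<forall>x. x \<notin> K e \<longrightarrow> \<phi> x \<bullet> e = 0)"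
  by metis
 show ?thesis
 proof (rule that[of "\<Union>e\<in>Basis. K e"])
  show "compact (\<Union>e\<in>Basis. K e)" using K by (intro compact_UN) auto
  show "(\<Union>e\<in>Basis. K e) \<subseteq> U" using K by blast
  fix x assume x: "x \<notin> (\<Union>e\<in>Basis. K e)"
  show "\<phi> x = 0" using K x by (intro euclidean_eqI[of "\<phi> x" 0]) auto
  have "partial_deriv \<alpha> (\<lambda>x. \<phi> x \<bullet> e) x = 0" if "e \<in> Basis" for \<alpha> e
   using K[OF that] x that by (intro partial_deriv_support[of "K e"]) auto
  then show "grad \<phi> x = 0" by (simp add: grad_def vec_eq_iff)
 qed
qed

lemma has_weak_deriv_test_vec:
 fixes \<phi> :: "real^'n::finite \<Rightarrow> 'b::euclidean_space"
 assumes U: "open U" and \<phi>: "\<phi> \<in> test_vec V"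
 shows "has_weak_deriv U \<phi> (grad \<phi>)"
 unfolding has_weak_deriv_alt
proof (intro conjI ballI allI)
 show l: "locally_integrable U \<phi>" by (rule locally_integrable_continuous[OF U test_vec_continuous[OF \<phi>]])
 show lg: "locally_integrable U (grad \<phi>)" by (rule locally_integrable_continuous[OF U grad_continuous[OF \<phi>]])
 fix \<psi> \<alpha> assume \<psi>: "\<psi> \<in> test_fun U"
 show "(\<integral>x. partial_deriv \<alpha> \<psi> x *\<^sub>R \<phi> x \<partial>lebesgue) = - (\<integral>x. \<psi> x *\<^sub>R grad \<phi> x $ \<alpha> \<partial>lebesgue)"
 proof (rule euclidean_eqI)
  fix e :: 'b assume e: "e \<in> Basis"
  have "(\<integral>x. partial_deriv \<alpha> \<psi> x *\<^sub>R \<phi> x \<partial>lebesgue) \<bullet> e = (\<integral>x. (partial_deriv \<alpha> \<psi> x *\<^sub>R \<phi> x) \<bullet> e \<partial>lebesgue)"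
   by (rule integral_inner_left[symmetric]) (rule test_fun_integrable_scaleR[OF test_fun_partial_deriv[OF \<psi>] l])
  also have "... = (\<integral>x. partial_deriv \<alpha> \<psi> x * (\<phi> x \<bullet> e) \<partial>lebesgue)" by simp
  also have "... = - (\<integral>x. \<psi> x * partial_deriv \<alpha> (\<lambda>x. \<phi> x \<bullet> e) x \<partial>lebesgue)"
   using test_fun_mono[of V UNIV] test_vecD[OF \<phi> e] test_fun_smooth[OF \<psi>] by (intro integration_by_parts) auto
  also have "(\<integral>x. \<psi> x * partial_deriv \<alpha> (\<lambda>x. \<phi> x \<bullet> e) x \<partial>lebesgue) = (\<integral>x. (\<psi> x *\<^sub>R grad \<phi> x $ \<alpha>) \<bullet> e \<partial>lebesgue)"
   using e by (simp add: grad_def)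
  also have "... = (\<integral>x. \<psi> x *\<^sub>R grad \<phi> x $ \<alpha> \<partial>lebesgue) \<bullet> e" by (rule integral_inner_left)
     (rule test_fun_integrable_scaleR[OF \<psi> locally_integrable_linear[OF lg bounded_linear_vec_nth]])
  finally show "(\<integral>x. partial_deriv \<alpha> \<psi> x *\<^sub>R \<phi> x \<partial>lebesgue) \<bullet> e = - (\<integral>x. \<psi> x *\<^sub>R grad \<phi> x $ \<alpha> \<partial>lebesgue) \<bullet> e"
   by simp
 qed
qed

lemma norm_vec_square: "(norm (v :: 'b::real_normed_vector^'n))^2 = (\<Sum>i\<in>UNIV. (norm (v $ i))^2)"
 by (simp add: norm_vec_def L2_set_def sum_nonneg)

lemma norm_Basis_square: "(norm (v :: 'b::euclidean_space))^2 = (\<Sum>e\<in>Basis. (v \<bullet> e)^2)"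
 unfolding power2_norm_eq_inner by (subst euclidean_inner) (simp add: power2_eq_square)

lemma norm_grad_square:
 "(norm (grad \<phi> x))^2 = (\<Sum>e\<in>Basis. \<Sum>\<alpha>\<in>UNIV. (partial_deriv \<alpha> (\<lambda>x. \<phi> x \<bullet> e) x)^2)"
 unfolding norm_vec_square norm_Basis_square by (subst sum.swap) (simp add: grad_def)

text \<open>The divergence of \<open>\<phi>\<^sup>2 X\<close> with \<open>X = (x - a) / (|x - a|\<^sup>2 + R\<^sup>2)\<close> integrates to zero, while
 \<open>div X \<ge> (n - 2) / (|x - a|\<^sup>2 + R\<^sup>2)\<close> and \<open>|X|\<^sup>2 \<le> 1 / (|x - a|\<^sup>2 + R\<^sup>2)\<close>.\<close>

lemma hardy_real:
 fixes \<phi> :: "real^'n::finite \<Rightarrow> real"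
 assumes n: "CARD('n) \<ge> 3" and \<phi>: "\<phi> \<in> test_fun UNIV" and R: "R > 0"
 shows "(\<integral>\<^sup>+x\<in>ball a R. ennreal ((\<phi> x)^2) \<partial>lebesgue)
  \<le> ennreal (8 * R^2) * (\<integral>\<^sup>+x. ennreal (\<Sum>i\<in>UNIV. (partial_deriv i \<phi> x)^2) \<partial>lebesgue)"
proof -
 define w where "w = (\<lambda>x. inverse ((norm (x - a))^2 + R^2))"
 have den: "(norm (x - a))^2 + R^2 > 0" for x using R by (simp add: add_nonneg_pos)
 have wpos: "w x > 0" for x using den[of x] by (simp add: w_def)
 have w1: "(norm (x - a))^2 * w x \<le> 1" for x using den[of x] R by (simp add: w_def field_simps)
 have smw: "smooth_fun w" unfolding w_def using den
  by (intro smooth_fun_inverse smooth_fun_add smooth_fun_norm_square smooth_fun_const) (metis less_irrefl)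
 define Y where "Y = (\<lambda>i x. \<phi> x * \<phi> x * ((x \<bullet> axis i 1 - a \<bullet> axis i 1) * w x))"
 have smi: "smooth_fun (\<lambda>x. (x \<bullet> axis i 1 - a \<bullet> axis i 1))" for i :: 'n
  by (intro smooth_fun_diff smooth_fun_inner smooth_fun_const)
 have Y: "Y i \<in> test_fun UNIV" for i unfolding Y_def by (intro test_fun_mult smooth_fun_mult smi smw \<phi> test_fun_smooth[OF \<phi>])
 have dY: "partial_deriv i (Y i) x = 2 * \<phi> x * w x * (partial_deriv i \<phi> x * (x - a) $ i) + (\<phi> x)^2 * w x
   - 2 * (\<phi> x)^2 * (w x)^2 * ((x - a) $ i)^2" for i x
 proof -
  obtain f' where f': "(\<phi> has_derivative f') (at x)"
   using smooth_fun_differentiable[OF test_fun_smooth[OF \<phi>]] by (auto simp: differentiable_def)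
  have dw: "(w has_derivative (\<lambda>h. - (w x * (2 * ((x - a) \<bullet> h)) * w x))) (at x)"
  proof -
   have "((\<lambda>x. (norm (x - a))^2 + R^2) has_derivative (\<lambda>h. 2 * ((x - a) \<bullet> h))) (at x)"
    unfolding power2_norm_eq_inner by (auto intro!: derivative_eq_intros simp: inner_commute)
   from Deriv.has_derivative_inverse[OF _ this] den[of x] R show ?thesis by (simp add: w_def)
  qed
  have dx: "((\<lambda>x. x \<bullet> axis i 1 - a \<bullet> axis i 1) has_derivative (\<lambda>h. h \<bullet> axis i 1)) (at x)"
   by (auto intro!: derivative_eq_intros)
  have "(Y i has_derivative (\<lambda>h. \<phi> x * \<phi> x * ((x \<bullet> axis i 1 - a \<bullet> axis i 1) * - (w x * (2 * ((x - a) \<bullet> h)) * w x) + (h \<bullet> axis i 1) * w x)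
    + (\<phi> x * f' h + f' h * \<phi> x) * ((x \<bullet> axis i 1 - a \<bullet> axis i 1) * w x))) (at x)"
   unfolding Y_def by (rule has_derivative_mult[OF has_derivative_mult[OF f' f'] has_derivative_mult[OF dx dw]])
  from partial_deriv_eq[OF this, of i] partial_deriv_eq[OF f', of i] show ?thesis by (simp add: inner_axis power2_eq_square algebra_simps)
 qed
 define F where "F = (\<lambda>x. \<Sum>i\<in>UNIV. partial_deriv i (Y i) x)"
 define g where "g = (\<lambda>x. \<Sum>i\<in>UNIV. (partial_deriv i \<phi> x)^2)"
 have g0: "g x \<ge> 0" for x by (simp add: g_def sum_nonneg)
 have ptw: "(\<phi> x)^2 * w x \<le> 2 * F x + 4 * g x" for x
 proof -
  let ?s = "\<Sum>i\<in>UNIV. partial_deriv i \<phi> x * (x - a) $ i"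
  have nsq: "(\<Sum>i\<in>UNIV. ((x - a) $ i)^2) = (norm (x - a))^2" by (simp add: norm_vec_square)
  have Feq: "F x = 2 * \<phi> x * w x * ?s + real CARD('n) * ((\<phi> x)^2 * w x) - 2 * (\<phi> x)^2 * (w x)^2 * (norm (x - a))^2"
   unfolding F_def dY sum.distrib sum_subtractf sum_distrib_left[symmetric] nsq by simp
  have "?s^2 \<le> g x * (norm (x - a))^2" unfolding g_def nsq[symmetric] by (rule Cauchy_Schwarz_ineq_sum)
  then have s: "w x * ?s^2 \<le> g x"
  proof -
   assume "?s^2 \<le> g x * (norm (x - a))^2"
   then have "w x * ?s^2 \<le> w x * (g x * (norm (x - a))^2)" using wpos[of x] by (intro mult_left_mono) auto
   also have "... = g x * ((norm (x - a))^2 * w x)" by simp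
   also have "... \<le> g x * 1" using g0 w1 by (intro mult_left_mono)
   finally show ?thesis by simp
  qed
  \<comment> \<open>The weights are chosen so that the cross term costs half of \<phi>^2 w. The
    divergence of x - a gives n \<ge> 3 and the derivative of w takes away at most 2, which leaves 3
    - 2 - 1/2 = 1/2 and explains the factors 2 and 4 in \<open>ptw\<close>.\<close>
  have "0 \<le> w x * (\<phi> x + 2 * ?s)^2" using wpos[of x] by simp
  then have a1: "- (2 * \<phi> x * w x * ?s) \<le> (\<phi> x)^2 * w x / 2 + 2 * (w x * ?s^2)" by (simp add: power2_eq_square algebra_simps)
  have "(\<phi> x)^2 * w x * ((norm (x - a))^2 * w x) \<le> (\<phi> x)^2 * w x * 1" using wpos[of x] w1[of x] by (intro mult_left_mono) auto
  then have a2: "2 * (\<phi> x)^2 * (w x)^2 * (norm (x - a))^2 \<le> 2 * ((\<phi> x)^2 * w x)" by (simp add: power2_eq_square algebra_simps)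
  have a3: "3 * ((\<phi> x)^2 * w x) \<le> real CARD('n) * ((\<phi> x)^2 * w x)" using n wpos[of x] by (intro mult_right_mono) auto
  from Feq a1 a2 a3 s show ?thesis by linarith
 qed
 have iF: "integrable lebesgue F" "(\<integral>x. F x \<partial>lebesgue) = 0"
  unfolding F_def using test_fun_integrable[OF test_fun_partial_deriv[OF Y]] integral_partial_deriv[OF Y] by simp_all
 have ig: "integrable lebesgue g" unfolding g_def power2_eq_square
  by (intro test_fun_integrable[of _ UNIV] test_fun_sum test_fun_mult test_fun_smooth[of _ UNIV] test_fun_partial_deriv \<phi>)
 have iw: "integrable lebesgue (\<lambda>x. \<phi> x * \<phi> x * w x)"
  by (rule test_fun_integrable[of _ UNIV]) (intro test_fun_mult \<phi> test_fun_smooth[OF \<phi>] smw)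
 have "(\<integral>x. (\<phi> x)^2 * w x \<partial>lebesgue) \<le> (\<integral>x. 2 * F x + 4 * g x \<partial>lebesgue)"
  using iF ig iw by (intro integral_mono ptw) (auto simp: power2_eq_square)
 also have "... = 4 * (\<integral>x. g x \<partial>lebesgue)" using iF ig by simp
 finally have main: "(\<integral>x. (\<phi> x)^2 * w x \<partial>lebesgue) \<le> 4 * (\<integral>x. g x \<partial>lebesgue)" .
 have "(\<integral>\<^sup>+x\<in>ball a R. ennreal ((\<phi> x)^2) \<partial>lebesgue) \<le> (\<integral>\<^sup>+x. ennreal (2 * R^2 * ((\<phi> x)^2 * w x)) \<partial>lebesgue)"
 proof (intro nn_integral_mono)
  fix x
  show "ennreal ((\<phi> x)^2) * indicator (ball a R) x \<le> ennreal (2 * R^2 * ((\<phi> x)^2 * w x))"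
  proof (cases "x \<in> ball a R")
   case True
   then have "(norm (x - a))^2 \<le> R^2" by (intro power_mono) (auto simp: dist_norm norm_minus_commute)
   \<comment> \<open>On the ball w is at least 1/(2 R^2), which removes the weight; together with
     the 4 above this gives the constant 8.\<close>
   then have "1 \<le> 2 * R^2 * w x" using den[of x] by (simp add: w_def field_simps)
   then have "(\<phi> x)^2 * 1 \<le> (\<phi> x)^2 * (2 * R^2 * w x)" by (intro mult_left_mono) auto
   then show ?thesis using True by (auto intro!: ennreal_leI simp: mult_ac)
  qed simp
 qed
 also have "... = ennreal (\<integral>x. 2 * R^2 * ((\<phi> x)^2 * w x) \<partial>lebesgue)"
  using iw wpos by (intro nn_integral_eq_integral) (auto simp: power2_eq_square less_imp_le)
 also have "... \<le> ennreal (8 * R^2 * (\<integral>x. g x \<partial>lebesgue))"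
 proof (rule ennreal_leI)
  have "2 * R^2 * (\<integral>x. (\<phi> x)^2 * w x \<partial>lebesgue) \<le> 2 * R^2 * (4 * (\<integral>x. g x \<partial>lebesgue))"
   using main by (intro mult_left_mono) auto
  then show "(\<integral>x. 2 * R^2 * ((\<phi> x)^2 * w x) \<partial>lebesgue) \<le> 8 * R^2 * (\<integral>x. g x \<partial>lebesgue)" by simp
 qed
 also have "... = ennreal (8 * R^2) * (\<integral>\<^sup>+x. ennreal (g x) \<partial>lebesgue)"
  using ig g0 by (subst nn_integral_eq_integral) (auto simp: ennreal_mult)
 finally show ?thesis by (simp add: g_def)
qed

lemma hardy_test_vec:
 fixes \<phi> :: "real^'n::finite \<Rightarrow> 'b::euclidean_space"
 assumes n: "CARD('n) \<ge> 3" and \<phi>: "\<phi> \<in> test_vec UNIV" and R: "R > 0"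
 shows "L2sq (ball a R) \<phi> \<le> ennreal (8 * R^2) * L2sq UNIV (grad \<phi>)"
proof -
 have pm: "(\<lambda>x. partial_deriv i (\<lambda>x. \<phi> x \<bullet> e) x) \<in> meas_L" if "e \<in> Basis" for e i
  by (rule test_fun_measurable[OF test_fun_partial_deriv[OF test_vecD[OF \<phi> that]]])
 have fm: "(\<lambda>x. \<phi> x \<bullet> e) \<in> meas_L" if "e \<in> Basis" for e by (rule test_fun_measurable[OF test_vecD[OF \<phi> that]])
 have "L2sq (ball a R) \<phi> = (\<integral>\<^sup>+x. (\<Sum>e\<in>Basis. ennreal ((\<phi> x \<bullet> e)^2) * indicator (ball a R) x) \<partial>lebesgue)"
  unfolding L2sq_def norm_Basis_square by (simp add: sum_ennreal sum_distrib_right[symmetric])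
 also have "... = (\<Sum>e\<in>Basis. (\<integral>\<^sup>+x\<in>ball a R. ennreal ((\<phi> x \<bullet> e)^2) \<partial>lebesgue))"
 proof (rule nn_integral_sum)
  fix e :: 'b assume "e \<in> Basis"
  from fm[OF this] have "(\<lambda>x. ennreal ((\<phi> x \<bullet> e)^2)) \<in> meas_L" by (rule measurable_compose) measurable
  then show "(\<lambda>x. ennreal ((\<phi> x \<bullet> e)^2) * indicator (ball a R) x) \<in> meas_L"
   by (intro borel_measurable_times_ennreal borel_measurable_indicator) auto
 qed
 also have "... \<le> (\<Sum>e\<in>Basis. ennreal (8 * R^2) * (\<integral>\<^sup>+x. ennreal (\<Sum>i\<in>UNIV. (partial_deriv i (\<lambda>x. \<phi> x \<bullet> e) x)^2) \<partial>lebesgue))"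
  using test_vecD[OF \<phi>] by (intro sum_mono hardy_real n R)
 also have "... = ennreal (8 * R^2) * (\<integral>\<^sup>+x. (\<Sum>e\<in>Basis. ennreal (\<Sum>i\<in>UNIV. (partial_deriv i (\<lambda>x. \<phi> x \<bullet> e) x)^2)) \<partial>lebesgue)"
  using pm by (subst nn_integral_sum) (auto simp: sum_distrib_left)
 also have "... = ennreal (8 * R^2) * L2sq UNIV (grad \<phi>)" unfolding L2sq_def norm_grad_square by (simp add: sum_ennreal sum_nonneg)
 finally show ?thesis .
qed

subsection \<open>The Lax--Milgram and uniform boundedness theorems on complete subspaces\<close>

text \<open>Positive definiteness is deliberately absent: functions that agree almost everywhere are
  different elements at distance zero. Limits and solutions are determined only up to zero norm, and
  the arguments below work with a seminorm.\<close>

locale complete_inner_subspace =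
 fixes S :: "'a::real_vector set" and ip :: "'a \<Rightarrow> 'a \<Rightarrow> real"
 assumes S: "subspace S"
  and ip_add: "u \<in> S \<Longrightarrow> v \<in> S \<Longrightarrow> w \<in> S \<Longrightarrow> ip (u + v) w = ip u w + ip v w"
  and ip_scale: "u \<in> S \<Longrightarrow> v \<in> S \<Longrightarrow> ip (c *\<^sub>R u) v = c * ip u v"
  and ip_sym: "u \<in> S \<Longrightarrow> v \<in> S \<Longrightarrow> ip u v = ip v u"
  and ip_nonneg: "u \<in> S \<Longrightarrow> 0 \<le> ip u u"
  and complete: "\<And>X::nat \<Rightarrow> 'a. (\<And>k. X k \<in> S) \<Longrightarrow>
   (\<And>\<epsilon>. \<epsilon> > 0 \<Longrightarrow> \<exists>M. \<forall>k\<ge>M. \<forall>m\<ge>M. sqrt (ip (X k - X m) (X k - X m)) < \<epsilon>) \<Longrightarrow>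
   \<exists>u\<in>S. (\<lambda>k. sqrt (ip (X k - u) (X k - u))) \<longlonglongrightarrow> 0"
begin

definition nr :: "'a \<Rightarrow> real" where "nr u = sqrt (ip u u)"

lemma mem_add: "u \<in> S \<Longrightarrow> v \<in> S \<Longrightarrow> u + v \<in> S" using S by (simp add: subspace_add)
lemma mem_diff: "u \<in> S \<Longrightarrow> v \<in> S \<Longrightarrow> u - v \<in> S" using S by (simp add: subspace_diff)
lemma mem_scale: "u \<in> S \<Longrightarrow> c *\<^sub>R u \<in> S" using S by (simp add: subspace_scale)
lemma mem_0: "0 \<in> S" using S by (simp add: subspace_0)

lemmas mem = mem_add mem_diff mem_scale mem_0

lemma ip_add_right: "u \<in> S \<Longrightarrow> v \<in> S \<Longrightarrow> w \<in> S \<Longrightarrow> ip w (u + v) = ip w u + ip w v"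
 by (metis ip_add ip_sym mem_add)

lemma ip_scale_right: "u \<in> S \<Longrightarrow> v \<in> S \<Longrightarrow> ip v (c *\<^sub>R u) = c * ip v u"
 by (metis ip_scale ip_sym mem_scale)

lemma ip_diff: "u \<in> S \<Longrightarrow> v \<in> S \<Longrightarrow> w \<in> S \<Longrightarrow> ip (u - v) w = ip u w - ip v w"
 using ip_add[of u "(-1) *\<^sub>R v" w] ip_scale[of v w "-1"] mem_scale[of v "-1"] by simp

lemma ip_diff_right: "u \<in> S \<Longrightarrow> v \<in> S \<Longrightarrow> w \<in> S \<Longrightarrow> ip w (u - v) = ip w u - ip w v"
 by (metis ip_diff ip_sym mem_diff)

lemma nr_nonneg: "u \<in> S \<Longrightarrow> 0 \<le> nr u" by (simp add: nr_def ip_nonneg)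

lemma nr_square: "u \<in> S \<Longrightarrow> (nr u)^2 = ip u u" by (simp add: nr_def ip_nonneg)

lemma nr_scale: "u \<in> S \<Longrightarrow> nr (c *\<^sub>R u) = \<bar>c\<bar> * nr u"
 by (simp add: nr_def ip_scale ip_scale_right mem_scale mult.assoc[symmetric] real_sqrt_mult)

lemma cauchy_schwarz:
 assumes "u \<in> S" "v \<in> S" shows "\<bar>ip u v\<bar> \<le> nr u * nr v"
proof -
 have q: "0 \<le> ip u u + 2 * t * ip u v + t^2 * ip v v" for t using ip_nonneg[of "u + t *\<^sub>R v"] assms
  by (simp add: ip_add ip_add_right ip_scale ip_scale_right mem ip_sym[of v u] power2_eq_square algebra_simps)
 have "(ip u v)^2 \<le> ip u u * ip v v"
 proof (cases "ip v v = 0")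
  case True
  have "ip u v = 0"
  proof (rule ccontr)
   assume "ip u v \<noteq> 0"
   \<comment> \<open>The quadratic is affine in t here; this t gives it the value -1.\<close>
   then show False using q[of "- (ip u u + 1) / (2 * ip u v)"] True by (simp add: field_simps)
  qed
  then show ?thesis using True by simp
 next
  case False
  then have "ip v v > 0" using ip_nonneg[OF assms(2)] by simp
  then show ?thesis using q[of "- ip u v / ip v v"] by (simp add: field_simps power2_eq_square)
 qed
 also have "... = (nr u * nr v)^2" using assms by (simp add: power_mult_distrib nr_square)
 finally show ?thesis using assms by (simp add: abs_le_square_iff[symmetric] nr_nonneg)
qed

lemma nr_triangle:
 assumes "u \<in> S" "v \<in> S" shows "nr (u + v) \<le> nr u + nr v"
proof (rule power2_le_imp_le)
 have "(nr (u + v))^2 = ip u u + 2 * ip u v + ip v v" using assms by (simp add: nr_square mem ip_add ip_add_right ip_sym[of v u])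
 also have "... \<le> (nr u)^2 + 2 * (nr u * nr v) + (nr v)^2" using cauchy_schwarz[OF assms] assms by (simp add: nr_square)
 finally show "(nr (u + v))^2 \<le> (nr u + nr v)^2" by (simp add: power2_sum)
 show "0 \<le> nr u + nr v" using assms by (simp add: nr_nonneg)
qed

lemma nr_0 [simp]: "nr 0 = 0" using nr_scale[OF mem_0, of 0] by simp

lemma nr_triangle_diff: "u \<in> S \<Longrightarrow> v \<in> S \<Longrightarrow> w \<in> S \<Longrightarrow> nr (u - w) \<le> nr (u - v) + nr (v - w)"
 using nr_triangle[of "u - v" "v - w"] by (simp add: mem)

lemma nr_minus_commute: "u \<in> S \<Longrightarrow> v \<in> S \<Longrightarrow> nr (u - v) = nr (v - u)"
 using nr_scale[of "u - v" "-1"] by (simp add: mem)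

text \<open>The single use of completeness: the minimising sequence, the fixed point iteration and
  the gliding hump below all have geometrically decreasing increments, and each of them uses the
  explicit distance to the limit.\<close>

lemma geometric_Cauchy:
 assumes X: "\<And>k. X k \<in> S" and c: "0 \<le> c" "c < 1" and D: "\<And>k. nr (X (Suc k) - X k) \<le> D * c ^ k"
 obtains u where "u \<in> S" "\<And>k. nr (X k - u) \<le> D * c ^ k / (1 - c)"
proof -
 have D0: "0 \<le> D" using D[of 0] nr_nonneg[of "X 1 - X 0"] X by (auto simp: mem)
 have bd: "nr (X (k + m) - X k) \<le> D * c ^ k * (1 - c ^ m) / (1 - c)" for k m
 proof (induction m)
  case (Suc m)
  have "nr (X (k + Suc m) - X k) \<le> D * c ^ (k + m) + D * c ^ k * (1 - c ^ m) / (1 - c)"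
   using nr_triangle_diff[OF X[of "k + Suc m"] X[of "k + m"] X[of k]] D[of "k + m"] Suc by simp
  also have "... = D * c ^ k * (1 - c ^ Suc m) / (1 - c)" using c by (simp add: field_simps power_add)
  finally show ?case .
 qed simp
 have bd': "nr (X m - X k) \<le> D * c ^ k / (1 - c)" if "k \<le> m" for k m
 proof -
  have "nr (X m - X k) \<le> D * c ^ k * (1 - c ^ (m - k)) / (1 - c)" using bd[of k "m - k"] that by simp
  also have "... \<le> D * c ^ k * 1 / (1 - c)" using c D0 by (intro divide_right_mono mult_left_mono) auto
  finally show ?thesis by simp
 qed
 have lim0: "(\<lambda>k. D * c ^ k / (1 - c)) \<longlonglongrightarrow> 0"
  using tendsto_divide[OF tendsto_mult[OF tendsto_const[of D] LIMSEQ_power_zero[of c]] tendsto_const[of "1 - c"]] c by simp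
 have "\<exists>u\<in>S. (\<lambda>k. nr (X k - u)) \<longlonglongrightarrow> 0" unfolding nr_def
 proof (rule complete[OF X])
  fix \<epsilon> :: real assume "\<epsilon> > 0"
  then obtain M where M: "D * c ^ M / (1 - c) < \<epsilon> / 2"
   using order_tendstoD(2)[OF lim0, of "\<epsilon> / 2"] by (auto simp: eventually_sequentially)
  show "\<exists>M. \<forall>k\<ge>M. \<forall>m\<ge>M. sqrt (ip (X k - X m) (X k - X m)) < \<epsilon>"
  proof (intro exI[of _ M] allI impI)
   fix k m assume "k \<ge> M" "m \<ge> M"
   then have "nr (X k - X m) \<le> D * c ^ M / (1 - c) + D * c ^ M / (1 - c)"
    using nr_triangle_diff[OF X[of k] X[of M] X[of m]] bd'[of M k] bd'[of M m] nr_minus_commute[OF X X, of M m] by linarith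
   with M have "nr (X k - X m) < \<epsilon>" by linarith
   then show "sqrt (ip (X k - X m) (X k - X m)) < \<epsilon>" by (simp only: nr_def)
  qed
 qed
 then obtain u where u: "u \<in> S" "(\<lambda>k. nr (X k - u)) \<longlonglongrightarrow> 0" by blast
 have "nr (X k - u) \<le> D * c ^ k / (1 - c)" for k
 proof (rule LIMSEQ_le_const)
  show "(\<lambda>m. D * c ^ k / (1 - c) + nr (X m - u)) \<longlonglongrightarrow> D * c ^ k / (1 - c)"
   using tendsto_add[OF tendsto_const u(2)] by simp
  show "\<exists>N. \<forall>m\<ge>N. nr (X k - u) \<le> D * c ^ k / (1 - c) + nr (X m - u)"
  proof (intro exI[of _ k] allI impI)
   fix m assume "m \<ge> k"
   then show "nr (X k - u) \<le> D * c ^ k / (1 - c) + nr (X m - u)"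
    using nr_triangle_diff[OF X[of k] X[of m] u(1)] bd'[of k m] nr_minus_commute[OF X X, of k m] by linarith
  qed
 qed
 with u(1) show ?thesis using that by blast
qed

text \<open>Direct method: J is bounded below because l is bounded, the parallelogram identity makes
  a minimising sequence Cauchy, and the first variation vanishes at the limit.\<close>

lemma riesz:
 assumes add: "\<And>u v. u \<in> S \<Longrightarrow> v \<in> S \<Longrightarrow> l (u + v) = l u + l v"
  and scale: "\<And>c u. u \<in> S \<Longrightarrow> l (c *\<^sub>R u) = c * l u"
  and bd: "\<And>u. u \<in> S \<Longrightarrow> \<bar>l u\<bar> \<le> M * nr u"
 shows "\<exists>u\<in>S. \<forall>v\<in>S. ip u v = l v"
proof -
 define J where "J = (\<lambda>v. ip v v - 2 * l v)"
 have Jlb: "J v \<ge> - (M^2)" if "v \<in> S" for v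
 proof -
  have "l v \<le> M * nr v" using bd[OF that] by linarith
  moreover have "0 \<le> (nr v - M)^2" by simp
  then have "2 * (M * nr v) \<le> ip v v + M^2" unfolding power2_diff nr_square[OF that] by (simp add: mult_ac)
  ultimately show ?thesis by (simp add: J_def)
 qed
 define d where "d = Inf (J ` S)"
 have bb: "bdd_below (J ` S)" using Jlb by (auto intro!: bdd_belowI2)
 have dle: "d \<le> J v" if "v \<in> S" for v unfolding d_def using bb that by (intro cInf_lower) auto
 have ne: "J ` S \<noteq> {}" using mem_0 by blast
 \<comment> \<open>Values within 4^-k of the infimum give increments of order 2^-k, since
   \<open>par\<close> bounds the squared distance.\<close>
 have "\<exists>v\<in>S. J v < d + (1/4) ^ k" for k :: nat using cInf_lessD[OF ne, of "d + (1/4) ^ k"] unfolding d_def by auto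
 then obtain X where X: "\<And>k. X k \<in> S" and JX: "\<And>k. J (X k) < d + (1/4) ^ k" by metis
 have par: "ip (u - v) (u - v) \<le> 2 * J u + 2 * J v - 4 * d" if "u \<in> S" "v \<in> S" for u v
 proof -
  have "4 * J ((1/2) *\<^sub>R (u + v)) = ip u u + 2 * ip u v + ip v v - 4 * l u - 4 * l v"
   using that by (simp add: J_def mem ip_scale ip_scale_right ip_add ip_add_right add scale ip_sym[of v u] algebra_simps)
  moreover have "ip (u - v) (u - v) = ip u u - 2 * ip u v + ip v v" using that by (simp add: mem ip_diff ip_diff_right ip_sym[of v u])
  moreover have "d \<le> J ((1/2) *\<^sub>R (u + v))" using that by (intro dle mem)
  ultimately show ?thesis by (simp add: J_def)
 qed
 have step: "nr (X (Suc k) - X k) \<le> 2 * (1/2) ^ k" for k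
 proof -
  have e: "((2::real) * (1/2) ^ k)^2 = 4 * (1/4) ^ k"
   by (simp add: power_mult_distrib power2_eq_square power_mult[symmetric] flip: power_mult_distrib)
  have "(nr (X (Suc k) - X k))^2 \<le> 2 * J (X (Suc k)) + 2 * J (X k) - 4 * d" using par[OF X X] X by (simp add: nr_square mem)
  also have "... \<le> (2 * (1/2) ^ k)^2" using JX[of k] JX[of "Suc k"] zero_le_power[of "1/4::real" k] unfolding e power_Suc by linarith
  finally show ?thesis by (rule power2_le_imp_le) simp
 qed
 obtain u where u: "u \<in> S" "\<And>k. nr (X k - u) \<le> 2 * (1/2) ^ k / (1 - 1/2)" by (rule geometric_Cauchy[OF X _ _ step]) auto
 have "ip u w = l w" if w: "w \<in> S" for w
 proof -
  have lim: "(\<lambda>k. ip (X k) w) \<longlonglongrightarrow> ip u w"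
  proof -
   have "(\<lambda>k. 4 * (1/2) ^ k * nr w) \<longlonglongrightarrow> 4 * 0 * nr w" by (intro tendsto_intros LIMSEQ_power_zero) auto
   then have "(\<lambda>k. ip (X k) w - ip u w) \<longlonglongrightarrow> 0"
   proof (rule Lim_null_comparison[rotated, OF tendsto_eq_rhs])
    show "\<forall>\<^sub>F k in sequentially. norm (ip (X k) w - ip u w) \<le> 4 * (1/2) ^ k * nr w"
    proof (intro always_eventually allI)
     fix k
     have "\<bar>ip (X k - u) w\<bar> \<le> nr (X k - u) * nr w" using X u w by (intro cauchy_schwarz mem)
     also have "... \<le> 4 * (1/2) ^ k * nr w" using u(2)[of k] nr_nonneg[OF w] by (intro mult_right_mono) auto
     finally show "norm (ip (X k) w - ip u w) \<le> 4 * (1/2) ^ k * nr w" using X u w by (simp add: ip_diff)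
    qed
   qed simp
   then show ?thesis by (simp add: LIM_zero_iff)
  qed
  have q: "0 \<le> 2 * t * (ip u w - l w) + t^2 * ip w w" for t
  proof (rule LIMSEQ_le_const)
   have "(\<lambda>k. (1/4) ^ k + 2 * t * (ip (X k) w - l w) + t^2 * ip w w) \<longlonglongrightarrow> 0 + 2 * t * (ip u w - l w) + t^2 * ip w w"
    by (intro tendsto_intros lim LIMSEQ_power_zero) auto
   then show "(\<lambda>k. (1/4) ^ k + 2 * t * (ip (X k) w - l w) + t^2 * ip w w) \<longlonglongrightarrow> 2 * t * (ip u w - l w) + t^2 * ip w w" by simp
   show "\<exists>N. \<forall>n\<ge>N. 0 \<le> (1/4) ^ n + 2 * t * (ip (X n) w - l w) + t^2 * ip w w"
   proof (intro exI[of _ 0] allI impI)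
    fix n
    have "d \<le> J (X n + t *\<^sub>R w)" using X w by (intro dle mem)
    also have "... = J (X n) + 2 * t * (ip (X n) w - l w) + t^2 * ip w w"
     using X w by (simp add: J_def mem ip_add ip_add_right ip_scale ip_scale_right add scale ip_sym[of w "X n"] power2_eq_square algebra_simps)
    finally show "0 \<le> (1/4) ^ n + 2 * t * (ip (X n) w - l w) + t^2 * ip w w" using JX[of n] by simp
   qed
  qed
  define a where "a = ip u w - l w"
  have p: "1 + ip w w > 0" using ip_nonneg[OF w] by simp
  \<comment> \<open>This t makes the quadratic negative unless a = 0; the summand 1 covers the case
    \<open>ip w w = 0\<close>.\<close>
  have "0 \<le> 2 * (- a / (1 + ip w w)) * a + (- a / (1 + ip w w))^2 * ip w w" using q[of "- a / (1 + ip w w)"] by (simp only: a_def)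
  also have "... = - (a^2 * (2 + ip w w) / (1 + ip w w)^2)" using p by (simp add: power2_eq_square divide_simps) (simp add: algebra_simps)
  finally have "a^2 * (2 + ip w w) / (1 + ip w w)^2 \<le> 0" by simp
  then have "a^2 * (2 + ip w w) \<le> 0" using p by (simp add: divide_le_0_iff)
  moreover have "2 + ip w w > 0" using ip_nonneg[OF w] by simp
  ultimately have "a^2 \<le> 0" by (simp add: mult_le_0_iff)
  then show ?thesis by (simp add: a_def)
 qed
 then show ?thesis using u(1) by blast
qed

theorem lax_milgram:
 assumes addl: "\<And>u v w. u \<in> S \<Longrightarrow> v \<in> S \<Longrightarrow> w \<in> S \<Longrightarrow> B (u + v) w = B u w + B v w"
  and addr: "\<And>u v w. u \<in> S \<Longrightarrow> v \<in> S \<Longrightarrow> w \<in> S \<Longrightarrow> B w (u + v) = B w u + B w v"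
  and scalel: "\<And>c u v. u \<in> S \<Longrightarrow> v \<in> S \<Longrightarrow> B (c *\<^sub>R u) v = c * B u v"
  and scaler: "\<And>c u v. u \<in> S \<Longrightarrow> v \<in> S \<Longrightarrow> B u (c *\<^sub>R v) = c * B u v"
  and Bbd: "\<And>u v. u \<in> S \<Longrightarrow> v \<in> S \<Longrightarrow> \<bar>B u v\<bar> \<le> \<Gamma> * nr u * nr v"
  and coer: "\<gamma> > 0" "\<And>u. u \<in> S \<Longrightarrow> \<gamma> * (nr u)^2 \<le> B u u"
  and ladd: "\<And>u v. u \<in> S \<Longrightarrow> v \<in> S \<Longrightarrow> l (u + v) = l u + l v"
  and lscale: "\<And>c u. u \<in> S \<Longrightarrow> l (c *\<^sub>R u) = c * l u"
  and lbd: "\<And>u. u \<in> S \<Longrightarrow> \<bar>l u\<bar> \<le> M * nr u"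
 shows "\<exists>w\<in>S. \<forall>v\<in>S. B w v = l v"
proof -
 have "\<exists>a\<in>S. \<forall>v\<in>S. ip a v = B u v" if "u \<in> S" for u
 proof (rule riesz)
  show "\<bar>B u v\<bar> \<le> (\<Gamma> * nr u) * nr v" if "v \<in> S" for v using Bbd \<open>u \<in> S\<close> that by auto
 qed (use that addr scaler in auto)
 then obtain A where A: "\<And>u. u \<in> S \<Longrightarrow> A u \<in> S" "\<And>u v. u \<in> S \<Longrightarrow> v \<in> S \<Longrightarrow> ip (A u) v = B u v" by metis
 obtain r where r: "r \<in> S" "\<And>v. v \<in> S \<Longrightarrow> ip r v = l v" using riesz[of l M] ladd lscale lbd by metis
 have Bdiff: "B (u - v) w = B u w - B v w" if "u \<in> S" "v \<in> S" "w \<in> S" for u v w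
  using addl[of u "(-1) *\<^sub>R v" w] scalel[of v w "-1"] mem_scale[of v "-1"] that by simp
 \<comment> \<open>\<Gamma> comes without a sign; this bound is positive and at least \<gamma>, so
   that 1 - (\<gamma>/G)^2 below is nonnegative and less than 1.\<close>
 define G where "G = \<bar>\<Gamma>\<bar> + \<gamma>"
 have G: "G > 0" "\<gamma> \<le> G" using coer by (auto simp: G_def)
 have GB: "\<bar>B u v\<bar> \<le> G * nr u * nr v" if "u \<in> S" "v \<in> S" for u v
 proof -
  have "\<Gamma> * (nr u * nr v) \<le> G * (nr u * nr v)" using coer that by (intro mult_right_mono) (auto simp: G_def nr_nonneg)
  with Bbd[OF that] show ?thesis by (simp add: mult.assoc)
 qed
 \<comment> \<open>Minimises 1 - 2 t \<gamma> + t^2 G^2, the square of the contraction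
   factor.\<close>
 define t where "t = \<gamma> / G^2"
 define T where "T = (\<lambda>u. u - t *\<^sub>R (A u - r))"
 have TS: "T u \<in> S" if "u \<in> S" for u using that A r by (simp add: T_def mem)
 define c where "c = sqrt (1 - (\<gamma> / G)^2)"
 have g1: "0 < (\<gamma> / G)^2" "(\<gamma> / G)^2 \<le> 1" using G coer by (auto simp: power_le_one)
 have c: "0 \<le> c" "c < 1" "c^2 = 1 - (\<gamma> / G)^2" using g1 by (auto simp: c_def)
 have contr: "nr (T u - T v) \<le> c * nr (u - v)" if uv: "u \<in> S" "v \<in> S" for u v
 proof -
  define h where "h = u - v"
  define k where "k = A u - A v"
  have hk: "h \<in> S" "k \<in> S" using uv A by (auto simp: h_def k_def mem)
  have ik: "ip k z = B h z" if "z \<in> S" for z using that uv A by (simp add: h_def k_def ip_diff Bdiff)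
  have nk: "nr k \<le> G * nr h"
  proof (cases "nr k = 0")
   case False
   have "nr k * nr k = B h k" using ik[OF hk(2)] nr_square[OF hk(2)] by (simp add: power2_eq_square)
   also have "... \<le> G * nr h * nr k" using GB[OF hk] by linarith
   finally show ?thesis using False nr_nonneg[OF hk(2)] by (simp add: mult_le_cancel_right)
  qed (use G hk nr_nonneg in auto)
  have "T u - T v = h - t *\<^sub>R k" by (simp add: T_def h_def k_def algebra_simps)
  then have "(nr (T u - T v))^2 = (nr (h - t *\<^sub>R k))^2" by (simp only:)
  also have "... = ip h h - 2 * t * ip k h + t^2 * ip k k" unfolding nr_square[OF mem_diff[OF hk(1) mem_scale[OF hk(2)]]]
   using hk by (simp add: mem ip_diff ip_diff_right ip_scale ip_scale_right ip_sym[of h k] power2_eq_square algebra_simps)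
  also have "... \<le> (nr h)^2 - 2 * t * (\<gamma> * (nr h)^2) + t^2 * (G * nr h)^2"
  proof -
   have "t * (\<gamma> * (nr h)^2) \<le> t * ip k h" using coer(1) coer(2)[of h] hk ik G by (intro mult_left_mono) (auto simp: t_def)
   moreover have "t^2 * ip k k \<le> t^2 * (G * nr h)^2"
    using nk nr_nonneg[OF hk(2)] hk by (intro mult_left_mono) (auto simp: nr_square[symmetric] intro: power_mono)
   ultimately show ?thesis using hk by (simp add: nr_square)
  qed
  also have "... = (c * nr h)^2" using G unfolding power_mult_distrib c(3) t_def by (simp add: field_simps power2_eq_square)
  finally show ?thesis using c hk unfolding h_def[symmetric] by (intro power2_le_imp_le[of "nr (T u - T v)"]) (auto simp: nr_nonneg)
 qed
 define X where "X = (\<lambda>k. (T ^^ k) 0)"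
 have X: "X k \<in> S" for k by (induction k) (auto simp: X_def mem TS)
 have XS: "X (Suc k) = T (X k)" for k by (simp add: X_def)
 have step: "nr (X (Suc k) - X k) \<le> nr (X 1 - X 0) * c ^ k" for k
 proof (induction k)
  case (Suc k)
  have "nr (X (Suc (Suc k)) - X (Suc k)) \<le> c * nr (X (Suc k) - X k)" unfolding XS[of "Suc k"] XS[of k]
   using contr[OF X X, of "Suc k" k] by (simp add: XS)
  also have "... \<le> c * (nr (X 1 - X 0) * c ^ k)" using Suc c by (intro mult_left_mono)
  finally show ?case by (simp add: mult_ac)
 qed simp
 define D where "D = nr (X 1 - X 0) / (1 - c)"
 obtain w where w: "w \<in> S" "\<And>k. nr (X k - w) \<le> nr (X 1 - X 0) * c ^ k / (1 - c)" using geometric_Cauchy[OF X c(1,2) step] by metis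
 have "nr (T w - w) \<le> 2 * D * c ^ k" for k
 proof -
  have "nr (T w - w) \<le> nr (T w - X (Suc k)) + nr (X (Suc k) - w)" using w X TS by (intro nr_triangle_diff)
  also have "nr (T w - X (Suc k)) \<le> c * nr (X k - w)" using contr[OF w(1) X, of k] w X by (simp add: XS nr_minus_commute)
  also have "... \<le> 1 * nr (X k - w)" using c w X by (intro mult_right_mono) (auto simp: nr_nonneg mem)
  also have "1 * nr (X k - w) \<le> D * c ^ k" using w(2)[of k] by (simp add: D_def)
  also have "nr (X (Suc k) - w) \<le> D * c ^ Suc k" using w(2)[of "Suc k"] by (simp add: D_def)
  also have "D * c ^ Suc k \<le> D * c ^ k" using c nr_nonneg[of "X 1 - X 0"] X by (intro mult_left_mono power_decreasing) (auto simp: D_def mem)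
  finally show ?thesis by simp
 qed
 moreover have "(\<lambda>k. 2 * D * c ^ k) \<longlonglongrightarrow> 2 * D * 0" using c by (intro tendsto_intros LIMSEQ_power_zero) auto
 \<comment> \<open>Only the norm of the defect is known to vanish, not the defect itself;
   Cauchy-Schwarz turns this into the required identity on S.\<close>
 ultimately have "nr (T w - w) \<le> 0" by (intro LIMSEQ_le_const) auto
 moreover have "T w - w = (- t) *\<^sub>R (A w - r)" by (simp add: T_def)
 ultimately have "\<bar>t\<bar> * nr (A w - r) \<le> 0" using A w r nr_scale[of "A w - r" "- t"] by (simp add: mem)
 moreover have "\<bar>t\<bar> > 0" using coer G by (simp add: t_def)
 ultimately have z: "nr (A w - r) \<le> 0" by (simp add: mult_le_0_iff)
 have "B w v = l v" if "v \<in> S" for v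
 proof -
  have "\<bar>ip (A w - r) v\<bar> \<le> nr (A w - r) * nr v" using A w r that by (intro cauchy_schwarz mem) auto
  also have "... \<le> 0" using z nr_nonneg[OF that] by (simp add: mult_nonpos_nonneg)
  finally show ?thesis using A w r that by (simp add: ip_diff)
 qed
 with w show ?thesis by blast
qed

text \<open>Sokal's gliding hump argument.\<close>

theorem uniform_boundedness:
 fixes T :: "nat \<Rightarrow> 'a \<Rightarrow> real"
 assumes add: "\<And>m u v. u \<in> S \<Longrightarrow> v \<in> S \<Longrightarrow> T m (u + v) = T m u + T m v"
  and scale: "\<And>m c u. u \<in> S \<Longrightarrow> T m (c *\<^sub>R u) = c * T m u"
  and bd: "\<And>m. \<exists>M. \<forall>u\<in>S. \<bar>T m u\<bar> \<le> M * nr u"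
  and pw: "\<And>u. u \<in> S \<Longrightarrow> \<exists>K. \<forall>m. \<bar>T m u\<bar> \<le> K"
 shows "\<exists>M. \<forall>m. \<forall>u\<in>S. \<bar>T m u\<bar> \<le> M * nr u"
proof (rule ccontr)
 assume neg: "\<nexists>M. \<forall>m. \<forall>u\<in>S. \<bar>T m u\<bar> \<le> M * nr u"
 define N where "N = (\<lambda>m. Sup ((\<lambda>u. \<bar>T m u\<bar>) ` {u\<in>S. nr u \<le> 1}))"
 have bdd: "bdd_above ((\<lambda>u. \<bar>T m u\<bar>) ` {u\<in>S. nr u \<le> 1})" for m
 proof -
  obtain M where M: "\<forall>u\<in>S. \<bar>T m u\<bar> \<le> M * nr u" using bd by blast
  have "\<bar>T m u\<bar> \<le> \<bar>M\<bar>" if "u \<in> S" "nr u \<le> 1" for u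
  proof -
   have "\<bar>T m u\<bar> \<le> M * nr u" using M that by blast
   also have "... \<le> \<bar>M\<bar> * nr u" using nr_nonneg[OF that(1)] by (intro mult_right_mono) auto
   also have "... \<le> \<bar>M\<bar> * 1" using that by (intro mult_left_mono) auto
   finally show ?thesis by simp
  qed
  then show ?thesis by (auto intro!: bdd_aboveI2)
 qed
 have T0: "T m 0 = 0" for m using scale[OF mem_0, of m 0] by simp
 have N0: "0 \<le> N m" for m unfolding N_def by (rule cSup_upper2[OF _ _ bdd, of 0]) (auto simp: mem_0 T0 intro!: rev_image_eqI[of 0])
 have TN: "\<bar>T m u\<bar> \<le> N m * nr u" if u: "u \<in> S" for m u
 proof (cases "nr u = 0")
  case True
  obtain M where "\<forall>u\<in>S. \<bar>T m u\<bar> \<le> M * nr u" using bd by blast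
  then show ?thesis using True u by fastforce
 next
  case False
  then have p: "nr u > 0" using nr_nonneg[OF u] by simp
  have "\<bar>T m ((1 / nr u) *\<^sub>R u)\<bar> \<le> N m" unfolding N_def
   using p u by (intro cSup_upper[OF _ bdd]) (auto intro!: imageI mem simp: nr_scale)
  then show ?thesis using p u by (simp add: scale abs_mult field_simps)
 qed
 have "\<exists>m. N m > K" for K
 proof (rule ccontr)
  assume "\<nexists>m. N m > K"
  then have "\<bar>T m u\<bar> \<le> K * nr u" if "u \<in> S" for m u
   using TN[OF that, of m] mult_right_mono[of "N m" K "nr u"] nr_nonneg[OF that] by (meson not_le order_trans)
  with neg show False by blast
 qed
 then have "\<forall>n. \<exists>m. N m > 4 ^ n" by blast
 \<comment> \<open>The norms grow faster than 3^n, the rate at which the humps shrink.\<close>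
 from choice[OF this] obtain m where m: "\<And>n::nat. N (m n) > 4 ^ n" by blast
 have "\<exists>z\<in>S. nr z \<le> 1 \<and> \<bar>T (m n) z\<bar> > 3/4 * N (m n)" for n
 proof -
  have "3/4 * N (m n) < N (m n)" using less_trans[OF zero_less_power m[of n]] by simp
  then obtain y where "y \<in> (\<lambda>u. \<bar>T (m n) u\<bar>) ` {u\<in>S. nr u \<le> 1}" "3/4 * N (m n) < y"
   unfolding N_def by (rule less_cSupE) (use mem_0 in auto)
  then show ?thesis by auto
 qed
 then obtain z where z: "\<And>n. z n \<in> S" "\<And>n. nr (z n) \<le> 1" "\<And>n. \<bar>T (m n) (z n)\<bar> > 3/4 * N (m n)" by metis
 \<comment> \<open>For \<xi> = 3^-n z, one of x + \<xi> and x - \<xi> satisfies |T| \<ge> |T \<xi>|,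
   because T \<xi> is half the difference of the two values; the larger one is taken.\<close>
 define nxt where "nxt = (\<lambda>n x. if \<bar>T (m n) (x + (1/3) ^ n *\<^sub>R z n)\<bar> \<ge> \<bar>T (m n) (x - (1/3) ^ n *\<^sub>R z n)\<bar>
   then x + (1/3) ^ n *\<^sub>R z n else x - (1/3) ^ n *\<^sub>R z n)"
 define x where "x = rec_nat 0 nxt"
 have xs: "x (Suc n) = nxt n (x n)" for n by (simp add: x_def)
 have xS: "x n \<in> S" for n by (induction n) (auto simp: xs nxt_def mem z, simp add: x_def mem)
 have big: "\<bar>T (m n) (x (Suc n))\<bar> \<ge> 3/4 * N (m n) * (1/3) ^ n" for n
 proof -
  let ?\<xi> = "(1/3) ^ n *\<^sub>R z n"
  have \<xi>: "?\<xi> \<in> S" using z by (simp add: mem)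
  have a: "T (m n) (x n + ?\<xi>) = T (m n) (x n) + T (m n) ?\<xi>" using xS \<xi> by (simp add: add)
  have b: "T (m n) (x n - ?\<xi>) = T (m n) (x n) - T (m n) ?\<xi>" using add[OF xS mem_scale[OF \<xi>, of "-1"]] scale[OF \<xi>, of _ "-1"] by simp
  have "\<bar>T (m n) ?\<xi>\<bar> \<le> \<bar>T (m n) (x (Suc n))\<bar>" unfolding xs nxt_def using a b by auto
  moreover have "\<bar>T (m n) ?\<xi>\<bar> = (1/3) ^ n * \<bar>T (m n) (z n)\<bar>" using z by (simp add: scale abs_mult)
  moreover have "(1/3) ^ n * (3/4 * N (m n)) \<le> (1/3) ^ n * \<bar>T (m n) (z n)\<bar>" using z(3)[of n] by (intro mult_left_mono) auto
  moreover have "3/4 * N (m n) * (1/3) ^ n = (1/3) ^ n * (3/4 * N (m n))" by (rule mult.commute)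
  ultimately show ?thesis by linarith
 qed
 have step: "nr (x (Suc n) - x n) \<le> 1 * (1/3) ^ n" for n
 proof -
  have "x (Suc n) - x n = (1/3) ^ n *\<^sub>R z n \<or> x (Suc n) - x n = (- ((1/3) ^ n)) *\<^sub>R z n" by (auto simp: xs nxt_def)
  then have "nr (x (Suc n) - x n) = (1/3) ^ n * nr (z n)" using z nr_scale[OF z(1), of "(1/3) ^ n"] nr_scale[OF z(1), of "- ((1/3) ^ n)"] by auto
  also have "... \<le> (1/3) ^ n * 1" using z by (intro mult_left_mono) auto
  finally show ?thesis by simp
 qed
 obtain u where u: "u \<in> S" "\<And>k. nr (x k - u) \<le> 1 * (1/3) ^ k / (1 - 1/3)" by (rule geometric_Cauchy[OF xS _ _ step]) auto
 obtain K where K: "\<And>m. \<bar>T m u\<bar> \<le> K" using pw[OF u(1)] by blast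
 \<comment> \<open>In units of \<open>N (m n)\<close> times 3^-n, the hump of size 3/4 loses at most
   1/2 to all later increments; the remaining quarter times 4^n is unbounded.\<close>
 have lower: "(4/3) ^ n / 4 \<le> K" for n
 proof -
  have "T (m n) (x (Suc n)) = T (m n) u + T (m n) (x (Suc n) - u)" using add[OF u(1), of "x (Suc n) - u" "m n"] xS u by (simp add: mem)
  moreover have "\<bar>T (m n) (x (Suc n) - u)\<bar> \<le> N (m n) * ((1/3) ^ n / 2)"
  proof -
   have "\<bar>T (m n) (x (Suc n) - u)\<bar> \<le> N (m n) * nr (x (Suc n) - u)" using xS u by (intro TN mem)
   also have "... \<le> N (m n) * ((1/3) ^ n / 2)" using u(2)[of "Suc n"] N0 by (intro mult_left_mono) auto
   finally show ?thesis .
  qed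
  ultimately have "3/4 * N (m n) * (1/3) ^ n \<le> K + N (m n) * ((1/3) ^ n / 2)" using big[of n] K[of "m n"] by linarith
  then have "N (m n) * ((1/3) ^ n / 4) \<le> K" by simp
  moreover have "4 ^ n * ((1/3) ^ n / 4) \<le> N (m n) * ((1/3) ^ n / 4)" using m[of n] by (intro mult_right_mono) auto
  ultimately show ?thesis by (simp add: power_divide)
 qed
 obtain n where "4 * K < (4/3) ^ n" using real_arch_pow[of "4/3" "4 * K"] by auto
 then show False using lower[of n] by simp
qed

end

subsection \<open>Hardy's inequality in \<open>Y\<^sub>0\<close>\<close>

lemma two_star_gt_2: "CARD('n::finite) \<ge> 3 \<Longrightarrow> two_star TYPE('n) > 2"
proof -
 assume "CARD('n) \<ge> 3"
 then have r: "real CARD('n) \<ge> 3" by linarith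
 have "2 < 2 * c / (c - 2)" if "c \<ge> 3" for c :: real using that by (simp add: less_divide_eq)
 from this[OF r] show ?thesis unfolding two_star_def .
qed

lemma ennreal_power2_le: "(a::ennreal)^2 \<le> ennreal (e^2) \<Longrightarrow> 0 \<le> e \<Longrightarrow> a \<le> ennreal e"
proof (cases a)
 case (real r)
 assume "a^2 \<le> ennreal (e^2)" "0 \<le> e"
 then have "r^2 \<le> e^2" using real by (simp add: ennreal_power)
 then show ?thesis using real \<open>0 \<le> e\<close> by (auto intro!: ennreal_leI power2_le_imp_le)
qed (simp add: top_unique)

lemma Y_norm_leD:
 assumes "Y_norm U u \<le> ennreal e" "e \<ge> 0"
 shows "weakly_diff U u" "Lp_norm (ennreal (two_star TYPE('n))) U (u :: real^'n::finite \<Rightarrow> 'b::euclidean_space) \<le> ennreal e"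
  "Lp_norm 2 U (wD U u) \<le> ennreal e"
proof -
 show w: "weakly_diff U u"
  using assms by (auto simp: Y_norm_def top_unique split: if_splits)
 have "(Lp_norm (ennreal (two_star TYPE('n))) U u)^2 + (Lp_norm 2 U (wD U u))^2 \<le> ennreal (e^2)"
  using assms w by (simp add: Y_norm_def ennpowr_le_iff)
 then have "(Lp_norm (ennreal (two_star TYPE('n))) U u)^2 \<le> ennreal (e^2)" "(Lp_norm 2 U (wD U u))^2 \<le> ennreal (e^2)"
  by (metis (no_types, lifting) add_increasing2 add_increasing order_trans zero_le order_refl)+
 then show "Lp_norm (ennreal (two_star TYPE('n))) U u \<le> ennreal e" "Lp_norm 2 U (wD U u) \<le> ennreal e"
  using ennreal_power2_le assms(2) by blast+
qed

lemma Y_norm_leI: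
 assumes "weakly_diff U u" "Lp_norm (ennreal (two_star TYPE('n))) U (u :: real^'n::finite \<Rightarrow> 'b::euclidean_space) \<le> ennreal a"
  "Lp_norm 2 U (wD U u) \<le> ennreal b" "a \<ge> 0" "b \<ge> 0"
 shows "Y_norm U u \<le> ennreal (a + b)"
proof -
 have "(Lp_norm (ennreal (two_star TYPE('n))) U u)^2 + (Lp_norm 2 U (wD U u))^2 \<le> (ennreal a)^2 + (ennreal b)^2"
  using assms by (intro add_mono power_mono) auto
 also have "... = ennreal (a^2 + b^2)" using assms by (simp add: ennreal_power)
 also have "... \<le> ennreal ((a + b)^2)" using assms by (intro ennreal_leI) (simp add: power2_sum)
 finally show ?thesis using assms by (simp add: Y_norm_def ennpowr_le_iff del: ennreal_plus)
qed

lemma Y_spaceD: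
 assumes "u \<in> Y_space U"
 shows "weakly_diff U u" "Lp_norm (ennreal (two_star TYPE('n))) U (u :: real^'n::finite \<Rightarrow> 'b::euclidean_space) < \<infinity>"
  "Lp_norm 2 U (wD U u) < \<infinity>"
proof -
 obtain e where "e \<ge> 0" "Y_norm U u \<le> ennreal e" using assms by (cases "Y_norm U u") (auto simp: Y_space_def)
 from Y_norm_leD[OF this(2,1)] show "weakly_diff U u" "Lp_norm (ennreal (two_star TYPE('n))) U u < \<infinity>"
  "Lp_norm 2 U (wD U u) < \<infinity>" by (auto intro: le_less_trans)
qed

lemma wD_diff_AE:
 assumes "open U" "has_weak_deriv U u D" "has_weak_deriv U v E"
 shows "AE x in lebesgue_on U. wD U (\<lambda>x. u x - v x) x = D x - E x"
 by (rule wD_AE[OF assms(1) has_weak_deriv_diff[OF assms(2,3)]])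

text \<open>On a bounded set the square integral is small as soon as the \<open>p\<close>-th power integral is, for \<open>p > 2\<close>.\<close>

lemma square_le_powr: "p > 2 \<Longrightarrow> \<delta> > 0 \<Longrightarrow> g \<ge> 0 \<Longrightarrow> (g::real)^2 \<le> \<delta> + \<delta> powr ((2 - p) / 2) * g powr p"
proof -
 assume p: "p > 2" and d: "\<delta> > 0" and g: "g \<ge> 0"
 show ?thesis
 proof (cases "g^2 \<le> \<delta>")
  case True then show ?thesis by (simp add: add_increasing2)
 next
  case False
  then have g0: "g > 0" using g d by (cases "g = 0") auto
  have g2: "g^2 = g powr 2" using g0 by simp
  have "g^2 = (g^2) powr ((2 - p) / 2) * g powr p" using g0 unfolding g2 powr_powr powr_add[symmetric] by (simp add: field_simps)
  also have "... \<le> \<delta> powr ((2 - p) / 2) * g powr p" using False d p by (intro mult_right_mono powr_mono2') auto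
  finally show ?thesis using d by simp
 qed
qed

text \<open>A test field close to u in the Y norm carries the inequality; the remainder is small in
  L^p with p = \<open>two_star\<close>, and on a ball \<open>square_le_powr\<close> makes its square
  integral small. The constant 32 is 2 times 8 times 2: one factor 2 for splitting u, one for
  splitting the gradient.\<close>

lemma hardy_Y0:
 fixes u :: "real^'n::finite \<Rightarrow> 'b::euclidean_space"
 assumes n: "CARD('n) \<ge> 3" and W: "open W" and u: "u \<in> Y0_space W" and R: "R > 0"
 shows "L2sq (W \<inter> ball a R) u \<le> ennreal (32 * R^2) * L2sq W (wD W u)"
proof (rule ennreal_le_epsilon)
 fix e :: real assume e: "0 < e"
 let ?p = "two_star TYPE('n)" and ?B = "W \<inter> ball a R"
 have p: "?p > 2" by (rule two_star_gt_2[OF n])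
 define vol where "vol = measure lebesgue (ball a R)"
 have vol: "emeasure lebesgue (ball a R) = ennreal vol" "vol \<ge> 0" unfolding vol_def by (auto simp: emeasure_eq_measure2 lmeasurable_ball)
 \<comment> \<open>\<delta> is fixed first, against the volume of the ball; \<epsilon> comes
   afterwards, since the factor c of the p-th power term blows up as \<delta> tends to 0.\<close>
 define \<delta> where "\<delta> = e / (4 * (vol + 1))"
 have \<delta>: "\<delta> > 0" "2 * \<delta> * vol \<le> e / 2" using e vol by (auto simp: \<delta>_def field_simps)
 define c where "c = \<delta> powr ((2 - ?p) / 2)"
 have c0: "c \<ge> 0" by (simp add: c_def)
 have "((\<lambda>\<epsilon>. 32 * R^2 * \<epsilon>^2 + 2 * (c * \<epsilon> powr ?p)) \<longlongrightarrow> 32 * R^2 * 0^2 + 2 * (c * 0 powr ?p)) (at_right 0)"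
  by (intro tendsto_intros tendsto_powr' ) (use p in \<open>auto intro!: tendsto_ident_at eventually_at_right_less simp: eventually_at_filter\<close>)
 then have "\<forall>\<^sub>F \<epsilon> in at_right 0. 32 * R^2 * \<epsilon>^2 + 2 * (c * \<epsilon> powr ?p) < e / 2"
  by (rule order_tendstoD(2)) (use e p in auto)
 moreover have "\<forall>\<^sub>F \<epsilon>::real in at_right 0. \<epsilon> > 0" by (simp add: eventually_at_right_less)
 ultimately have "\<forall>\<^sub>F \<epsilon> in at_right 0. 32 * R^2 * \<epsilon>^2 + 2 * (c * \<epsilon> powr ?p) < e / 2 \<and> \<epsilon> > 0"
  by (rule eventually_conj)
 then obtain \<epsilon> where \<epsilon>: "\<epsilon> > 0" "32 * R^2 * \<epsilon>^2 + 2 * (c * \<epsilon> powr ?p) < e / 2"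
  using eventually_happens[of _ "at_right (0::real)"] trivial_limit_at_right_real by blast
 obtain \<phi> where \<phi>: "\<phi> \<in> test_vec W" "Y_norm W (\<lambda>x. u x - \<phi> x) \<le> ennreal \<epsilon>"
  using u \<epsilon>(1) unfolding Y0_space_def by (auto dest: less_imp_le)
 have wu: "has_weak_deriv W u (wD W u)" using u by (auto simp: Y0_space_def intro: wD_has_weak_deriv Y_spaceD)
 note wphi = has_weak_deriv_test_vec[OF W \<phi>(1)]
 define v where "v = (\<lambda>x. u x - \<phi> x)"
 have Yv: "Y_norm W v \<le> ennreal \<epsilon>" using \<phi>(2) by (simp add: v_def)
 note Yv' = Y_norm_leD[OF Yv less_imp_le[OF \<epsilon>(1)]]
 have wv: "has_weak_deriv W v (wD W v)" by (rule wD_has_weak_deriv[OF Yv'(1)])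
 have S: "W \<in> sets lebesgue" "?B \<in> sets lebesgue" "?B \<subseteq> W" using W by auto
 note mu = has_weak_deriv_measurable[OF W wu] and mv = has_weak_deriv_measurable[OF W wv]
  and mphi = has_weak_deriv_measurable[OF W wphi]
 have vp: "(\<integral>\<^sup>+x\<in>W. ennreal (norm (v x) powr ?p) \<partial>lebesgue) \<le> ennreal (\<epsilon> powr ?p)"
  using Yv'(2) p \<epsilon> S by (subst (asm) Lp_norm_le_iff) auto
 have dv: "L2sq W (wD W v) \<le> ennreal (\<epsilon>^2)" using Yv'(3) \<epsilon> S by (subst (asm) Lp_norm_2_le_iff) auto
 have v2: "L2sq ?B v \<le> ennreal (\<delta> * vol + c * \<epsilon> powr ?p)"
 proof -
  have mpw: "(\<lambda>x. ennreal (norm (v x) powr ?p) * indicator W x) \<in> meas_L"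
   by (rule measurable_indicator_comp[OF S(1) mv(1) _ S(1), of "\<lambda>v. ennreal (norm v powr ?p)"]) auto
  have "L2sq ?B v \<le> (\<integral>\<^sup>+x. ennreal \<delta> * indicator (ball a R) x + ennreal c * (ennreal (norm (v x) powr ?p) * indicator W x) \<partial>lebesgue)"
   unfolding L2sq_def
  proof (intro nn_integral_mono)
   fix x
   have "ennreal ((norm (v x))^2) \<le> ennreal (\<delta> + c * norm (v x) powr ?p)"
    unfolding c_def by (intro ennreal_leI square_le_powr p \<delta>) auto
   also have "... = ennreal \<delta> + ennreal c * ennreal (norm (v x) powr ?p)" using \<delta> c0 by (simp add: ennreal_mult)
   finally show "ennreal ((norm (v x))^2) * indicator ?B x \<le> ennreal \<delta> * indicator (ball a R) x + ennreal c * (ennreal (norm (v x) powr ?p) * indicator W x)"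
    by (auto simp: indicator_def)
  qed
  also have "... = ennreal \<delta> * ennreal vol + ennreal c * (\<integral>\<^sup>+x\<in>W. ennreal (norm (v x) powr ?p) \<partial>lebesgue)"
   using mpw by (subst nn_integral_add) (auto simp: nn_integral_cmult nn_integral_cmult_indicator vol intro!: borel_measurable_times_ennreal borel_measurable_indicator)
  also have "... \<le> ennreal \<delta> * ennreal vol + ennreal c * ennreal (\<epsilon> powr ?p)" by (intro add_mono mult_left_mono vp) auto
  also have "... = ennreal (\<delta> * vol + c * \<epsilon> powr ?p)" using \<delta> c0 vol by (simp add: ennreal_mult)
  finally show ?thesis .
 qed
 have gphi: "L2sq UNIV (grad \<phi>) = L2sq W (grad \<phi>)"
 proof -
  obtain K where "K \<subseteq> W" "\<And>x. x \<notin> K \<Longrightarrow> grad \<phi> x = 0" using test_vec_support[OF \<phi>(1)] by metis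
  then show ?thesis unfolding L2sq_def by (intro nn_integral_cong) (auto simp: indicator_def)
 qed
 have "AE x in lebesgue_on W. grad \<phi> x = wD W u x + (-1) *\<^sub>R wD W v x" using wD_diff_AE[OF W wu wphi] by eventually_elim (simp add: v_def)
 then have "L2sq W (grad \<phi>) = L2sq W (\<lambda>x. wD W u x + (-1) *\<^sub>R wD W v x)" by (intro L2sq_cong_AE[OF S(1)]) auto
 also have "... \<le> 2 * L2sq W (wD W u) + 2 * L2sq W (\<lambda>x. (-1) *\<^sub>R wD W v x)"
  by (intro L2sq_add_le[OF S(1) mu(2) _ S(1)] borel_measurable_scaleR mv) auto
 also have "L2sq W (\<lambda>x. (-1) *\<^sub>R wD W v x) = L2sq W (wD W v)" by (simp add: L2sq_def)
 also have "2 * L2sq W (wD W u) + 2 * L2sq W (wD W v) \<le> 2 * L2sq W (wD W u) + 2 * ennreal (\<epsilon>^2)"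
  by (intro add_mono mult_left_mono dv) auto
 finally have g2: "L2sq W (grad \<phi>) \<le> 2 * L2sq W (wD W u) + 2 * ennreal (\<epsilon>^2)" .
 have "L2sq ?B \<phi> \<le> L2sq (ball a R) \<phi>" by (intro L2sq_mono_set) auto
 also have "... \<le> ennreal (8 * R^2) * L2sq UNIV (grad \<phi>)" using test_vec_mono[of W UNIV] \<phi>(1) by (intro hardy_test_vec n R) auto
 also have "... \<le> ennreal (8 * R^2) * (2 * L2sq W (wD W u) + 2 * ennreal (\<epsilon>^2))" unfolding gphi by (intro mult_left_mono g2) auto
 finally have phi2: "L2sq ?B \<phi> \<le> ennreal (8 * R^2) * (2 * L2sq W (wD W u) + 2 * ennreal (\<epsilon>^2))" .
 have "L2sq ?B u = L2sq ?B (\<lambda>x. \<phi> x + v x)" by (simp add: v_def)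
 also have "... \<le> 2 * L2sq ?B \<phi> + 2 * L2sq ?B v" by (intro L2sq_add_le[OF S(1) mphi(1) mv(1) S(2,3)])
 also have "... \<le> 2 * (ennreal (8 * R^2) * (2 * L2sq W (wD W u) + 2 * ennreal (\<epsilon>^2))) + 2 * ennreal (\<delta> * vol + c * \<epsilon> powr ?p)"
  by (intro add_mono mult_left_mono phi2 v2) auto
 also have "... = ennreal (32 * R^2) * L2sq W (wD W u) + ennreal (32 * R^2 * \<epsilon>^2 + 2 * (\<delta> * vol + c * \<epsilon> powr ?p))"
 proof -
  have a: "ennreal (32 * R^2) = 2 * (ennreal (8 * R^2) * 2)" by (simp flip: ennreal_numeral ennreal_mult')
  have b: "ennreal (32 * R^2 * \<epsilon>^2 + 2 * (\<delta> * vol + c * \<epsilon> powr ?p)) = 2 * (ennreal (8 * R^2) * (2 * ennreal (\<epsilon>^2))) + 2 * ennreal (\<delta> * vol + c * \<epsilon> powr ?p)"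
   using \<delta> c0 vol by (simp flip: ennreal_numeral ennreal_mult' ennreal_plus add: algebra_simps)
  show ?thesis unfolding a b by (simp add: algebra_simps)
 qed
 also have "... \<le> ennreal (32 * R^2) * L2sq W (wD W u) + ennreal e"
  using \<epsilon>(2) \<delta>(2) by (intro add_left_mono ennreal_leI) (simp add: algebra_simps)
 finally show "L2sq ?B u \<le> ennreal (32 * R^2) * L2sq W (wD W u) + ennreal e" .
qed

subsection \<open>The Cauchy--Schwarz inequality\<close>

text \<open>Young's inequality with weight t = b'/a', where a' > a and b' > b keep the weight
  defined when a or b is zero; letting both decrease gives the product bound.\<close>

lemma L2sq_inner:
 fixes f g :: "real^'n::finite \<Rightarrow> 'b::euclidean_space"
 assumes S: "S \<in> sets lebesgue" and m: "f \<in> meas_on S" "g \<in> meas_on S"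
  and b: "L2sq S f \<le> ennreal (a^2)" "L2sq S g \<le> ennreal (b^2)" "a \<ge> 0" "b \<ge> 0"
 shows "set_integrable lebesgue S (\<lambda>x. f x \<bullet> g x)" "\<bar>LINT x:S|lebesgue. f x \<bullet> g x\<bar> \<le> a * b"
proof -
 have mf: "(\<lambda>x. ennreal ((norm (h x))^2) * indicator S x) \<in> meas_L"
  if "h \<in> meas_on S" for h :: "real^'n \<Rightarrow> 'b"
  by (rule measurable_indicator_comp[OF S that _ S, of "\<lambda>v. ennreal ((norm v)^2)"]) auto
 have mfg: "(\<lambda>x. indicator S x *\<^sub>R (f x \<bullet> g x)) \<in> meas_L" by (intro indicator_measurable_on[OF S] borel_measurable_inner m)
 have key: "(\<integral>\<^sup>+x. ennreal (norm (indicator S x *\<^sub>R (f x \<bullet> g x))) \<partial>lebesgue) \<le> ennreal (a' * b')"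
  if ab: "a' > a" "b' > b" for a' b'
 proof -
  define t where "t = b' / a'"
  have pos: "a' > 0" "b' > 0" "t > 0" using ab b by (auto simp: t_def)
  have "(\<integral>\<^sup>+x. ennreal (norm (indicator S x *\<^sub>R (f x \<bullet> g x))) \<partial>lebesgue) \<le>
   (\<integral>\<^sup>+x. ennreal (t / 2) * (ennreal ((norm (f x))^2) * indicator S x) + ennreal (1 / (2 * t)) * (ennreal ((norm (g x))^2) * indicator S x) \<partial>lebesgue)"
  proof (intro nn_integral_mono)
   fix x
   have "0 \<le> (t * norm (f x) - norm (g x))^2" by simp
   then have "2 * (t * (norm (f x) * norm (g x))) \<le> (t * norm (f x))^2 + (norm (g x))^2" by (simp add: power2_diff mult_ac)
   then have "norm (f x) * norm (g x) \<le> t / 2 * (norm (f x))^2 + 1 / (2 * t) * (norm (g x))^2"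
    using pos by (simp add: field_simps power2_eq_square)
   then have "\<bar>f x \<bullet> g x\<bar> \<le> t / 2 * (norm (f x))^2 + 1 / (2 * t) * (norm (g x))^2"
    using Cauchy_Schwarz_ineq2[of "f x" "g x"] by linarith
   then have "ennreal \<bar>f x \<bullet> g x\<bar> \<le> ennreal (t / 2) * ennreal ((norm (f x))^2) + ennreal (1 / (2 * t)) * ennreal ((norm (g x))^2)"
    using pos by (subst (1 2) ennreal_mult[symmetric]) (auto simp flip: ennreal_plus intro!: ennreal_leI)
   then show "ennreal (norm (indicator S x *\<^sub>R (f x \<bullet> g x))) \<le> ennreal (t / 2) * (ennreal ((norm (f x))^2) * indicator S x) + ennreal (1 / (2 * t)) * (ennreal ((norm (g x))^2) * indicator S x)"
    by (auto simp: indicator_def)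
  qed
  also have "... = ennreal (t / 2) * L2sq S f + ennreal (1 / (2 * t)) * L2sq S g"
   unfolding L2sq_def using mf[OF m(1)] mf[OF m(2)] by (subst nn_integral_add) (auto simp: nn_integral_cmult)
  also have "... \<le> ennreal (t / 2) * ennreal (a'^2) + ennreal (1 / (2 * t)) * ennreal (b'^2)"
   using ab b by (intro add_mono mult_left_mono order_trans[OF b(1)] order_trans[OF b(2)] ennreal_leI power_mono) auto
  also have "... = ennreal (t / 2 * a'^2 + 1 / (2 * t) * b'^2)" using pos by (simp add: ennreal_mult[symmetric])
  also have "t / 2 * a'^2 + 1 / (2 * t) * b'^2 = a' * b'" using pos by (simp add: t_def power2_eq_square field_simps)
  finally show ?thesis .
 qed
 have fin: "(\<integral>\<^sup>+x. ennreal (norm (indicator S x *\<^sub>R (f x \<bullet> g x))) \<partial>lebesgue) < \<infinity>"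
  using key[of "a + 1" "b + 1"] by (auto intro: le_less_trans)
 then show i: "set_integrable lebesgue S (\<lambda>x. f x \<bullet> g x)"
  unfolding set_integrable_def using mfg by (simp add: integrable_iff_bounded)
 have "\<bar>LINT x:S|lebesgue. f x \<bullet> g x\<bar> \<le> (a + e) * (b + e)" if e: "e > 0" for e
 proof -
  have "ennreal \<bar>LINT x:S|lebesgue. f x \<bullet> g x\<bar> \<le> (\<integral>\<^sup>+x. ennreal (norm (indicator S x *\<^sub>R (f x \<bullet> g x))) \<partial>lebesgue)"
   unfolding set_lebesgue_integral_def real_norm_def[symmetric] using i by (intro integral_norm_bound_ennreal) (simp add: set_integrable_def)
  also have "... \<le> ennreal ((a + e) * (b + e))" using e by (intro key) auto
  finally show ?thesis using e b by (subst (asm) ennreal_le_iff) auto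
 qed
 moreover have "((\<lambda>e. (a + e) * (b + e)) \<longlongrightarrow> (a + 0) * (b + 0)) (at_right 0)" by (intro tendsto_intros)
 ultimately show "\<bar>LINT x:S|lebesgue. f x \<bullet> g x\<bar> \<le> a * b"
  using tendsto_lowerbound[of "\<lambda>e. (a + e) * (b + e)" "a * b" "at_right 0" "\<bar>LINT x:S|lebesgue. f x \<bullet> g x\<bar>"]
  by (simp add: eventually_at_right_less eventually_mono[OF eventually_at_right_less])
qed

subsection \<open>The abstract Hilbert space\<close>

text \<open>Makes sets of functions admissible carriers for \<open>complete_inner_subspace\<close>,
  which is stated over a real vector space type.\<close>

instantiation "fun" :: (type, real_vector) real_vector
begin

definition scaleR_fun :: "real \<Rightarrow> ('a \<Rightarrow> 'b) \<Rightarrow> 'a \<Rightarrow> 'b" where "scaleR_fun c f = (\<lambda>x. c *\<^sub>R f x)"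

instance by standard (auto simp: scaleR_fun_def plus_fun_def fun_eq_iff algebra_simps)

end

lemma test_vec_add: "f \<in> test_vec U \<Longrightarrow> g \<in> test_vec U \<Longrightarrow> (\<lambda>x. f x + g x) \<in> test_vec U"
 unfolding test_vec_def mem_Collect_eq inner_add_left by (rule ballI, rule test_fun_add; drule bspec, assumption, assumption)

lemma test_vec_mult: "f \<in> test_vec U \<Longrightarrow> smooth_fun c \<Longrightarrow> (\<lambda>x. c x *\<^sub>R f x) \<in> test_vec U"
 unfolding test_vec_def mem_Collect_eq inner_scaleR_left by (rule ballI, rule test_fun_mult_left, drule bspec, assumption, assumption)

lemma test_vec_scaleR: "f \<in> test_vec U \<Longrightarrow> (\<lambda>x. c *\<^sub>R f x) \<in> test_vec U"
 by (rule test_vec_mult) auto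

lemma test_vec_0: "(\<lambda>x. 0) \<in> test_vec U"
 by (simp add: test_vec_def test_fun_0)

locale elliptic_space =
 fixes W :: "(real^'n::finite) set" and F :: "('n, 'N::finite) family" and nF :: "('n, 'N) family_norm" and c\<^sub>0 :: real
 assumes n3: "CARD('n) \<ge> 3" and open_W: "open W"
  and banach: "banach_function_space W (F W) (nF W)"
  and hilbert: "hilbert_property F nF W"
  and embed: "embedding_property F nF c\<^sub>0 W"
begin

abbreviation "H \<equiv> F0 F nF W"
abbreviation "N \<equiv> nF W"

lemma test_F: "test_vec W \<subseteq> F W" using hilbert by (simp add: hilbert_property_def)

lemma F_add: "u \<in> F W \<Longrightarrow> v \<in> F W \<Longrightarrow> (\<lambda>x. u x + v x) \<in> F W \<and> N (\<lambda>x. u x + v x) \<le> N u + N v"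
 using banach unfolding banach_function_space_def by meson

lemma F_scale: "u \<in> F W \<Longrightarrow> (\<lambda>x. c *\<^sub>R u x) \<in> F W \<and> N (\<lambda>x. c *\<^sub>R u x) = \<bar>c\<bar> * N u"
 using banach unfolding banach_function_space_def by meson

lemma F_diff: "u \<in> F W \<Longrightarrow> v \<in> F W \<Longrightarrow> (\<lambda>x. u x - v x) \<in> F W \<and> N (\<lambda>x. u x - v x) \<le> N u + N v"
 using F_add[of u "\<lambda>x. (-1) *\<^sub>R v x"] F_scale[of v "-1"] by simp

lemma F_nonneg: "u \<in> F W \<Longrightarrow> 0 \<le> N u"
 using banach unfolding banach_function_space_def by meson

lemma H_F: "u \<in> H \<Longrightarrow> u \<in> F W" by (simp add: F0_def)

lemma H_nonneg: "u \<in> H \<Longrightarrow> 0 \<le> N u" using F_nonneg H_F by blast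

lemma F_0: "(\<lambda>x. 0) \<in> F W" "N (\<lambda>x. 0) = 0"
proof -
 show "(\<lambda>x. 0) \<in> F W" using banach unfolding banach_function_space_def by meson
 from F_scale[OF this, of 0] show "N (\<lambda>x. 0) = 0" by simp
qed

lemma test_H: "\<phi> \<in> test_vec W \<Longrightarrow> \<phi> \<in> H"
 using test_F F_0 by (auto simp: F0_def intro!: bexI[of _ \<phi>])

lemma H_approx: "u \<in> H \<Longrightarrow> e > 0 \<Longrightarrow> \<exists>\<phi>\<in>test_vec W. N (\<lambda>x. u x - \<phi> x) < e"
 by (auto simp: F0_def)

lemma H_add: assumes "u \<in> H" "v \<in> H" shows "(\<lambda>x. u x + v x) \<in> H"
proof -
 have "\<exists>\<phi>\<in>test_vec W. N (\<lambda>x. u x + v x - \<phi> x) < e" if "e > 0" for e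
 proof -
  obtain \<phi> \<psi> where a: "\<phi> \<in> test_vec W" "N (\<lambda>x. u x - \<phi> x) < e / 2" "\<psi> \<in> test_vec W" "N (\<lambda>x. v x - \<psi> x) < e / 2"
   using H_approx[OF assms(1), of "e/2"] H_approx[OF assms(2), of "e/2"] \<open>e > 0\<close> by auto
  have "N (\<lambda>x. (u x - \<phi> x) + (v x - \<psi> x)) \<le> N (\<lambda>x. u x - \<phi> x) + N (\<lambda>x. v x - \<psi> x)"
   using a assms test_H by (intro F_add[THEN conjunct2] F_diff[THEN conjunct1] H_F) auto
  moreover have "(\<lambda>x. (u x - \<phi> x) + (v x - \<psi> x)) = (\<lambda>x. u x + v x - (\<phi> x + \<psi> x))" by auto
  ultimately have "N (\<lambda>x. u x + v x - (\<phi> x + \<psi> x)) < e" using a by simp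
  then show ?thesis using test_vec_add[OF a(1,3)] by (intro bexI[of _ "\<lambda>x. \<phi> x + \<psi> x"])
 qed
 then show ?thesis using assms F_add by (simp add: F0_def)
qed

lemma H_scale: assumes "u \<in> H" shows "(\<lambda>x. c *\<^sub>R u x) \<in> H"
proof -
 have "\<exists>\<phi>\<in>test_vec W. N (\<lambda>x. c *\<^sub>R u x - \<phi> x) < e" if "e > 0" for e
 proof -
  have p: "\<bar>c\<bar> + 1 > 0" by simp
  obtain \<phi> where a: "\<phi> \<in> test_vec W" "N (\<lambda>x. u x - \<phi> x) < e / (\<bar>c\<bar> + 1)"
   using H_approx[OF assms, of "e / (\<bar>c\<bar> + 1)"] \<open>e > 0\<close> by auto
  have d: "(\<lambda>x. u x - \<phi> x) \<in> F W" using a assms test_F F_diff H_F by blast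
  have "N (\<lambda>x. c *\<^sub>R u x - c *\<^sub>R \<phi> x) = \<bar>c\<bar> * N (\<lambda>x. u x - \<phi> x)"
   using F_scale[OF d, of c] by (simp add: scaleR_diff_right)
  also have "... \<le> (\<bar>c\<bar> + 1) * N (\<lambda>x. u x - \<phi> x)" using F_nonneg[OF d] by (intro mult_right_mono) auto
  also have "... < e" using a(2) p by (simp add: pos_less_divide_eq mult.commute)
  finally show ?thesis using test_vec_scaleR[OF a(1), of c] by (intro bexI[of _ "\<lambda>x. c *\<^sub>R \<phi> x"])
 qed
 then show ?thesis using assms F_scale by (simp add: F0_def)
qed

lemma H_diff: "u \<in> H \<Longrightarrow> v \<in> H \<Longrightarrow> (\<lambda>x. u x - v x) \<in> H"
 using H_add[of u "\<lambda>x. (-1) *\<^sub>R v x"] H_scale[of v "-1"] by simp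

lemma H_0: "(\<lambda>x. 0) \<in> H" using test_H[OF test_vec_0] .

text \<open>Kernel integrals are identified with solutions only almost everywhere, so membership
  must survive a change of representative.\<close>

lemma H_cong:
 assumes "u \<in> H" "AE x in lebesgue_on W. v x = u x"
 shows "v \<in> H"
proof -
 have cong: "w' \<in> F W \<and> N w' = N w" if "w \<in> F W" "AE x in lebesgue_on W. w' x = w x" for w w'
  using banach that unfolding banach_function_space_def by meson
 have "N (\<lambda>x. v x - \<phi> x) = N (\<lambda>x. u x - \<phi> x)" if "\<phi> \<in> test_vec W" for \<phi>
 proof -
  have "(\<lambda>x. u x - \<phi> x) \<in> F W" using that assms test_F F_diff H_F by blast
  moreover have "AE x in lebesgue_on W. v x - \<phi> x = u x - \<phi> x" using assms(2) by eventually_elim simp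
  ultimately show ?thesis by (rule cong[THEN conjunct2])
 qed
 then show ?thesis using assms cong by (auto simp: F0_def)
qed

lemma H_inner_product:
 obtains ip c c' where "complete_inner_subspace H ip" "c > 0" "c' > 0"
  "\<And>u. u \<in> H \<Longrightarrow> c * N u \<le> complete_inner_subspace.nr ip u"
  "\<And>u. u \<in> H \<Longrightarrow> complete_inner_subspace.nr ip u \<le> c' * N u"
proof -
 obtain ip where ip: "bilinear_form_on H ip" "\<forall>u\<in>H. \<forall>v\<in>H. ip u v = ip v u"
   "\<forall>u\<in>H. 0 \<le> ip u u" "complete_wrt H (\<lambda>u. sqrt (ip u u))"
   "\<exists>c>0. \<exists>c'>0. \<forall>u\<in>H. c * N u \<le> sqrt (ip u u) \<and> sqrt (ip u u) \<le> c' * N u"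
  using hilbert unfolding hilbert_property_def by blast
 obtain c c' where c: "c > 0" "c' > 0" "\<forall>u\<in>H. c * N u \<le> sqrt (ip u u) \<and> sqrt (ip u u) \<le> c' * N u" using ip(5) by blast
 have I: "complete_inner_subspace H ip"
 proof
  show "subspace H"
   unfolding subspace_def using H_0 H_add H_scale by (simp add: zero_fun_def plus_fun_def scaleR_fun_def)
  show "ip (u + v) w = ip u w + ip v w" if "u \<in> H" "v \<in> H" "w \<in> H" for u v w
   using ip(1) that unfolding bilinear_form_on_def plus_fun_def by meson
  show "ip (c *\<^sub>R u) v = c * ip u v" if "u \<in> H" "v \<in> H" for c u v
   using ip(1) that unfolding bilinear_form_on_def scaleR_fun_def by meson
  show "\<exists>u\<in>H. (\<lambda>k. sqrt (ip (X k - u) (X k - u))) \<longlonglongrightarrow> 0"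
   if "\<And>k. X k \<in> H" "\<And>\<epsilon>. \<epsilon> > 0 \<Longrightarrow> \<exists>M. \<forall>k\<ge>M. \<forall>m\<ge>M. sqrt (ip (X k - X m) (X k - X m)) < \<epsilon>" for X :: "nat \<Rightarrow> _"
   using ip(4) that unfolding complete_wrt_def by (simp add: fun_diff_def)
 qed (use ip in auto)
 interpret complete_inner_subspace H ip by (rule I)
 show ?thesis using that[OF I c(1,2)] c(3) by (simp add: nr_def)
qed

text \<open>The Hilbert norm is equivalent to N with uncontrolled constants. They disappear because
  only existence is concluded; the size of the solution is estimated afterwards from coercivity in
  N.\<close>

lemma H_lax_milgram:
 assumes B: "bilinear_form_on H B" and bd: "\<And>u v. u \<in> H \<Longrightarrow> v \<in> H \<Longrightarrow> \<bar>B u v\<bar> \<le> \<Gamma> * N u * N v"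
  and coer: "\<gamma> > 0" "\<And>u. u \<in> H \<Longrightarrow> \<gamma> * (N u)^2 \<le> B u u"
  and l: "\<And>u v. u \<in> H \<Longrightarrow> v \<in> H \<Longrightarrow> l (\<lambda>x. u x + v x) = l u + l v"
   "\<And>c u. u \<in> H \<Longrightarrow> l (\<lambda>x. c *\<^sub>R u x) = c * l u" "\<And>u. u \<in> H \<Longrightarrow> \<bar>l u\<bar> \<le> M * N u"
 shows "\<exists>w\<in>H. \<forall>v\<in>H. B w v = l v"
proof -
 obtain ip c c' where I: "complete_inner_subspace H ip" and c: "c > 0" "c' > 0"
  "\<And>u. u \<in> H \<Longrightarrow> c * N u \<le> complete_inner_subspace.nr ip u"
  "\<And>u. u \<in> H \<Longrightarrow> complete_inner_subspace.nr ip u \<le> c' * N u"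
  using H_inner_product by metis
 interpret complete_inner_subspace H ip by (rule I)
 have Nnr: "N u \<le> nr u / c" if "u \<in> H" for u using c(3)[OF that] c(1) by (simp add: field_simps)
 show ?thesis
 proof (rule lax_milgram[where \<Gamma> = "\<bar>\<Gamma>\<bar> / c / c" and \<gamma> = "\<gamma> / c'^2" and M = "\<bar>M\<bar> / c"])
  show "B (u + v) w = B u w + B v w" "B w (u + v) = B w u + B w v" if "u \<in> H" "v \<in> H" "w \<in> H" for u v w
   using B that unfolding bilinear_form_on_def plus_fun_def by meson+
  show "B (k *\<^sub>R u) v = k * B u v" "B u (k *\<^sub>R v) = k * B u v" if "u \<in> H" "v \<in> H" for k u v
   using B that unfolding bilinear_form_on_def scaleR_fun_def by meson+
  show "\<bar>B u v\<bar> \<le> \<bar>\<Gamma>\<bar> / c / c * nr u * nr v" if uv: "u \<in> H" "v \<in> H" for u v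
  proof -
   have "\<bar>B u v\<bar> \<le> \<Gamma> * N u * N v" by (rule bd[OF uv])
   also have "... \<le> \<bar>\<Gamma>\<bar> * (nr u / c) * (nr v / c)" using uv Nnr c by (intro mult_mono) (auto simp: H_nonneg nr_nonneg)
   finally show ?thesis by simp
  qed
  show "\<gamma> / c'^2 * (nr u)^2 \<le> B u u" if u: "u \<in> H" for u
  proof -
   have "(nr u)^2 \<le> (c' * N u)^2" using c(4)[OF u] nr_nonneg[OF u] by (intro power_mono)
   then have "\<gamma> / c'^2 * (nr u)^2 \<le> \<gamma> / c'^2 * (c' * N u)^2" using coer by (intro mult_left_mono) auto
   also have "... = \<gamma> * (N u)^2" using c by (simp add: power_mult_distrib)
   finally show ?thesis using coer(2)[OF u] by linarith
  qed
  show "0 < \<gamma> / c'^2" using coer c by simp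
  show "l (u + v) = l u + l v" if "u \<in> H" "v \<in> H" for u v using l(1)[OF that] by (simp add: plus_fun_def)
  show "l (k *\<^sub>R u) = k * l u" if "u \<in> H" for k u using l(2)[OF that] by (simp add: scaleR_fun_def)
  show "\<bar>l u\<bar> \<le> \<bar>M\<bar> / c * nr u" if u: "u \<in> H" for u
  proof -
   have "\<bar>l u\<bar> \<le> M * N u" by (rule l(3)[OF u])
   also have "... \<le> \<bar>M\<bar> * (nr u / c)" using u Nnr by (intro mult_mono) (auto simp: H_nonneg)
   finally show ?thesis by simp
  qed
 qed
qed

lemma H_uniform_boundedness:
 fixes T :: "nat \<Rightarrow> (real^'n \<Rightarrow> real^'N) \<Rightarrow> real"
 assumes l: "\<And>m u v. u \<in> H \<Longrightarrow> v \<in> H \<Longrightarrow> T m (\<lambda>x. u x + v x) = T m u + T m v"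
   "\<And>m c u. u \<in> H \<Longrightarrow> T m (\<lambda>x. c *\<^sub>R u x) = c * T m u"
  and bd: "\<And>m. \<exists>M. \<forall>u\<in>H. \<bar>T m u\<bar> \<le> M * N u"
  and pw: "\<And>u. u \<in> H \<Longrightarrow> \<exists>K. \<forall>m. \<bar>T m u\<bar> \<le> K"
 shows "\<exists>M. \<forall>m. \<forall>u\<in>H. \<bar>T m u\<bar> \<le> M * N u"
proof -
 obtain ip c c' where I: "complete_inner_subspace H ip" and c: "c > 0" "c' > 0"
  "\<And>u. u \<in> H \<Longrightarrow> c * N u \<le> complete_inner_subspace.nr ip u"
  "\<And>u. u \<in> H \<Longrightarrow> complete_inner_subspace.nr ip u \<le> c' * N u"
  using H_inner_product by metis
 interpret complete_inner_subspace H ip by (rule I)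
 have "\<exists>M. \<forall>m. \<forall>u\<in>H. \<bar>T m u\<bar> \<le> M * nr u"
 proof (rule uniform_boundedness)
  show "T m (u + v) = T m u + T m v" if "u \<in> H" "v \<in> H" for m u v using l(1)[OF that] by (simp add: plus_fun_def)
  show "T m (k *\<^sub>R u) = k * T m u" if "u \<in> H" for m k u using l(2)[OF that] by (simp add: scaleR_fun_def)
  show "\<exists>M. \<forall>u\<in>H. \<bar>T m u\<bar> \<le> M * nr u" for m
  proof -
   obtain M where M: "\<And>u. u \<in> H \<Longrightarrow> \<bar>T m u\<bar> \<le> M * N u" using bd by blast
   have "\<bar>T m u\<bar> \<le> \<bar>M\<bar> / c * nr u" if u: "u \<in> H" for u
   proof -
    have "M * N u \<le> \<bar>M\<bar> * (nr u / c)" using u c by (intro mult_mono) (auto simp: H_nonneg field_simps)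
    with M[OF u] show ?thesis by simp
   qed
   then show ?thesis by blast
  qed
 qed (use pw in auto)
 then obtain M where M: "\<And>m u. u \<in> H \<Longrightarrow> \<bar>T m u\<bar> \<le> M * nr u" by blast
 have "\<bar>T m u\<bar> \<le> (\<bar>M\<bar> * c') * N u" if u: "u \<in> H" for m u
 proof -
  have "M * nr u \<le> \<bar>M\<bar> * (c' * N u)" using u c by (intro mult_mono) (auto simp: nr_nonneg)
  with M[OF u, of m] show ?thesis by (simp add: mult.assoc)
 qed
 then show ?thesis by blast
qed

text \<open>\<open>c\<^sub>0\<close> is an arbitrary real and may be negative, while products of
  this constant with norms have to be monotone.\<close>

definition "cD = max c\<^sub>0 0"

lemma cD_nonneg: "cD \<ge> 0" by (simp add: cD_def)

lemma H_Y0: "u \<in> H \<Longrightarrow> u \<in> Y0_space W"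
 using embed by (simp add: embedding_property_def)

lemma H_Y: "u \<in> H \<Longrightarrow> u \<in> Y_space W" using H_Y0 by (auto simp: Y0_space_def)

lemma H_weak_deriv: "u \<in> H \<Longrightarrow> has_weak_deriv W u (wD W u)"
 by (intro wD_has_weak_deriv Y_spaceD(1) H_Y)

lemma sets_W: "W \<in> sets lebesgue" using open_W by simp

lemma H_measurable: "u \<in> H \<Longrightarrow> u \<in> meas_on W"
 "u \<in> H \<Longrightarrow> wD W u \<in> meas_on W"
 using has_weak_deriv_measurable[OF open_W H_weak_deriv] by auto

lemma H_dirichlet: assumes "u \<in> H" shows "L2sq W (wD W u) \<le> ennreal ((cD * N u)^2)"
proof -
 have "Lp_norm 2 W (wD W u) \<le> ennreal (c\<^sub>0 * N u)" using embed assms by (simp add: embedding_property_def)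
 also have "... \<le> ennreal (cD * N u)" using H_nonneg[OF assms] by (intro ennreal_leI mult_right_mono) (auto simp: cD_def)
 finally show ?thesis using H_nonneg[OF assms] cD_nonneg sets_W by (subst (asm) Lp_norm_2_le_iff) auto
qed

lemma H_hardy: assumes "u \<in> H" "R > 0" shows "L2sq (W \<inter> ball a R) u \<le> ennreal ((6 * cD * R * N u)^2)"
proof -
 have "L2sq (W \<inter> ball a R) u \<le> ennreal (32 * R^2) * L2sq W (wD W u)" by (rule hardy_Y0[OF n3 open_W H_Y0[OF assms(1)] assms(2)])
 \<comment> \<open>32 is enlarged to the perfect square 36 so that the bound becomes a single
   square.\<close>
 also have "... \<le> ennreal (36 * R^2) * ennreal ((cD * N u)^2)" by (intro mult_mono H_dirichlet assms ennreal_leI) auto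
 also have "... = ennreal ((6 * cD * R * N u)^2)" by (simp add: ennreal_mult[symmetric] power_mult_distrib mult_ac)
 finally show ?thesis .
qed

end

subsection \<open>Continuity of the bilinear form against test fields\<close>

lemma set_integrable_cong_AE':
 fixes f g :: "real^'n::finite \<Rightarrow> 'b::euclidean_space"
 assumes U: "U \<in> sets lebesgue" and f: "set_integrable lebesgue U f"
  and ae: "AE x in lebesgue_on U. g x = f x"
 shows "set_integrable lebesgue U g" "(LINT x:U|lebesgue. g x) = (LINT x:U|lebesgue. f x)"
proof -
 have ae': "AE x in lebesgue. indicator U x *\<^sub>R f x = indicator U x *\<^sub>R g x"
  using ae U by (auto simp: AE_restrict_space_iff indicator_def elim!: eventually_mono)
 have i: "integrable lebesgue (\<lambda>x. indicator U x *\<^sub>R f x)" using f by (simp add: set_integrable_def)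
 have m: "(\<lambda>x. indicator U x *\<^sub>R g x) \<in> meas_L" by (rule borel_measurable_AE[OF _ ae']) (use i in auto)
 show "set_integrable lebesgue U g"
  unfolding set_integrable_def using integrable_cong_AE_imp[OF i m] ae' by (auto elim: eventually_mono)
 show "(LINT x:U|lebesgue. g x) = (LINT x:U|lebesgue. f x)"
  unfolding set_lebesgue_integral_def using m i ae' by (intro integral_cong_AE) (auto elim: eventually_mono)
qed

lemma compact_lebesgue_finite: "compact (K :: (real^'n::finite) set) \<Longrightarrow> emeasure lebesgue K < \<infinity>"
 using fmeasurableD2[OF lmeasurable_compact] by (simp add: less_top)

text \<open>A local power condition with real exponent: it absorbs the case p = \<infinity> of
  \<open>Lp_loc\<close> and survives lowering the exponent, which is all that continuity of the form
  requires of the coefficients.\<close>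

definition loc_pow :: "real \<Rightarrow> (real^'n::finite) set \<Rightarrow> (real^'n \<Rightarrow> 'b::real_normed_vector) \<Rightarrow> bool" where
 "loc_pow r U c \<longleftrightarrow> (\<forall>K. compact K \<and> K \<subseteq> U \<longrightarrow> c \<in> meas_on K \<and>
   (\<integral>\<^sup>+x\<in>K. ennreal (norm (c x) powr r) \<partial>lebesgue) < \<infinity>)"

lemma powr_le_1_plus: "0 < r \<Longrightarrow> r \<le> s \<Longrightarrow> 0 \<le> t \<Longrightarrow> t powr r \<le> 1 + t powr (s::real)"
proof -
 assume a: "0 < r" "r \<le> s" "0 \<le> t"
 show ?thesis
 proof (cases "t \<le> 1")
  case True
  then have "t powr r \<le> 1 powr r" using a by (intro powr_mono2) auto
  then show ?thesis by (simp add: add_increasing2)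
 next
  case False
  then have "t powr r \<le> t powr s" using a by (intro powr_mono) auto
  then show ?thesis by (simp add: add_increasing)
 qed
qed

lemma finite_powr_integral_mono:
 fixes c :: "real^'n::finite \<Rightarrow> 'b::real_normed_vector"
 assumes K: "compact K" and rs: "0 < r" "r \<le> s"
  and m: "c \<in> meas_on K"
  and fin: "(\<integral>\<^sup>+x\<in>K. ennreal (norm (c x) powr s) \<partial>lebesgue) < \<infinity>"
 shows "(\<integral>\<^sup>+x\<in>K. ennreal (norm (c x) powr r) \<partial>lebesgue) < \<infinity>"
proof -
 have KS: "K \<in> sets lebesgue" using K by (simp add: borel_compact)
 have KF: "emeasure lebesgue K < \<infinity>" using K by (intro compact_lebesgue_finite) auto
 have "(\<lambda>x. indicator K x *\<^sub>R norm (c x)) \<in> meas_L" by (rule indicator_measurable_on[OF KS]) (use m in measurable)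
 then have "(\<lambda>x. ennreal ((indicator K x *\<^sub>R norm (c x)) powr s) * indicator K x) \<in> meas_L"
  using KS by (intro borel_measurable_times_ennreal borel_measurable_indicator) auto
 moreover have "ennreal ((indicator K x *\<^sub>R norm (c x)) powr s) * indicator K x = ennreal (norm (c x) powr s) * indicator K x" for x
  by (auto simp: indicator_def)
 ultimately have ms: "(\<lambda>x. ennreal (norm (c x) powr s) * indicator K x) \<in> meas_L" by simp
 have "(\<integral>\<^sup>+x\<in>K. ennreal (norm (c x) powr r) \<partial>lebesgue) \<le>
  (\<integral>\<^sup>+x. indicator K x + ennreal (norm (c x) powr s) * indicator K x \<partial>lebesgue)"
 proof (intro nn_integral_mono)
  fix x
  have "ennreal (norm (c x) powr r) \<le> ennreal (1 + norm (c x) powr s)" using rs by (intro ennreal_leI powr_le_1_plus) auto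
  also have "... = 1 + ennreal (norm (c x) powr s)" by simp
  finally show "ennreal (norm (c x) powr r) * indicator K x \<le> indicator K x + ennreal (norm (c x) powr s) * indicator K x"
   by (auto simp: indicator_def)
 qed
 also have "... = emeasure lebesgue K + (\<integral>\<^sup>+x\<in>K. ennreal (norm (c x) powr s) \<partial>lebesgue)"
  using ms KS by (subst nn_integral_add) auto
 also have "... < \<infinity>" using fin KF by auto
 finally show ?thesis .
qed

lemma loc_pow_mono: "loc_pow s U c \<Longrightarrow> 0 < r \<Longrightarrow> r \<le> s \<Longrightarrow> loc_pow r U c"
 unfolding loc_pow_def using finite_powr_integral_mono[of _ r s c] by blast

lemma Lp_loc_loc_pow:
 fixes c :: "real^'n::finite \<Rightarrow> 'b::euclidean_space"
 assumes "Lp_loc p U c" "p > ennreal r" "r > 0"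
 shows "loc_pow r U c"
 unfolding loc_pow_def
proof (intro allI impI)
 fix K assume K: "compact K \<and> K \<subseteq> U"
 then have fin: "Lp_norm p K c < \<infinity>" using assms(1) by (simp add: Lp_loc_def)
 then have m: "c \<in> meas_on K" by (auto simp: Lp_norm_def split: if_splits)
 have KS: "K \<in> sets lebesgue" using K by (simp add: borel_compact)
 have KF: "emeasure lebesgue K < \<infinity>" using K by (intro compact_lebesgue_finite) auto
 show "c \<in> meas_on K \<and> (\<integral>\<^sup>+x\<in>K. ennreal (norm (c x) powr r) \<partial>lebesgue) < \<infinity>"
 proof (cases p)
  case (real p')
  then have "r < p'" using assms by (simp add: ennreal_less_iff)
  then have "(\<integral>\<^sup>+x\<in>K. ennreal (norm (c x) powr p') \<partial>lebesgue) < \<infinity>"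
   using Lp_norm_finite_iff[of p' K c] fin real assms KS by simp
  then show ?thesis using m K assms(3) \<open>r < p'\<close> by (intro conjI finite_powr_integral_mono[of K r p']) auto
 next
  case top
  then have "esssup (lebesgue_on K) (\<lambda>x. ennreal (norm (c x))) < \<infinity>" using fin m by (simp add: Lp_norm_def)
  then obtain C where C: "C \<ge> 0" "esssup (lebesgue_on K) (\<lambda>x. ennreal (norm (c x))) = ennreal C"
   by (cases "esssup (lebesgue_on K) (\<lambda>x. ennreal (norm (c x)))") auto
  have "AE x in lebesgue_on K. ennreal (norm (c x)) \<le> ennreal C"
   using esssup_AE[of "\<lambda>x. ennreal (norm (c x))" "lebesgue_on K"] C by simp
  then have "AE x in lebesgue. x \<in> K \<longrightarrow> norm (c x) \<le> C" using KS C by (simp add: AE_restrict_space_iff ennreal_le_iff)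
  then have "AE x in lebesgue. ennreal (norm (c x) powr r) * indicator K x \<le> ennreal (C powr r) * indicator K x"
   by eventually_elim (use assms in \<open>auto simp: indicator_def intro!: ennreal_leI powr_mono2\<close>)
  then have "(\<integral>\<^sup>+x\<in>K. ennreal (norm (c x) powr r) \<partial>lebesgue) \<le> (\<integral>\<^sup>+x\<in>K. ennreal (C powr r) \<partial>lebesgue)"
   by (rule nn_integral_mono_AE)
  also have "... < \<infinity>" using KS KF by (simp add: nn_integral_cmult_indicator ennreal_mult_less_top)
  finally show ?thesis using m by simp
 qed
qed

lemma loc_pow_component:
 fixes c :: "real^'n::finite \<Rightarrow> 'b::real_normed_vector" and T :: "'b \<Rightarrow> real"
 assumes "loc_pow r U c" "continuous_on UNIV T" "\<And>v. \<bar>T v\<bar> \<le> norm v" "r > 0"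
 shows "loc_pow r U (\<lambda>x. T (c x))"
 unfolding loc_pow_def
proof (intro allI impI conjI)
 fix K assume K: "compact K \<and> K \<subseteq> U"
 then have c: "c \<in> meas_on K" "(\<integral>\<^sup>+x\<in>K. ennreal (norm (c x) powr r) \<partial>lebesgue) < \<infinity>"
  using assms(1) by (auto simp: loc_pow_def)
 show "(\<lambda>x. T (c x)) \<in> meas_on K"
  using measurable_compose[OF c(1) borel_measurable_continuous_onI[OF assms(2)]] .
 have "(\<integral>\<^sup>+x\<in>K. ennreal (norm (T (c x)) powr r) \<partial>lebesgue) \<le> (\<integral>\<^sup>+x\<in>K. ennreal (norm (c x) powr r) \<partial>lebesgue)"
  using assms by (intro nn_integral_mono mult_right_mono ennreal_leI powr_mono2) auto
 then show "(\<integral>\<^sup>+x\<in>K. ennreal (norm (T (c x)) powr r) \<partial>lebesgue) < \<infinity>" using c(2) by (rule le_less_trans)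
qed

lemma measurable_times_supported:
 fixes c \<psi> :: "real^'n::finite \<Rightarrow> real"
 assumes "K \<in> sets lebesgue" "c \<in> meas_on K" "\<psi> \<in> meas_L" "\<And>x. x \<notin> K \<Longrightarrow> \<psi> x = 0"
 shows "(\<lambda>x. c x * \<psi> x) \<in> meas_L"
proof -
 have "(\<lambda>x. (indicator K x *\<^sub>R c x) * \<psi> x) \<in> meas_L" by (intro borel_measurable_times indicator_measurable_on assms)
 moreover have "(indicator K x *\<^sub>R c x) * \<psi> x = c x * \<psi> x" for x using assms(4)[of x] by (cases "x \<in> K") auto
 ultimately show ?thesis by (simp only:)
qed

text \<open>The integrand as an algebraic function of point values. Detached from \<open>wD\<close>,
  which is a choice of representative, it lets weak gradients be replaced almost everywhere by
  rewriting.\<close>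

definition form_at :: "('n::finite, 'N::finite) operator \<Rightarrow> real^'n \<Rightarrow> real^'N^'n \<Rightarrow> real^'N \<Rightarrow> real^'N^'n \<Rightarrow> real^'N \<Rightarrow> real" where
 "form_at L x P p Q q =
   (\<Sum>\<alpha>\<in>UNIV. \<Sum>\<beta>\<in>UNIV. \<Sum>i\<in>UNIV. \<Sum>j\<in>UNIV. cA L x $ \<alpha> $ \<beta> $ i $ j * P $ \<beta> $ j * Q $ \<alpha> $ i)
  + (\<Sum>\<alpha>\<in>UNIV. \<Sum>i\<in>UNIV. \<Sum>j\<in>UNIV. cb L x $ \<alpha> $ i $ j * p $ j * Q $ \<alpha> $ i)
  + (\<Sum>\<beta>\<in>UNIV. \<Sum>i\<in>UNIV. \<Sum>j\<in>UNIV. cd L x $ \<beta> $ i $ j * P $ \<beta> $ j * q $ i)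
  + (\<Sum>i\<in>UNIV. \<Sum>j\<in>UNIV. cV L x $ i $ j * p $ j * q $ i)"

text \<open>When the test field sits in the first slot, this order puts its factor last, so that
  every term has the shape of \<open>good_deriv\<close> or \<open>good_zeroth\<close>.\<close>

lemma form_at_swap:
 "form_at L x P p Q q =
   (\<Sum>\<alpha>\<in>UNIV. \<Sum>\<beta>\<in>UNIV. \<Sum>i\<in>UNIV. \<Sum>j\<in>UNIV. cA L x $ \<alpha> $ \<beta> $ i $ j * Q $ \<alpha> $ i * P $ \<beta> $ j)
  + (\<Sum>\<alpha>\<in>UNIV. \<Sum>i\<in>UNIV. \<Sum>j\<in>UNIV. cb L x $ \<alpha> $ i $ j * Q $ \<alpha> $ i * p $ j)
  + (\<Sum>\<beta>\<in>UNIV. \<Sum>i\<in>UNIV. \<Sum>j\<in>UNIV. cd L x $ \<beta> $ i $ j * q $ i * P $ \<beta> $ j)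
  + (\<Sum>i\<in>UNIV. \<Sum>j\<in>UNIV. cV L x $ i $ j * q $ i * p $ j)"
 unfolding form_at_def by (simp only: mult.assoc mult.commute[of "P $ _ $ _"] mult.commute[of "p $ _"])

lemma form_integrand_form_at: "form_integrand L U u v x = form_at L x (wD U u x) (u x) (wD U v x) (v x)"
 by (simp only: form_integrand_def form_at_def)

lemma form_at_diff_left: "form_at L x (P - P') (p - p') Q q = form_at L x P p Q q - form_at L x P' p' Q q"
 unfolding form_at_def by (simp add: sum_subtractf left_diff_distrib right_diff_distrib)

lemma form_at_diff_right: "form_at L x P p (Q - Q') (q - q') = form_at L x P p Q q - form_at L x P p Q' q'"
 unfolding form_at_def by (simp add: sum_subtractf left_diff_distrib right_diff_distrib)

lemma form_at_0_left [simp]: "form_at L x 0 0 Q q = 0"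
 by (simp add: form_at_def)

lemma form_at_0_right [simp]: "form_at L x P p 0 0 = 0"
 by (simp add: form_at_def)

text \<open>2n/(n+2) is the exponent conjugate to \<open>two_star\<close> and is at most n/2, so V
  pairs with functions in Y; exponent 2 pairs the other coefficients with gradients.\<close>

definition regular_coeffs :: "(real^'n::finite) set \<Rightarrow> ('n, 'N::finite) operator \<Rightarrow> bool" where
 "regular_coeffs U L \<longleftrightarrow> (\<forall>\<alpha> \<beta> i j. loc_pow 2 U (\<lambda>x. cA L x $ \<alpha> $ \<beta> $ i $ j)) \<and>
   (\<forall>\<alpha> i j. loc_pow 2 U (\<lambda>x. cb L x $ \<alpha> $ i $ j)) \<and>
   (\<forall>\<alpha> i j. loc_pow 2 U (\<lambda>x. cd L x $ \<alpha> $ i $ j)) \<and>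
   (\<forall>i j. loc_pow (2 * real CARD('n) / (real CARD('n) + 2)) U (\<lambda>x. cV L x $ i $ j))"

lemma admissible_regular_coeffs:
 fixes L :: "('n::finite, 'N::finite) operator"
 assumes n: "CARD('n) \<ge> 3" and U: "open U" and L: "admissible_coeffs U L"
 shows "regular_coeffs U L"
 unfolding regular_coeffs_def
proof (intro conjI allI)
 have n': "real CARD('n) \<ge> 3" using n by linarith
 obtain Lam p s t where
  A: "cA L \<in> meas_on U" "Lam > 0"
   "\<And>x. x \<in> U \<Longrightarrow> (\<Sum>\<alpha>\<in>UNIV. \<Sum>\<beta>\<in>UNIV. \<Sum>i\<in>UNIV. \<Sum>j\<in>UNIV. (cA L x $ \<alpha> $ \<beta> $ i $ j)^2) \<le> Lam^2"
  and V: "p > ennreal (real CARD('n) / 2)" "Lp_loc p U (cV L)"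
  and b: "s > ennreal (real CARD('n))" "Lp_loc s U (cb L)"
  and d: "t > ennreal (real CARD('n))" "Lp_loc t U (cd L)"
  using L unfolding admissible_coeffs_def by blast
 have comp2: "\<bar>v $ i $ j\<bar> \<le> norm v" for v :: "real^'N^'N" and i j
  by (rule order_trans[OF component_le_norm_cart Finite_Cartesian_Product.norm_nth_le])
 have comp3: "\<bar>v $ \<alpha> $ i $ j\<bar> \<le> norm v" for v :: "real^'N^'N^'n" and \<alpha> i j
  by (rule order_trans[OF comp2 Finite_Cartesian_Product.norm_nth_le])
 have two: "2 \<le> real CARD('n)" using n' by linarith
 show "loc_pow 2 U (\<lambda>x. cb L x $ \<alpha> $ i $ j)" for \<alpha> i j
  using loc_pow_mono[OF Lp_loc_loc_pow[OF b(2,1)] _ two] n'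
  by (intro loc_pow_component[where T = "\<lambda>v. v $ \<alpha> $ i $ j"] comp3 continuous_intros) auto
 show "loc_pow 2 U (\<lambda>x. cd L x $ \<alpha> $ i $ j)" for \<alpha> i j
  using loc_pow_mono[OF Lp_loc_loc_pow[OF d(2,1)] _ two] n'
  by (intro loc_pow_component[where T = "\<lambda>v. v $ \<alpha> $ i $ j"] comp3 continuous_intros) auto
 have r: "0 < 2 * real CARD('n) / (real CARD('n) + 2)" "2 * real CARD('n) / (real CARD('n) + 2) \<le> real CARD('n) / 2"
 proof -
  have "2 * c / (c + 2) \<le> c / 2" if "c \<ge> 3" for c :: real
  proof -
   have "2 * (2 * c) \<le> c * (c + 2)" using that by (simp add: algebra_simps)
   then show ?thesis using that by (simp add: divide_le_eq field_simps)
  qed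
  from this[OF n'] show "2 * real CARD('n) / (real CARD('n) + 2) \<le> real CARD('n) / 2" .
  show "0 < 2 * real CARD('n) / (real CARD('n) + 2)" using n' by (intro divide_pos_pos) auto
 qed
 show "loc_pow (2 * real CARD('n) / (real CARD('n) + 2)) U (\<lambda>x. cV L x $ i $ j)" for i j
 proof (rule loc_pow_component[where T = "\<lambda>v. v $ i $ j", OF _ _ comp2 r(1)])
  show "loc_pow (2 * real CARD('n) / (real CARD('n) + 2)) U (cV L)"
   by (rule loc_pow_mono[OF Lp_loc_loc_pow[OF V(2,1)] r]) (use n' in auto)
 qed (intro continuous_intros)
 show "loc_pow 2 U (\<lambda>x. cA L x $ \<alpha> $ \<beta> $ i $ j)" for \<alpha> \<beta> i j
  unfolding loc_pow_def
 proof (intro allI impI conjI)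
  fix K assume K: "compact K \<and> K \<subseteq> U"
  have KS: "K \<in> sets lebesgue" using K by (simp add: borel_compact)
  have KF: "emeasure lebesgue K < \<infinity>" using K by (intro compact_lebesgue_finite) auto
  have "cA L \<in> borel_measurable (restrict_space (lebesgue_on U) K)" by (rule measurable_restrict_space1[OF A(1)])
  also have "restrict_space (lebesgue_on U) K = lebesgue_on K" using K KS U by (subst restrict_restrict_space) (auto simp: Int_absorb1)
  finally have m: "cA L \<in> meas_on K" .
  have "continuous_on UNIV (\<lambda>v :: real^'N^'N^'n^'n. v $ \<alpha> $ \<beta> $ i $ j)" by (intro continuous_intros)
  from measurable_compose[OF m borel_measurable_continuous_onI[OF this]]
  show "(\<lambda>x. cA L x $ \<alpha> $ \<beta> $ i $ j) \<in> meas_on K" .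
  have bd: "(cA L x $ \<alpha> $ \<beta> $ i $ j)^2 \<le> Lam^2" if "x \<in> U" for x
  proof -
   have "(cA L x $ \<alpha> $ \<beta> $ i $ j)^2 \<le> (\<Sum>j\<in>UNIV. (cA L x $ \<alpha> $ \<beta> $ i $ j)^2)"
    by (rule member_le_sum[of j UNIV "\<lambda>j. (cA L x $ \<alpha> $ \<beta> $ i $ j)^2"]) auto
   also have "... \<le> (\<Sum>i\<in>UNIV. \<Sum>j\<in>UNIV. (cA L x $ \<alpha> $ \<beta> $ i $ j)^2)"
    by (rule member_le_sum[of i UNIV "\<lambda>i. \<Sum>j\<in>UNIV. (cA L x $ \<alpha> $ \<beta> $ i $ j)^2"]) (auto intro!: sum_nonneg)
   also have "... \<le> (\<Sum>\<beta>\<in>UNIV. \<Sum>i\<in>UNIV. \<Sum>j\<in>UNIV. (cA L x $ \<alpha> $ \<beta> $ i $ j)^2)"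
    by (rule member_le_sum[of \<beta> UNIV "\<lambda>\<beta>. \<Sum>i\<in>UNIV. \<Sum>j\<in>UNIV. (cA L x $ \<alpha> $ \<beta> $ i $ j)^2"]) (auto intro!: sum_nonneg)
   also have "... \<le> (\<Sum>\<alpha>\<in>UNIV. \<Sum>\<beta>\<in>UNIV. \<Sum>i\<in>UNIV. \<Sum>j\<in>UNIV. (cA L x $ \<alpha> $ \<beta> $ i $ j)^2)"
    by (rule member_le_sum[of \<alpha> UNIV "\<lambda>\<alpha>. \<Sum>\<beta>\<in>UNIV. \<Sum>i\<in>UNIV. \<Sum>j\<in>UNIV. (cA L x $ \<alpha> $ \<beta> $ i $ j)^2"]) (auto intro!: sum_nonneg)
   also have "... \<le> Lam^2" by (rule A(3)[OF that])
   finally show ?thesis .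
  qed
  have "(\<integral>\<^sup>+x\<in>K. ennreal (norm (cA L x $ \<alpha> $ \<beta> $ i $ j) powr 2) \<partial>lebesgue) \<le> (\<integral>\<^sup>+x\<in>K. ennreal (Lam^2) \<partial>lebesgue)"
  proof (intro nn_integral_mono)
   fix x show "ennreal (norm (cA L x $ \<alpha> $ \<beta> $ i $ j) powr 2) * indicator K x \<le> ennreal (Lam^2) * indicator K x"
    using bd[of x] K by (cases "x \<in> K") (auto intro!: ennreal_leI)
  qed
  also have "... < \<infinity>" using KS KF by (simp add: nn_integral_cmult_indicator ennreal_mult_less_top)
  finally show "(\<integral>\<^sup>+x\<in>K. ennreal (norm (cA L x $ \<alpha> $ \<beta> $ i $ j) powr 2) \<partial>lebesgue) < \<infinity>" .
 qed
qed

section \<open>Bounded functionals given by the form against a fixed test field\<close>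

context elliptic_space
begin

text \<open>Convergence of the integral and continuity in the norm are recorded together. M may
  depend on the coefficients: it serves density arguments and never reaches the final
  constants.\<close>

definition good :: "((real^'n \<Rightarrow> real^'N) \<Rightarrow> real^'n \<Rightarrow> real) \<Rightarrow> bool" where
 "good h \<longleftrightarrow> (\<exists>M. \<forall>v\<in>H. set_integrable lebesgue W (h v) \<and> \<bar>LINT x:W|lebesgue. h v x\<bar> \<le> M * N v)"

lemma good_add:
 assumes "good h" "good k" shows "good (\<lambda>v x. h v x + k v x)"
proof -
 obtain M where M: "\<And>v. v \<in> H \<Longrightarrow> set_integrable lebesgue W (h v)" "\<And>v. v \<in> H \<Longrightarrow> \<bar>LINT x:W|lebesgue. h v x\<bar> \<le> M * N v"
  using assms(1) unfolding good_def by blast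
 obtain M' where M': "\<And>v. v \<in> H \<Longrightarrow> set_integrable lebesgue W (k v)" "\<And>v. v \<in> H \<Longrightarrow> \<bar>LINT x:W|lebesgue. k v x\<bar> \<le> M' * N v"
  using assms(2) unfolding good_def by blast
 have "\<bar>LINT x:W|lebesgue. h v x + k v x\<bar> \<le> (M + M') * N v" if "v \<in> H" for v
  using set_integral_add(2)[OF M(1) M'(1), OF that that] M(2)[OF that] M'(2)[OF that] by (simp add: distrib_right)
 then show ?thesis unfolding good_def using set_integral_add(1)[OF M(1) M'(1)] by blast
qed

lemma good_0: "good (\<lambda>v x. 0)"
 by (auto simp: good_def set_integrable_def set_lebesgue_integral_def intro!: exI[of _ 0])

lemma good_sum: "finite I \<Longrightarrow> (\<And>i. i \<in> I \<Longrightarrow> good (h i)) \<Longrightarrow> good (\<lambda>v x. \<Sum>i\<in>I. h i v x)"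
proof (induction I rule: finite_induct)
 case empty then show ?case by (simp add: good_0)
next
 case (insert i I) then show ?case by (simp add: good_add)
qed

text \<open>The coefficient times a continuous function of compact support is square integrable, and
  so is the gradient; Cauchy-Schwarz pairs them.\<close>

lemma good_deriv:
 assumes c: "loc_pow 2 W c" and \<psi>: "continuous_on UNIV \<psi>" "compact K" "K \<subseteq> W" "\<And>x. x \<notin> K \<Longrightarrow> \<psi> x = 0"
 shows "good (\<lambda>v x. c x * wD W v x $ \<beta> $ j * \<psi> x)"
proof -
 have KS: "K \<in> sets lebesgue" using \<psi> by (simp add: borel_compact)
 have cK: "c \<in> meas_on K" "(\<integral>\<^sup>+x\<in>K. ennreal (norm (c x) powr 2) \<partial>lebesgue) < \<infinity>"
  using c \<psi>(2,3) unfolding loc_pow_def by blast+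
 have m: "(\<lambda>x. c x * \<psi> x) \<in> meas_L"
  by (rule measurable_times_supported[OF KS cK(1) borel_measurable_lebesgue_continuous[OF \<psi>(1)] \<psi>(4)])
 have "bounded (\<psi> ` K)" by (intro compact_imp_bounded compact_continuous_image continuous_on_subset[OF \<psi>(1)] \<psi>) auto
 then obtain M where M: "\<And>x. x \<in> K \<Longrightarrow> \<bar>\<psi> x\<bar> \<le> M" unfolding bounded_iff by (metis imageI real_norm_def)
 have "L2sq W (\<lambda>x. c x * \<psi> x) \<le> (\<integral>\<^sup>+x. ennreal (norm (c x) powr 2) * indicator K x * ennreal (M^2) \<partial>lebesgue)"
  unfolding L2sq_def
 proof (intro nn_integral_mono)
  fix x
  show "ennreal ((norm (c x * \<psi> x))^2) * indicator W x \<le> ennreal (norm (c x) powr 2) * indicator K x * ennreal (M^2)"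
  proof (cases "x \<in> K")
   case True
   then have "(\<psi> x)^2 \<le> M^2" using M[of x] by (metis abs_ge_zero power2_abs power_mono)
   then have "(c x)^2 * (\<psi> x)^2 \<le> (c x)^2 * M^2" by (intro mult_left_mono) auto
   then show ?thesis using True \<psi>(3) by (auto simp: ennreal_mult[symmetric] power_mult_distrib intro!: ennreal_leI)
  qed (simp add: \<psi>)
 qed
 also have "... = (\<integral>\<^sup>+x\<in>K. ennreal (norm (c x) powr 2) \<partial>lebesgue) * ennreal (M^2)"
 proof (rule nn_integral_multc)
  have "(\<lambda>x. ennreal ((indicator K x *\<^sub>R norm (c x)) powr 2) * indicator K x) \<in> meas_L"
   using KS cK by (intro borel_measurable_times_ennreal borel_measurable_indicator measurable_compose[OF indicator_measurable_on[OF KS, of "\<lambda>x. norm (c x)"]]) auto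
  moreover have "ennreal ((indicator K x *\<^sub>R norm (c x)) powr 2) * indicator K x = ennreal (norm (c x) powr 2) * indicator K x" for x
   by (auto simp: indicator_def)
  ultimately show "(\<lambda>x. ennreal (norm (c x) powr 2) * indicator K x) \<in> meas_L" by simp
 qed
 also have "... < \<infinity>" using cK(2) by (simp add: ennreal_mult_less_top)
 finally obtain a where a: "a \<ge> 0" "L2sq W (\<lambda>x. c x * \<psi> x) = ennreal a" by (cases "L2sq W (\<lambda>x. c x * \<psi> x)") auto
 have a2: "L2sq W (\<lambda>x. c x * \<psi> x) \<le> ennreal ((sqrt a)^2)" using a by simp
 have "set_integrable lebesgue W (\<lambda>x. c x * wD W v x $ \<beta> $ j * \<psi> x) \<and>
  \<bar>LINT x:W|lebesgue. c x * wD W v x $ \<beta> $ j * \<psi> x\<bar> \<le> sqrt a * cD * N v" if v: "v \<in> H" for v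
 proof -
  have "L2sq W (\<lambda>x. wD W v x $ \<beta> $ j) \<le> L2sq W (wD W v)" unfolding L2sq_def
  proof (intro nn_integral_mono mult_right_mono ennreal_leI power_mono)
   show "norm (wD W v x $ \<beta> $ j) \<le> norm (wD W v x)" for x
    by (rule order_trans[OF Finite_Cartesian_Product.norm_nth_le Finite_Cartesian_Product.norm_nth_le])
  qed auto
  also have "... \<le> ennreal ((cD * N v)^2)" by (rule H_dirichlet[OF v])
  finally have b: "L2sq W (\<lambda>x. wD W v x $ \<beta> $ j) \<le> ennreal ((cD * N v)^2)" .
  have mv: "(\<lambda>x. wD W v x $ \<beta> $ j) \<in> meas_on W"
   by (rule measurable_compose[OF H_measurable(2)[OF v] borel_measurable_continuous_onI]) (intro continuous_intros)
  note r = L2sq_inner[OF sets_W measurable_restrict_space1[OF m] mv a2 b]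
  have e: "(\<lambda>x. (c x * \<psi> x) \<bullet> (wD W v x $ \<beta> $ j)) = (\<lambda>x. c x * wD W v x $ \<beta> $ j * \<psi> x)"
   by (auto simp: mult_ac)
  show ?thesis using r H_nonneg[OF v] cD_nonneg a unfolding e by (simp add: mult.assoc)
 qed
 then show ?thesis unfolding good_def by blast
qed

text \<open>The zeroth order coefficient is only assumed to lie in \<open>L\<^sup>p\<close> with \<open>p > n/2\<close>. Instead of a
 Sobolev inequality, boundedness of the functional is obtained from that of its truncations.\<close>

lemma good_zeroth:
 assumes c: "loc_pow (2 * real CARD('n) / (real CARD('n) + 2)) W c"
  and \<psi>: "continuous_on UNIV \<psi>" "compact K" "K \<subseteq> W" "\<And>x. x \<notin> K \<Longrightarrow> \<psi> x = 0"
 shows "good (\<lambda>v x. c x * v x $ j * \<psi> x)"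
proof -
 let ?r = "2 * real CARD('n) / (real CARD('n) + 2)" and ?p = "two_star TYPE('n)"
 have n': "real CARD('n) \<ge> 3" using n3 by linarith
 have ex: "?r > 1" "?p > 1" "1 / ?r + 1 / ?p = 1"
 proof -
  have "2 * c / (c + 2) > 1 \<and> 1 / (2 * c / (c + 2)) + 1 / (2 * c / (c - 2)) = 1" if "c \<ge> 3" for c :: real
   using that by (simp add: less_divide_eq) (simp add: field_simps)
  from this[OF n'] show "?r > 1" "1 / ?r + 1 / ?p = 1" by (auto simp: two_star_def)
  show "?p > 1" using two_star_gt_2[OF n3] by simp
 qed
 have KS: "K \<in> sets lebesgue" using \<psi> by (simp add: borel_compact)
 have cK: "c \<in> meas_on K" "(\<integral>\<^sup>+x\<in>K. ennreal (norm (c x) powr ?r) \<partial>lebesgue) < \<infinity>"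
  using c \<psi>(2,3) unfolding loc_pow_def by blast+
 define k where "k = (\<lambda>x. c x * \<psi> x)"
 have m: "k \<in> meas_L" unfolding k_def
  by (rule measurable_times_supported[OF KS cK(1) borel_measurable_lebesgue_continuous[OF \<psi>(1)] \<psi>(4)])
 have "bounded (\<psi> ` K)" by (intro compact_imp_bounded compact_continuous_image continuous_on_subset[OF \<psi>(1)] \<psi>) auto
 then obtain M where M: "\<And>x. x \<in> K \<Longrightarrow> \<bar>\<psi> x\<bar> \<le> M" unfolding bounded_iff by (metis imageI real_norm_def)
 have kr: "(\<integral>\<^sup>+x. ennreal (\<bar>k x\<bar> powr ?r) \<partial>lebesgue) < \<infinity>"
 proof -
  have "(\<integral>\<^sup>+x. ennreal (\<bar>k x\<bar> powr ?r) \<partial>lebesgue) \<le> (\<integral>\<^sup>+x. ennreal (norm (c x) powr ?r) * indicator K x * ennreal (\<bar>M\<bar> powr ?r) \<partial>lebesgue)"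
  proof (intro nn_integral_mono)
   fix x show "ennreal (\<bar>k x\<bar> powr ?r) \<le> ennreal (norm (c x) powr ?r) * indicator K x * ennreal (\<bar>M\<bar> powr ?r)"
   proof (cases "x \<in> K")
    case True
    have "\<bar>k x\<bar> powr ?r \<le> (\<bar>c x\<bar> * \<bar>M\<bar>) powr ?r"
     using M[OF True] ex by (intro powr_mono2) (auto simp: k_def abs_mult intro!: mult_left_mono)
    then show ?thesis using True by (simp add: ennreal_mult[symmetric] powr_mult ennreal_leI)
   qed (simp add: k_def \<psi>)
  qed
  also have "... = (\<integral>\<^sup>+x\<in>K. ennreal (norm (c x) powr ?r) \<partial>lebesgue) * ennreal (\<bar>M\<bar> powr ?r)"
  proof (rule nn_integral_multc)
   have "(\<lambda>x. ennreal ((indicator K x *\<^sub>R norm (c x)) powr ?r) * indicator K x) \<in> meas_L"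
    using KS cK by (intro borel_measurable_times_ennreal borel_measurable_indicator measurable_compose[OF indicator_measurable_on[OF KS, of "\<lambda>x. norm (c x)"]]) auto
   moreover have "ennreal ((indicator K x *\<^sub>R norm (c x)) powr ?r) * indicator K x = ennreal (norm (c x) powr ?r) * indicator K x" for x
    by (auto simp: indicator_def)
   ultimately show "(\<lambda>x. ennreal (norm (c x) powr ?r) * indicator K x) \<in> meas_L" by simp
  qed
  also have "... < \<infinity>" using cK(2) by (simp add: ennreal_mult_less_top)
  finally show ?thesis .
 qed
 have mv: "(\<lambda>x. v x $ j) \<in> meas_on W" if "v \<in> H" for v
  by (rule measurable_compose[OF H_measurable(1)[OF that] borel_measurable_continuous_onI]) (intro continuous_intros)
 have mkv: "(\<lambda>x. indicator W x *\<^sub>R (k x * v x $ j)) \<in> meas_L" if "v \<in> H" for v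
  by (intro indicator_measurable_on[OF sets_W] borel_measurable_times mv that measurable_restrict_space1[OF m])
 have int: "integrable lebesgue (\<lambda>x. indicator W x *\<^sub>R (k x * v x $ j))" if v: "v \<in> H" for v
 proof (rule integrableI_bounded[OF mkv[OF v]])
  have "Lp_norm (ennreal ?p) W v < \<infinity>" by (rule Y_spaceD(2)[OF H_Y[OF v]])
  then have vp: "(\<integral>\<^sup>+x\<in>W. ennreal (norm (v x) powr ?p) \<partial>lebesgue) < \<infinity>"
   using ex sets_W by (subst (asm) Lp_norm_finite_iff) auto
  have mvp: "(\<lambda>x. ennreal (norm (v x) powr ?p) * indicator W x) \<in> meas_L"
   by (rule measurable_indicator_comp[OF sets_W H_measurable(1)[OF v] _ sets_W, of "\<lambda>v. ennreal (norm v powr ?p)"]) auto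
  have "(\<integral>\<^sup>+x. ennreal (norm (indicator W x *\<^sub>R (k x * v x $ j))) \<partial>lebesgue) \<le>
   (\<integral>\<^sup>+x. ennreal (\<bar>k x\<bar> powr ?r) + ennreal (norm (v x) powr ?p) * indicator W x \<partial>lebesgue)"
  proof (intro nn_integral_mono)
   fix x
   \<comment> \<open>Young's inequality with conjugate exponents shows that the integral converges,
     but not that it is bounded linearly by the norm of v; that is left to the truncations.\<close>
   have "\<bar>k x\<bar> * \<bar>v x $ j\<bar> \<le> \<bar>k x\<bar> powr ?r / ?r + \<bar>v x $ j\<bar> powr ?p / ?p"
    by (rule Youngs_inequality[OF ex]) auto
   also have "... \<le> \<bar>k x\<bar> powr ?r + norm (v x) powr ?p"
   proof (rule add_mono)
    show "\<bar>k x\<bar> powr ?r / ?r \<le> \<bar>k x\<bar> powr ?r" using ex(1) by (intro divide_left_mono[of 1, simplified]) auto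
    have "\<bar>v x $ j\<bar> powr ?p / ?p \<le> \<bar>v x $ j\<bar> powr ?p" using ex(2) by (intro divide_left_mono[of 1, simplified]) auto
    also have "... \<le> norm (v x) powr ?p" using ex(2) by (intro powr_mono2 component_le_norm_cart) auto
    finally show "\<bar>v x $ j\<bar> powr ?p / ?p \<le> norm (v x) powr ?p" .
   qed
   finally have "ennreal (\<bar>k x\<bar> * \<bar>v x $ j\<bar>) \<le> ennreal (\<bar>k x\<bar> powr ?r) + ennreal (norm (v x) powr ?p)"
    by (simp flip: ennreal_plus add: ennreal_leI)
   then show "ennreal (norm (indicator W x *\<^sub>R (k x * v x $ j))) \<le> ennreal (\<bar>k x\<bar> powr ?r) + ennreal (norm (v x) powr ?p) * indicator W x"
    by (auto simp: indicator_def abs_mult)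
  qed
  also have "... = (\<integral>\<^sup>+x. ennreal (\<bar>k x\<bar> powr ?r) \<partial>lebesgue) + (\<integral>\<^sup>+x\<in>W. ennreal (norm (v x) powr ?p) \<partial>lebesgue)"
   using m mvp by (intro nn_integral_add) auto
  also have "... < \<infinity>" using kr vp by simp
  finally show "(\<integral>\<^sup>+x. ennreal (norm (indicator W x *\<^sub>R (k x * v x $ j))) \<partial>lebesgue) < \<infinity>" .
 qed
 \<comment> \<open>Each truncation is bounded with compact support, so Hardy's inequality makes its
   functional continuous. Dominated convergence bounds the sequence at each v, and uniform
   boundedness survives the limit.\<close>
 define km where "km = (\<lambda>(m::nat) x. if \<bar>k x\<bar> \<le> real m then k x else 0)"
 have mkm: "km i \<in> meas_L" for i unfolding km_def using m by measurable
 define T where "T = (\<lambda>m v. LINT x|lebesgue. indicator W x *\<^sub>R (km m x * v x $ j))"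
 have intm: "integrable lebesgue (\<lambda>x. indicator W x *\<^sub>R (km m x * v x $ j))" if v: "v \<in> H" for m v
 proof (rule Bochner_Integration.integrable_bound[OF int[OF v]])
  show "(\<lambda>x. indicator W x *\<^sub>R (km m x * v x $ j)) \<in> meas_L"
   by (intro indicator_measurable_on[OF sets_W] borel_measurable_times mv v measurable_restrict_space1[OF mkm])
 qed (auto simp: km_def indicator_def)
 have lim: "(\<lambda>m. T m v) \<longlonglongrightarrow> (LINT x|lebesgue. indicator W x *\<^sub>R (k x * v x $ j))" if v: "v \<in> H" for v
  unfolding T_def
 proof (rule integral_dominated_convergence[where w = "\<lambda>x. norm (indicator W x *\<^sub>R (k x * v x $ j))"])
  show "AE x in lebesgue. (\<lambda>m. indicator W x *\<^sub>R (km m x * v x $ j)) \<longlonglongrightarrow> indicator W x *\<^sub>R (k x * v x $ j)"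
  proof (intro AE_I2 tendsto_intros)
   fix x
   have "\<forall>\<^sub>F m in sequentially. km m x = k x"
    using eventually_ge_at_top[of "nat \<lceil>\<bar>k x\<bar>\<rceil>"] by eventually_elim (auto simp: km_def)
   then show "(\<lambda>m. km m x) \<longlonglongrightarrow> k x" by (rule tendsto_eventually)
  qed
  show "integrable lebesgue (\<lambda>x. norm (indicator W x *\<^sub>R (k x * v x $ j)))" by (rule integrable_norm[OF int[OF v]])
  show "(\<lambda>x. indicator W x *\<^sub>R (km m x * v x $ j)) \<in> meas_L" for m using intm[OF v] by auto
 qed (use mkv[OF v] in \<open>auto simp: km_def indicator_def\<close>)
 have "\<exists>M. \<forall>m. \<forall>v\<in>H. \<bar>T m v\<bar> \<le> M * N v"
 proof (rule H_uniform_boundedness)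
  show "T m (\<lambda>x. u x + v x) = T m u + T m v" if "u \<in> H" "v \<in> H" for m u v
   using intm[OF that(1), of m] intm[OF that(2), of m] unfolding T_def by (simp add: distrib_left flip: Bochner_Integration.integral_add)
  show "T m (\<lambda>x. a *\<^sub>R u x) = a * T m u" for m a u
   unfolding T_def by (simp add: mult_ac flip: integral_mult_right_zero)
  show "\<exists>K. \<forall>m. \<bar>T m u\<bar> \<le> K" if "u \<in> H" for u
   using convergent_imp_bounded[OF lim[OF that]] unfolding bounded_iff by auto
  show "\<exists>M. \<forall>u\<in>H. \<bar>T m u\<bar> \<le> M * N u" for m
  proof -
   obtain R where R: "R > 0" "K \<subseteq> ball 0 R" using bounded_subset_ballD[OF compact_imp_bounded[OF \<psi>(2)], of 0] by auto
   let ?S = "W \<inter> ball 0 R"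
   have S: "?S \<in> sets lebesgue" using open_W by auto
   have SF: "emeasure lebesgue (ball (0::real^'n) R) < \<infinity>" using lmeasurable_ball by (simp add: fmeasurable_def)
   have "L2sq ?S (km m) \<le> (\<integral>\<^sup>+x\<in>ball (0::real^'n) R. ennreal ((real m)^2) \<partial>lebesgue)" unfolding L2sq_def
   proof (intro nn_integral_mono)
    fix x
    have "(km m x)^2 \<le> (real m)^2" by (rule abs_le_square_iff[THEN iffD1]) (auto simp: km_def)
    then show "ennreal ((norm (km m x))^2) * indicator ?S x \<le> ennreal ((real m)^2) * indicator (ball 0 R) x"
     by (auto simp: indicator_def intro!: ennreal_leI)
   qed
   also have "... < \<infinity>" using SF by (simp add: nn_integral_cmult_indicator ennreal_mult_less_top)
   finally obtain a where a: "a \<ge> 0" "L2sq ?S (km m) = ennreal a" by (cases "L2sq ?S (km m)") auto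
   have a2: "L2sq ?S (km m) \<le> ennreal ((sqrt a)^2)" using a by simp
   have "\<bar>T m v\<bar> \<le> sqrt a * (6 * cD * R) * N v" if v: "v \<in> H" for v
   proof -
    have "L2sq ?S (\<lambda>x. v x $ j) \<le> L2sq ?S v" unfolding L2sq_def
     by (intro nn_integral_mono mult_right_mono ennreal_leI power_mono Finite_Cartesian_Product.norm_nth_le) auto
    also have "... \<le> ennreal ((6 * cD * R * N v)^2)" by (rule H_hardy[OF v R(1)])
    finally have b: "L2sq ?S (\<lambda>x. v x $ j) \<le> ennreal ((6 * cD * R * N v)^2)" .
    have rr: "restrict_space (lebesgue_on W) ?S = lebesgue_on ?S" using sets_W S by (subst restrict_restrict_space) (auto simp: Int_absorb1)
    have mvS: "(\<lambda>x. v x $ j) \<in> meas_on ?S" using measurable_restrict_space1[OF mv[OF v], of ?S] by (simp only: rr)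
    have "\<bar>LINT x:?S|lebesgue. km m x \<bullet> v x $ j\<bar> \<le> sqrt a * (6 * cD * R * N v)" using a cD_nonneg R H_nonneg[OF v]
     by (intro L2sq_inner(2)[OF S measurable_restrict_space1[OF mkm] mvS a2 b]) auto
    moreover have "(LINT x:?S|lebesgue. km m x \<bullet> v x $ j) = T m v"
    proof -
     have "indicator ?S x *\<^sub>R (km m x \<bullet> v x $ j) = indicator W x *\<^sub>R (km m x * v x $ j)" for x
      using subsetD[OF R(2), of x] \<psi>(4)[of x] by (cases "x \<in> K") (auto simp: indicator_def km_def k_def)
     then show ?thesis unfolding T_def set_lebesgue_integral_def by (simp only:)
    qed
    ultimately show ?thesis by (simp add: mult.assoc)
   qed
   then show ?thesis by blast
  qed
 qed
 then obtain M where M: "\<And>m v. v \<in> H \<Longrightarrow> \<bar>T m v\<bar> \<le> M * N v" by blast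
 have e: "c x * v x $ j * \<psi> x = k x * v x $ j" for v :: "real^'n \<Rightarrow> real^'N" and x by (simp add: k_def)
 have "set_integrable lebesgue W (\<lambda>x. c x * v x $ j * \<psi> x) \<and> \<bar>LINT x:W|lebesgue. c x * v x $ j * \<psi> x\<bar> \<le> M * N v" if v: "v \<in> H" for v
  unfolding e set_integrable_def set_lebesgue_integral_def using int[OF v] LIMSEQ_le_const2[OF tendsto_rabs[OF lim[OF v]]] M[OF v] by blast
 then show ?thesis unfolding good_def by blast
qed

lemma good_form:
 assumes L: "regular_coeffs W L" and \<phi>: "\<phi> \<in> test_vec W"
 shows "good (\<lambda>v x. form_at L x (wD W v x) (v x) (grad \<phi> x) (\<phi> x))"
  and "good (\<lambda>v x. form_at L x (grad \<phi> x) (\<phi> x) (wD W v x) (v x))"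
proof -
 obtain K where K: "compact K" "K \<subseteq> W" "\<And>x. x \<notin> K \<Longrightarrow> \<phi> x = 0" "\<And>x. x \<notin> K \<Longrightarrow> grad \<phi> x = 0"
  using test_vec_support[OF \<phi>] by metis
 have cg: "continuous_on UNIV (\<lambda>x. grad \<phi> x $ \<alpha> $ i)" for \<alpha> i
  by (intro bounded_linear.continuous_on[OF bounded_linear_vec_nth] grad_continuous[OF \<phi>])
 have cp: "continuous_on UNIV (\<lambda>x. \<phi> x $ i)" for i
  by (intro bounded_linear.continuous_on[OF bounded_linear_vec_nth] test_vec_continuous[OF \<phi>])
 have n': "real CARD('n) \<ge> 3" using n3 by linarith
 have r: "0 < 2 * real CARD('n) / (real CARD('n) + 2)" "2 * real CARD('n) / (real CARD('n) + 2) \<le> 2" using n' by (auto simp: divide_le_eq)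
 have A: "loc_pow 2 W (\<lambda>x. cA L x $ \<alpha> $ \<beta> $ i $ j)" and b: "loc_pow 2 W (\<lambda>x. cb L x $ \<alpha> $ i $ j)"
  and d: "loc_pow 2 W (\<lambda>x. cd L x $ \<alpha> $ i $ j)"
  and V: "loc_pow (2 * real CARD('n) / (real CARD('n) + 2)) W (\<lambda>x. cV L x $ i $ j)" for \<alpha> \<beta> i j
  using L unfolding regular_coeffs_def by blast+
 \<comment> \<open>The terms of b or d in which the varying field is not differentiated fall under
   \<open>good_zeroth\<close>, hence the lowered exponent.\<close>
 note b' = loc_pow_mono[OF b r] and d' = loc_pow_mono[OF d r]
 note Dg = good_deriv[OF _ cg K(1,2)] and Dp = good_deriv[OF _ cp K(1,2)]
  and Zg = good_zeroth[OF _ cg K(1,2)] and Zp = good_zeroth[OF _ cp K(1,2)]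
 show "good (\<lambda>v x. form_at L x (wD W v x) (v x) (grad \<phi> x) (\<phi> x))"
  unfolding form_at_def by (intro good_add good_sum finite; (rule Dg[OF A] Zg[OF b'] Dp[OF d] Zp[OF V]; simp add: K))
 show "good (\<lambda>v x. form_at L x (grad \<phi> x) (\<phi> x) (wD W v x) (v x))"
  unfolding form_at_swap by (intro good_add good_sum finite; (rule Dg[OF A] Dp[OF b] Zg[OF d'] Zp[OF V]; simp add: K))
qed

text \<open>Two bounded functionals compatible with differences coincide once they agree on the
  dense set of test fields; for g this compatibility holds almost everywhere, as weak gradients
  do.\<close>

lemma form_eq_aux:
 assumes B: "\<And>u v. u \<in> H \<Longrightarrow> v \<in> H \<Longrightarrow> b (\<lambda>x. u x - v x) = b u - b v" "\<And>u. u \<in> H \<Longrightarrow> \<bar>b u\<bar> \<le> M * N u"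
  and g: "good g" and diff: "\<And>u v. u \<in> H \<Longrightarrow> v \<in> H \<Longrightarrow> AE x in lebesgue_on W. g (\<lambda>x. u x - v x) x = g u x - g v x"
  and eq: "\<And>v. v \<in> test_vec W \<Longrightarrow> b v = (LINT x:W|lebesgue. g v x)"
  and u: "u \<in> H"
 shows "(LINT x:W|lebesgue. g u x) = b u"
proof -
 obtain M' where M': "\<And>v. v \<in> H \<Longrightarrow> set_integrable lebesgue W (g v)" "\<And>v. v \<in> H \<Longrightarrow> \<bar>LINT x:W|lebesgue. g v x\<bar> \<le> M' * N v"
  using g unfolding good_def by blast
 have small: "\<bar>(LINT x:W|lebesgue. g u x) - b u\<bar> \<le> (\<bar>M\<bar> + \<bar>M'\<bar>) * e" if e: "e > 0" for e
 proof -
  obtain \<phi> where \<phi>: "\<phi> \<in> test_vec W" "N (\<lambda>x. u x - \<phi> x) < e" using H_approx[OF u e] by blast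
  have h: "\<phi> \<in> H" "(\<lambda>x. u x - \<phi> x) \<in> H" using \<phi> test_H H_diff u by auto
  have "(LINT x:W|lebesgue. g (\<lambda>x. u x - \<phi> x) x) = (LINT x:W|lebesgue. g u x - g \<phi> x)"
   by (rule set_integrable_cong_AE'(2)[OF sets_W _ diff[OF u h(1)]]) (intro set_integral_diff M' u h)
  also have "... = (LINT x:W|lebesgue. g u x) - (LINT x:W|lebesgue. g \<phi> x)" by (intro set_integral_diff M' u h)
  finally have "(LINT x:W|lebesgue. g u x) - b u = (LINT x:W|lebesgue. g (\<lambda>x. u x - \<phi> x) x) - b (\<lambda>x. u x - \<phi> x)"
   using B(1)[OF u h(1)] eq[OF \<phi>(1)] by simp
  then have "\<bar>(LINT x:W|lebesgue. g u x) - b u\<bar> \<le> M' * N (\<lambda>x. u x - \<phi> x) + M * N (\<lambda>x. u x - \<phi> x)"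
   using M'(2)[OF h(2)] B(2)[OF h(2)] by linarith
  also have "... \<le> \<bar>M'\<bar> * e + \<bar>M\<bar> * e" using \<phi>(2) H_nonneg[OF h(2)] by (intro add_mono mult_mono) auto
  finally show ?thesis by (simp add: algebra_simps)
 qed
 have "\<bar>(LINT x:W|lebesgue. g u x) - b u\<bar> \<le> 0"
 proof (rule field_le_epsilon)
  fix e :: real assume "e > 0"
  then have "\<bar>(LINT x:W|lebesgue. g u x) - b u\<bar> \<le> (\<bar>M\<bar> + \<bar>M'\<bar>) * (e / (\<bar>M\<bar> + \<bar>M'\<bar> + 1))"
   by (intro small) (simp add: add_nonneg_pos)
  also have "... \<le> e"
  proof -
   have "(a * (e / (a + 1))) \<le> e" if "a \<ge> 0" for a using that \<open>e > 0\<close> by (simp add: field_simps)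
   then show ?thesis by simp
  qed
  finally show "\<bar>(LINT x:W|lebesgue. g u x) - b u\<bar> \<le> 0 + e" by simp
 qed
 then show ?thesis by simp
qed

text \<open>The given bound on B is one-sided, so it is applied to v and to -v.\<close>

lemma bounded_form_abs:
 assumes "bounded_form_extension F nF L W \<Gamma> B" "u \<in> H" "v \<in> H"
 shows "\<bar>B u v\<bar> \<le> \<Gamma> * N u * N v"
proof -
 have b: "B u v \<le> \<Gamma> * N u * N v" "B u (\<lambda>x. (-1) *\<^sub>R v x) \<le> \<Gamma> * N u * N (\<lambda>x. (-1) *\<^sub>R v x)"
  "B u (\<lambda>x. (-1) *\<^sub>R v x) = (-1) * B u v"
  using assms H_scale[OF assms(3), of "-1"] unfolding bounded_form_extension_def bilinear_form_on_def by meson+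
 then show ?thesis using F_scale[OF H_F[OF assms(3)], of "-1"] by simp
qed

lemma bilinear_form_on_diff:
 assumes "bilinear_form_on H B" "u \<in> H" "v \<in> H" "w \<in> H"
 shows "B (\<lambda>x. u x - v x) w = B u w - B v w" "B w (\<lambda>x. u x - v x) = B w u - B w v"
proof -
 have add: "B (\<lambda>x. u x + (-1) *\<^sub>R v x) w = B u w + B (\<lambda>x. (-1) *\<^sub>R v x) w"
  "B w (\<lambda>x. u x + (-1) *\<^sub>R v x) = B w u + B w (\<lambda>x. (-1) *\<^sub>R v x)"
  using assms H_scale[OF assms(3), of "-1"] unfolding bilinear_form_on_def by meson+
 have sc: "B (\<lambda>x. (-1) *\<^sub>R v x) w = (-1) * B v w" "B w (\<lambda>x. (-1) *\<^sub>R v x) = (-1) * B w v"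
  using assms unfolding bilinear_form_on_def by meson+
 show "B (\<lambda>x. u x - v x) w = B u w - B v w" "B w (\<lambda>x. u x - v x) = B w u - B w v"
  using add sc by simp_all
qed

text \<open>Against one test field the integral converges for every element of the space and depends
  continuously on it, so it still computes B. This is the bridge between identities in the Hilbert
  space and weak equations.\<close>

lemma form_eq:
 assumes L: "regular_coeffs W L" and B: "bounded_form_extension F nF L W \<Gamma> B"
  and u: "u \<in> H" and \<phi>: "\<phi> \<in> test_vec W"
 shows "set_integrable lebesgue W (form_integrand L W u \<phi>)" "form L W u \<phi> = B u \<phi>"
  "set_integrable lebesgue W (form_integrand L W \<phi> u)" "form L W \<phi> u = B \<phi> u"
proof -
 have ga: "AE x in lebesgue_on W. wD W v x = grad v x" if "v \<in> test_vec W" for v :: "real^'n \<Rightarrow> real^'N"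
  by (rule wD_AE[OF open_W has_weak_deriv_test_vec[OF open_W that]])
 let ?g = "\<lambda>v x. form_at L x (wD W v x) (v x) (grad \<phi> x) (\<phi> x)"
 let ?g' = "\<lambda>v x. form_at L x (grad \<phi> x) (\<phi> x) (wD W v x) (v x)"
 have ae: "AE x in lebesgue_on W. form_integrand L W v \<phi> x = ?g v x" "AE x in lebesgue_on W. form_integrand L W \<phi> v x = ?g' v x" for v
  using ga[OF \<phi>] by (eventually_elim, simp add: form_integrand_form_at)+
 have int: "set_integrable lebesgue W (?g v)" "set_integrable lebesgue W (?g' v)" if "v \<in> H" for v
  using good_form[OF L \<phi>] that unfolding good_def by blast+
 have f: "form L W v \<phi> = (LINT x:W|lebesgue. ?g v x)" "form L W \<phi> v = (LINT x:W|lebesgue. ?g' v x)" if "v \<in> H" for v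
  unfolding form_def using set_integrable_cong_AE'(2)[OF sets_W int(1)[OF that] ae(1)]
   set_integrable_cong_AE'(2)[OF sets_W int(2)[OF that] ae(2)] by simp_all
 show "set_integrable lebesgue W (form_integrand L W u \<phi>)" "set_integrable lebesgue W (form_integrand L W \<phi> u)"
  using set_integrable_cong_AE'(1)[OF sets_W int(1)[OF u] ae(1)] set_integrable_cong_AE'(1)[OF sets_W int(2)[OF u] ae(2)] by auto
 have bil: "bilinear_form_on H B" and Beq: "\<And>u v. u \<in> test_vec W \<Longrightarrow> v \<in> test_vec W \<Longrightarrow> B u v = form L W u v"
  using B unfolding bounded_form_extension_def by blast+
 note \<phi>H = test_H[OF \<phi>]
 have wdd: "AE x in lebesgue_on W. wD W (\<lambda>x. u x - v x) x = wD W u x - wD W v x" if "u \<in> H" "v \<in> H" for u v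
  by (rule wD_diff_AE[OF open_W H_weak_deriv[OF that(1)] H_weak_deriv[OF that(2)]])
 have "(LINT x:W|lebesgue. ?g u x) = B u \<phi>"
 proof (rule form_eq_aux[where b = "\<lambda>u. B u \<phi>" and M = "\<Gamma> * N \<phi>"])
  show "\<bar>B u \<phi>\<bar> \<le> \<Gamma> * N \<phi> * N u" if "u \<in> H" for u using bounded_form_abs[OF B that \<phi>H] by (simp add: mult_ac)
  show "AE x in lebesgue_on W. ?g (\<lambda>x. u x - v x) x = ?g u x - ?g v x" if "u \<in> H" "v \<in> H" for u v
   using wdd[OF that] by eventually_elim (simp add: form_at_diff_left)
  show "B v \<phi> = (LINT x:W|lebesgue. ?g v x)" if "v \<in> test_vec W" for v
   using Beq[OF that \<phi>] f(1)[OF test_H[OF that]] by simp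
 qed (use good_form[OF L \<phi>] u \<phi>H bilinear_form_on_diff[OF bil] in auto)
 then show "form L W u \<phi> = B u \<phi>" using f(1)[OF u] by simp
 have "(LINT x:W|lebesgue. ?g' u x) = B \<phi> u"
 proof (rule form_eq_aux[where b = "\<lambda>u. B \<phi> u" and M = "\<Gamma> * N \<phi>"])
  show "\<bar>B \<phi> u\<bar> \<le> \<Gamma> * N \<phi> * N u" if "u \<in> H" for u using bounded_form_abs[OF B \<phi>H that] by (simp add: mult_ac)
  show "AE x in lebesgue_on W. ?g' (\<lambda>x. u x - v x) x = ?g' u x - ?g' v x" if "u \<in> H" "v \<in> H" for u v
   using wdd[OF that] by eventually_elim (simp add: form_at_diff_right)
  show "B \<phi> v = (LINT x:W|lebesgue. ?g' v x)" if "v \<in> test_vec W" for v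
   using Beq[OF \<phi> that] f(2)[OF test_H[OF that]] by simp
 qed (use good_form[OF L \<phi>] u \<phi>H bilinear_form_on_diff[OF bil] in auto)
 then show "form L W \<phi> u = B \<phi> u" using f(2)[OF u] by simp
qed

end

subsection \<open>Pointwise bounds for the Green matrix\<close>

text \<open>Balls have positive measure. Almost everywhere bounds thereby hold at points as close as
  desired to a given one, where continuity of G takes over.\<close>

lemma AE_ball_exists:
 fixes a :: "real^'n::finite"
 assumes "AE x in lebesgue. x \<in> S \<longrightarrow> P x" "r > 0" "ball a r \<subseteq> S"
 shows "\<exists>x\<in>ball a r. P x"
proof (rule ccontr)
 assume "\<not> ?thesis"
 then have "AE x in lebesgue. x \<notin> ball a r" using assms(1) by (elim eventually_mono) (use assms(3) in blast)
 then have "ball a r \<in> null_sets lebesgue" using AE_iff_null_sets[of "ball a r" lebesgue] by auto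
 then have "emeasure lebesgue (ball a r) = 0" by auto
 then show False using assms(2) zero_less_power[OF assms(2), of "CARD('n)"]
  by (simp add: emeasure_ball ennreal_eq_0_iff mult_le_0_iff) (use unit_ball_vol_pos[of "real CARD('n)"] in linarith)
qed

text \<open>The predicate \<open>sol\<close> stands for solving the homogeneous equation of either operator, which makes the
 setting invariant under exchanging the arguments of \<open>B\<close>. No constant below refers to \<open>W\<close>, \<open>F\<close>, \<open>B\<close> or \<open>G\<close>,
 so the constants of the theorem can be chosen first.\<close>

locale green_setting = elliptic_space W F nF c\<^sub>0
 for W :: "(real^'n::finite) set" and F :: "('n, 'N::finite) family" and nF :: "('n, 'N) family_norm" and c\<^sub>0 :: real +
 fixes B :: "(real^'n \<Rightarrow> real^'N) \<Rightarrow> (real^'n \<Rightarrow> real^'N) \<Rightarrow> real" and \<Gamma> \<gamma> :: real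
  and sol :: "(real^'n) set \<Rightarrow> (real^'n \<Rightarrow> real^'N) \<Rightarrow> bool" and K1 K2 :: real and \<eta> CH :: "real \<Rightarrow> real"
 assumes bil: "bilinear_form_on H B"
  and bnd: "\<And>u v. u \<in> H \<Longrightarrow> v \<in> H \<Longrightarrow> \<bar>B u v\<bar> \<le> \<Gamma> * N u * N v"
  and \<gamma>_pos: "\<gamma> > 0" and coer: "\<And>u. u \<in> H \<Longrightarrow> \<gamma> * (N u)^2 \<le> B u u"
  and sol_left: "\<And>U u. open U \<Longrightarrow> U \<subseteq> W \<Longrightarrow> u \<in> H \<Longrightarrow> (\<And>v. v \<in> test_vec U \<Longrightarrow> B u v = 0) \<Longrightarrow> sol U u"
  and sol_right: "\<And>U u. open U \<Longrightarrow> U \<subseteq> W \<Longrightarrow> u \<in> H \<Longrightarrow> (\<And>v. v \<in> test_vec U \<Longrightarrow> B v u = 0) \<Longrightarrow> sol U u"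
  and K1: "K1 \<ge> 0" and K2: "K2 \<ge> 0"
  and caccioppoli_annulus: "\<And>u y r. u \<in> H \<Longrightarrow> r > 0 \<Longrightarrow> sol (W - cball y (r/2)) u \<Longrightarrow>
   L2sq (W - cball y r) (wD W u) \<le> ennreal (K1 / r^2) * L2sq (W \<inter> cball y r - cball y (r/2)) u"
  and boundedness: "\<And>u x R a. u \<in> H \<Longrightarrow> x \<in> W \<Longrightarrow> R > 0 \<Longrightarrow> sol (W \<inter> ball x R) u \<Longrightarrow> a \<ge> 0 \<Longrightarrow>
   L2sq (W \<inter> ball x R) u \<le> ennreal (a^2) \<Longrightarrow>
   AE z in lebesgue. z \<in> W \<inter> ball x (R/2) \<longrightarrow> norm (u z) \<le> K2 * R powr (- real CARD('n) / 2) * a"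
  and hoelder: "\<And>R\<^sub>0. R\<^sub>0 > 0 \<Longrightarrow> 0 < \<eta> R\<^sub>0 \<and> \<eta> R\<^sub>0 < 1 \<and> 0 < CH R\<^sub>0"
   "\<And>u x R\<^sub>0. u \<in> H \<Longrightarrow> R\<^sub>0 > 0 \<Longrightarrow> ball x (2 * R\<^sub>0) \<subseteq> W \<Longrightarrow> sol (ball x R\<^sub>0) u \<Longrightarrow>
    \<exists>w. (AE z in lebesgue. z \<in> ball x R\<^sub>0 \<longrightarrow> w z = u z) \<and>
     (\<forall>R. 0 < R \<and> R \<le> R\<^sub>0 \<longrightarrow> (\<forall>y\<in>ball x (R/2). \<forall>z\<in>ball x (R/2). y \<noteq> z \<longrightarrow>
       ennreal (norm (w y - w z) / norm (y - z) powr \<eta> R\<^sub>0) \<le> ennreal (CH R\<^sub>0 * R powr (- \<eta> R\<^sub>0)) *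
        ennpowr ((\<integral>\<^sup>+z. ennreal (norm (u z) powr two_star TYPE('n)) \<partial>lebesgue_on (ball x R))
               / emeasure lebesgue (ball x R)) (1 / two_star TYPE('n))))"
begin

lemma n_ge_3: "real CARD('n) \<ge> 3" using n3 by linarith

definition "\<kappa> = 6 * cD"

lemma \<kappa>_nonneg: "\<kappa> \<ge> 0" by (simp add: \<kappa>_def cD_nonneg)

lemma H_hardy': "u \<in> H \<Longrightarrow> R > 0 \<Longrightarrow> L2sq (W \<inter> ball a R) u \<le> ennreal ((\<kappa> * R * N u)^2)"
 using H_hardy[of u R a] by (simp add: \<kappa>_def)

lemma swapped: "green_setting W F nF c\<^sub>0 (\<lambda>u v. B v u) \<Gamma> \<gamma> sol K1 K2 \<eta> CH"
proof (unfold_locales, goal_cases)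
 case 1 show ?case using bil unfolding bilinear_form_on_def by meson
next
 case (2 u v) then show ?case using bnd[of v u] by (simp add: mult_ac)
next
 case (6 U u) then show ?case using sol_left by blast
next
 case (5 U u) then show ?case using sol_right by blast
next
 case (10 u x R a) then show ?case by (rule boundedness)
qed (use \<gamma>_pos coer K1 K2 caccioppoli_annulus hoelder in \<open>assumption | blast\<close>)+

lemma restrict_W_subset:
 assumes "S \<in> sets lebesgue" "S \<subseteq> W" "f \<in> meas_on W"
 shows "f \<in> meas_on S"
proof -
 have "restrict_space (lebesgue_on W) S = lebesgue_on S" using sets_W assms by (subst restrict_restrict_space) (auto simp: Int_absorb1)
 then show ?thesis using measurable_restrict_space1[OF assms(3), of S] by simp
qed

text \<open>The datum lives in a ball of radius R, where Hardy's inequality controls the L2 norm of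
  v by \<kappa> R times its norm in the space.\<close>

lemma rhs_bound:
 assumes g: "g \<in> meas_on W" "L2sq W g \<le> ennreal (a^2)" "a \<ge> 0"
  and supp: "\<forall>x\<in>W. x \<notin> ball c R \<longrightarrow> g x = 0" and R: "R > 0" and v: "v \<in> H"
 shows "set_integrable lebesgue W (\<lambda>x. g x \<bullet> v x)" "\<bar>LINT x:W|lebesgue. g x \<bullet> v x\<bar> \<le> a * \<kappa> * R * N v"
proof -
 let ?S = "W \<inter> ball c R"
 have S: "?S \<in> sets lebesgue" "?S \<subseteq> W" using open_W by auto
 have g2: "L2sq ?S g \<le> ennreal (a^2)" using L2sq_mono_set[OF S(2), of g] g(2) by (rule order_trans)
 have e: "indicator W x *\<^sub>R (g x \<bullet> v x) = indicator ?S x *\<^sub>R (g x \<bullet> v x)" for x using supp by (auto simp: indicator_def)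
 note i = L2sq_inner[OF S(1) restrict_W_subset[OF S g(1)] restrict_W_subset[OF S H_measurable(1)[OF v]] g2 H_hardy'[OF v R] g(3)]
 show "set_integrable lebesgue W (\<lambda>x. g x \<bullet> v x)" "\<bar>LINT x:W|lebesgue. g x \<bullet> v x\<bar> \<le> a * \<kappa> * R * N v"
  using i \<kappa>_nonneg R H_nonneg[OF v] unfolding set_integrable_def set_lebesgue_integral_def e by (simp_all add: mult.assoc)
qed

text \<open>Testing with u itself: the right hand side is linear in the norm of u, the coercive side
  quadratic.\<close>

lemma energy_bound:
 assumes g: "g \<in> meas_on W" "L2sq W g \<le> ennreal (a^2)" "a \<ge> 0"
  and supp: "\<forall>x\<in>W. x \<notin> ball c R \<longrightarrow> g x = 0" and R: "R > 0" and u: "u \<in> H"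
  and eq: "B u u = (LINT x:W|lebesgue. g x \<bullet> u x)"
 shows "N u \<le> a * \<kappa> * R / \<gamma>"
proof (cases "N u = 0")
 case True then show ?thesis using g \<kappa>_nonneg R \<gamma>_pos by simp
next
 case False
 then have p: "N u > 0" using H_nonneg[OF u] by simp
 have "\<gamma> * (N u)^2 \<le> a * \<kappa> * R * N u" using coer[OF u] eq rhs_bound(2)[OF g supp R u] by linarith
 then have "(\<gamma> * N u) * N u \<le> (a * \<kappa> * R) * N u" by (simp add: power2_eq_square mult.assoc)
 then have "\<gamma> * N u \<le> a * \<kappa> * R" using p by (simp add: mult_le_cancel_right)
 then show ?thesis using \<gamma>_pos by (simp add: field_simps)
qed

lemma solve:
 assumes g: "g \<in> meas_on W" "L2sq W g \<le> ennreal (a^2)" "a \<ge> 0"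
  and supp: "\<forall>x\<in>W. x \<notin> ball c R \<longrightarrow> g x = 0" and R: "R > 0"
 shows "\<exists>w\<in>H. (\<forall>v\<in>H. B w v = (LINT x:W|lebesgue. g x \<bullet> v x)) \<and> N w \<le> a * \<kappa> * R / \<gamma>"
proof -
 have "\<exists>w\<in>H. \<forall>v\<in>H. B w v = (LINT x:W|lebesgue. g x \<bullet> v x)"
 proof (rule H_lax_milgram[OF bil bnd \<gamma>_pos coer])
  show "(LINT x:W|lebesgue. g x \<bullet> (u x + v x)) = (LINT x:W|lebesgue. g x \<bullet> u x) + (LINT x:W|lebesgue. g x \<bullet> v x)"
   if "u \<in> H" "v \<in> H" for u v unfolding inner_add_right by (intro set_integral_add rhs_bound[OF g supp R] that)
  show "(LINT x:W|lebesgue. g x \<bullet> (k *\<^sub>R u x)) = k * (LINT x:W|lebesgue. g x \<bullet> u x)" for k u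
   by (simp add: set_integral_mult_right)
  show "\<bar>LINT x:W|lebesgue. g x \<bullet> u x\<bar> \<le> (a * \<kappa> * R) * N u" if "u \<in> H" for u
   by (rule rhs_bound(2)[OF g supp R that])
 qed
 then obtain w where w: "w \<in> H" "\<And>v. v \<in> H \<Longrightarrow> B w v = (LINT x:W|lebesgue. g x \<bullet> v x)" by blast
 then show ?thesis using energy_bound[OF g supp R w(1) w(2)[OF w(1)]] by blast
qed

lemma rhs_disjoint_0:
 assumes v: "v \<in> test_vec U" and g: "\<And>x. x \<in> W \<Longrightarrow> x \<in> U \<Longrightarrow> g x = 0"
 shows "(LINT x:W|lebesgue. g x \<bullet> v x) = 0"
proof -
 obtain K where "K \<subseteq> U" "\<And>x. x \<notin> K \<Longrightarrow> v x = 0" using test_vec_support[OF v] by metis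
 then have "indicator W x *\<^sub>R (g x \<bullet> v x) = 0" for x using g[of x] by (cases "x \<in> K") (auto simp: indicator_def)
 then show ?thesis by (simp only: set_lebesgue_integral_def Bochner_Integration.integral_zero)
qed

lemma test_vec_subset_H: "U \<subseteq> W \<Longrightarrow> v \<in> test_vec U \<Longrightarrow> v \<in> H"
 using test_H test_vec_mono[of U W] by blast

end

section \<open>The Green matrix as a kernel and its ball averages\<close>

locale green_kernel = green_setting +
 fixes G :: "real^'a \<Rightarrow> real^'a \<Rightarrow> real^'b^'b"
 assumes G_cont: "continuous_on {(x, y). x \<in> W \<and> y \<in> W \<and> x \<noteq> y} (\<lambda>(x, y). G x y)"
  and G_repr: "\<And>f. f \<in> Linf_c W \<Longrightarrow> (\<lambda>y. \<chi> k. LINT x:W|lebesgue. (\<Sum>j\<in>UNIV. G x y $ j $ k * f x $ j)) \<in> H"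
   "\<And>f v. f \<in> Linf_c W \<Longrightarrow> v \<in> H \<Longrightarrow>
    B v (\<lambda>y. \<chi> k. LINT x:W|lebesgue. (\<Sum>j\<in>UNIV. G x y $ j $ k * f x $ j)) = (LINT x:W|lebesgue. f x \<bullet> v x)"
begin

definition rep :: "(real^'a \<Rightarrow> real^'b) \<Rightarrow> real^'a \<Rightarrow> real^'b" where
 "rep f y = (\<chi> k. LINT x:W|lebesgue. (\<Sum>j\<in>UNIV. G x y $ j $ k * f x $ j))"

lemma rep_H: "f \<in> Linf_c W \<Longrightarrow> rep f \<in> H" using G_repr(1) unfolding rep_def[abs_def] .

lemma rep_eq: "f \<in> Linf_c W \<Longrightarrow> v \<in> H \<Longrightarrow> B v (rep f) = (LINT x:W|lebesgue. f x \<bullet> v x)"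
 using G_repr(2) unfolding rep_def[abs_def] .

definition vol :: "real \<Rightarrow> real" where "vol q = unit_ball_vol (real CARD('a)) * q ^ CARD('a)"

lemma vol_pos: "q > 0 \<Longrightarrow> vol q > 0" by (simp add: vol_def)

lemma emeasure_ball_vol:
 assumes "q > 0"
 shows "emeasure lebesgue (ball (a::real^'a) q) = ennreal (vol q)" "emeasure lborel (ball (a::real^'a) q) = ennreal (vol q)"
  "emeasure lebesgue (cball (a::real^'a) q) = ennreal (vol q)" "emeasure lborel (cball (a::real^'a) q) = ennreal (vol q)"
 using assms by (simp_all add: vol_def emeasure_ball emeasure_cball)

definition bump :: "real^'a \<Rightarrow> real \<Rightarrow> 'b \<Rightarrow> real^'a \<Rightarrow> real^'b" where
 "bump x q k z = (indicator (ball x q) z / vol q) *\<^sub>R axis k 1"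

text \<open>In the second variable, the average of the k-th row of G over the ball around x. It
  solves the equation with datum \<open>bump\<close>, has finite energy, and stands in for the row
  of G wherever the form or the local hypotheses are applied.\<close>

definition approx :: "real^'a \<Rightarrow> real \<Rightarrow> 'b \<Rightarrow> real^'a \<Rightarrow> real^'b" where
 "approx x q k = rep (bump x q k)"

lemma bump_measurable: "bump x q k \<in> meas_on S"
proof (rule measurable_restrict_space1)
 show "bump x q k \<in> meas_L"
  unfolding bump_def by (intro borel_measurable_scaleR borel_measurable_divide borel_measurable_indicator) auto
qed

lemma norm_bump: "q > 0 \<Longrightarrow> norm (bump x q k z) = indicator (ball x q) z / vol q"
 using vol_pos[of q] by (simp add: bump_def norm_axis_1)

lemma bump_Linf_c: assumes "q > 0" "cball x q \<subseteq> W" shows "bump x q k \<in> Linf_c W"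
proof -
 have "esssup (lebesgue_on W) (\<lambda>z. ennreal (norm (bump x q k z))) \<le> ennreal (1 / vol q)"
 proof (rule esssup_I)
  show "(\<lambda>z. ennreal (norm (bump x q k z))) \<in> meas_on W"
   using bump_measurable[of x q k W] by measurable
  show "AE z in lebesgue_on W. ennreal (norm (bump x q k z)) \<le> ennreal (1 / vol q)"
   using assms(1) vol_pos[of q] by (intro AE_I2 ennreal_leI) (auto simp: norm_bump indicator_def)
 qed
 then have "Lp_norm \<infinity> W (bump x q k) < \<infinity>" using bump_measurable by (auto simp: Lp_norm_def intro: le_less_trans)
 moreover have "\<exists>K. compact K \<and> K \<subseteq> W \<and> (\<forall>z\<in>W - K. bump x q k z = 0)"
  using assms by (intro exI[of _ "cball x q"]) (auto simp: bump_def)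
 ultimately show ?thesis by (simp add: Linf_c_def)
qed

lemma bump_L2: assumes "q > 0" shows "L2sq W (bump x q k) \<le> ennreal ((1 / sqrt (vol q))^2)"
proof -
 have "L2sq W (bump x q k) \<le> (\<integral>\<^sup>+z\<in>ball x q. ennreal (1 / (vol q)^2) \<partial>lebesgue)"
  unfolding L2sq_def norm_bump[OF assms] by (intro nn_integral_mono) (auto simp: indicator_def power_divide)
 also have "... = ennreal (1 / (vol q)^2) * ennreal (vol q)" using assms by (simp add: nn_integral_cmult_indicator emeasure_ball_vol)
 also have "... = ennreal ((1 / sqrt (vol q))^2)" using vol_pos[OF assms] by (simp add: ennreal_mult[symmetric] power_divide power2_eq_square)
 finally show ?thesis .
qed

lemma approx_H: "q > 0 \<Longrightarrow> cball x q \<subseteq> W \<Longrightarrow> approx x q k \<in> H"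
 unfolding approx_def by (intro rep_H bump_Linf_c)

lemma approx_eq: "q > 0 \<Longrightarrow> cball x q \<subseteq> W \<Longrightarrow> v \<in> H \<Longrightarrow> B v (approx x q k) = (LINT z:W|lebesgue. bump x q k z \<bullet> v z)"
 unfolding approx_def by (intro rep_eq bump_Linf_c)

lemma approx_eq_average: assumes "q > 0" "cball x q \<subseteq> W"
 shows "B v (approx x q k) = (LINT z:W|lebesgue. bump x q k z \<bullet> v z) \<Longrightarrow>
  B v (approx x q k) = (LINT z:ball x q|lebesgue. v z $ k) / vol q"
proof -
 have "indicator W z *\<^sub>R (bump x q k z \<bullet> v z) = (indicator (ball x q) z *\<^sub>R v z $ k) / vol q" for z
  using assms(2) by (auto simp: indicator_def bump_def inner_axis' subset_iff)
 then have "(LINT z:W|lebesgue. bump x q k z \<bullet> v z) = (LINT z:ball x q|lebesgue. v z $ k) / vol q"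
  unfolding set_lebesgue_integral_def by simp
 then show "B v (approx x q k) = (LINT z:W|lebesgue. bump x q k z \<bullet> v z) \<Longrightarrow> ?thesis" by simp
qed

lemma approx_component: assumes "q > 0" "cball x q \<subseteq> W"
 shows "approx x q k y $ m = (LINT z:ball x q|lebesgue. G z y $ k $ m) / vol q"
proof -
 have "indicator W z *\<^sub>R (\<Sum>j\<in>UNIV. G z y $ j $ m * bump x q k z $ j) = (indicator (ball x q) z *\<^sub>R G z y $ k $ m) / vol q" for z
 proof -
  have "(\<Sum>j\<in>UNIV. G z y $ j $ m * bump x q k z $ j) = (\<Sum>j\<in>UNIV. if j = k then G z y $ k $ m * (indicator (ball x q) z / vol q) else 0)"
   by (intro sum.cong) (auto simp: bump_def axis_def)
  also have "... = G z y $ k $ m * (indicator (ball x q) z / vol q)" by simp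
  finally show ?thesis using assms(2) by (auto simp: indicator_def subset_iff)
 qed
 then show ?thesis unfolding approx_def rep_def set_lebesgue_integral_def by simp
qed

lemma G_cont_left: "y \<in> W \<Longrightarrow> continuous_on (W - {y}) (\<lambda>x. G x y)"
proof -
 assume y: "y \<in> W"
 have "continuous_on (W - {y}) ((\<lambda>(x, y). G x y) \<circ> (\<lambda>x. (x, y)))"
  by (intro continuous_on_compose continuous_intros continuous_on_subset[OF G_cont]) (use y in auto)
 then show ?thesis by (simp add: o_def)
qed

lemma G_cont_right: "x \<in> W \<Longrightarrow> continuous_on (W - {x}) (\<lambda>y. G x y)"
proof -
 assume x: "x \<in> W"
 have "continuous_on (W - {x}) ((\<lambda>(x, y). G x y) \<circ> (\<lambda>y. (x, y)))"
  by (intro continuous_on_compose continuous_intros continuous_on_subset[OF G_cont]) (use x in auto)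
 then show ?thesis by (simp add: o_def)
qed

text \<open>The value at y is arbitrary, but a point is a null set.\<close>

lemma measurable_off_point:
 fixes f :: "real^'a \<Rightarrow> 'c::euclidean_space"
 assumes "continuous_on (W - {y}) f"
 shows "f \<in> meas_on W"
proof -
 have o: "open (W - {y})" using open_W by auto
 have "(\<lambda>x. indicator (W - {y}) x *\<^sub>R f x) \<in> borel_measurable lborel"
  using borel_measurable_continuous_on_indicator[OF _ assms] o by simp
 then have m: "(\<lambda>x. indicator (W - {y}) x *\<^sub>R f x) \<in> meas_L" by (rule measurable_completion)
 have "AE x in lebesgue. x \<notin> {y}" by (intro AE_not_in) (simp add: null_sets_completionI)
 then have "AE x in lebesgue. indicator (W - {y}) x *\<^sub>R f x = indicator W x *\<^sub>R f x" by eventually_elim (auto simp: indicator_def)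
 from borel_measurable_AE[OF m this] show ?thesis using borel_measurable_restrict_space_iff[of W lebesgue f] sets_W by simp
qed

lemma G_uniform_cont:
 assumes "x \<in> W" "y \<in> W" "x \<noteq> y" "e > 0"
 obtains d where "d > 0" "cball x d \<subseteq> W" "cball y d \<subseteq> W" "2 * d < dist x y"
  "\<And>x' y'. x' \<in> ball x d \<Longrightarrow> y' \<in> ball y d \<Longrightarrow> norm (G x' y' - G x y) < e"
proof -
 let ?D = "{(x, y). x \<in> W \<and> y \<in> W \<and> x \<noteq> y}"
 have "(x, y) \<in> ?D" using assms by simp
 then have "\<exists>d>0. \<forall>p\<in>?D. dist p (x, y) < d \<longrightarrow> dist (case p of (x, y) \<Rightarrow> G x y) (case (x, y) of (x, y) \<Rightarrow> G x y) < e"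
  using G_cont assms(4) unfolding continuous_on_iff by blast
 then obtain d1 where d1: "d1 > 0" "\<And>p. p \<in> ?D \<Longrightarrow> dist p (x, y) < d1 \<Longrightarrow> dist (case p of (x, y) \<Rightarrow> G x y) (G x y) < e"
  by auto
 obtain d2 where d2: "d2 > 0" "cball x d2 \<subseteq> W" using open_W assms by (meson open_contains_cball)
 obtain d3 where d3: "d3 > 0" "cball y d3 \<subseteq> W" using open_W assms by (meson open_contains_cball)
 define d where "d = min (min (d1 / 2) (dist x y / 3)) (min d2 d3)"
 have d: "d > 0" "d \<le> d1 / 2" "d \<le> dist x y / 3" "d \<le> d2" "d \<le> d3" using d1 d2 d3 assms by (auto simp: d_def)
 show ?thesis
 proof (rule that[OF d(1)])
  show "cball x d \<subseteq> W" "cball y d \<subseteq> W" using d d2 d3 subset_cball by (meson order_trans)+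
  have "dist x y > 0" using assms by simp
  then show "2 * d < dist x y" using d(3) by linarith
  fix x' y' assume xy: "x' \<in> ball x d" "y' \<in> ball y d"
  have "x' \<in> W" "y' \<in> W" using xy \<open>cball x d \<subseteq> W\<close> \<open>cball y d \<subseteq> W\<close> ball_subset_cball by blast+
  moreover have "x' \<noteq> y'"
  proof
   assume "x' = y'"
   then have "dist x y < 2 * d" using xy dist_triangle[of x y x'] by (simp add: dist_commute)
   with \<open>2 * d < dist x y\<close> show False by simp
  qed
  moreover have "dist (x', y') (x, y) < d1"
  proof -
   have "dist (x', y') (x, y) \<le> dist x' x + dist y' y" by (simp add: dist_Pair_Pair sqrt_sum_squares_le_sum)
   then show ?thesis using xy d by (simp add: dist_commute)
  qed
  ultimately show "norm (G x' y' - G x y) < e" using d1(2)[of "(x', y')"] by (simp add: dist_norm)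
 qed
qed

lemma approx_close:
 assumes q: "q > 0" "cball x q \<subseteq> W" and y: "y \<in> W" "y \<notin> ball x q"
  and e: "\<And>x'. x' \<in> ball x q \<Longrightarrow> norm (G x' y - A) \<le> e"
 shows "norm (approx x q k y - A $ k) \<le> e"
proof -
 have sub: "ball x q \<subseteq> W - {y}" using q y ball_subset_cball by blast
 have c: "continuous_on (ball x q) (\<lambda>x'. G x' y $ k)"
  by (intro bounded_linear.continuous_on[OF bounded_linear_vec_nth] continuous_on_subset[OF G_cont_left[OF y(1)] sub])
 have "(\<lambda>z. indicator (ball x q) z *\<^sub>R G z y $ k) \<in> borel_measurable lborel"
  using borel_measurable_continuous_on_indicator[OF _ c] by simp
 then have m: "(\<lambda>z. indicator (ball x q) z *\<^sub>R G z y $ k) \<in> meas_L" by (rule measurable_completion)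
 have e0: "e \<ge> 0" using e[of x] q by (meson centre_in_ball norm_ge_zero order_trans)
 have fin: "emeasure lebesgue (ball x q) < \<infinity>" using q by (simp add: emeasure_ball_vol)
 have ii: "integrable lebesgue (\<lambda>z. indicator (ball x q) z *\<^sub>R v)" for v :: "real^'b"
  using fin by (intro integrable_scaleR_left integrable_real_indicator) auto
 have i: "integrable lebesgue (\<lambda>z. indicator (ball x q) z *\<^sub>R G z y $ k)"
 proof (rule Bochner_Integration.integrable_bound[OF _ m])
  show "integrable lebesgue (\<lambda>z. indicator (ball x q) z * (norm (A $ k) + e))"
   using fin by (intro integrable_mult_left integrable_real_indicator) auto
  have "norm (G z y $ k) \<le> norm (A $ k) + e" if "z \<in> ball x q" for z
  proof -
   have "norm (G z y $ k - A $ k) \<le> norm (G z y - A)" using Finite_Cartesian_Product.norm_nth_le[of "G z y - A" k] by simp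
   then show ?thesis using e[OF that] norm_triangle_sub[of "G z y $ k" "A $ k"] by linarith
  qed
  then show "AE z in lebesgue. norm (indicator (ball x q) z *\<^sub>R G z y $ k) \<le> norm (indicator (ball x q) z * (norm (A $ k) + e))"
   using e0 by (intro AE_I2) (auto simp: indicator_def intro: order_trans[OF _ abs_ge_self])
 qed
 have rep: "approx x q k y = (1 / vol q) *\<^sub>R (LINT z|lebesgue. indicator (ball x q) z *\<^sub>R G z y $ k)"
 proof (rule vec_eq_iff[THEN iffD2], rule allI)
  fix m
  have "(LINT z|lebesgue. indicator (ball x q) z *\<^sub>R G z y $ k) $ m = (LINT z|lebesgue. (indicator (ball x q) z *\<^sub>R G z y $ k) $ m)"
   by (rule integral_bounded_linear[OF bounded_linear_vec_nth i, symmetric])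
  then show "approx x q k y $ m = ((1 / vol q) *\<^sub>R (LINT z|lebesgue. indicator (ball x q) z *\<^sub>R G z y $ k)) $ m"
   by (simp add: approx_component[OF q] set_lebesgue_integral_def)
 qed
 have "(LINT z|lebesgue. indicator (ball x q) z *\<^sub>R A $ k) = vol q *\<^sub>R A $ k"
  using fin q vol_pos[OF q(1)] by (simp add: measure_def emeasure_ball_vol)
 then have A: "A $ k = (1 / vol q) *\<^sub>R (LINT z|lebesgue. indicator (ball x q) z *\<^sub>R A $ k)" using vol_pos[OF q(1)] by simp
 have "norm (LINT z|lebesgue. indicator (ball x q) z *\<^sub>R G z y $ k - indicator (ball x q) z *\<^sub>R A $ k) \<le> (LINT z|lebesgue. indicator (ball x q) z * e)"
 proof (rule Bochner_Integration.integral_norm_bound_integral)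
  show "integrable lebesgue (\<lambda>z. indicator (ball x q) z *\<^sub>R G z y $ k - indicator (ball x q) z *\<^sub>R A $ k)"
   using i ii by (rule Bochner_Integration.integrable_diff)
  show "integrable lebesgue (\<lambda>z. indicator (ball x q) z * e)"
   using fin by (intro integrable_mult_left integrable_real_indicator) auto
  show "norm (indicator (ball x q) z *\<^sub>R G z y $ k - indicator (ball x q) z *\<^sub>R A $ k) \<le> indicator (ball x q) z * e" for z
   using e[of z] Finite_Cartesian_Product.norm_nth_le[of "G z y - A" k] by (auto simp: indicator_def)
 qed
 also have "... = vol q * e" using fin q vol_pos[OF q(1)] by (simp add: measure_def emeasure_ball_vol)
 finally have b: "norm (LINT z|lebesgue. indicator (ball x q) z *\<^sub>R G z y $ k - indicator (ball x q) z *\<^sub>R A $ k) \<le> vol q * e" .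
 have "approx x q k y - A $ k = (1 / vol q) *\<^sub>R (LINT z|lebesgue. indicator (ball x q) z *\<^sub>R G z y $ k - indicator (ball x q) z *\<^sub>R A $ k)"
  unfolding rep by (subst A) (simp only: Bochner_Integration.integral_diff[OF i ii] scaleR_diff_right)
 then have "norm (approx x q k y - A $ k) = (1 / vol q) * norm (LINT z|lebesgue. indicator (ball x q) z *\<^sub>R G z y $ k - indicator (ball x q) z *\<^sub>R A $ k)"
  using vol_pos[OF q(1)] by simp
 also have "... \<le> (1 / vol q) * (vol q * e)" using b vol_pos[OF q(1)] by (intro mult_left_mono) auto
 finally show ?thesis using vol_pos[OF q(1)] by simp
qed

text \<open>Local boundedness is applied twice, near x and near y, Hardy's inequality twice, and
  coercivity once.\<close>

definition "C1 = K2 * (K2 * \<kappa>^2 / \<gamma>)"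

lemma C1_nonneg: "C1 \<ge> 0" using K2 \<gamma>_pos by (simp add: C1_def)

text \<open>Duality: \<open>u\<close> is tested against the solution \<open>w\<close> with right hand side \<open>u\<close> near \<open>y\<close>; since \<open>w\<close> is a
 solution near \<open>x\<close>, its average over the support of the datum of \<open>u\<close> is controlled by local boundedness.\<close>

lemma approx_bound:
 assumes xy: "x \<in> W" "y \<in> W" and R: "R > 0" "2 * R \<le> dist x y" and q: "0 < q" "q \<le> R / 2" "cball x q \<subseteq> W"
 shows "AE z in lebesgue. z \<in> W \<inter> ball y (R / 2) \<longrightarrow> norm (approx x q k z) \<le> C1 * R powr (2 - real CARD('a))"
proof -
 let ?n = "real CARD('a)"
 define u where "u = approx x q k"
 have u: "u \<in> H" unfolding u_def by (rule approx_H[OF q(1,3)])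
 have disj: "ball x R \<inter> ball y R = {}"
 proof -
  have False if "z \<in> ball x R" "z \<in> ball y R" for z using that dist_triangle[of x y z] R by (simp add: dist_commute)
  then show ?thesis by blast
 qed
 let ?S = "W \<inter> ball y R"
 have S: "?S \<in> sets lebesgue" "?S \<subseteq> W" using open_W by auto
 \<comment> \<open>Finite by Hardy's inequality, with a bound that may depend on q. This suffices to
   define a and to divide by it at the end.\<close>
 have "L2sq ?S u < \<infinity>" using H_hardy'[OF u R(1), of y] by (rule le_less_trans) simp
 then obtain a2 where a2: "a2 \<ge> 0" "L2sq ?S u = ennreal a2" by (cases "L2sq ?S u") auto
 define a where "a = sqrt a2"
 have a: "a \<ge> 0" "L2sq ?S u = ennreal (a^2)" using a2 by (auto simp: a_def)
 define g where "g = (\<lambda>z. indicator ?S z *\<^sub>R u z)"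
 have gm: "g \<in> meas_on W" unfolding g_def
  using indicator_measurable_on[OF S(1) restrict_W_subset[OF S H_measurable(1)[OF u]]] by (rule measurable_restrict_space1)
 have g2: "L2sq W g = ennreal (a^2)" unfolding a(2)[symmetric] L2sq_def g_def by (intro nn_integral_cong) (auto simp: indicator_def)
 have gs: "\<forall>z\<in>W. z \<notin> ball y R \<longrightarrow> g z = 0" by (simp add: g_def)
 obtain w where w: "w \<in> H" "\<And>v. v \<in> H \<Longrightarrow> B w v = (LINT x:W|lebesgue. g x \<bullet> v x)" "N w \<le> a * \<kappa> * R / \<gamma>"
  using solve[OF gm eq_refl[OF g2] a(1) gs R(1)] by blast
 have solw: "sol (W \<inter> ball x R) w"
 proof (rule sol_left[OF _ _ w(1)])
  show "open (W \<inter> ball x R)" "W \<inter> ball x R \<subseteq> W" using open_W by auto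
  fix v :: "real^'a \<Rightarrow> real^'b" assume v: "v \<in> test_vec (W \<inter> ball x R)"
  have "B w v = (LINT x:W|lebesgue. g x \<bullet> v x)" by (rule w(2)[OF test_vec_subset_H[OF _ v]]) auto
  also have "... = 0" by (rule rhs_disjoint_0[OF v]) (use disj gs in blast)
  finally show "B w v = 0" .
 qed
 define b where "b = \<kappa>^2 * R^2 * a / \<gamma>"
 have b0: "b \<ge> 0" using a \<gamma>_pos by (simp add: b_def)
 have "\<kappa> * R * N w \<le> \<kappa> * R * (a * \<kappa> * R / \<gamma>)" using w(3) \<kappa>_nonneg R by (intro mult_left_mono) auto
 also have "... = b" by (simp add: b_def power2_eq_square)
 finally have "(\<kappa> * R * N w)^2 \<le> b^2" using \<kappa>_nonneg R H_nonneg[OF w(1)] by (intro power_mono) auto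
 then have w2: "L2sq (W \<inter> ball x R) w \<le> ennreal (b^2)" using H_hardy'[OF w(1) R(1), of x] by (meson ennreal_leI order_trans)
 define s where "s = K2 * R powr (- ?n / 2) * b"
 have s0: "s \<ge> 0" using K2 b0 by (simp add: s_def)
 have bw: "AE z in lebesgue. z \<in> W \<inter> ball x (R / 2) \<longrightarrow> norm (w z) \<le> s"
  unfolding s_def by (rule boundedness[OF w(1) xy(1) R(1) solw b0 w2])
 \<comment> \<open>The square norm of u near y equals \<open>B w u\<close>, and the equation for u
   evaluates this as the average of a component of w over the small ball. Hence a^2 is at most the
   bound s for w near x, which is itself linear in a.\<close>
 have "a^2 = (LINT z:W|lebesgue. g z \<bullet> u z)"
 proof -
  have "(LINT z:W|lebesgue. g z \<bullet> u z) = enn2real (\<integral>\<^sup>+z. ennreal (indicator W z *\<^sub>R (g z \<bullet> u z)) \<partial>lebesgue)"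
   unfolding set_lebesgue_integral_def
  proof (rule integral_eq_nn_integral)
   show "(\<lambda>z. indicator W z *\<^sub>R (g z \<bullet> u z)) \<in> meas_L"
    by (intro indicator_measurable_on[OF sets_W] borel_measurable_inner gm H_measurable(1)[OF u])
  qed (auto simp: g_def indicator_def)
  also have "(\<integral>\<^sup>+z. ennreal (indicator W z *\<^sub>R (g z \<bullet> u z)) \<partial>lebesgue) = L2sq ?S u"
   unfolding L2sq_def by (intro nn_integral_cong) (auto simp: g_def indicator_def power2_norm_eq_inner)
  finally show ?thesis using a by simp
 qed
 also have "... = B w u" using w(2)[OF u] by simp
 also have "... = (LINT z:ball x q|lebesgue. w z $ k) / vol q" unfolding u_def by (rule approx_eq_average[OF q(1,3) approx_eq[OF q(1,3) w(1)]])
 also have "... \<le> s"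
 proof -
  have sub: "ball x q \<subseteq> W \<inter> ball x (R / 2)" using q ball_subset_cball[of x q] by auto
  have Bs: "ball x q \<in> sets lebesgue" "ball x q \<subseteq> W" using sub by auto
  have "norm (LINT z|lebesgue. indicator (ball x q) z *\<^sub>R w z $ k) \<le> (LINT z|lebesgue. indicator (ball x q) z * s)"
  proof -
   have ind: "integrable lebesgue (\<lambda>z. indicator (ball x q) z * s)"
    using q by (intro integrable_mult_left integrable_real_indicator) (auto simp: emeasure_ball_vol)
   have ae: "AE z in lebesgue. norm (indicator (ball x q) z *\<^sub>R w z $ k) \<le> indicator (ball x q) z * s" using bw
   proof eventually_elim
    case (elim z)
    then show ?case using sub component_le_norm_cart[of "w z" k] by (auto simp: indicator_def)
   qed
   have mw: "(\<lambda>z. indicator (ball x q) z *\<^sub>R w z) \<in> meas_L"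
    by (rule indicator_measurable_on[OF Bs(1) restrict_W_subset[OF Bs H_measurable(1)[OF w(1)]]])
   have "(\<lambda>z. (indicator (ball x q) z *\<^sub>R w z) $ k) \<in> meas_L"
    by (rule measurable_compose[OF mw borel_measurable_continuous_onI]) (intro continuous_intros)
   then have m: "(\<lambda>z. indicator (ball x q) z *\<^sub>R w z $ k) \<in> meas_L" by (simp only: vector_scaleR_component)
   have iw: "integrable lebesgue (\<lambda>z. indicator (ball x q) z *\<^sub>R w z $ k)"
    by (rule Bochner_Integration.integrable_bound[OF ind m]) (use ae s0 in \<open>auto elim!: eventually_mono simp: indicator_def\<close>)
   show ?thesis
    by (rule order_trans[OF integral_norm_bound integral_mono_AE[OF integrable_norm[OF iw] ind ae]])
  qed
  also have "... = vol q * s" using q vol_pos[OF q(1)] by (simp add: measure_def emeasure_ball_vol)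
  finally have "(LINT z:ball x q|lebesgue. w z $ k) \<le> vol q * s" by (simp add: set_lebesgue_integral_def)
  then show ?thesis using vol_pos[OF q(1)] by (simp add: field_simps)
 qed
 finally have "a^2 \<le> s" .
 define t where "t = K2 * R powr (- ?n / 2) * \<kappa>^2 * R^2 / \<gamma>"
 have t0: "t \<ge> 0" using K2 \<gamma>_pos by (simp add: t_def)
 \<comment> \<open>Dividing by a removes the dependence on q: t involves R but not the averaging
   radius.\<close>
 have "a * a \<le> t * a" using \<open>a^2 \<le> s\<close> by (simp add: s_def b_def t_def power2_eq_square mult_ac)
 then have at: "a \<le> t" using a t0 by (cases "a = 0") auto
 have u2: "L2sq ?S u \<le> ennreal (t^2)" unfolding a(2) using at a by (intro ennreal_leI power_mono)
 have solu: "sol ?S u"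
 proof (rule sol_right[OF _ _ u])
  show "open ?S" "?S \<subseteq> W" using open_W by auto
  fix v :: "real^'a \<Rightarrow> real^'b" assume v: "v \<in> test_vec ?S"
  have "B v u = (LINT z:W|lebesgue. bump x q k z \<bullet> v z)" unfolding u_def by (rule approx_eq[OF q(1,3) test_vec_subset_H[OF _ v]]) auto
  also have "... = 0"
  proof (rule rhs_disjoint_0[OF v])
   fix z assume "z \<in> W" "z \<in> ?S"
   then have "z \<notin> ball x R" using disj by blast
   then have "z \<notin> ball x q" using q R by auto
   then show "bump x q k z = 0" by (simp add: bump_def)
  qed
  finally show "B v u = 0" .
 qed
 have "AE z in lebesgue. z \<in> W \<inter> ball y (R / 2) \<longrightarrow> norm (u z) \<le> K2 * R powr (- ?n / 2) * t"
  by (rule boundedness[OF u xy(2) R(1) solu t0 u2])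
 also have "K2 * R powr (- ?n / 2) * t = C1 * (R powr (- ?n / 2) * R powr (- ?n / 2) * R powr 2)" using R by (simp add: t_def C1_def)
 also have "R powr (- ?n / 2) * R powr (- ?n / 2) * R powr 2 = R powr (2 - ?n)" using R unfolding powr_add[symmetric] by simp
 finally show ?thesis by (simp add: u_def)
qed

text \<open>At almost every point near y the averaged kernel obeys the bound with R = |x - y|/2,
  uniformly in q; for small q it is close to G x y by joint continuity.\<close>

lemma G_row_bound:
 assumes xy: "x \<in> W" "y \<in> W" "x \<noteq> y"
 shows "norm (G x y $ k) \<le> C1 * (dist x y / 2) powr (2 - real CARD('a))"
proof (rule field_le_epsilon)
 fix e :: real assume e: "e > 0"
 define R where "R = dist x y / 2"
 have R: "R > 0" "2 * R \<le> dist x y" using xy by (auto simp: R_def)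
 obtain d where d: "d > 0" "cball x d \<subseteq> W" "cball y d \<subseteq> W" "2 * d < dist x y"
  "\<And>x' y'. x' \<in> ball x d \<Longrightarrow> y' \<in> ball y d \<Longrightarrow> norm (G x' y' - G x y) < e"
  using G_uniform_cont[OF xy e] by metis
 define q where "q = min d (R / 2)"
 have q: "0 < q" "q \<le> R / 2" "q \<le> d" using d R by (auto simp: q_def)
 have cq: "cball x q \<subseteq> W" using q d(2) subset_cball[of q d x] by blast
 have sub: "ball y q \<subseteq> W \<inter> ball y (R / 2)" using q d(3) by auto
 obtain z where z: "z \<in> ball y q" "norm (approx x q k z) \<le> C1 * R powr (2 - real CARD('a))"
  using AE_ball_exists[OF approx_bound[OF xy(1,2) R q(1,2) cq] q(1) sub] by blast
 have "norm (approx x q k z - G x y $ k) \<le> e"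
 proof (rule approx_close[OF q(1) cq])
  show "z \<in> W" using z sub by blast
  show "z \<notin> ball x q"
  proof
   assume "z \<in> ball x q"
   then have "dist x y < 2 * d" using z q dist_triangle[of x y z] by (simp add: dist_commute)
   with d(4) show False by simp
  qed
  show "norm (G x' z - G x y) \<le> e" if "x' \<in> ball x q" for x'
   using d(5)[of x' z] that z q by (simp add: less_imp_le)
 qed
 then show "norm (G x y $ k) \<le> C1 * (dist x y / 2) powr (2 - real CARD('a)) + e"
  using z(2) norm_triangle_sub[of "G x y $ k" "approx x q k z"] by (simp add: R_def norm_minus_commute)
qed

end

subsection \<open>Integrals over dyadic shells\<close>

lemma nn_integral_shells:
 fixes h :: "'a \<Rightarrow> ennreal"
 assumes m: "\<And>j::nat. (\<lambda>x. h x * indicator (S j) x) \<in> borel_measurable M"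
  and b: "\<And>j. (\<integral>\<^sup>+x\<in>S j. h x \<partial>M) \<le> ennreal (c * q ^ j)"
  and q: "0 \<le> q" "q < 1" and c: "c \<ge> 0" and T: "T \<subseteq> (\<Union>j. S j)"
 shows "(\<integral>\<^sup>+x\<in>T. h x \<partial>M) \<le> ennreal (c / (1 - q))"
proof -
 have "(\<integral>\<^sup>+x\<in>T. h x \<partial>M) \<le> (\<integral>\<^sup>+x. (\<Sum>j. h x * indicator (S j) x) \<partial>M)"
 proof (intro nn_integral_mono)
  fix x
  show "h x * indicator T x \<le> (\<Sum>j. h x * indicator (S j) x)"
  proof (cases "x \<in> T")
   case True
   then obtain j where j: "x \<in> S j" using T by blast
   then have "h x * indicator T x = sum (\<lambda>j. h x * indicator (S j) x) {j}" using True by simp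
   also have "... \<le> (\<Sum>j. h x * indicator (S j) x)" by (rule sum_le_suminf) auto
   finally show ?thesis .
  qed simp
 qed
 also have "... = (\<Sum>j. \<integral>\<^sup>+x\<in>S j. h x \<partial>M)" by (rule nn_integral_suminf[OF m])
 also have "... \<le> (\<Sum>j. ennreal (c * q ^ j))" by (intro suminf_le b) auto
 also have "... = ennreal (c / (1 - q))"
 proof -
  have "(\<lambda>j. c * q ^ j) sums (c * (1 / (1 - q)))" using q by (intro sums_mult geometric_sums) auto
  then show ?thesis using q c by (subst suminf_ennreal2) (auto simp: sums_iff)
 qed
 finally show ?thesis .
qed

definition shell :: "real^'n::finite \<Rightarrow> real \<Rightarrow> (real^'n) set" where
 "shell y \<rho> = cball y \<rho> - cball y (\<rho> / 2)"

lemma shell_sets [simp]: "shell y \<rho> \<in> sets lebesgue" by (simp add: shell_def)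

text \<open>Dyadic shells shrinking to y cover the ball up to its centre, a null set; the shell
  bounds form a geometric series of ratio 2^-a.\<close>

lemma inner_shells:
 fixes h :: "real^'n::finite \<Rightarrow> ennreal"
 assumes m: "\<And>S. S \<in> sets lebesgue \<Longrightarrow> (\<lambda>x. h x * indicator S x) \<in> meas_L"
  and b: "\<And>\<rho>. 0 < \<rho> \<Longrightarrow> (\<integral>\<^sup>+x\<in>shell y \<rho>. h x \<partial>lebesgue) \<le> ennreal (A * \<rho> powr a)"
  and a: "a > 0" "A \<ge> 0" and r: "r > 0"
 shows "(\<integral>\<^sup>+x\<in>cball y r. h x \<partial>lebesgue) \<le> ennreal (A / (1 - 2 powr (- a)) * r powr a)"
proof -
 define S where "S = (\<lambda>j::nat. shell y (r / 2 ^ j))"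
 have q: "0 \<le> (2::real) powr (- a)" "(2::real) powr (- a) < 1" using a powr_less_mono[of "-a" 0 "2::real"] by auto
 have "(\<integral>\<^sup>+x\<in>cball y r - {y}. h x \<partial>lebesgue) \<le> ennreal ((A * r powr a) / (1 - 2 powr (- a)))"
 proof (rule nn_integral_shells[where S = S])
  show "(\<integral>\<^sup>+x\<in>S j. h x \<partial>lebesgue) \<le> ennreal (A * r powr a * (2 powr (- a)) ^ j)" for j
  proof -
   have "(\<integral>\<^sup>+x\<in>S j. h x \<partial>lebesgue) \<le> ennreal (A * (r / 2 ^ j) powr a)" unfolding S_def using r by (intro b) auto
   also have "(r / 2 ^ j) powr a = r powr a * (2 powr (- a)) ^ j"
   proof -
    have "((2::real) ^ j) powr a = (2 powr real j) powr a" by (simp add: powr_realpow)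
    also have "... = (2 powr a) ^ j" by (simp add: powr_powr powr_power mult.commute)
    finally have "((2::real) ^ j) powr a = (2 powr a) ^ j" .
    then show ?thesis using r by (simp add: powr_divide powr_minus power_inverse) (simp add: divide_inverse)
   qed
   finally show ?thesis by (simp add: mult.assoc)
  qed
  show "cball y r - {y} \<subseteq> (\<Union>j. S j)"
  proof
   fix x assume x: "x \<in> cball y r - {y}"
   define d where "d = dist y x"
   have d: "0 < d" "d \<le> r" using x by (auto simp: d_def)
   obtain j0 where "r / d < 2 ^ j0" using real_arch_pow[of 2 "r / d"] by auto
   then have ex: "r / 2 ^ j0 < d" using d by (simp add: field_simps)
   \<comment> \<open>The first radius below d; the preceding shell contains x.\<close>
   define j where "j = (LEAST j. r / 2 ^ j < d)"
   have j: "r / 2 ^ j < d" unfolding j_def by (rule LeastI[of _ j0]) (rule ex)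
   have "j \<noteq> 0" using j d by (cases j) auto
   then obtain i where i: "j = Suc i" by (cases j) auto
   have "\<not> r / 2 ^ i < d" using not_less_Least[of i "\<lambda>j. r / 2 ^ j < d"] i by (simp add: j_def)
   then have "x \<in> S i" using j i by (auto simp: S_def shell_def d_def)
   then show "x \<in> (\<Union>j. S j)" by blast
  qed
 qed (use m q a in \<open>auto simp: S_def\<close>)
 moreover have "(\<integral>\<^sup>+x\<in>cball y r. h x \<partial>lebesgue) = (\<integral>\<^sup>+x\<in>cball y r - {y}. h x \<partial>lebesgue)"
 proof (rule nn_integral_cong_AE)
  have "AE x in lebesgue. x \<notin> {y}" by (intro AE_not_in) (simp add: null_sets_completionI)
  then show "AE x in lebesgue. h x * indicator (cball y r) x = h x * indicator (cball y r - {y}) x" by eventually_elim (auto simp: indicator_def)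
 qed
 ultimately show ?thesis by (simp add: mult.commute)
qed

lemma outer_shells:
 fixes h :: "real^'n::finite \<Rightarrow> ennreal"
 assumes m: "\<And>S. S \<in> sets lebesgue \<Longrightarrow> (\<lambda>x. h x * indicator S x) \<in> meas_L"
  and b: "\<And>\<rho>. 0 < \<rho> \<Longrightarrow> (\<integral>\<^sup>+x\<in>shell y \<rho>. h x \<partial>lebesgue) \<le> ennreal (A * \<rho> powr (- a))"
  and a: "a > 0" "A \<ge> 0" and r: "r > 0"
 shows "(\<integral>\<^sup>+x\<in>- cball y r. h x \<partial>lebesgue) \<le> ennreal (A / (1 - 2 powr (- a)) * r powr (- a))"
proof -
 define S where "S = (\<lambda>j::nat. shell y (r * 2 ^ Suc j))"
 have q: "0 \<le> (2::real) powr (- a)" "(2::real) powr (- a) < 1" using a powr_less_mono[of "-a" 0 "2::real"] by auto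
 have "(\<integral>\<^sup>+x\<in>- cball y r. h x \<partial>lebesgue) \<le> ennreal ((A * r powr (- a)) / (1 - 2 powr (- a)))"
 proof (rule nn_integral_shells[where S = S])
  show "(\<integral>\<^sup>+x\<in>S j. h x \<partial>lebesgue) \<le> ennreal (A * r powr (- a) * (2 powr (- a)) ^ j)" for j
  proof -
   have "(\<integral>\<^sup>+x\<in>S j. h x \<partial>lebesgue) \<le> ennreal (A * (r * 2 ^ Suc j) powr (- a))"
    unfolding S_def using r by (intro b) auto
   \<comment> \<open>The exponent is negative, so rounding 2^(j+1) down to 2^j weakens the bound and
     lets the series start at r.\<close>
   also have "... \<le> ennreal (A * (r * 2 ^ j) powr (- a))" using r a by (intro ennreal_leI mult_left_mono powr_mono2') auto
   also have "(r * 2 ^ j) powr (- a) = r powr (- a) * (2 powr (- a)) ^ j"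
    using r by (simp add: powr_mult powr_power powr_realpow[symmetric] powr_powr mult.commute)
   finally show ?thesis by (simp add: mult.assoc)
  qed
  show "- cball y r \<subseteq> (\<Union>j. S j)"
  proof
   fix x assume x: "x \<in> - cball y r"
   define d where "d = dist y x"
   have d: "r < d" using x by (auto simp: d_def)
   obtain j0 where "d / r < 2 ^ j0" using real_arch_pow[of 2 "d / r"] by auto
   then have ex: "d \<le> r * 2 ^ j0" using r by (simp add: field_simps)
   define j where "j = (LEAST j. d \<le> r * 2 ^ j)"
   have j: "d \<le> r * 2 ^ j" unfolding j_def by (rule LeastI[of _ j0]) (rule ex)
   have "j \<noteq> 0" using j d by (cases j) auto
   then obtain i where i: "j = Suc i" by (cases j) auto
   have "\<not> d \<le> r * 2 ^ i" using not_less_Least[of i "\<lambda>j. d \<le> r * 2 ^ j"] i by (simp add: j_def)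
   then have "x \<in> S i" using j i by (auto simp: S_def shell_def d_def)
   then show "x \<in> (\<Union>j. S j)" by blast
  qed
 qed (use m q a in \<open>auto simp: S_def\<close>)
 then show ?thesis by (simp add: mult.commute)
qed

section \<open>Integrals of powers of the distance\<close>

abbreviation ball_vol :: "'n::finite itself \<Rightarrow> real" where
 "ball_vol _ \<equiv> unit_ball_vol (real CARD('n))"

lemma emeasure_cball_powr:
 "r > 0 \<Longrightarrow> emeasure lebesgue (cball (a :: real^'n::finite) r) = ennreal (ball_vol TYPE('n) * r powr real CARD('n))"
 by (simp add: emeasure_cball powr_realpow)

lemma kernel_measurable:
 "S \<in> sets lebesgue \<Longrightarrow> (\<lambda>x. ennreal (dist x y powr s) * indicator S x) \<in> meas_L"
proof -
 assume "S \<in> sets lebesgue"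
 moreover have "(\<lambda>x. ennreal (dist x y powr s)) \<in> meas_L" by (rule measurable_completion) auto
 ultimately show ?thesis by (intro borel_measurable_times_ennreal borel_measurable_indicator)
qed

lemma kernel_shell:
 fixes y :: "real^'n::finite"
 assumes "0 < \<rho>" "s \<ge> 0"
 shows "(\<integral>\<^sup>+x\<in>shell y \<rho>. ennreal (dist x y powr (- s)) \<partial>lebesgue)
  \<le> ennreal ((2 powr s * ball_vol TYPE('n)) * \<rho> powr (real CARD('n) - s))"
proof -
 have "(\<integral>\<^sup>+x\<in>shell y \<rho>. ennreal (dist x y powr (- s)) \<partial>lebesgue) \<le>
  (\<integral>\<^sup>+x\<in>cball y \<rho>. ennreal ((\<rho> / 2) powr (- s)) \<partial>lebesgue)"
 proof (intro nn_integral_mono)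
  fix x show "ennreal (dist x y powr (- s)) * indicator (shell y \<rho>) x \<le> ennreal ((\<rho> / 2) powr (- s)) * indicator (cball y \<rho>) x"
   using assms by (auto simp: indicator_def shell_def dist_commute intro!: ennreal_leI powr_mono2')
 qed
 also have "... = ennreal ((\<rho> / 2) powr (- s)) * ennreal (ball_vol TYPE('n) * \<rho> powr real CARD('n))"
  using assms emeasure_cball_powr[of \<rho> y] by (subst nn_integral_cmult_indicator) auto
 also have "... = ennreal ((\<rho> / 2) powr (- s) * (ball_vol TYPE('n) * \<rho> powr real CARD('n)))" using assms by (simp add: ennreal_mult)
 also have "(\<rho> / 2) powr (- s) * (ball_vol TYPE('n) * \<rho> powr real CARD('n)) = (2 powr s * ball_vol TYPE('n)) * \<rho> powr (real CARD('n) - s)"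
  using assms by (simp add: powr_divide powr_minus powr_diff field_simps)
 finally show ?thesis .
qed

text \<open>The absolute value lets one formula serve balls, where s < n, and complements of balls,
  where s > n.\<close>

definition kernel_const :: "'n::finite itself \<Rightarrow> real \<Rightarrow> real" where
 "kernel_const _ s = (2 powr s * ball_vol TYPE('n)) / (1 - 2 powr (- \<bar>real CARD('n) - s\<bar>))"

lemma two_powr_neg_less_1: "a > 0 \<Longrightarrow> (2::real) powr (- a) < 1"
 using powr_less_mono[of "-a" 0 "2::real"] by auto

lemma kernel_const_nonneg: "s \<noteq> real CARD('n) \<Longrightarrow> kernel_const TYPE('n::finite) s \<ge> 0"
 unfolding kernel_const_def using two_powr_neg_less_1[of "\<bar>real CARD('n) - s\<bar>"] by (intro divide_nonneg_pos) auto

lemma kernel_inner: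
 fixes y :: "real^'n::finite"
 assumes "r > 0" "0 \<le> s" "s < real CARD('n)"
 shows "(\<integral>\<^sup>+x\<in>cball y r. ennreal (dist x y powr (- s)) \<partial>lebesgue)
  \<le> ennreal (kernel_const TYPE('n) s * r powr (real CARD('n) - s))"
proof -
 have "(\<integral>\<^sup>+x\<in>cball y r. ennreal (dist x y powr (- s)) \<partial>lebesgue)
  \<le> ennreal ((2 powr s * ball_vol TYPE('n)) / (1 - 2 powr (- (real CARD('n) - s))) * r powr (real CARD('n) - s))"
  using assms by (intro inner_shells kernel_measurable kernel_shell) auto
 then show ?thesis using assms by (simp add: kernel_const_def)
qed

lemma kernel_outer:
 fixes y :: "real^'n::finite"
 assumes "r > 0" "s > real CARD('n)"
 shows "(\<integral>\<^sup>+x\<in>- cball y r. ennreal (dist x y powr (- s)) \<partial>lebesgue)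
  \<le> ennreal (kernel_const TYPE('n) s * r powr (real CARD('n) - s))"
proof -
 have sh: "(\<integral>\<^sup>+x\<in>shell y \<rho>. ennreal (dist x y powr (- s)) \<partial>lebesgue)
  \<le> ennreal ((2 powr s * ball_vol TYPE('n)) * \<rho> powr (- (s - real CARD('n))))" if "0 < \<rho>" for \<rho>
  using kernel_shell[OF that, of s y] assms by simp
 have "(\<integral>\<^sup>+x\<in>- cball y r. ennreal (dist x y powr (- s)) \<partial>lebesgue)
  \<le> ennreal ((2 powr s * ball_vol TYPE('n)) / (1 - 2 powr (- (s - real CARD('n)))) * r powr (- (s - real CARD('n))))"
  using assms by (intro outer_shells kernel_measurable sh) auto
 then show ?thesis using assms by (simp add: kernel_const_def)
qed

lemma kernel_Lq:
 fixes f :: "real^'n::finite \<Rightarrow> 'b::euclidean_space"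
 assumes C: "C \<ge> 0" and f: "\<And>x. x \<in> U \<Longrightarrow> x \<noteq> y \<Longrightarrow> norm (f x) \<le> C * dist x y powr (- s)" and q: "q > 0"
  and S: "S \<in> sets lebesgue"
 shows "(\<integral>\<^sup>+x\<in>U \<inter> S. ennreal (norm (f x) powr q) \<partial>lebesgue)
  \<le> ennreal (C powr q) * (\<integral>\<^sup>+x\<in>S. ennreal (dist x y powr (- (s * q))) \<partial>lebesgue)"
proof -
 have "AE x in lebesgue. x \<notin> {y}" by (intro AE_not_in) (simp add: null_sets_completionI)
 then have "AE x in lebesgue. ennreal (norm (f x) powr q) * indicator (U \<inter> S) x \<le> ennreal (C powr q) * (ennreal (dist x y powr (- (s * q))) * indicator S x)"
 proof eventually_elim
  case (elim x)
  show ?case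
  proof (cases "x \<in> U \<inter> S")
   case True
   have "norm (f x) powr q \<le> (C * dist x y powr (- s)) powr q" using f[of x] True elim q by (intro powr_mono2) auto
   also have "... = C powr q * dist x y powr (- (s * q))" using C by (simp add: powr_mult powr_powr)
   finally show ?thesis using True by (auto simp: ennreal_mult[symmetric] intro!: ennreal_leI)
  qed simp
 qed
 then have "(\<integral>\<^sup>+x\<in>U \<inter> S. ennreal (norm (f x) powr q) \<partial>lebesgue) \<le>
  (\<integral>\<^sup>+x. ennreal (C powr q) * (ennreal (dist x y powr (- (s * q))) * indicator S x) \<partial>lebesgue)"
  by (rule nn_integral_mono_AE)
 also have "... = ennreal (C powr q) * (\<integral>\<^sup>+x\<in>S. ennreal (dist x y powr (- (s * q))) \<partial>lebesgue)"
  by (rule nn_integral_cmult[OF kernel_measurable[OF S]])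
 finally show ?thesis .
qed

text \<open>Splitting at a level t replaces Hoelder's inequality on a shell; t is free and is later
  set to the expected size of the function.\<close>

lemma powr_le_square: "0 < q \<Longrightarrow> q \<le> 2 \<Longrightarrow> t > 0 \<Longrightarrow> (g::real) \<ge> 0 \<Longrightarrow> g powr q \<le> t powr q + t powr (q - 2) * g^2"
proof -
 assume a: "0 < q" "q \<le> 2" "t > 0" "g \<ge> 0"
 show ?thesis
 proof (cases "g \<le> t")
  case True
  then have "g powr q \<le> t powr q" using a by (intro powr_mono2) auto
  then show ?thesis by (simp add: add_increasing2)
 next
  case False
  then have "g powr q = g powr (q - 2) * g^2" using a by (simp add: powr_diff)
  also have "... \<le> t powr (q - 2) * g^2" using False a by (intro mult_right_mono powr_mono2') auto
  finally show ?thesis by (simp add: add_increasing)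
 qed
qed

section \<open>Functions whose square integral is controlled away from a pole\<close>

context
 fixes U :: "(real^'n::finite) set" and D :: "real^'n \<Rightarrow> 'b::euclidean_space" and y :: "real^'n" and C :: real
 assumes U: "U \<in> sets lebesgue" and D: "D \<in> meas_on U" and C: "C \<ge> 0"
  and tail: "\<And>t. t > 0 \<Longrightarrow> L2sq (U - cball y t) D \<le> ennreal (C * t powr (2 - real CARD('n)))"
begin

lemma tail_Lq:
 assumes q: "1 \<le> q" "q \<le> 2" "q * (real CARD('n) - 1) < real CARD('n)" and r: "r > 0"
 shows "(\<integral>\<^sup>+x\<in>U \<inter> cball y r. ennreal (norm (D x) powr q) \<partial>lebesgue)
  \<le> ennreal ((ball_vol TYPE('n) + C * 2 powr (real CARD('n) - 2)) / (1 - 2 powr (- (real CARD('n) - q * (real CARD('n) - 1)))) *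
    r powr (real CARD('n) - q * (real CARD('n) - 1)))"
proof -
 let ?n = "real CARD('n)"
 have mD: "(\<lambda>x. ennreal (norm (D x) powr p) * indicator S x) \<in> meas_L" if "S \<in> sets lebesgue" "S \<subseteq> U" for p S
  by (rule measurable_indicator_comp[OF U D _ that, of "\<lambda>v. ennreal (norm v powr p)"]) auto
 have m2: "(\<lambda>x. ennreal ((norm (D x))^2) * indicator S x) \<in> meas_L" if "S \<in> sets lebesgue" "S \<subseteq> U" for S
  by (rule measurable_indicator_comp[OF U D _ that, of "\<lambda>v. ennreal ((norm v)^2)"]) auto
 have "(\<integral>\<^sup>+x\<in>cball y r. ennreal (norm (D x) powr q) * indicator U x \<partial>lebesgue)
  \<le> ennreal ((ball_vol TYPE('n) + C * 2 powr (?n - 2)) / (1 - 2 powr (- (?n - q * (?n - 1)))) * r powr (?n - q * (?n - 1)))"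
 proof (rule inner_shells)
  fix S :: "(real^'n) set" assume "S \<in> sets lebesgue"
  then show "(\<lambda>x. ennreal (norm (D x) powr q) * indicator U x * indicator S x) \<in> meas_L"
   by (intro borel_measurable_times_ennreal[OF mD[OF U order_refl] borel_measurable_indicator])
 next
  fix \<rho> :: real assume \<rho>: "0 < \<rho>"
  \<comment> \<open>The expected size of a gradient at distance \<rho>; with this level both terms
    of the splitting scale like \<rho> to the power n - q (n - 1).\<close>
  define t where "t = \<rho> powr (1 - ?n)"
  have t: "t > 0" using \<rho> by (simp add: t_def)
  let ?S = "U - cball y (\<rho> / 2)"
  have S: "?S \<in> sets lebesgue" "?S \<subseteq> U" using U by auto
  have "(\<integral>\<^sup>+x\<in>shell y \<rho>. ennreal (norm (D x) powr q) * indicator U x \<partial>lebesgue) \<le>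
   (\<integral>\<^sup>+x. ennreal (t powr q) * indicator (cball y \<rho>) x + ennreal (t powr (q - 2)) * (ennreal ((norm (D x))^2) * indicator ?S x) \<partial>lebesgue)"
  proof (intro nn_integral_mono)
   fix x
   have "ennreal (norm (D x) powr q) \<le> ennreal (t powr q + t powr (q - 2) * (norm (D x))^2)"
    using q t by (intro ennreal_leI powr_le_square) auto
   also have "... = ennreal (t powr q) + ennreal (t powr (q - 2)) * ennreal ((norm (D x))^2)" by (simp add: ennreal_mult)
   finally show "ennreal (norm (D x) powr q) * indicator U x * indicator (shell y \<rho>) x \<le>
    ennreal (t powr q) * indicator (cball y \<rho>) x + ennreal (t powr (q - 2)) * (ennreal ((norm (D x))^2) * indicator ?S x)"
    by (auto simp: indicator_def shell_def)
  qed
  also have "... = (\<integral>\<^sup>+x\<in>cball y \<rho>. ennreal (t powr q) \<partial>lebesgue) + (\<integral>\<^sup>+x. ennreal (t powr (q - 2)) * (ennreal ((norm (D x))^2) * indicator ?S x) \<partial>lebesgue)"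
   by (intro nn_integral_add borel_measurable_times_ennreal[OF borel_measurable_const m2[OF S]]
     borel_measurable_times_ennreal[OF borel_measurable_const borel_measurable_indicator]) auto
  also have "(\<integral>\<^sup>+x\<in>cball y \<rho>. ennreal (t powr q) \<partial>lebesgue) = ennreal (t powr q) * ennreal (ball_vol TYPE('n) * \<rho> powr ?n)"
   using emeasure_cball_powr[OF \<rho>, of y] by (subst nn_integral_cmult_indicator) auto
  also have "(\<integral>\<^sup>+x. ennreal (t powr (q - 2)) * (ennreal ((norm (D x))^2) * indicator ?S x) \<partial>lebesgue) = ennreal (t powr (q - 2)) * L2sq ?S D"
   unfolding L2sq_def by (rule nn_integral_cmult[OF m2[OF S]])
  also have "... \<le> ennreal (t powr (q - 2)) * ennreal (C * (\<rho> / 2) powr (2 - ?n))" using \<rho> by (intro mult_left_mono tail) auto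
  also have "ennreal (t powr q) * ennreal (ball_vol TYPE('n) * \<rho> powr ?n) + ennreal (t powr (q - 2)) * ennreal (C * (\<rho> / 2) powr (2 - ?n)) =
   ennreal (t powr q * (ball_vol TYPE('n) * \<rho> powr ?n) + t powr (q - 2) * (C * (\<rho> / 2) powr (2 - ?n)))"
   using C by (simp add: ennreal_mult)
  also have "t powr q * (ball_vol TYPE('n) * \<rho> powr ?n) + t powr (q - 2) * (C * (\<rho> / 2) powr (2 - ?n)) =
   (ball_vol TYPE('n) + C * 2 powr (?n - 2)) * \<rho> powr (?n - q * (?n - 1))"
  proof -
   have "t powr q * \<rho> powr ?n = \<rho> powr (?n - q * (?n - 1))" unfolding t_def powr_powr powr_add[symmetric] by (simp add: algebra_simps)
   moreover have "t powr (q - 2) * (\<rho> / 2) powr (2 - ?n) = 2 powr (?n - 2) * \<rho> powr (?n - q * (?n - 1))"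
   proof -
    have "(\<rho> / 2) powr (2 - ?n) = \<rho> powr (2 - ?n) * 2 powr (?n - 2)" using \<rho> by (simp add: powr_divide powr_diff)
    moreover have "t powr (q - 2) * \<rho> powr (2 - ?n) = \<rho> powr (?n - q * (?n - 1))"
     unfolding t_def powr_powr powr_add[symmetric] by (simp add: algebra_simps)
    ultimately show ?thesis by simp
   qed
   ultimately show ?thesis by (simp add: algebra_simps)
  qed
  finally show "(\<integral>\<^sup>+x\<in>shell y \<rho>. ennreal (norm (D x) powr q) * indicator U x \<partial>lebesgue) \<le>
   ennreal ((ball_vol TYPE('n) + C * 2 powr (?n - 2)) * \<rho> powr (?n - q * (?n - 1)))" by (simp add: add_left_mono)
 qed (use q r C in auto)
 moreover have "ennreal (norm (D x) powr q) * indicator U x * indicator (cball y r) x = ennreal (norm (D x) powr q) * indicator (U \<inter> cball y r) x" for x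
  by (auto simp: indicator_def)
 ultimately show ?thesis by simp
qed

lemma tail_weak_type:
 assumes n: "CARD('n) \<ge> 3" and \<tau>: "\<tau> > 0"
 shows "emeasure lebesgue {z\<in>U. norm (D z) > \<tau>} \<le> ennreal ((ball_vol TYPE('n) + C) * \<tau> powr (- real CARD('n) / (real CARD('n) - 1)))"
proof -
 let ?n = "real CARD('n)"
 have n': "?n \<ge> 3" using n by linarith
 \<comment> \<open>The radius at which the expected size r^(1-n) equals \<tau>: inside, the level
   set costs at most the volume of the ball; outside, Chebyshev's inequality applies to the
   tail.\<close>
 define r where "r = \<tau> powr (- 1 / (?n - 1))"
 have r: "r > 0" using \<tau> by (simp add: r_def)
 let ?S = "U - cball y r"
 have S: "?S \<in> sets lebesgue" "?S \<subseteq> U" using U by auto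
 have m2: "(\<lambda>x. ennreal ((norm (D x))^2) * indicator ?S x) \<in> meas_L"
  by (rule measurable_indicator_comp[OF U D _ S, of "\<lambda>v. ennreal ((norm v)^2)"]) auto
 have E: "{z\<in>U. norm (D z) > \<tau>} \<in> sets lebesgue"
 proof -
  have "{z \<in> space (lebesgue_on U). norm (D z) > \<tau>} \<in> sets (lebesgue_on U)" using D by measurable
  then show ?thesis using U by (simp add: sets_restrict_space_iff space_restrict_space)
 qed
 have "emeasure lebesgue {z\<in>U. norm (D z) > \<tau>} = (\<integral>\<^sup>+x. indicator {z\<in>U. norm (D z) > \<tau>} x \<partial>lebesgue)" using E by simp
 also have "... \<le> (\<integral>\<^sup>+x. indicator (cball y r) x + ennreal (1 / \<tau>^2) * (ennreal ((norm (D x))^2) * indicator ?S x) \<partial>lebesgue)"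
 proof (intro nn_integral_mono)
  fix x
  show "indicator {z\<in>U. norm (D z) > \<tau>} x \<le> indicator (cball y r) x + ennreal (1 / \<tau>^2) * (ennreal ((norm (D x))^2) * indicator ?S x)"
  proof (cases "x \<in> ?S \<and> norm (D x) > \<tau>")
   case True
   then have "\<tau>^2 \<le> (norm (D x))^2" using \<tau> by (intro power_mono) auto
   then have "1 \<le> 1 / \<tau>^2 * (norm (D x))^2" using \<tau> by (simp add: field_simps)
   then have "ennreal 1 \<le> ennreal (1 / \<tau>^2) * ennreal ((norm (D x))^2)"
    using \<tau> by (subst ennreal_mult[symmetric]) (auto intro!: ennreal_leI)
   then show ?thesis using True by (auto simp: indicator_def)
  qed (auto simp: indicator_def)
 qed
 also have "... = (\<integral>\<^sup>+x. indicator (cball y r) x \<partial>lebesgue) + (\<integral>\<^sup>+x. ennreal (1 / \<tau>^2) * (ennreal ((norm (D x))^2) * indicator ?S x) \<partial>lebesgue)"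
  by (intro nn_integral_add borel_measurable_times_ennreal[OF borel_measurable_const m2] borel_measurable_indicator) auto
 also have "(\<integral>\<^sup>+x. indicator (cball y r) x \<partial>lebesgue) = ennreal (ball_vol TYPE('n) * r powr ?n)"
  using emeasure_cball_powr[OF r, of y] by (subst nn_integral_indicator) auto
 also have "(\<integral>\<^sup>+x. ennreal (1 / \<tau>^2) * (ennreal ((norm (D x))^2) * indicator ?S x) \<partial>lebesgue) = ennreal (1 / \<tau>^2) * L2sq ?S D"
  unfolding L2sq_def by (rule nn_integral_cmult[OF m2])
 also have "ennreal (ball_vol TYPE('n) * r powr ?n) + ennreal (1 / \<tau>^2) * L2sq ?S D \<le> ennreal (ball_vol TYPE('n) * r powr ?n) + ennreal (1 / \<tau>^2) * ennreal (C * r powr (2 - ?n))"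
  using r by (intro add_left_mono mult_left_mono tail) auto
 also have "... = ennreal (ball_vol TYPE('n) * r powr ?n + 1 / \<tau>^2 * (C * r powr (2 - ?n)))"
  using C \<tau> by (simp add: ennreal_mult[symmetric])
 also have "ball_vol TYPE('n) * r powr ?n + 1 / \<tau>^2 * (C * r powr (2 - ?n)) = (ball_vol TYPE('n) + C) * \<tau> powr (- ?n / (?n - 1))"
 proof -
  have "r powr ?n = \<tau> powr (- ?n / (?n - 1))" unfolding r_def powr_powr by simp
  moreover have "1 / \<tau>^2 * r powr (2 - ?n) = \<tau> powr (- ?n / (?n - 1))"
  proof -
   have "1 / \<tau>^2 = \<tau> powr (- 2)" using \<tau> by (simp add: powr_minus divide_inverse)
   then have "1 / \<tau>^2 * r powr (2 - ?n) = \<tau> powr (- 2 + - 1 / (?n - 1) * (2 - ?n))" unfolding r_def powr_powr powr_add by simp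
   also have "- 2 + - 1 / (?n - 1) * (2 - ?n) = - ?n / (?n - 1)"
   proof -
    have "- 2 + - 1 / (c - 1) * (2 - c) = - c / (c - 1)" if "c \<ge> 3" for c :: real using that by (simp add: field_simps)
    from this[OF n'] show ?thesis .
   qed
   finally show ?thesis .
  qed
  ultimately show ?thesis by (simp add: algebra_simps)
 qed
 finally show ?thesis .
qed

end

subsection \<open>Strong limits of gradients away from the pole\<close>

lemma half_powr: "d \<ge> 0 \<Longrightarrow> (d / 2) powr (- s) = 2 powr s * (d::real) powr (- s)"
 by (simp add: powr_divide powr_minus_divide)

text \<open>The Bochner integral of a non-integrable function is 0 by convention, so the bound is
  true in that case as well.\<close>

lemma norm_integral_le_nn:
 fixes f :: "'a \<Rightarrow> 'b::{banach, second_countable_topology}"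
 assumes "(\<integral>\<^sup>+x. ennreal (norm (f x)) \<partial>M) \<le> ennreal V" "V \<ge> 0"
 shows "norm (\<integral>x. f x \<partial>M) \<le> V"
proof (cases "integrable M f")
 case True
 have "ennreal (norm (\<integral>x. f x \<partial>M)) \<le> ennreal V" by (rule order_trans[OF integral_norm_bound_ennreal[OF True] assms(1)])
 then show ?thesis using assms(2) by (simp add: ennreal_le_iff)
next
 case False then show ?thesis using assms(2) by (simp add: not_integrable_integral_eq)
qed

lemma L2sq_fatou:
 fixes f :: "nat \<Rightarrow> real^'n::finite \<Rightarrow> 'b::euclidean_space"
 assumes U: "U \<in> sets lebesgue" and m: "\<And>i. f i \<in> meas_on U"
  and S: "S \<in> sets lebesgue" "S \<subseteq> U" and lim: "AE z in lebesgue. z \<in> S \<longrightarrow> (\<lambda>i. f i z) \<longlonglongrightarrow> g z"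
  and b: "\<And>i. i \<ge> (i0::nat) \<Longrightarrow> L2sq S (f i) \<le> c"
 shows "L2sq S g \<le> c"
proof -
 have mi: "(\<lambda>x. ennreal ((norm (f i x))^2) * indicator S x) \<in> meas_L" for i
  by (rule measurable_indicator_comp[OF U m _ S, of "\<lambda>v. ennreal ((norm v)^2)"]) auto
 have "L2sq S g = (\<integral>\<^sup>+x. liminf (\<lambda>i. ennreal ((norm (f i x))^2) * indicator S x) \<partial>lebesgue)" unfolding L2sq_def
 proof (rule nn_integral_cong_AE)
  show "AE x in lebesgue. ennreal ((norm (g x))^2) * indicator S x = liminf (\<lambda>i. ennreal ((norm (f i x))^2) * indicator S x)"
   using lim
  proof eventually_elim
   case (elim x)
   show ?case
   proof (cases "x \<in> S")
    case True
    then have "(\<lambda>i. f i x) \<longlonglongrightarrow> g x" using elim by simp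
    then have "(\<lambda>i. ennreal ((norm (f i x))^2)) \<longlonglongrightarrow> ennreal ((norm (g x))^2)"
     by (intro tendsto_ennrealI tendsto_power tendsto_norm)
    from lim_imp_Liminf[OF _ this] show ?thesis using True by simp
   qed (simp add: Liminf_const)
  qed
 qed
 also have "... \<le> liminf (\<lambda>i. L2sq S (f i))" unfolding L2sq_def by (rule nn_integral_liminf[OF mi])
 also have "... \<le> liminf (\<lambda>i. c)" by (intro Liminf_mono eventually_sequentiallyI[of i0] b)
 also have "... = c" by (rule Liminf_const) simp
 finally show ?thesis .
qed

text \<open>|d i| \<le> 2^i |d i|^2 + 2^-i compares the sequence with two convergent series.\<close>

lemma summable_of_weighted_squares:
 fixes d :: "nat \<Rightarrow> 'b::banach"
 assumes "(\<Sum>i. ennreal (2 ^ i * (norm (d i))^2)) \<noteq> \<infinity>"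
 shows "summable d"
proof -
 have s: "summable (\<lambda>i. 2 ^ i * (norm (d i))^2)" by (rule summable_suminf_not_top) (use assms in auto)
 have g: "summable (\<lambda>i. (1/2::real) ^ i)" by (rule summable_geometric) simp
 have "norm (d i) \<le> 2 ^ i * (norm (d i))^2 + (1/2) ^ i" for i
 proof -
  have "norm (d i) powr 1 \<le> ((1/2) ^ i) powr 1 + ((1/2) ^ i) powr (1 - 2) * (norm (d i))^2" by (rule powr_le_square) auto
  moreover have "((1/2::real) ^ i) powr (1 - 2) = 2 ^ i" by (simp add: powr_neg_one power_one_over)
  ultimately show ?thesis by (simp only: powr_one_gt_zero_iff norm_ge_zero) (simp add: power_one_over)
 qed
 then show ?thesis using summable_comparison_test'[OF summable_add[OF s g], of 0 d] by auto
qed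

text \<open>Completeness of L2 away from the pole, carried out by hand with one subsequence for all
  radii. The k-th error is measured outside the ball of radius 2^-k and is 16^-k, so accuracy
  outruns the shrinking of the excluded ball; this rate later allows the limit to be taken across
  the pole.\<close>

lemma tail_limit:
 fixes D :: "nat \<Rightarrow> real^'n::finite \<Rightarrow> 'b::euclidean_space"
 assumes U: "U \<in> sets lebesgue" and m: "\<And>i. D i \<in> meas_on U"
  and cau: "\<And>t e. t > 0 \<Longrightarrow> e > 0 \<Longrightarrow> \<exists>I. \<forall>i\<ge>I. \<forall>j\<ge>I. L2sq (U - cball y t) (\<lambda>x. D i x - D j x) \<le> ennreal e"
  and bd: "\<And>i t. t > 0 \<Longrightarrow> L2sq (U - cball y t) (D i) \<le> ennreal (f t)"
 shows "\<exists>E \<sigma>. E \<in> meas_on U \<and> (\<forall>k. k \<le> \<sigma> k) \<and> (\<forall>t>0. L2sq (U - cball y t) E \<le> ennreal (f t)) \<and>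
  (\<forall>k. L2sq (U - cball y (1 / 2 ^ k)) (\<lambda>x. D (\<sigma> k) x - E x) \<le> ennreal ((1/16) ^ k))"
proof -
 define S where "S = (\<lambda>k::nat. U - cball y (1 / 2 ^ k))"
 have S: "S k \<in> sets lebesgue" "S k \<subseteq> U" for k using U by (auto simp: S_def)
 have "\<exists>I. \<forall>i\<ge>I. \<forall>j\<ge>I. L2sq (S k) (\<lambda>x. D i x - D j x) \<le> ennreal ((1/16) ^ k)" for k
  unfolding S_def by (rule cau) auto
 then obtain I where I: "\<And>k i j. i \<ge> I k \<Longrightarrow> j \<ge> I k \<Longrightarrow> L2sq (S k) (\<lambda>x. D i x - D j x) \<le> ennreal ((1/16) ^ k)"
  by metis
 \<comment> \<open>Summing makes \<open>\<sigma> i\<close> at least \<open>I k\<close> for every k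
   \<le> i, so that one sequence is Cauchy off every ball; the summand k makes it unbounded.\<close>
 define \<sigma> where "\<sigma> = (\<lambda>k. k + (\<Sum>l\<le>k. I l))"
 have \<sigma>: "k \<le> \<sigma> k" for k by (simp add: \<sigma>_def)
 have \<sigma>I: "I k \<le> \<sigma> i" if "k \<le> i" for k i
 proof -
  have "I k \<le> (\<Sum>l\<le>i. I l)" by (rule member_le_sum[of k "{..i}" I]) (use that in auto)
  then show ?thesis by (simp add: \<sigma>_def)
 qed
 define A where "A = (\<lambda>i x. indicator U x *\<^sub>R D (\<sigma> i) x)"
 have mA: "A i \<in> meas_L" for i unfolding A_def by (rule indicator_measurable_on[OF U m])
 have AU: "A i x = D (\<sigma> i) x" if "x \<in> U" for i x using that by (simp add: A_def)
 have cauS: "L2sq (S k) (\<lambda>x. D (\<sigma> i) x - D (\<sigma> j) x) \<le> ennreal ((1/16) ^ k)" if "k \<le> i" "k \<le> j" for k i j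
  by (rule I[OF \<sigma>I[OF that(1)] \<sigma>I[OF that(2)]])
 have conv: "AE x in lebesgue. x \<in> S k \<longrightarrow> convergent (\<lambda>i. A i x)" for k
 proof -
  let ?d = "\<lambda>i x. A (Suc (k + i)) x - A (k + i) x"
  have mm: "(\<lambda>x. ennreal (2 ^ i * (norm (?d i x))^2) * indicator (S k) x) \<in> meas_L" for i
  proof (intro borel_measurable_times_ennreal borel_measurable_indicator S)
   have "(\<lambda>x. ?d i x) \<in> meas_L" by (intro borel_measurable_diff mA)
   then show "(\<lambda>x. ennreal (2 ^ i * (norm (?d i x))^2)) \<in> meas_L" by (rule measurable_compose) measurable
  qed
  \<comment> \<open>The weight 2^i prepares the summability criterion; square integrals of order
    16^-i still leave 8^-i.\<close>
  have tb: "(\<integral>\<^sup>+x\<in>S k. ennreal (2 ^ i * (norm (?d i x))^2) \<partial>lebesgue) \<le> ennreal ((1/8) ^ i)" for i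
  proof -
   have "S k \<subseteq> S (k + i)"
   proof -
    have "1 / 2 ^ (k + i) \<le> (1::real) / 2 ^ k" by (intro divide_left_mono power_increasing) auto
    then show ?thesis by (auto simp: S_def)
   qed
   have "(\<integral>\<^sup>+x\<in>S k. ennreal (2 ^ i * (norm (?d i x))^2) \<partial>lebesgue) \<le>
    (\<integral>\<^sup>+x. ennreal (2 ^ i) * (ennreal ((norm (D (\<sigma> (Suc (k + i))) x - D (\<sigma> (k + i)) x))^2) * indicator (S (k + i)) x) \<partial>lebesgue)"
   proof (intro nn_integral_mono)
    fix x
    show "ennreal (2 ^ i * (norm (?d i x))^2) * indicator (S k) x \<le>
     ennreal (2 ^ i) * (ennreal ((norm (D (\<sigma> (Suc (k + i))) x - D (\<sigma> (k + i)) x))^2) * indicator (S (k + i)) x)"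
    proof (cases "x \<in> S k")
     case True
     then have "x \<in> S (k + i)" "x \<in> U" using \<open>S k \<subseteq> S (k + i)\<close> S by auto
     then show ?thesis using True by (simp add: AU ennreal_mult)
    qed simp
   qed
   also have "... = ennreal (2 ^ i) * L2sq (S (k + i)) (\<lambda>x. D (\<sigma> (Suc (k + i))) x - D (\<sigma> (k + i)) x)" unfolding L2sq_def
    by (rule nn_integral_cmult)
      (rule measurable_indicator_comp[OF U borel_measurable_diff[OF m m] _ S, of "\<lambda>v. ennreal ((norm v)^2)"], measurable)
   also have "... \<le> ennreal (2 ^ i) * ennreal ((1/16) ^ (k + i))" by (intro mult_left_mono cauS) auto
   also have "... \<le> ennreal ((1/8) ^ i)"
   proof -
    have "(2::real) ^ i * (1/16) ^ (k + i) \<le> 2 ^ i * (1/16) ^ i" by (intro mult_left_mono power_decreasing) auto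
    also have "... = (1/8) ^ i" by (simp flip: power_mult_distrib)
    finally show ?thesis by (simp add: ennreal_mult[symmetric] ennreal_leI)
   qed
   finally show ?thesis .
  qed
  have "(\<Sum>i. \<integral>\<^sup>+x\<in>S k. ennreal (2 ^ i * (norm (?d i x))^2) \<partial>lebesgue) \<le> (\<Sum>i. ennreal ((1/8) ^ i))"
   by (intro suminf_le tb) auto
  also have "(\<Sum>i. ennreal ((1/8) ^ i)) < \<infinity>"
  proof -
   have "(\<Sum>i. ennreal ((1/8) ^ i)) = ennreal (\<Sum>i. (1/8) ^ i)"
    by (rule suminf_ennreal2) (rule zero_le_power, simp, rule summable_geometric, simp)
   then show ?thesis by (simp only: ennreal_less_top infinity_ennreal_def)
  qed
  finally have "(\<integral>\<^sup>+x. (\<Sum>i. ennreal (2 ^ i * (norm (?d i x))^2) * indicator (S k) x) \<partial>lebesgue) \<noteq> \<infinity>"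
   by (subst nn_integral_suminf[OF mm]) auto
  then have "AE x in lebesgue. (\<Sum>i. ennreal (2 ^ i * (norm (?d i x))^2) * indicator (S k) x) \<noteq> \<infinity>"
   by (intro nn_integral_noteq_infinite borel_measurable_suminf_order mm)
  then show ?thesis
  proof eventually_elim
   case (elim x)
   show ?case
   proof
    assume "x \<in> S k"
    then have "summable (\<lambda>i. ?d i x)" using elim by (intro summable_of_weighted_squares) simp
    then have "convergent (\<lambda>n. \<Sum>i<n. ?d i x)" by (simp add: summable_iff_convergent)
    moreover have "(\<Sum>i<n. ?d i x) = A (n + k) x - A k x" for n by (induction n) (auto simp: add.commute)
    ultimately have "convergent (\<lambda>n. (A (n + k) x - A k x) + A k x)" by (intro convergent_add convergent_const) simp
    then show "convergent (\<lambda>i. A i x)" using convergent_ignore_initial_segment[of "\<lambda>i. A i x" k] by simp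
   qed
  qed
 qed
 define E where "E = (\<lambda>x. lim (\<lambda>i. A i x))"
 have mE: "E \<in> meas_L" unfolding E_def by (rule borel_measurable_lim_metric[OF mA])
 have "AE x in lebesgue. \<forall>k. x \<in> S k \<longrightarrow> convergent (\<lambda>i. A i x)" unfolding AE_all_countable using conv by blast
 then have limE: "AE x in lebesgue. x \<in> U - {y} \<longrightarrow> (\<lambda>i. D (\<sigma> i) x) \<longlonglongrightarrow> E x"
 proof eventually_elim
  case (elim x)
  show ?case
  proof
   assume x: "x \<in> U - {y}"
   then have "dist y x > 0" by auto
   then obtain k where "(1/2::real) ^ k < dist y x" using real_arch_pow_inv[of "dist y x" "1/2"] by auto
   then have "x \<in> S k" using x by (auto simp: S_def power_one_over)
   then have "(\<lambda>i. A i x) \<longlonglongrightarrow> E x" using elim unfolding E_def convergent_LIMSEQ_iff by blast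
   then show "(\<lambda>i. D (\<sigma> i) x) \<longlonglongrightarrow> E x" using x by (simp add: AU)
  qed
 qed
 have "L2sq (U - cball y t) E \<le> ennreal (f t)" if t: "t > 0" for t
 proof (rule L2sq_fatou[OF U, where f = "\<lambda>i. D (\<sigma> i)" and ?i0.0 = 0])
  show "AE z in lebesgue. z \<in> U - cball y t \<longrightarrow> (\<lambda>i. D (\<sigma> i) z) \<longlonglongrightarrow> E z"
   using limE by eventually_elim (use t in auto)
 qed (use m bd t U in auto)
 moreover have "L2sq (S k) (\<lambda>x. D (\<sigma> k) x - E x) \<le> ennreal ((1/16) ^ k)" for k
 proof (rule L2sq_fatou[OF U, where f = "\<lambda>i x. D (\<sigma> k) x - D (\<sigma> i) x" and ?i0.0 = k])
  show "AE z in lebesgue. z \<in> S k \<longrightarrow> (\<lambda>i. D (\<sigma> k) z - D (\<sigma> i) z) \<longlonglongrightarrow> D (\<sigma> k) z - E z"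
   using limE by eventually_elim (auto simp: S_def intro!: tendsto_diff)
 qed (use m S cauS in \<open>auto intro!: borel_measurable_diff\<close>)
 ultimately show ?thesis using measurable_restrict_space1[OF mE] \<sigma> unfolding S_def by blast
qed

section \<open>Bounds for the averaged kernels, uniform in the averaging radius\<close>

context green_kernel
begin

definition s :: real where "s = real CARD('a) - 2"

lemma s_bounds: "0 < s" "s < real CARD('a)" "s \<ge> 1" using n_ge_3 by (auto simp: s_def)

definition "C1' = C1 * 2 powr s"

lemma C1'_nonneg: "C1' \<ge> 0" using C1_nonneg by (simp add: C1'_def)

lemma G_row_bound':
 assumes "x \<in> W" "y \<in> W" "x \<noteq> y"
 shows "norm (G x y $ k) \<le> C1' * dist x y powr (- s)"
proof -
 have "norm (G x y $ k) \<le> C1 * (dist x y / 2) powr (- s)" using G_row_bound[OF assms, of k] by (simp add: s_def)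
 also have "(dist x y / 2) powr (- s) = 2 powr s * dist x y powr (- s)" by (simp add: half_powr)
 finally show ?thesis by (simp add: C1'_def mult.assoc)
qed

definition \<omega> :: real where "\<omega> = ball_vol TYPE('a)"

lemma \<omega>_pos: "\<omega> > 0" by (simp add: \<omega>_def)

lemma vol_powr: "q > 0 \<Longrightarrow> vol q = \<omega> * q powr real CARD('a)"
 by (simp add: vol_def \<omega>_def powr_realpow)

definition Ck :: real where "Ck = kernel_const TYPE('a) s"

lemma Ck_nonneg: "Ck \<ge> 0" unfolding Ck_def using s_bounds by (intro kernel_const_nonneg) auto

text \<open>\<open>CARD('b)\<close> passes from components to the norm. In the bracket, 1 is the
  share of points far from the averaging ball, and 9 = 3^2 belongs to points near it.\<close>

definition "C2 = real CARD('b) * (C1' * 2 powr s * (1 + 9 * Ck / \<omega>))"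

lemma C2_nonneg: "C2 \<ge> 0"
 using C1'_nonneg Ck_nonneg \<omega>_pos by (simp add: C2_def)

text \<open>Averaging the kernel over a ball loses only a constant against its value at the centre,
  because s < n: for distant z half the distance survives, and for z near the ball the singularity
  is integrated out. Uniformity in q makes this a dominating function as q tends to 0.\<close>

lemma approx_pointwise:
 assumes q: "0 < q" "cball x q \<subseteq> W" and z: "z \<in> W" "z \<noteq> x"
 shows "norm (approx x q k z) \<le> C2 * dist x z powr (- s)"
proof -
 define d where "d = dist x z"
 have d: "d > 0" using z by (simp add: d_def)
 define V where "V = C1' * 2 powr s * (1 + 9 * Ck / \<omega>) * d powr (- s)"
 have V0: "V \<ge> 0" using C1'_nonneg Ck_nonneg \<omega>_pos by (simp add: V_def)
 have kerb: "(\<integral>\<^sup>+z'\<in>ball x q. ennreal (dist z' z powr (- s)) \<partial>lebesgue) \<le> ennreal (2 powr s * (1 + 9 * Ck / \<omega>) * d powr (- s) * vol q)"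
 proof (cases "d \<ge> 2 * q")
  case True
  have "(\<integral>\<^sup>+z'\<in>ball x q. ennreal (dist z' z powr (- s)) \<partial>lebesgue) \<le>
   (\<integral>\<^sup>+z'\<in>ball x q. ennreal ((d / 2) powr (- s)) \<partial>lebesgue)"
  proof (intro nn_integral_mono)
   fix z'
   show "ennreal (dist z' z powr (- s)) * indicator (ball x q) z' \<le> ennreal ((d / 2) powr (- s)) * indicator (ball x q) z'"
   proof (cases "z' \<in> ball x q")
    case t: True
    then have "d / 2 \<le> dist z' z" using True dist_triangle[of x z z'] by (simp add: d_def)
    then show ?thesis using t d s_bounds by (auto intro!: ennreal_leI powr_mono2')
   qed simp
  qed
  also have "... = ennreal ((d / 2) powr (- s) * vol q)"
   using q vol_pos[OF q(1)] by (simp add: nn_integral_cmult_indicator emeasure_ball_vol ennreal_mult)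
  also have "(d / 2) powr (- s) * vol q = 2 powr s * 1 * d powr (- s) * vol q" using d by (simp add: half_powr)
  also have "ennreal (2 powr s * 1 * d powr (- s) * vol q) \<le> ennreal (2 powr s * (1 + 9 * Ck / \<omega>) * d powr (- s) * vol q)"
   using Ck_nonneg \<omega>_pos vol_pos[OF q(1)] by (intro ennreal_leI mult_right_mono mult_left_mono) auto
  finally show ?thesis .
 next
  case False
  have "(\<integral>\<^sup>+z'\<in>ball x q. ennreal (dist z' z powr (- s)) \<partial>lebesgue) \<le>
   (\<integral>\<^sup>+z'\<in>cball z (3 * q). ennreal (dist z' z powr (- s)) \<partial>lebesgue)"
  proof (intro nn_integral_mono mult_left_mono)
   fix z'
   show "indicator (ball x q) z' \<le> (indicator (cball z (3 * q)) z' :: ennreal)"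
    using False dist_triangle[of z z' x] by (auto simp: indicator_def d_def dist_commute)
  qed auto
  also have "... \<le> ennreal (Ck * (3 * q) powr (real CARD('a) - s))" unfolding Ck_def using q s_bounds by (intro kernel_inner) auto
  \<comment> \<open>The exponent n - s is 2. Since d < 2q, the averaging ball lies in the ball of
    radius 3q around z.\<close>
  also have "(3 * q) powr (real CARD('a) - s) = 9 * q powr 2" using q by (simp add: s_def powr_mult)
  also have "Ck * (9 * q powr 2) = (9 * Ck / \<omega>) * q powr (- s) * vol q"
  proof -
   have "q powr (- s) * q powr real CARD('a) = q powr 2" unfolding powr_add[symmetric] by (simp add: s_def)
   then show ?thesis using \<omega>_pos by (simp add: vol_powr[OF q(1)])
  qed
  also have "ennreal ((9 * Ck / \<omega>) * q powr (- s) * vol q) \<le> ennreal ((1 + 9 * Ck / \<omega>) * (2 powr s * d powr (- s)) * vol q)"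
  proof (intro ennreal_leI mult_right_mono mult_mono)
   have "q powr (- s) \<le> (d / 2) powr (- s)" using False d s_bounds by (intro powr_mono2') auto
   then show "q powr (- s) \<le> 2 powr s * d powr (- s)" using d by (simp add: half_powr)
  qed (use Ck_nonneg \<omega>_pos vol_pos[OF q(1)] in auto)
  finally show ?thesis by (simp add: mult_ac)
 qed
 have comp: "\<bar>approx x q k z $ m\<bar> \<le> V" for m
 proof -
  have ae: "AE z' in lebesgue. z' \<notin> {z}" by (intro AE_not_in) (simp add: null_sets_completionI)
  have "(\<integral>\<^sup>+z'. ennreal (norm (indicator (ball x q) z' *\<^sub>R G z' z $ k $ m)) \<partial>lebesgue) \<le>
   (\<integral>\<^sup>+z'. ennreal C1' * (ennreal (dist z' z powr (- s)) * indicator (ball x q) z') \<partial>lebesgue)"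
  proof (rule nn_integral_mono_AE, use ae in eventually_elim)
   fix z' assume "z' \<notin> {z}"
   then have z': "z' \<noteq> z" by simp
   show "ennreal (norm (indicator (ball x q) z' *\<^sub>R G z' z $ k $ m)) \<le> ennreal C1' * (ennreal (dist z' z powr (- s)) * indicator (ball x q) z')"
   proof (cases "z' \<in> ball x q")
    case True
    then have "z' \<in> W" using q(2) ball_subset_cball by blast
    then have "\<bar>G z' z $ k $ m\<bar> \<le> C1' * dist z' z powr (- s)"
     using order_trans[OF component_le_norm_cart G_row_bound'[OF _ z(1) z']] by blast
    then show ?thesis using True C1'_nonneg by (auto simp: ennreal_mult[symmetric] intro!: ennreal_leI)
   qed simp
  qed
  also have "... = ennreal C1' * (\<integral>\<^sup>+z'\<in>ball x q. ennreal (dist z' z powr (- s)) \<partial>lebesgue)"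
   by (intro nn_integral_cmult kernel_measurable) auto
  also have "... \<le> ennreal C1' * ennreal (2 powr s * (1 + 9 * Ck / \<omega>) * d powr (- s) * vol q)" by (intro mult_left_mono kerb) auto
  also have "... = ennreal (V * vol q)" using C1'_nonneg by (simp add: V_def ennreal_mult'[symmetric] mult_ac)
  finally have "norm (LINT z'|lebesgue. indicator (ball x q) z' *\<^sub>R G z' z $ k $ m) \<le> V * vol q"
   using V0 vol_pos[OF q(1)] by (intro norm_integral_le_nn) auto
  then show ?thesis using vol_pos[OF q(1)] by (simp add: approx_component[OF q] set_lebesgue_integral_def abs_divide divide_le_eq)
 qed
 have "norm (approx x q k z) \<le> (\<Sum>m\<in>UNIV. \<bar>approx x q k z $ m\<bar>)" by (rule norm_le_l1_cart)
 also have "... \<le> (\<Sum>m\<in>(UNIV::'b set). V)" by (intro sum_mono comp)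
 also have "... = C2 * dist x z powr (- s)" by (simp add: C2_def V_def d_def)
 finally show ?thesis .
qed

lemma L2sq_annulus:
 assumes f: "\<And>z. z \<in> W \<Longrightarrow> z \<noteq> x \<Longrightarrow> norm (f z) \<le> C * dist x z powr (- s)" and "C \<ge> 0" "t > 0"
 shows "L2sq (W \<inter> cball x t - cball x (t / 2)) f \<le> ennreal (C^2 * 2 powr (2 * s) * \<omega> * t powr (real CARD('a) - 2 * s))"
proof -
 have "L2sq (W \<inter> cball x t - cball x (t / 2)) f \<le> (\<integral>\<^sup>+z\<in>cball x t. ennreal ((C * (t / 2) powr (- s))^2) \<partial>lebesgue)"
  unfolding L2sq_def
 proof (intro nn_integral_mono)
  fix z
  show "ennreal ((norm (f z))^2) * indicator (W \<inter> cball x t - cball x (t / 2)) z \<le> ennreal ((C * (t / 2) powr (- s))^2) * indicator (cball x t) z"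
  proof (cases "z \<in> W \<inter> cball x t - cball x (t / 2)")
   case True
   then have "norm (f z) \<le> C * dist x z powr (- s)" using assms by (intro f) auto
   also have "... \<le> C * (t / 2) powr (- s)" using True assms s_bounds by (intro mult_left_mono powr_mono2') auto
   finally have "(norm (f z))^2 \<le> (C * (t / 2) powr (- s))^2" by (intro power_mono) auto
   then show ?thesis using True by (auto intro!: ennreal_leI)
  qed simp
 qed
 also have "... = ennreal ((C * (t / 2) powr (- s))^2) * ennreal (\<omega> * t powr real CARD('a))"
  using emeasure_cball_powr[OF assms(3), of x] by (subst nn_integral_cmult_indicator) (auto simp: \<omega>_def)
 also have "... = ennreal ((C * (t / 2) powr (- s))^2 * (\<omega> * t powr real CARD('a)))"
  using \<omega>_pos by (intro ennreal_mult[symmetric]) auto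
 also have "(C * (t / 2) powr (- s))^2 * (\<omega> * t powr real CARD('a)) = C^2 * 2 powr (2 * s) * \<omega> * t powr (real CARD('a) - 2 * s)"
 proof -
  have "((t / 2) powr (- s))^2 = 2 powr (2 * s) * t powr (- (2 * s))"
   using assms(3) by (simp add: half_powr power_mult_distrib powr_power mult.commute)
  moreover have "t powr (- (2 * s)) * t powr real CARD('a) = t powr (real CARD('a) - 2 * s)" unfolding powr_add[symmetric] by simp
  ultimately show ?thesis unfolding power_mult_distrib by (simp add: mult.assoc mult.left_commute)
 qed
 finally show ?thesis .
qed

definition "C3 = K1 * C2^2 * 2 powr (2 * s) * \<omega> + (cD * \<kappa> / \<gamma>)^2 * 2 powr s / \<omega>"

lemma C3_nonneg: "C3 \<ge> 0" using K1 \<omega>_pos by (simp add: C3_def)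

lemma approx_sol:
 assumes q: "0 < q" "cball x q \<subseteq> W" and U: "open U" "U \<subseteq> W" "U \<inter> ball x q = {}"
 shows "sol U (approx x q k)"
proof (rule sol_right[OF U(1,2) approx_H[OF q]])
 fix v :: "real^'a \<Rightarrow> real^'b" assume v: "v \<in> test_vec U"
 have "B v (approx x q k) = (LINT z:W|lebesgue. bump x q k z \<bullet> v z)" by (rule approx_eq[OF q test_vec_subset_H[OF U(2) v]])
 also have "... = 0" by (rule rhs_disjoint_0[OF v]) (use U(3) in \<open>auto simp: bump_def indicator_def\<close>)
 finally show "B v (approx x q k) = 0" .
qed

text \<open>Two regimes. If 2q \<le> t, the average solves the homogeneous equation off the ball of
  radius t/2, and Caccioppoli's inequality turns pointwise decay into energy. Otherwise the total
  energy suffices: the datum has L2 norm at most vol(q)^(-1/2), so the energy is of order q^(2-n),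
  and q > t/2.\<close>

lemma approx_gradient:
 assumes q: "0 < q" "cball x q \<subseteq> W" and t: "t > 0"
 shows "L2sq (W - cball x t) (wD W (approx x q k)) \<le> ennreal (C3 * t powr (2 - real CARD('a)))"
proof (cases "2 * q \<le> t")
 case True
 have "sol (W - cball x (t / 2)) (approx x q k)" using True open_W by (intro approx_sol[OF q]) auto
 then have "L2sq (W - cball x t) (wD W (approx x q k)) \<le> ennreal (K1 / t^2) * L2sq (W \<inter> cball x t - cball x (t / 2)) (approx x q k)"
  by (rule caccioppoli_annulus[OF approx_H[OF q] t])
 also have "... \<le> ennreal (K1 / t^2) * ennreal (C2^2 * 2 powr (2 * s) * \<omega> * t powr (real CARD('a) - 2 * s))"
  by (intro mult_left_mono L2sq_annulus approx_pointwise q C2_nonneg t) auto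
 also have "... = ennreal (K1 * C2^2 * 2 powr (2 * s) * \<omega> * t powr (2 - real CARD('a)))"
 proof -
  have "1 / t^2 * t powr (real CARD('a) - 2 * s) = t powr (2 - real CARD('a))"
  proof -
   have "1 / t^2 = t powr (- 2)" using t by (simp add: powr_minus_divide)
   then show ?thesis by (simp add: powr_add[symmetric] s_def)
  qed
  then have e: "K1 / t^2 * (C2^2 * 2 powr (2 * s) * \<omega> * t powr (real CARD('a) - 2 * s)) = K1 * C2^2 * 2 powr (2 * s) * \<omega> * t powr (2 - real CARD('a))"
  proof -
   assume a: "1 / t^2 * t powr (real CARD('a) - 2 * s) = t powr (2 - real CARD('a))"
   show ?thesis unfolding a[symmetric] by simp
  qed
  show ?thesis unfolding e[symmetric] using K1 by (simp only: ennreal_mult'[symmetric] divide_nonneg_nonneg zero_le_power2)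
 qed
 also have "... \<le> ennreal (C3 * t powr (2 - real CARD('a)))" using \<omega>_pos by (intro ennreal_leI mult_right_mono) (auto simp: C3_def)
 finally show ?thesis .
next
 case False
 let ?u = "approx x q k"
 have u: "?u \<in> H" by (rule approx_H[OF q])
 have "N ?u \<le> (1 / sqrt (vol q)) * \<kappa> * q / \<gamma>" using vol_pos[OF q(1)] q(1)
  by (intro energy_bound[OF bump_measurable bump_L2[OF q(1)] _ _ _ u approx_eq[OF q u], where c = x]) (auto simp: bump_def indicator_def)
 then have "cD * N ?u \<le> cD * ((1 / sqrt (vol q)) * \<kappa> * q / \<gamma>)" by (intro mult_left_mono cD_nonneg)
 then have "(cD * N ?u)^2 \<le> (cD * ((1 / sqrt (vol q)) * \<kappa> * q / \<gamma>))^2" using cD_nonneg H_nonneg[OF u] by (intro power_mono) auto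
 also have "... = (cD * \<kappa> / \<gamma>)^2 * (q^2 / vol q)" using vol_pos[OF q(1)] by (simp add: power_mult_distrib power_divide mult_ac)
 also have "q^2 / vol q = q powr (- s) / \<omega>"
 proof -
  have "q^2 / q powr real CARD('a) = q powr (2 - real CARD('a))" using q(1) by (simp add: powr_diff)
  then show ?thesis using q(1) by (simp add: vol_powr s_def field_simps)
 qed
 also have "(cD * \<kappa> / \<gamma>)^2 * (q powr (- s) / \<omega>) \<le> (cD * \<kappa> / \<gamma>)^2 * (2 powr s * t powr (- s) / \<omega>)"
 proof (intro mult_left_mono divide_right_mono)
  have "q powr (- s) \<le> (t / 2) powr (- s)" using False t s_bounds by (intro powr_mono2') auto
  then show "q powr (- s) \<le> 2 powr s * t powr (- s)" using t by (simp add: half_powr)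
 qed (use \<omega>_pos in auto)
 also have "... = (cD * \<kappa> / \<gamma>)^2 * 2 powr s / \<omega> * t powr (2 - real CARD('a))" by (simp add: s_def)
 also have "... \<le> C3 * t powr (2 - real CARD('a))" using K1 \<omega>_pos by (intro mult_right_mono) (auto simp: C3_def)
 finally have "ennreal ((cD * N ?u)^2) \<le> ennreal (C3 * t powr (2 - real CARD('a)))" by (rule ennreal_leI)
 moreover have "L2sq (W - cball x t) (wD W ?u) \<le> L2sq W (wD W ?u)" by (rule L2sq_mono_set) auto
 ultimately show ?thesis using H_dirichlet[OF u] by (meson order_trans)
qed

lemma approx_tendsto:
 assumes xz: "x \<in> W" "z \<in> W" "x \<noteq> z" and q: "\<And>i. 0 < q i" "\<And>i. cball x (q i) \<subseteq> W" "q \<longlonglongrightarrow> 0"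
 shows "(\<lambda>i. approx x (q i) k z) \<longlonglongrightarrow> G x z $ k"
proof (rule LIMSEQ_I)
 fix e :: real assume e: "e > 0"
 obtain d where d: "d > 0" "2 * d < dist x z"
  "\<And>x' y'. x' \<in> ball x d \<Longrightarrow> y' \<in> ball z d \<Longrightarrow> norm (G x' y' - G x z) < e / 2"
  using G_uniform_cont[OF xz half_gt_zero[OF e]] by metis
 have "\<forall>\<^sub>F i in sequentially. q i < d" using order_tendstoD(2)[OF q(3) d(1)] .
 then obtain i0 where i0: "\<And>i. i \<ge> i0 \<Longrightarrow> q i < d" by (auto simp: eventually_sequentially)
 show "\<exists>no. \<forall>i\<ge>no. norm (approx x (q i) k z - G x z $ k) < e"
 proof (intro exI[of _ i0] allI impI)
  fix i assume "i \<ge> i0"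
  then have i: "q i < d" by (rule i0)
  have "norm (approx x (q i) k z - G x z $ k) \<le> e / 2"
  proof (rule approx_close[OF q(1,2) xz(2)])
   show "z \<notin> ball x (q i)" using i d by auto
   show "norm (G x' z - G x z) \<le> e / 2" if "x' \<in> ball x (q i)" for x'
    using d(3)[of x' z] that i d(1) by (simp add: less_imp_le)
  qed
  then show "norm (approx x (q i) k z - G x z $ k) < e" using e by simp
 qed
qed

lemma row_measurable: "x \<in> W \<Longrightarrow> (\<lambda>z. G x z $ k) \<in> meas_on W"
 by (intro measurable_off_point[of x] bounded_linear.continuous_on[OF bounded_linear_vec_nth] G_cont_right)

lemma approx_L2_tendsto:
 assumes x: "x \<in> W" and q: "\<And>i. 0 < q i" "\<And>i. cball x (q i) \<subseteq> W" "q \<longlonglongrightarrow> 0" and t: "t > 0"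
 shows "(\<lambda>i. L2sq (W \<inter> cball x t - cball x (t / 2)) (\<lambda>z. approx x (q i) k z - G x z $ k)) \<longlonglongrightarrow> 0"
proof -
 let ?A = "W \<inter> cball x t - cball x (t / 2)"
 have A: "?A \<in> sets lebesgue" "?A \<subseteq> W" using open_W by auto
 define c where "c = (C2 + C1') * (t / 2) powr (- s)"
 have c: "c \<ge> 0" using C2_nonneg C1'_nonneg by (simp add: c_def)
 have m: "(\<lambda>z. approx x (q i) k z - G x z $ k) \<in> meas_on W" for i
  by (intro borel_measurable_diff row_measurable x H_measurable(1) approx_H q)
 have "(\<lambda>i. \<integral>\<^sup>+z\<in>?A. ennreal ((norm (approx x (q i) k z - G x z $ k))^2) \<partial>lebesgue) \<longlonglongrightarrow> (\<integral>\<^sup>+z. 0 \<partial>(lebesgue :: (real^'a) measure))"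
 proof (rule nn_integral_dominated_convergence)
  show "(\<lambda>z. ennreal ((norm (approx x (q i) k z - G x z $ k))^2) * indicator ?A z) \<in> meas_L" for i
   by (rule measurable_indicator_comp[OF sets_W m _ A, of "\<lambda>v. ennreal ((norm v)^2)"]) auto
  show "(\<lambda>z. ennreal (c^2) * indicator (cball x t) z) \<in> meas_L"
   by (intro borel_measurable_times_ennreal borel_measurable_indicator) auto
  show "(\<integral>\<^sup>+z\<in>cball x t. ennreal (c^2) \<partial>lebesgue) < \<infinity>"
   using emeasure_cball_powr[OF t, of x] by (subst nn_integral_cmult_indicator) (auto simp: ennreal_mult_less_top)
  show "AE z in lebesgue. ennreal ((norm (approx x (q i) k z - G x z $ k))^2) * indicator ?A z \<le> ennreal (c^2) * indicator (cball x t) z" for i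
  proof (intro AE_I2)
   fix z
   show "ennreal ((norm (approx x (q i) k z - G x z $ k))^2) * indicator ?A z \<le> ennreal (c^2) * indicator (cball x t) z"
   proof (cases "z \<in> ?A")
    case True
    then have z: "z \<in> W" "z \<noteq> x" "x \<noteq> z" using t by auto
    have "norm (approx x (q i) k z - G x z $ k) \<le> (C2 + C1') * dist x z powr (- s)"
     using norm_triangle_ineq4[of "approx x (q i) k z" "G x z $ k"] approx_pointwise[OF q(1,2) z(1,2), of i k] G_row_bound'[OF x z(1,3), of k]
     by (simp add: distrib_right)
    also have "... \<le> c" unfolding c_def using True t s_bounds C2_nonneg C1'_nonneg by (intro mult_left_mono powr_mono2') auto
    finally have "(norm (approx x (q i) k z - G x z $ k))^2 \<le> c^2" by (intro power_mono) auto
    then show ?thesis using True by (auto intro!: ennreal_leI)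
   qed simp
  qed
  show "AE z in lebesgue. (\<lambda>i. ennreal ((norm (approx x (q i) k z - G x z $ k))^2) * indicator ?A z) \<longlonglongrightarrow> 0"
  proof (intro AE_I2)
   fix z
   show "(\<lambda>i. ennreal ((norm (approx x (q i) k z - G x z $ k))^2) * indicator ?A z) \<longlonglongrightarrow> 0"
   proof (cases "z \<in> ?A")
    case True
    then have z: "z \<in> W" "x \<noteq> z" using t by auto
    have "(\<lambda>i. ennreal ((norm (approx x (q i) k z - G x z $ k))^2)) \<longlonglongrightarrow> ennreal ((norm (G x z $ k - G x z $ k))^2)"
     by (intro tendsto_ennrealI tendsto_power tendsto_norm tendsto_diff tendsto_const approx_tendsto x z q)
    then show ?thesis using True by simp
   qed simp
  qed
 qed auto
 then show ?thesis by (simp add: L2sq_def)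
qed

text \<open>The difference of two averages solves the homogeneous equation off both averaging balls,
  so Caccioppoli's inequality bounds its gradient by its L2 norm on an annulus, where the averages
  converge. The gradients thus converge strongly and weak compactness is avoided.\<close>

lemma approx_Cauchy:
 assumes x: "x \<in> W" and q: "\<And>i. 0 < q i" "\<And>i. cball x (q i) \<subseteq> W" "q \<longlonglongrightarrow> 0" and t: "t > 0" and e: "e > 0"
 shows "\<exists>I. \<forall>i\<ge>I. \<forall>j\<ge>I. L2sq (W - cball x t) (\<lambda>z. wD W (approx x (q i) k) z - wD W (approx x (q j) k) z) \<le> ennreal e"
proof -
 let ?A = "W \<inter> cball x t - cball x (t / 2)" and ?h = "\<lambda>z. G x z $ k"
 let ?u = "\<lambda>i. approx x (q i) k"
 have A: "?A \<in> sets lebesgue" "?A \<subseteq> W" using open_W by auto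
 define e' where "e' = e / (4 * (K1 / t^2 + 1))"
 have p: "K1 / t^2 + 1 > 0" using K1 t by (simp add: add_nonneg_pos)
 have e': "e' > 0" using e p by (simp add: e'_def)
 have "\<forall>\<^sub>F i in sequentially. L2sq ?A (\<lambda>z. ?u i z - ?h z) < ennreal e' \<and> q i < t / 2"
  using order_tendstoD(2)[OF approx_L2_tendsto[OF x q t], of "ennreal e'"] order_tendstoD(2)[OF q(3), of "t / 2"] e' t
  by (intro eventually_conj) auto
 then obtain I where I: "\<And>i. i \<ge> I \<Longrightarrow> L2sq ?A (\<lambda>z. ?u i z - ?h z) < ennreal e' \<and> q i < t / 2"
  by (auto simp: eventually_sequentially)
 show ?thesis
 proof (intro exI[of _ I] allI impI)
  fix i j assume ij: "i \<ge> I" "j \<ge> I"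
  have H: "?u i \<in> H" "?u j \<in> H" by (intro approx_H q)+
  define v where "v = (\<lambda>z. ?u i z - ?u j z)"
  have v: "v \<in> H" unfolding v_def by (rule H_diff[OF H])
  have "sol (W - cball x (t / 2)) v"
  proof (rule sol_right[OF _ _ v])
   show "open (W - cball x (t / 2))" "W - cball x (t / 2) \<subseteq> W" using open_W by auto
   fix w :: "real^'a \<Rightarrow> real^'b" assume w: "w \<in> test_vec (W - cball x (t / 2))"
   have wH: "w \<in> H" by (rule test_vec_subset_H[OF _ w]) auto
   have z: "B w (?u l) = 0" if "l \<ge> I" for l
   proof -
    have "B w (?u l) = (LINT z:W|lebesgue. bump x (q l) k z \<bullet> w z)" by (rule approx_eq[OF q(1,2) wH])
    also have "... = 0" by (rule rhs_disjoint_0[OF w]) (use I[OF that] in \<open>auto simp: bump_def\<close>)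
    finally show ?thesis .
   qed
   show "B w v = 0" unfolding v_def using bilinear_form_on_diff(2)[OF bil H wH] z ij by simp
  qed
  have mh: "?h \<in> meas_on W" by (rule row_measurable[OF x])
  have "L2sq (W - cball x t) (\<lambda>z. wD W (?u i) z - wD W (?u j) z) = L2sq (W - cball x t) (wD W v)"
   unfolding v_def by (rule L2sq_cong_AE[OF sets_W, symmetric])
    (auto intro: wD_diff_AE[OF open_W H_weak_deriv[OF H(1)] H_weak_deriv[OF H(2)]])
  also have "... \<le> ennreal (K1 / t^2) * L2sq ?A v" by (rule caccioppoli_annulus[OF v t]) fact
  also have "L2sq ?A v = L2sq ?A (\<lambda>z. (?u i z - ?h z) + (-1) *\<^sub>R (?u j z - ?h z))" by (simp add: v_def)
  also have "... \<le> 2 * L2sq ?A (\<lambda>z. ?u i z - ?h z) + 2 * L2sq ?A (\<lambda>z. (-1) *\<^sub>R (?u j z - ?h z))"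
   by (intro L2sq_add_le[OF sets_W _ _ A] borel_measurable_scaleR borel_measurable_const borel_measurable_diff mh H_measurable(1) H)
  also have "L2sq ?A (\<lambda>z. (-1) *\<^sub>R (?u j z - ?h z)) = L2sq ?A (\<lambda>z. ?u j z - ?h z)" by (simp only: L2sq_def norm_scaleR) simp
  also have "2 * L2sq ?A (\<lambda>z. ?u i z - ?h z) + 2 * L2sq ?A (\<lambda>z. ?u j z - ?h z) \<le> 2 * ennreal e' + 2 * ennreal e'"
   using I ij by (intro add_mono mult_left_mono) (auto intro: less_imp_le)
  also have "2 * ennreal e' + 2 * ennreal e' = ennreal (4 * e')" using e' by (simp flip: ennreal_numeral ennreal_mult' ennreal_plus)
  also have "ennreal (K1 / t^2) * ennreal (4 * e') = ennreal (K1 / t^2 * (4 * e'))" using K1 e' by (intro ennreal_mult[symmetric]) auto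
  also have "... \<le> ennreal e"
  proof (rule ennreal_leI)
   have "K1 / t^2 * (4 * e') \<le> (K1 / t^2 + 1) * (4 * e')" using e' by (intro mult_right_mono) auto
   also have "... = e"
   proof -
    have "a * (4 * (e / (4 * a))) = e" if "a > 0" for a using that by simp
    from this[OF p] show ?thesis unfolding e'_def .
   qed
   finally show "K1 / t^2 * (4 * e') \<le> e" .
  qed
  finally show "L2sq (W - cball x t) (\<lambda>z. wD W (?u i) z - wD W (?u j) z) \<le> ennreal e" by (simp add: mult_left_mono)
 qed
qed

end

text \<open>The case q = 1 of \<open>tail_Lq\<close>: the exponent of r is 1 and the geometric
  series sums to 2.\<close>

lemma tail_L1:
 fixes D :: "real^'n::finite \<Rightarrow> 'b::euclidean_space"
 assumes "U \<in> sets lebesgue" "D \<in> meas_on U" "C \<ge> 0"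
  "\<And>t. t > 0 \<Longrightarrow> L2sq (U - cball y t) D \<le> ennreal (C * t powr (2 - real CARD('n)))" and n: "CARD('n) \<ge> 3" and r: "r > 0"
 shows "(\<integral>\<^sup>+x\<in>U \<inter> cball y r. ennreal (norm (D x)) \<partial>lebesgue)
  \<le> ennreal (2 * (ball_vol TYPE('n) + C * 2 powr (real CARD('n) - 2)) * r)"
proof -
 have "(\<integral>\<^sup>+x\<in>U \<inter> cball y r. ennreal (norm (D x) powr 1) \<partial>lebesgue)
  \<le> ennreal ((ball_vol TYPE('n) + C * 2 powr (real CARD('n) - 2)) / (1 - 2 powr (- (real CARD('n) - 1 * (real CARD('n) - 1)))) *
    r powr (real CARD('n) - 1 * (real CARD('n) - 1)))" by (rule tail_Lq[OF assms(1-4) _ _ _ r]) auto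
 also have "real CARD('n) - 1 * (real CARD('n) - 1) = 1" by simp
 also have "1 - (2::real) powr (- 1) = 1 / 2" by (simp add: powr_neg_one)
 finally show ?thesis using r by (simp add: mult_ac)
qed

section \<open>Rows of the Green matrix: weak gradient and Hoelder continuity\<close>

context green_kernel
begin

lemma locally_integrable_from_balls:
 fixes f :: "real^'a \<Rightarrow> 'c::euclidean_space"
 assumes m: "f \<in> meas_on W"
  and b: "\<And>r. r > 0 \<Longrightarrow> (\<integral>\<^sup>+z\<in>W \<inter> cball x r. ennreal (norm (f z)) \<partial>lebesgue) < \<infinity>"
 shows "locally_integrable W f"
 unfolding locally_integrable_def
proof (intro allI impI)
 fix K assume K: "compact K \<and> K \<subseteq> W"
 have KS: "K \<in> sets lebesgue" using K by (simp add: borel_compact)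
 obtain r where r: "r > 0" "K \<subseteq> cball x r"
  using bounded_subset_ballD[of K x] K compact_imp_bounded ball_subset_cball by (metis order_trans)
 show "f absolutely_integrable_on K"
  unfolding set_integrable_def
 proof (rule integrableI_bounded)
  show "(\<lambda>z. indicator K z *\<^sub>R f z) \<in> meas_L"
   using K by (intro indicator_measurable_on[OF KS] restrict_W_subset[OF KS] m) auto
  have "(\<integral>\<^sup>+z. ennreal (norm (indicator K z *\<^sub>R f z)) \<partial>lebesgue) \<le> (\<integral>\<^sup>+z\<in>W \<inter> cball x r. ennreal (norm (f z)) \<partial>lebesgue)"
   using K r(2) by (intro nn_integral_mono) (auto simp: indicator_def)
  also have "... < \<infinity>" by (rule b[OF r(1)])
  finally show "(\<integral>\<^sup>+z. ennreal (norm (indicator K z *\<^sub>R f z)) \<partial>lebesgue) < \<infinity>" .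
 qed
qed

text \<open>The identity defining the weak derivative passes to the limit along the averages, even
  for test functions supported across the pole: near x all gradients are uniformly small in L1,
  because their L2 tails integrate to order r, and away from x they converge in L2.\<close>

lemma row_weak_deriv:
 assumes x: "x \<in> W"
 shows "\<exists>D. has_weak_deriv W (\<lambda>z. G x z $ k) D \<and> (\<forall>t>0. L2sq (W - cball x t) D \<le> ennreal (C3 * t powr (2 - real CARD('a))))"
proof -
 let ?h = "\<lambda>z. G x z $ k"
 obtain r0 where r0: "r0 > 0" "cball x r0 \<subseteq> W" using open_W x by (meson open_contains_cball)
 define p where "p = (\<lambda>i. r0 * inverse (real (Suc i)))"
 have p: "\<And>i. 0 < p i" "\<And>i. cball x (p i) \<subseteq> W" "p \<longlonglongrightarrow> 0"
 proof -
  show "0 < p i" for i using r0 by (simp add: p_def)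
  have "p i \<le> r0" for i using r0 by (simp add: p_def divide_simps)
  then show "cball x (p i) \<subseteq> W" for i using r0(2) subset_cball by (meson order_trans)
  show "p \<longlonglongrightarrow> 0" unfolding p_def using tendsto_mult[OF tendsto_const[of r0] LIMSEQ_inverse_real_of_nat] by simp
 qed
 have "\<exists>E \<sigma>. E \<in> meas_on W \<and> (\<forall>m. m \<le> \<sigma> m) \<and>
  (\<forall>t>0. L2sq (W - cball x t) E \<le> ennreal (C3 * t powr (2 - real CARD('a)))) \<and>
  (\<forall>m. L2sq (W - cball x (1 / 2 ^ m)) (\<lambda>z. wD W (approx x (p (\<sigma> m)) k) z - E z) \<le> ennreal ((1/16) ^ m))"
  by (rule tail_limit[OF sets_W]) (intro H_measurable(2) approx_H p approx_Cauchy[OF x p] approx_gradient | assumption)+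
 then obtain E \<sigma> where mE: "E \<in> meas_on W" and \<sigma>: "\<And>m. m \<le> \<sigma> m"
  and tE: "\<And>t. t > 0 \<Longrightarrow> L2sq (W - cball x t) E \<le> ennreal (C3 * t powr (2 - real CARD('a)))"
  and dE: "\<And>m. L2sq (W - cball x (1 / 2 ^ m)) (\<lambda>z. wD W (approx x (p (\<sigma> m)) k) z - E z) \<le> ennreal ((1/16) ^ m)"
  by blast
 define u where "u = (\<lambda>m. approx x (p (\<sigma> m)) k)"
 have uH: "u m \<in> H" for m unfolding u_def by (intro approx_H p)
 have "filterlim \<sigma> sequentially sequentially" by (rule filterlim_at_top_mono[OF filterlim_ident]) (simp add: \<sigma>)
 then have p\<sigma>: "(\<lambda>m. p (\<sigma> m)) \<longlonglongrightarrow> 0" by (rule filterlim_compose[OF p(3)])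
 have u_lim: "(\<lambda>m. u m z) \<longlonglongrightarrow> ?h z" if "z \<in> W" "x \<noteq> z" for z
  unfolding u_def by (rule approx_tendsto[OF x that p(1,2) p\<sigma>])
 have u_bd: "norm (u m z) \<le> C2 * dist z x powr (- s)" if "z \<in> W" "z \<noteq> x" for m z
  unfolding u_def using approx_pointwise[OF p(1,2) that] by (simp add: dist_commute)
 define T where "T = 2 * (ball_vol TYPE('a) + C3 * 2 powr (real CARD('a) - 2))"
 have T: "T \<ge> 0" using C3_nonneg by (simp add: T_def)
 have E1: "(\<integral>\<^sup>+z\<in>W \<inter> cball x r. ennreal (norm (E z)) \<partial>lebesgue) \<le> ennreal (T * r)" if "r > 0" for r
  unfolding T_def by (rule tail_L1[OF sets_W mE C3_nonneg tE n3 that])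
 have u1: "(\<integral>\<^sup>+z\<in>W \<inter> cball x r. ennreal (norm (wD W (u m) z)) \<partial>lebesgue) \<le> ennreal (T * r)" if "r > 0" for r m
  unfolding T_def by (rule tail_L1[OF sets_W H_measurable(2)[OF uH] C3_nonneg _ n3 that])
   (unfold u_def, intro approx_gradient p)
 have lE: "locally_integrable W E" by (rule locally_integrable_from_balls[OF mE, of x]) (rule le_less_trans[OF E1], auto)
 have ker_fin: "(\<integral>\<^sup>+z\<in>cball x r. ennreal (dist z x powr (- s)) \<partial>lebesgue) < \<infinity>" if "r > 0" for r
  using kernel_inner[OF that, of s x] s_bounds by (auto intro: le_less_trans)
 have lh: "locally_integrable W ?h"
 proof (rule locally_integrable_from_balls[OF row_measurable[OF x]])
  fix r :: real assume r: "r > 0"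
  have "(\<integral>\<^sup>+z\<in>W \<inter> cball x r. ennreal (norm (?h z) powr 1) \<partial>lebesgue) \<le>
   ennreal (C1' powr 1) * (\<integral>\<^sup>+z\<in>cball x r. ennreal (dist z x powr (- (s * 1))) \<partial>lebesgue)"
   using G_row_bound'[OF x] by (intro kernel_Lq C1'_nonneg) (auto simp: dist_commute)
  also have "... < \<infinity>" using ker_fin[OF r] by (simp add: ennreal_mult_less_top)
  finally show "(\<integral>\<^sup>+z\<in>W \<inter> cball x r. ennreal (norm (?h z)) \<partial>lebesgue) < \<infinity>" by simp
 qed
 have "has_weak_deriv W ?h E" unfolding has_weak_deriv_alt
 proof (intro conjI ballI allI lh lE)
  fix \<phi> \<alpha> assume \<phi>: "\<phi> \<in> test_fun W"
  obtain K where K: "compact K" "K \<subseteq> W" "\<And>z. z \<notin> K \<Longrightarrow> \<phi> z = 0" using test_fun_support[OF \<phi>] by metis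
  obtain M1 where M1: "\<And>z. \<bar>\<phi> z\<bar> \<le> M1" "M1 > 0" using test_fun_bounded[OF \<phi>] by metis
  obtain M2 where M2: "\<And>z. \<bar>partial_deriv \<alpha> \<phi> z\<bar> \<le> M2" "M2 > 0"
   using test_fun_bounded[OF test_fun_partial_deriv[OF \<phi>]] by metis
  obtain r where r: "r > 0" "K \<subseteq> cball x r" using bounded_subset_ballD[OF compact_imp_bounded[OF K(1)], of x] ball_subset_cball by blast
  have dK: "partial_deriv \<alpha> \<phi> z = 0" if "z \<notin> K" for z by (rule partial_deriv_support[OF K(1,3) that])
  have lu: "locally_integrable W (u m)" "locally_integrable W (wD W (u m))" for m using H_weak_deriv[OF uH[of m]] by (auto simp: has_weak_deriv_alt)
  have ax: "AE z in lebesgue. z \<notin> {x}" by (intro AE_not_in) (simp add: null_sets_completionI)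
  have "(\<lambda>m. \<integral>z. partial_deriv \<alpha> \<phi> z *\<^sub>R u m z \<partial>lebesgue) \<longlonglongrightarrow> (\<integral>z. partial_deriv \<alpha> \<phi> z *\<^sub>R ?h z \<partial>lebesgue)"
  proof (rule integral_dominated_convergence[where w = "\<lambda>z. M2 * C2 * (dist z x powr (- s) * indicator (cball x r) z)"])
   show "(\<lambda>z. partial_deriv \<alpha> \<phi> z *\<^sub>R ?h z) \<in> meas_L"
    using test_fun_integrable_scaleR[OF test_fun_partial_deriv[OF \<phi>] lh] by auto
   show "(\<lambda>z. partial_deriv \<alpha> \<phi> z *\<^sub>R u m z) \<in> meas_L" for m
    using test_fun_integrable_scaleR[OF test_fun_partial_deriv[OF \<phi>] lu(1)] by auto
   show "integrable lebesgue (\<lambda>z. M2 * C2 * (dist z x powr (- s) * indicator (cball x r) z))"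
   proof (intro integrable_mult_right integrableI_bounded)
    have "(\<lambda>z. dist z x powr (- s)) \<in> meas_L" by (rule measurable_completion) auto
    then show "(\<lambda>z. dist z x powr (- s) * indicator (cball x r) z) \<in> meas_L"
     by (intro borel_measurable_times borel_measurable_indicator) auto
    have "(\<integral>\<^sup>+z. ennreal (norm (dist z x powr (- s) * indicator (cball x r) z)) \<partial>lebesgue) = (\<integral>\<^sup>+z\<in>cball x r. ennreal (dist z x powr (- s)) \<partial>lebesgue)"
     by (intro nn_integral_cong) (auto simp: indicator_def)
    then show "(\<integral>\<^sup>+z. ennreal (norm (dist z x powr (- s) * indicator (cball x r) z)) \<partial>lebesgue) < \<infinity>" using ker_fin[OF r(1)] by simp
   qed
   show "AE z in lebesgue. (\<lambda>m. partial_deriv \<alpha> \<phi> z *\<^sub>R u m z) \<longlonglongrightarrow> partial_deriv \<alpha> \<phi> z *\<^sub>R ?h z"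
    using ax
   proof eventually_elim
    case (elim z)
    show ?case
    proof (cases "z \<in> K")
     case True
     then show ?thesis using elim K(2) by (intro tendsto_scaleR tendsto_const u_lim) auto
    qed (simp add: dK)
   qed
   show "AE z in lebesgue. norm (partial_deriv \<alpha> \<phi> z *\<^sub>R u m z) \<le> M2 * C2 * (dist z x powr (- s) * indicator (cball x r) z)" for m
    using ax
   proof eventually_elim
    case (elim z)
    show ?case
    proof (cases "z \<in> K")
     case True
     then have "\<bar>partial_deriv \<alpha> \<phi> z\<bar> * norm (u m z) \<le> M2 * (C2 * dist z x powr (- s))"
      using elim K(2) M2 by (intro mult_mono u_bd) auto
     then show ?thesis using True r(2) by (auto simp: mult.assoc)
    next
     case False
     then show ?thesis using M2 C2_nonneg by (simp add: dK)
    qed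
   qed
  qed
  moreover have "(\<lambda>m. \<integral>z. partial_deriv \<alpha> \<phi> z *\<^sub>R u m z \<partial>lebesgue) \<longlonglongrightarrow> - (\<integral>z. \<phi> z *\<^sub>R (E z $ \<alpha>) \<partial>lebesgue)"
  proof -
   have iD: "integrable lebesgue (\<lambda>z. \<phi> z *\<^sub>R (wD W (u m) z $ \<alpha>))" for m
    by (rule test_fun_integrable_scaleR[OF \<phi> locally_integrable_linear[OF lu(2) bounded_linear_vec_nth]])
   have iE: "integrable lebesgue (\<lambda>z. \<phi> z *\<^sub>R (E z $ \<alpha>))"
    by (rule test_fun_integrable_scaleR[OF \<phi> locally_integrable_linear[OF lE bounded_linear_vec_nth]])
   \<comment> \<open>Collects 2T from the two gradients in the ball around the pole, the volume from
     Young's inequality, and 1 for the L2 error, all in units of q.\<close>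
   define V where "V = M1 * (2 * T + (ball_vol TYPE('a) * r powr real CARD('a) + 1))"
   have V: "V \<ge> 0" using M1 T r by (simp add: V_def)
   have bound: "norm ((\<integral>z. \<phi> z *\<^sub>R (wD W (u m) z $ \<alpha>) \<partial>lebesgue) - (\<integral>z. \<phi> z *\<^sub>R (E z $ \<alpha>) \<partial>lebesgue)) \<le> V * (1/2) ^ m" for m
   proof -
    \<comment> \<open>Both the radius excluded around the pole and the level in Young's inequality;
      the L2 error 16^-m = q^4 contributes q^3 \<le> q.\<close>
    define q where "q = (1/2::real) ^ m"
    have q: "q > 0" "1 / 2 ^ m = q" "q \<le> 1" by (auto simp: q_def power_one_over power_le_one)
    let ?d = "\<lambda>z. wD W (u m) z - E z"
    let ?S = "W - cball x q" and ?Q = "W \<inter> cball x q" and ?b = "ball_vol TYPE('a) * r powr real CARD('a)"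
    let ?R = "\<lambda>z. (ennreal (norm (wD W (u m) z)) * indicator ?Q z + ennreal (norm (E z)) * indicator ?Q z) +
     (ennreal q * indicator (cball x r) z + ennreal (1 / q) * (ennreal ((norm (?d z))^2) * indicator ?S z))"
    have S: "?S \<in> sets lebesgue" "?S \<subseteq> W" using open_W by auto
    have md: "?d \<in> meas_on W" by (intro borel_measurable_diff H_measurable(2) uH mE)
    have m1: "(\<lambda>z. ennreal (norm (f z)) * indicator ?Q z) \<in> meas_L"
     if "f \<in> meas_on W" for f :: "real^'a \<Rightarrow> real^'b^'a"
     by (rule measurable_indicator_comp[OF sets_W that, of "\<lambda>v. ennreal (norm v)"]) (use open_W in auto)
    have m2: "(\<lambda>z. ennreal ((norm (?d z))^2) * indicator ?S z) \<in> meas_L"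
     by (rule measurable_indicator_comp[OF sets_W md _ S, of "\<lambda>v. ennreal ((norm v)^2)"]) auto
    have "(\<integral>\<^sup>+z. ennreal (norm (\<phi> z *\<^sub>R (wD W (u m) z $ \<alpha>) - \<phi> z *\<^sub>R (E z $ \<alpha>))) \<partial>lebesgue) \<le>
     (\<integral>\<^sup>+z. ennreal M1 * ?R z \<partial>lebesgue)"
    proof (intro nn_integral_mono)
     fix z
     show "ennreal (norm (\<phi> z *\<^sub>R (wD W (u m) z $ \<alpha>) - \<phi> z *\<^sub>R (E z $ \<alpha>))) \<le>
      ennreal M1 * ?R z"
     proof (cases "z \<in> K")
      case True
      have "norm (\<phi> z *\<^sub>R (wD W (u m) z $ \<alpha>) - \<phi> z *\<^sub>R (E z $ \<alpha>)) = \<bar>\<phi> z\<bar> * norm (?d z $ \<alpha>)"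
       by (simp flip: scaleR_diff_right)
      also have "... \<le> M1 * norm (?d z)" using M1 by (intro mult_mono Finite_Cartesian_Product.norm_nth_le) auto
      finally have a: "ennreal (norm (\<phi> z *\<^sub>R (wD W (u m) z $ \<alpha>) - \<phi> z *\<^sub>R (E z $ \<alpha>))) \<le> ennreal M1 * ennreal (norm (?d z))"
       using M1 by (simp flip: ennreal_mult add: ennreal_leI)
      have zz: "z \<in> W" "z \<in> cball x r" using True K(2) r(2) by auto
      have "ennreal (norm (?d z)) \<le> ?R z"
      proof (cases "z \<in> cball x q")
       case True
       have "ennreal (norm (?d z)) \<le> ennreal (norm (wD W (u m) z) + norm (E z))" by (intro ennreal_leI norm_triangle_ineq4)
       also have "... = ennreal (norm (wD W (u m) z)) + ennreal (norm (E z))" by simp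
       finally show ?thesis using True zz by (simp add: add_increasing2)
      next
       case False
       have "norm (?d z) powr 1 \<le> q powr 1 + q powr (1 - 2) * (norm (?d z))^2" using q by (intro powr_le_square) auto
       then have "norm (?d z) \<le> q + 1 / q * (norm (?d z))^2" using q by (simp add: powr_neg_one)
       then have "ennreal (norm (?d z)) \<le> ennreal (q + 1 / q * (norm (?d z))^2)" by (rule ennreal_leI)
       also have "... = ennreal q + ennreal (1 / q) * ennreal ((norm (?d z))^2)"
        using q by (subst ennreal_mult[symmetric]) (auto simp flip: ennreal_plus)
       finally show ?thesis using False zz by simp
      qed
      then show ?thesis using a by (meson mult_left_mono order_trans zero_le)
     qed (simp add: K(3))
    qed
    also have "... = ennreal M1 * (((\<integral>\<^sup>+z\<in>?Q. ennreal (norm (wD W (u m) z)) \<partial>lebesgue) +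
     (\<integral>\<^sup>+z\<in>?Q. ennreal (norm (E z)) \<partial>lebesgue)) +
     (ennreal q * emeasure lebesgue (cball x r) + ennreal (1 / q) * L2sq ?S ?d))"
    proof -
     have a1: "(\<lambda>z. ennreal q * indicator (cball x r) z) \<in> borel_measurable (lebesgue :: (real^'a) measure)"
      by (intro borel_measurable_times_ennreal borel_measurable_const borel_measurable_indicator) auto
     have a2: "(\<lambda>z. ennreal (1 / q) * (ennreal ((norm (?d z))^2) * indicator ?S z)) \<in> meas_L"
      by (rule borel_measurable_times_ennreal[OF borel_measurable_const m2])
     have a3: "(\<integral>\<^sup>+z\<in>cball x r. ennreal q \<partial>lebesgue) = ennreal q * emeasure lebesgue (cball x r)"
      by (rule nn_integral_cmult_indicator) auto
     have a4: "(\<integral>\<^sup>+z. ennreal (1 / q) * (ennreal ((norm (?d z))^2) * indicator ?S z) \<partial>lebesgue) = ennreal (1 / q) * L2sq ?S ?d"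
      unfolding L2sq_def by (rule nn_integral_cmult[OF m2])
     show ?thesis
      unfolding nn_integral_cmult[OF borel_measurable_add[OF borel_measurable_add[OF m1[OF H_measurable(2)[OF uH]] m1[OF mE]] borel_measurable_add[OF a1 a2]]]
       nn_integral_add[OF borel_measurable_add[OF m1[OF H_measurable(2)[OF uH]] m1[OF mE]] borel_measurable_add[OF a1 a2]]
       nn_integral_add[OF m1[OF H_measurable(2)[OF uH]] m1[OF mE]] nn_integral_add[OF a1 a2] a3 a4 ..
    qed
    also have "... \<le> ennreal M1 * ((ennreal (T * q) + ennreal (T * q)) + (ennreal q * ennreal ?b + ennreal (1 / q) * ennreal ((1/16) ^ m)))"
     using dE[of m] unfolding emeasure_cball_powr[OF r(1), of x] q(2) u_def[symmetric]
     by (intro mult_left_mono add_mono E1 u1 q) (auto simp: u_def)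
    also have "... = ennreal (M1 * ((T * q + T * q) + (q * ?b + 1 / q * (1/16) ^ m)))"
     using M1 T q by (simp add: ennreal_mult[symmetric] flip: ennreal_plus)
    also have "... \<le> ennreal (V * q)"
    proof (rule ennreal_leI)
     have "1 / q * (1/16) ^ m \<le> q"
     proof -
      have "q ^ 4 = ((1/2) ^ 4) ^ m" by (simp only: q_def power_mult[symmetric] mult.commute)
      also have "(1/2::real) ^ 4 = 1/16" by (simp add: power_one_over)
      finally have "(1/16::real) ^ m = q ^ 4" by simp
      then have "1 / q * (1/16) ^ m = q ^ 3" using q by (simp add: power_numeral_reduce)
      also have "... \<le> q ^ 1" using q by (intro power_decreasing) auto
      finally show ?thesis by simp
     qed
     then have "M1 * ((T * q + T * q) + (q * ?b + 1 / q * (1/16) ^ m)) \<le>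
      M1 * ((T * q + T * q) + (q * ?b + q))" using M1 by (intro mult_left_mono add_left_mono) auto
     also have "... = V * q" by (simp add: V_def algebra_simps)
     finally show "M1 * ((T * q + T * q) + (q * ?b + 1 / q * (1/16) ^ m)) \<le> V * q" .
    qed
    finally have "norm (\<integral>z. \<phi> z *\<^sub>R (wD W (u m) z $ \<alpha>) - \<phi> z *\<^sub>R (E z $ \<alpha>) \<partial>lebesgue) \<le> V * q"
     using V q by (intro norm_integral_le_nn) auto
    then show ?thesis unfolding Bochner_Integration.integral_diff[OF iD iE] q_def .
   qed
   have "(\<lambda>m. V * (1/2) ^ m) \<longlonglongrightarrow> V * 0" by (intro tendsto_intros LIMSEQ_power_zero) auto
   then have "(\<lambda>m. (\<integral>z. \<phi> z *\<^sub>R (wD W (u m) z $ \<alpha>) \<partial>lebesgue) - (\<integral>z. \<phi> z *\<^sub>R (E z $ \<alpha>) \<partial>lebesgue)) \<longlonglongrightarrow> 0"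
    by (intro Lim_null_comparison[OF always_eventually[OF allI[OF bound]]]) simp
   then have "(\<lambda>m. - (\<integral>z. \<phi> z *\<^sub>R (wD W (u m) z $ \<alpha>) \<partial>lebesgue)) \<longlonglongrightarrow> - (\<integral>z. \<phi> z *\<^sub>R (E z $ \<alpha>) \<partial>lebesgue)"
    by (intro tendsto_minus) (simp only: LIM_zero_iff)
   moreover have "(\<integral>z. partial_deriv \<alpha> \<phi> z *\<^sub>R u m z \<partial>lebesgue) = - (\<integral>z. \<phi> z *\<^sub>R (wD W (u m) z $ \<alpha>) \<partial>lebesgue)" for m
    using H_weak_deriv[OF uH[of m]] \<phi> by (simp add: has_weak_deriv_alt)
   ultimately show ?thesis by simp
  qed
  ultimately show "(\<integral>z. partial_deriv \<alpha> \<phi> z *\<^sub>R ?h z \<partial>lebesgue) = - (\<integral>z. \<phi> z *\<^sub>R (E z $ \<alpha>) \<partial>lebesgue)"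
   by (rule LIMSEQ_unique)
 qed
 then show ?thesis using tE by blast
qed

text \<open>(H) is applied to an averaged kernel, which belongs to the space, on the ball of radius
  R around y. This ball keeps distance at least R from x, so the averaged kernel and its mean of
  order \<open>two_star\<close> are at most C2 R^(2-n) there. Shrinking the averaging radius
  transfers the estimate to G.\<close>

lemma row_hoelder:
 assumes xy: "x \<in> W" "y \<in> W" and R: "0 < R" "R \<le> R\<^sub>0" and sub: "ball y (2 * R\<^sub>0) \<subseteq> W" and far: "2 * R\<^sub>0 < dist x y"
  and z: "norm (y - z) < R / 2"
 shows "norm (G x y $ k - G x z $ k) \<le> CH R\<^sub>0 * C2 * (norm (y - z) / R) powr \<eta> R\<^sub>0 * R powr (2 - real CARD('a))"
proof (cases "y = z")
 case True then show ?thesis using hoelder(1)[of R\<^sub>0] R C2_nonneg by simp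
next
 case False
 let ?\<eta> = "\<eta> R\<^sub>0"
 have R0: "R\<^sub>0 > 0" using R by simp
 note eta = hoelder(1)[OF R0]
 have zB: "z \<in> ball y (R / 2)" using z by (simp add: dist_norm)
 have zO: "z \<in> W" using sub zB R by auto
 have ne: "x \<noteq> y" "x \<noteq> z"
 proof -
  show "x \<noteq> y" using far R0 by auto
  show "x \<noteq> z" using far zB R by (auto simp: dist_commute)
 qed
 define c where "c = CH R\<^sub>0 * R powr (- ?\<eta>) * (C2 * R powr (- s))"
 have c0: "c \<ge> 0" using eta C2_nonneg by (simp add: c_def)
 have key: "norm (G x y $ k - G x z $ k) \<le> 2 * e + c * (norm (y - z) + 2 * e) powr ?\<eta>" if e: "e > 0" for e
 proof -
  obtain d1 where d1: "d1 > 0" "cball x d1 \<subseteq> W" "2 * d1 < dist x y"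
   "\<And>x' y'. x' \<in> ball x d1 \<Longrightarrow> y' \<in> ball y d1 \<Longrightarrow> norm (G x' y' - G x y) < e"
   using G_uniform_cont[OF xy ne(1) e] by metis
  obtain d2 where d2: "d2 > 0" "2 * d2 < dist x z"
   "\<And>x' y'. x' \<in> ball x d2 \<Longrightarrow> y' \<in> ball z d2 \<Longrightarrow> norm (G x' y' - G x z) < e"
   using G_uniform_cont[OF xy(1) zO ne(2) e] by metis
  obtain d3 where d3: "d3 > 0" "ball z d3 \<subseteq> ball y (R / 2)" using zB open_ball[of y "R / 2"] unfolding open_contains_ball by meson
  \<comment> \<open>R/2 separates the averaging ball from the ball around y on which the equation is
    solved, \<open>dist y z / 2\<close> keeps the substitutes for y and z distinct, and
    \<open>d3\<close> keeps the substitute for z inside the ball of radius R/2.\<close>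
  define d where "d = Min {d1, d2, d3, e, R / 2, dist y z / 2}"
  have d: "d > 0" "d \<le> d1" "d \<le> d2" "d \<le> d3" "d \<le> e" "d \<le> R / 2" "d \<le> dist y z / 2"
   using d1 d2 d3 e R False by (auto simp: d_def)
  have cd: "cball x d \<subseteq> W" using d1(2) d(2) subset_cball by (meson order_trans)
  define u where "u = approx x d k"
  have u: "u \<in> H" unfolding u_def by (rule approx_H[OF d(1) cd])
  have disj: "ball y R\<^sub>0 \<inter> ball x d = {}"
  proof -
   have False if "v \<in> ball y R\<^sub>0" "v \<in> ball x d" for v using that far d(6) R dist_triangle[of x y v] by (simp add: dist_commute)
   then show ?thesis by blast
  qed
  have "sol (ball y R\<^sub>0) u" unfolding u_def using sub R0 disj by (intro approx_sol[OF d(1) cd]) auto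
  from hoelder(2)[OF u R0 sub this] obtain w where
   w: "AE v in lebesgue. v \<in> ball y R\<^sub>0 \<longrightarrow> w v = u v"
   and wH: "\<And>y1 z1. y1 \<in> ball y (R/2) \<Longrightarrow> z1 \<in> ball y (R/2) \<Longrightarrow> y1 \<noteq> z1 \<Longrightarrow>
    ennreal (norm (w y1 - w z1) / norm (y1 - z1) powr ?\<eta>) \<le> ennreal (CH R\<^sub>0 * R powr (- ?\<eta>)) *
     ennpowr ((\<integral>\<^sup>+v. ennreal (norm (u v) powr two_star TYPE('a)) \<partial>lebesgue_on (ball y R)) / emeasure lebesgue (ball y R)) (1 / two_star TYPE('a))"
   using R by meson
  have "ball y d \<subseteq> ball y R\<^sub>0" "ball z d \<subseteq> ball y R\<^sub>0" "ball y d \<subseteq> ball y (R / 2)" "ball z d \<subseteq> ball y (R / 2)"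
   using d d3(2) R subset_ball[of d d3 z] subset_ball[of "R / 2" R\<^sub>0 y] by auto
  note subs = this
  \<comment> \<open>The Hoelder estimate holds for a representative w; at y' and z' it agrees with
    the average, and these points lie within e of y and z.\<close>
  obtain y' where y': "y' \<in> ball y d" "w y' = u y'" using AE_ball_exists[OF w d(1) subs(1)] by blast
  obtain z' where z': "z' \<in> ball z d" "w z' = u z'" using AE_ball_exists[OF w d(1) subs(2)] by blast
  have "y' \<noteq> z'"
  proof
   assume "y' = z'"
   then have "dist y z < 2 * d" using y' z' dist_triangle[of y z y'] by (simp add: dist_commute)
   with d(7) show False by simp
  qed
  have p2: "two_star TYPE('a) > 0" using two_star_gt_2[OF n3] by simp
  have avg: "ennpowr ((\<integral>\<^sup>+v. ennreal (norm (u v) powr two_star TYPE('a)) \<partial>lebesgue_on (ball y R)) / emeasure lebesgue (ball y R)) (1 / two_star TYPE('a)) \<le> ennreal (C2 * R powr (- s))"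
  proof -
   let ?c = "(C2 * R powr (- s)) powr two_star TYPE('a)"
   have "(\<integral>\<^sup>+v. ennreal (norm (u v) powr two_star TYPE('a)) \<partial>lebesgue_on (ball y R)) = (\<integral>\<^sup>+v\<in>ball y R. ennreal (norm (u v) powr two_star TYPE('a)) \<partial>lebesgue)"
    by (subst nn_integral_restrict_space) auto
   also have "... \<le> (\<integral>\<^sup>+v\<in>ball y R. ennreal ?c \<partial>lebesgue)"
   proof (intro nn_integral_mono)
    fix v
    show "ennreal (norm (u v) powr two_star TYPE('a)) * indicator (ball y R) v \<le> ennreal ?c * indicator (ball y R) v"
    proof (cases "v \<in> ball y R")
     case True
     then have v: "v \<in> W" using sub R by auto
     have dv: "dist x v \<ge> R" using True far R dist_triangle[of x y v] by (simp add: dist_commute)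
     then have "v \<noteq> x" using R by auto
     have "norm (u v) \<le> C2 * dist x v powr (- s)" unfolding u_def by (rule approx_pointwise[OF d(1) cd v \<open>v \<noteq> x\<close>])
     also have "... \<le> C2 * R powr (- s)" using dv R s_bounds C2_nonneg by (intro mult_left_mono powr_mono2') auto
     finally have "norm (u v) powr two_star TYPE('a) \<le> ?c" using p2 by (intro powr_mono2) auto
     then show ?thesis by (intro mult_right_mono ennreal_leI) auto
    qed simp
   qed
   also have "... = emeasure lebesgue (ball y R) * ennreal ?c" by (subst nn_integral_cmult_indicator) (auto simp: mult.commute)
   finally have "(\<integral>\<^sup>+v. ennreal (norm (u v) powr two_star TYPE('a)) \<partial>lebesgue_on (ball y R)) / emeasure lebesgue (ball y R) \<le> ennreal ?c"
    using vol_pos[OF R(1)] by (intro divide_le_posI_ennreal) (auto simp: emeasure_ball_vol[OF R(1)])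
   then show ?thesis using p2 C2_nonneg by (subst ennpowr_le_iff) auto
  qed
  have "ennreal (norm (w y' - w z') / norm (y' - z') powr ?\<eta>) \<le> ennreal (CH R\<^sub>0 * R powr (- ?\<eta>)) * ennreal (C2 * R powr (- s))"
   using wH[of y' z'] y' z' subs \<open>y' \<noteq> z'\<close> mult_left_mono[OF avg, of "ennreal (CH R\<^sub>0 * R powr (- ?\<eta>))"]
   by (meson order_trans subsetD zero_le)
  also have "... = ennreal c" using eta C2_nonneg by (simp add: c_def ennreal_mult[symmetric])
  finally have "norm (w y' - w z') / norm (y' - z') powr ?\<eta> \<le> c" using c0 by (simp add: ennreal_le_iff)
  then have "norm (u y' - u z') \<le> c * norm (y' - z') powr ?\<eta>" using \<open>y' \<noteq> z'\<close> y' z' by (simp add: divide_le_eq)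
  also have "... \<le> c * (norm (y - z) + 2 * e) powr ?\<eta>"
  proof (intro mult_left_mono powr_mono2)
   have "dist y' z' \<le> dist y' y + dist y z + dist z z'" using dist_triangle[of y' z' y] dist_triangle[of y z' z] by linarith
   then show "norm (y' - z') \<le> norm (y - z) + 2 * e" using y' z' d(5) by (simp add: dist_norm norm_minus_commute)
  qed (use eta c0 in auto)
  finally have m: "norm (u y' - u z') \<le> c * (norm (y - z) + 2 * e) powr ?\<eta>" .
  have a1: "norm (u y' - G x y $ k) \<le> e" unfolding u_def
  proof (rule approx_close[OF d(1) cd])
   show "y' \<in> W" using subsetD[OF sub] subsetD[OF subset_ball[of R\<^sub>0 "2 * R\<^sub>0" y]] subsetD[OF subs(1) y'(1)] R0 by simp
   show "y' \<notin> ball x d" using y'(1) subs(1) disj by blast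
   show "norm (G x' y' - G x y) \<le> e" if "x' \<in> ball x d" for x'
    using d1(4)[of x' y'] that y'(1) d(2) by (simp add: less_imp_le)
  qed
  have a2: "norm (u z' - G x z $ k) \<le> e" unfolding u_def
  proof (rule approx_close[OF d(1) cd])
   show "z' \<in> W" using subsetD[OF sub] subsetD[OF subset_ball[of R\<^sub>0 "2 * R\<^sub>0" y]] subsetD[OF subs(2) z'(1)] R0 by simp
   show "z' \<notin> ball x d" using z'(1) subs(2) disj by blast
   show "norm (G x' z' - G x z) \<le> e" if "x' \<in> ball x d" for x'
    using d2(3)[of x' z'] that z'(1) d(3) by (simp add: less_imp_le)
  qed
  have eq: "G x y $ k - G x z $ k = (u y' - u z') + (u z' - G x z $ k) - (u y' - G x y $ k)" by simp
  have "norm (G x y $ k - G x z $ k) \<le> norm (u y' - u z') + norm (u z' - G x z $ k) + norm (u y' - G x y $ k)"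
   unfolding eq using norm_triangle_ineq4[of "(u y' - u z') + (u z' - G x z $ k)" "u y' - G x y $ k"]
    norm_triangle_ineq[of "u y' - u z'" "u z' - G x z $ k"] by linarith
  with m a1 a2 show ?thesis by linarith
 qed
 have "((\<lambda>e. 2 * e + c * (norm (y - z) + 2 * e) powr ?\<eta>) \<longlongrightarrow> 2 * 0 + c * (norm (y - z) + 2 * 0) powr ?\<eta>) (at_right 0)"
  using False by (intro tendsto_intros) auto
 then have "norm (G x y $ k - G x z $ k) \<le> 2 * 0 + c * (norm (y - z) + 2 * 0) powr ?\<eta>"
  by (rule tendsto_lowerbound) (auto intro: eventually_mono[OF eventually_at_right_less] key)
 also have "... = CH R\<^sub>0 * C2 * (norm (y - z) / R) powr ?\<eta> * R powr (2 - real CARD('a))"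
  using R by (simp add: c_def s_def powr_divide powr_minus_divide)
 finally show ?thesis .
qed

end

subsection \<open>The kernel of the adjoint problem\<close>

lemma Linf_cE:
 fixes g :: "real^'n::finite \<Rightarrow> 'b::euclidean_space"
 assumes "g \<in> Linf_c U" "open U"
 obtains M K where "g \<in> meas_on U" "M \<ge> 0" "AE x in lebesgue. x \<in> U \<longrightarrow> norm (g x) \<le> M"
  "compact K" "K \<subseteq> U" "\<And>x. x \<in> U \<Longrightarrow> x \<notin> K \<Longrightarrow> g x = 0"
proof -
 have fin: "Lp_norm \<infinity> U g < \<infinity>" using assms by (simp add: Linf_c_def)
 then have m: "g \<in> meas_on U" by (auto simp: Lp_norm_def split: if_splits)
 then have "esssup (lebesgue_on U) (\<lambda>x. ennreal (norm (g x))) < \<infinity>" using fin by (simp add: Lp_norm_def)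
 then obtain M where M: "M \<ge> 0" "esssup (lebesgue_on U) (\<lambda>x. ennreal (norm (g x))) = ennreal M"
  by (cases "esssup (lebesgue_on U) (\<lambda>x. ennreal (norm (g x)))") auto
 have "AE x in lebesgue_on U. ennreal (norm (g x)) \<le> ennreal M" using esssup_AE[of "\<lambda>x. ennreal (norm (g x))" "lebesgue_on U"] M by simp
 then have ae: "AE x in lebesgue. x \<in> U \<longrightarrow> norm (g x) \<le> M"
  using assms(2) M by (simp add: AE_restrict_space_iff ennreal_le_iff)
 obtain K where "compact K" "K \<subseteq> U" "\<forall>x\<in>U - K. g x = 0" using assms(1) unfolding Linf_c_def by blast
 then show ?thesis using m M(1) ae that by blast
qed

lemma Linf_c_L2:
 fixes g :: "real^'n::finite \<Rightarrow> 'b::euclidean_space"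
 assumes g: "g \<in> Linf_c U" and U: "open U"
 obtains a R where "g \<in> meas_on U" "L2sq U g \<le> ennreal (a^2)" "a \<ge> 0"
  "\<forall>x\<in>U. x \<notin> ball 0 R \<longrightarrow> g x = 0" "R > 0"
proof -
 obtain M K where g': "g \<in> meas_on U" "M \<ge> 0" "AE x in lebesgue. x \<in> U \<longrightarrow> norm (g x) \<le> M"
  "compact K" "K \<subseteq> U" "\<And>x. x \<in> U \<Longrightarrow> x \<notin> K \<Longrightarrow> g x = 0"
  by (rule Linf_cE[OF g U]) blast
 obtain R where R: "R > 0" "K \<subseteq> ball 0 R" using bounded_subset_ballD[OF compact_imp_bounded[OF g'(4)], of 0] by auto
 have KS: "K \<in> sets lebesgue" using g'(4) by (simp add: borel_compact)
 have "L2sq U g \<le> (\<integral>\<^sup>+x\<in>K. ennreal (M^2) \<partial>lebesgue)" unfolding L2sq_def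
 proof (rule nn_integral_mono_AE, use g'(3) in eventually_elim)
  fix x assume x: "x \<in> U \<longrightarrow> norm (g x) \<le> M"
  show "ennreal ((norm (g x))^2) * indicator U x \<le> ennreal (M^2) * indicator K x"
  proof (cases "x \<in> K")
   case True
   then have "x \<in> U" "norm (g x) \<le> M" using x g'(5) by auto
   then show ?thesis using True by (simp add: ennreal_leI power_mono)
  next
   case False
   then show ?thesis using g'(6)[of x] by (cases "x \<in> U") auto
  qed
 qed
 also have "... < \<infinity>" using KS compact_lebesgue_finite[OF g'(4)] by (simp add: nn_integral_cmult_indicator ennreal_mult_less_top)
 finally obtain a where a: "a \<ge> 0" "L2sq U g = ennreal a" by (cases "L2sq U g") auto
 have a2: "L2sq U g \<le> ennreal ((sqrt a)^2)" "sqrt a \<ge> 0" using a by auto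
 have supp: "\<forall>x\<in>U. x \<notin> ball 0 R \<longrightarrow> g x = 0" using g'(6) R(2) by blast
 show ?thesis by (rule that[OF g'(1) a2 supp R(1)])
qed

lemma completion_ex_borel_measurable_vec:
 fixes g :: "'a \<Rightarrow> 'b::euclidean_space"
 assumes g: "g \<in> borel_measurable (completion M)"
 shows "\<exists>g'\<in>borel_measurable M. AE x in M. g x = g' x"
proof -
 have "\<exists>f\<in>borel_measurable M. AE x in M. g x \<bullet> e = f x" for e
  by (rule completion_ex_borel_measurable_real) (intro borel_measurable_inner g borel_measurable_const)
 then obtain f where f: "\<And>e. f e \<in> borel_measurable M" "\<And>e. AE x in M. g x \<bullet> e = f e x" by metis
 define g' where "g' = (\<lambda>x. \<Sum>e\<in>Basis. f e x *\<^sub>R e)"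
 have "g' \<in> borel_measurable M" unfolding g'_def by (intro borel_measurable_sum borel_measurable_scaleR f borel_measurable_const)
 moreover have "AE x in M. \<forall>e\<in>Basis. g x \<bullet> e = f e x"
  by (subst AE_ball_countable[OF countable_finite[OF finite_Basis]]) (use f(2) in blast)
 then have "AE x in M. g x = g' x"
 proof eventually_elim
  case (elim x)
  have "g x = (\<Sum>e\<in>Basis. (g x \<bullet> e) *\<^sub>R e)" by (rule euclidean_representation[symmetric])
  also have "... = g' x" unfolding g'_def by (intro sum.cong refl) (use elim in simp)
  finally show ?case .
 qed
 ultimately show ?thesis by blast
qed

context green_kernel
begin

text \<open>Integrates out the second variable, where \<open>rep\<close> integrates out the first:
  the candidate solution when the arguments of B are exchanged.\<close>

definition corep :: "(real^'a \<Rightarrow> real^'b) \<Rightarrow> real^'a \<Rightarrow> real^'b" where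
 "corep g x = (\<chi> j. LINT y:W|lebesgue. G x y $ j \<bullet> g y)"

text \<open>G with its arbitrary values off the domain and on the diagonal set to 0. It is then
  jointly Borel, as Fubini's theorem on the product measure requires.\<close>

definition Gt :: "real^'a \<Rightarrow> real^'a \<Rightarrow> real^'b^'b" where
 "Gt x y = indicator {(x, y). x \<in> W \<and> y \<in> W \<and> x \<noteq> y} (x, y) *\<^sub>R G x y"

lemma Gt_eq: "x \<in> W \<Longrightarrow> y \<in> W \<Longrightarrow> x \<noteq> y \<Longrightarrow> Gt x y = G x y"
 by (simp add: Gt_def)

lemma Gt_measurable: "(\<lambda>(x, y). Gt x y) \<in> borel_measurable (lborel \<Otimes>\<^sub>M lborel)"
proof -
 let ?D = "{(x, y). x \<in> W \<and> y \<in> W \<and> x \<noteq> y}"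
 have "?D = (W \<times> W) - {p. fst p = snd p}" by auto
 moreover have "closed {p :: (real^'a) \<times> (real^'a). fst p = snd p}" by (intro closed_Collect_eq continuous_intros)
 ultimately have "open ?D" using open_W by (auto intro!: open_Diff open_Times)
 then have "(\<lambda>p. indicator ?D p *\<^sub>R (case p of (x, y) \<Rightarrow> G x y)) \<in> borel_measurable borel"
  by (intro borel_measurable_continuous_on_indicator G_cont) auto
 moreover have "(\<lambda>p. indicator ?D p *\<^sub>R (case p of (x, y) \<Rightarrow> G x y)) = (\<lambda>(x, y). Gt x y)"
  by (auto simp: Gt_def fun_eq_iff)
 ultimately have m: "(\<lambda>(x, y). Gt x y) \<in> borel_measurable borel" by simp
 have "sets (lborel \<Otimes>\<^sub>M lborel) = sets (borel :: ((real^'a) \<times> (real^'a)) measure)"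
  using sets_pair_measure_cong[OF sets_lborel sets_lborel] by (metis borel_prod)
 then show ?thesis using m measurable_cong_sets[OF _ refl] by blast
qed

lemma Gt_row_bound: "norm (Gt x y $ j) \<le> C1' * dist x y powr (- s)"
 using G_row_bound'[of x y j] C1'_nonneg by (cases "x \<in> W \<and> y \<in> W \<and> x \<noteq> y") (auto simp: Gt_def)

lemma AE_not_point: "AE y in lebesgue. y \<noteq> (x :: real^'a)"
proof -
 have "AE y in lebesgue. y \<notin> {x}" by (intro AE_not_in) (simp add: null_sets_completionI)
 then show ?thesis by simp
qed

lemma test_bump_Linf_c:
 assumes \<phi>: "\<phi> \<in> test_fun W"
 shows "(\<lambda>x. \<phi> x *\<^sub>R axis j 1 :: real^'b) \<in> Linf_c W"
proof -
 obtain K where K: "compact K" "K \<subseteq> W" "\<And>z. z \<notin> K \<Longrightarrow> \<phi> z = 0" using test_fun_support[OF \<phi>] by metis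
 obtain M where M: "\<And>z. \<bar>\<phi> z\<bar> \<le> M" using test_fun_bounded[OF \<phi>] by metis
 have m: "(\<lambda>x. \<phi> x *\<^sub>R axis j 1 :: real^'b) \<in> meas_on W"
  by (intro measurable_restrict_space1 borel_measurable_scaleR test_fun_measurable[OF \<phi>] borel_measurable_const)
 have "esssup (lebesgue_on W) (\<lambda>x. ennreal (norm (\<phi> x *\<^sub>R axis j 1 :: real^'b))) \<le> ennreal M"
 proof (rule esssup_I)
  show "(\<lambda>x. ennreal (norm (\<phi> x *\<^sub>R axis j 1 :: real^'b))) \<in> meas_on W" using m by measurable
  show "AE x in lebesgue_on W. ennreal (norm (\<phi> x *\<^sub>R axis j 1 :: real^'b)) \<le> ennreal M"
   using M by (intro AE_I2 ennreal_leI) (simp add: norm_axis_1)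
 qed
 then have "Lp_norm \<infinity> W (\<lambda>x. \<phi> x *\<^sub>R axis j 1 :: real^'b) < \<infinity>"
  using m by (auto simp: Lp_norm_def intro: le_less_trans)
 then show ?thesis using K by (auto simp: Linf_c_def)
qed

text \<open>For f = \<phi> e_j, evaluating \<open>B w (rep f)\<close> by either equation equates the
  integral of f against w with that of g against \<open>rep f\<close>; Fubini's theorem rewrites the
  latter as the integral of \<phi> against the j-th component of \<open>corep g\<close>. As \<phi>
  is arbitrary, the fundamental lemma applies.\<close>

lemma corep_AE:
 assumes g: "g \<in> Linf_c W" and w: "w \<in> H" and eq: "\<And>v. v \<in> H \<Longrightarrow> B w v = (LINT x:W|lebesgue. g x \<bullet> v x)"
 shows "AE x in lebesgue_on W. corep g x = w x"
proof -
 obtain M K where g': "g \<in> meas_on W" "M \<ge> 0" "AE x in lebesgue. x \<in> W \<longrightarrow> norm (g x) \<le> M"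
  "compact K" "K \<subseteq> W" "\<And>x. x \<in> W \<Longrightarrow> x \<notin> K \<Longrightarrow> g x = 0"
  by (rule Linf_cE[OF g open_W]) blast
 \<comment> \<open>A Borel representative of g extended by zero, for use on the product
   space.\<close>
 obtain h where hm: "h \<in> borel_measurable lborel" and hg: "AE y in lborel. indicator W y *\<^sub>R g y = h y"
  using completion_ex_borel_measurable_vec[OF indicator_measurable_on[OF sets_W g'(1)]] by blast
 have hg': "AE y in lebesgue. indicator W y *\<^sub>R g y = h y" by (rule AE_completion[OF hg])
 have hb: "AE y in lebesgue. norm (h y) \<le> M * indicator K y" using hg' g'(3)
 proof eventually_elim
  case (elim y)
  show ?case using elim(1)[symmetric] elim(2) g'(2,5) g'(6)[of y] by (cases "y \<in> W") (auto simp: indicator_def)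
 qed
 have row_m: "(\<lambda>(x, y). Gt x y $ j) \<in> borel_measurable (lborel \<Otimes>\<^sub>M lborel)" for j
  using measurable_compose[OF Gt_measurable, of "\<lambda>A. A $ j" borel]
  by (simp add: case_prod_beta' borel_measurable_continuous_onI continuous_intros)
 have F_m: "(\<lambda>(x, y). Gt x y $ j \<bullet> h y) \<in> borel_measurable (lborel \<Otimes>\<^sub>M lborel)" for j
 proof -
  have "(\<lambda>p. h (snd p)) \<in> borel_measurable (lborel \<Otimes>\<^sub>M lborel)" using hm by measurable
  then show ?thesis using borel_measurable_inner[OF row_m[of j]] by (simp add: case_prod_beta')
 qed
 \<comment> \<open>The singularity has order n - 2 < n, so the inner integral is bounded locally
   uniformly in x; K lies within 2R of every x in the ball.\<close>
 have inner_bound: "(\<integral>\<^sup>+y. ennreal (norm (Gt x y $ j \<bullet> h y)) \<partial>lborel) \<le> ennreal (C1' * M * (Ck * (2 * R) powr 2))"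
  if R: "R > 0" "K \<subseteq> cball 0 R" and x: "x \<in> cball 0 R" for x j R
 proof -
  have sub: "K \<subseteq> cball x (2 * R)"
  proof
   fix y assume "y \<in> K"
   then have "norm y \<le> R" "norm x \<le> R" using R x by auto
   then show "y \<in> cball x (2 * R)" using norm_triangle_ineq4[of x y] by (simp add: dist_norm)
  qed
  have "(\<integral>\<^sup>+y. ennreal (norm (Gt x y $ j \<bullet> h y)) \<partial>lborel) = (\<integral>\<^sup>+y. ennreal (norm (Gt x y $ j \<bullet> h y)) \<partial>lebesgue)"
   by (rule nn_integral_completion[symmetric])
  also have "... \<le> (\<integral>\<^sup>+y. ennreal (C1' * M) * (ennreal (dist y x powr (- s)) * indicator (cball x (2 * R)) y) \<partial>lebesgue)"
  proof (rule nn_integral_mono_AE, use hb in eventually_elim)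
   fix y assume y: "norm (h y) \<le> M * indicator K y"
   show "ennreal (norm (Gt x y $ j \<bullet> h y)) \<le> ennreal (C1' * M) * (ennreal (dist y x powr (- s)) * indicator (cball x (2 * R)) y)"
   proof (cases "y \<in> K")
    case True
    have "norm (Gt x y $ j \<bullet> h y) \<le> norm (Gt x y $ j) * norm (h y)" by (simp add: Cauchy_Schwarz_ineq2)
    also have "... \<le> (C1' * dist x y powr (- s)) * M" using y True C1'_nonneg by (intro mult_mono Gt_row_bound) auto
    finally have "ennreal (norm (Gt x y $ j \<bullet> h y)) \<le> ennreal (C1' * M * dist y x powr (- s))"
     by (intro ennreal_leI) (simp add: mult_ac dist_commute)
    also have "... = ennreal (C1' * M) * ennreal (dist y x powr (- s))" using C1'_nonneg g'(2) by (simp add: ennreal_mult)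
    finally show ?thesis using subsetD[OF sub True] by simp
   next
    case False
    then have "h y = 0" using y by simp
    then show ?thesis by simp
   qed
  qed
  also have "... = ennreal (C1' * M) * (\<integral>\<^sup>+y\<in>cball x (2 * R). ennreal (dist y x powr (- s)) \<partial>lebesgue)"
   by (intro nn_integral_cmult kernel_measurable) auto
  also have "... \<le> ennreal (C1' * M) * ennreal (Ck * (2 * R) powr (real CARD('a) - s))"
   unfolding Ck_def using R s_bounds by (intro mult_left_mono kernel_inner) auto
  also have "... = ennreal (C1' * M * (Ck * (2 * R) powr 2))" using C1'_nonneg g'(2) by (simp add: ennreal_mult'[symmetric] s_def)
  finally show ?thesis .
 qed
 have corep_j: "corep g x $ j = (\<integral>y. Gt x y $ j \<bullet> h y \<partial>lborel)" if x: "x \<in> W" for x j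
 proof -
  have m1: "(\<lambda>y. Gt x y $ j \<bullet> h y) \<in> borel_measurable lborel" using measurable_compose_Pair1[OF _ F_m[of j], of x] by simp
  have "corep g x $ j = (\<integral>y. indicator W y *\<^sub>R (G x y $ j \<bullet> g y) \<partial>lebesgue)"
   by (simp add: corep_def set_lebesgue_integral_def)
  also have "... = (\<integral>y. Gt x y $ j \<bullet> h y \<partial>lebesgue)"
  proof (rule integral_cong_AE)
   show "(\<lambda>y. indicator W y *\<^sub>R (G x y $ j \<bullet> g y)) \<in> meas_L"
    by (intro indicator_measurable_on[OF sets_W] borel_measurable_inner row_measurable x g')
   show "(\<lambda>y. Gt x y $ j \<bullet> h y) \<in> meas_L" by (rule measurable_completion[OF m1])
   show "AE y in lebesgue. indicator W y *\<^sub>R (G x y $ j \<bullet> g y) = Gt x y $ j \<bullet> h y"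
    using hg' AE_not_point[of x]
   proof eventually_elim
    case (elim y)
    then show ?case using x Gt_eq[of x y] by (cases "y \<in> W") auto
   qed
  qed
  also have "... = (\<integral>y. Gt x y $ j \<bullet> h y \<partial>lborel)" by (rule integral_completion[OF m1])
  finally show ?thesis .
 qed
 obtain R1 where R1: "R1 > 0" "K \<subseteq> ball 0 R1" using bounded_subset_ballD[OF compact_imp_bounded[OF g'(4)], of 0] by auto
 have param_m: "(\<lambda>x. \<integral>y. Gt x y $ j \<bullet> h y \<partial>lborel) \<in> borel_measurable lborel" for j
  by (rule lborel.borel_measurable_lebesgue_integral[OF F_m])
 have "AE x in lebesgue_on W. corep g x $ j - w x $ j = 0" for j
 proof (rule fundamental_lemma[OF open_W])
  have mc: "(\<lambda>x. corep g x $ j) \<in> meas_on W" using measurable_restrict_space1[OF measurable_completion[OF param_m[of j]], of W] corep_j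
   by (simp cong: measurable_lebesgue_cong)
  have lc: "locally_integrable W (\<lambda>x. corep g x $ j)"
  proof (rule locally_integrable_from_balls[OF mc, of 0])
   fix r :: real assume r: "r > 0"
   define R where "R = max r R1"
   have R: "R > 0" "K \<subseteq> cball 0 R" "cball 0 r \<subseteq> cball (0::real^'a) R" using r R1 by (auto simp: R_def)
   have "(\<integral>\<^sup>+x\<in>W \<inter> cball 0 r. ennreal (norm (corep g x $ j)) \<partial>lebesgue) \<le>
    (\<integral>\<^sup>+x\<in>cball (0::real^'a) r. ennreal (C1' * M * (Ck * (2 * R) powr 2)) \<partial>lebesgue)"
   proof (intro nn_integral_mono)
    fix x
    show "ennreal (norm (corep g x $ j)) * indicator (W \<inter> cball 0 r) x \<le> ennreal (C1' * M * (Ck * (2 * R) powr 2)) * indicator (cball 0 r) x"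
    proof (cases "x \<in> W \<inter> cball 0 r")
     case True
     then have "norm (corep g x $ j) \<le> C1' * M * (Ck * (2 * R) powr 2)"
      unfolding corep_j[of x j, OF IntD1[OF True]] using True R(3) C1'_nonneg Ck_nonneg g'(2) by (intro norm_integral_le_nn inner_bound R) auto
     then show ?thesis using True by (auto intro!: ennreal_leI)
    qed simp
   qed
   also have "... < \<infinity>" using emeasure_cball_powr[OF r, of "0::real^'a"]
    by (subst nn_integral_cmult_indicator) (auto simp: ennreal_mult_less_top)
   finally show "(\<integral>\<^sup>+x\<in>W \<inter> cball 0 r. ennreal (norm (corep g x $ j)) \<partial>lebesgue) < \<infinity>" .
  qed
  have lw: "locally_integrable W (\<lambda>x. w x $ j)"
   using locally_integrable_linear[OF _ bounded_linear_vec_nth, of W w j] H_weak_deriv[OF w] by (simp add: has_weak_deriv_alt)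
  have "locally_integrable W (\<lambda>x. corep g x $ j + (-1) *\<^sub>R (w x $ j))"
   by (intro locally_integrable_add lc locally_integrable_linear[OF lw bounded_linear_scaleR_right])
  then show "locally_integrable W (\<lambda>x. corep g x $ j - w x $ j)" by simp
  fix \<phi> assume \<phi>: "\<phi> \<in> test_fun W"
  obtain K1 where K1: "compact K1" "K1 \<subseteq> W" "\<And>z. z \<notin> K1 \<Longrightarrow> \<phi> z = 0"
   using test_fun_support[OF \<phi>] by metis
  obtain M1 where M1: "\<And>z. \<bar>\<phi> z\<bar> \<le> M1" "M1 > 0" using test_fun_bounded[OF \<phi>] by metis
  obtain R2 where R2: "R2 > 0" "K1 \<subseteq> ball 0 R2" using bounded_subset_ballD[OF compact_imp_bounded[OF K1(1)], of 0] by auto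
  define R where "R = max R2 R1"
  have R: "R > 0" "K \<subseteq> cball 0 R" "K1 \<subseteq> cball 0 R" using R1 R2 by (auto simp: R_def)
  define f where "f = (\<lambda>x. \<phi> x *\<^sub>R axis j 1 :: real^'b)"
  have f: "f \<in> Linf_c W" unfolding f_def by (rule test_bump_Linf_c[OF \<phi>])
  have phim: "\<phi> \<in> borel_measurable lborel"
   using smooth_fun_continuous[OF test_fun_smooth[OF \<phi>], of UNIV] by (simp add: borel_measurable_continuous_onI)
  define \<Phi> where "\<Phi> = (\<lambda>x y. \<phi> x * (Gt x y $ j \<bullet> h y))"
  have \<Phi>m: "(\<lambda>(x, y). \<Phi> x y) \<in> borel_measurable (lborel \<Otimes>\<^sub>M lborel)"
  proof -
   have "(\<lambda>p. \<phi> (fst p)) \<in> borel_measurable (lborel \<Otimes>\<^sub>M lborel)" using phim by measurable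
   then show ?thesis using borel_measurable_times[OF _ F_m[of j]] by (simp add: \<Phi>_def case_prod_beta')
  qed
  have \<Phi>i: "integrable (lborel \<Otimes>\<^sub>M lborel) (\<lambda>(x, y). \<Phi> x y)"
  proof (rule integrableI_bounded[OF \<Phi>m])
   define b where "b = C1' * M * (Ck * (2 * R) powr 2)"
   have "(\<integral>\<^sup>+p. ennreal (norm (case p of (x, y) \<Rightarrow> \<Phi> x y)) \<partial>(lborel \<Otimes>\<^sub>M lborel)) = (\<integral>\<^sup>+x. \<integral>\<^sup>+y. ennreal (norm (\<Phi> x y)) \<partial>lborel \<partial>lborel)"
   proof -
    have "(\<lambda>p. ennreal (norm (case p of (x, y) \<Rightarrow> \<Phi> x y))) \<in> borel_measurable (lborel \<Otimes>\<^sub>M lborel)"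
     using \<Phi>m by measurable
    from lborel.nn_integral_fst[OF this] show ?thesis by simp
   qed
   also have "... \<le> (\<integral>\<^sup>+x\<in>cball (0::real^'a) R. ennreal (M1 * b) \<partial>lborel)"
   proof (intro nn_integral_mono)
    fix x
    show "(\<integral>\<^sup>+y. ennreal (norm (\<Phi> x y)) \<partial>lborel) \<le> ennreal (M1 * b) * indicator (cball 0 R) x"
    proof (cases "x \<in> K1")
     case True
     have mx: "(\<lambda>y. ennreal (norm (Gt x y $ j \<bullet> h y))) \<in> borel_measurable lborel"
      using measurable_compose_Pair1[OF _ F_m[of j], of x] by simp
     have "(\<integral>\<^sup>+y. ennreal (norm (\<Phi> x y)) \<partial>lborel) = ennreal \<bar>\<phi> x\<bar> * (\<integral>\<^sup>+y. ennreal (norm (Gt x y $ j \<bullet> h y)) \<partial>lborel)"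
      by (subst nn_integral_cmult[OF mx, symmetric]) (simp add: \<Phi>_def abs_mult ennreal_mult)
     also have "... \<le> ennreal M1 * ennreal b" unfolding b_def using R True M1 by (intro mult_mono ennreal_leI inner_bound) auto
     also have "... = ennreal (M1 * b)" using M1 by (simp add: ennreal_mult')
     finally show ?thesis using True R(3) by auto
    qed (simp add: \<Phi>_def K1)
   qed
   also have "... < \<infinity>" using emeasure_cball_powr[OF R(1), of "0::real^'a"]
    by (subst nn_integral_cmult_indicator) (auto simp: ennreal_mult_less_top)
   finally show "(\<integral>\<^sup>+p. ennreal (norm (case p of (x, y) \<Rightarrow> \<Phi> x y)) \<partial>(lborel \<Otimes>\<^sub>M lborel)) < \<infinity>" .
  qed
  have fub: "(\<integral>y. (\<integral>x. \<Phi> x y \<partial>lborel) \<partial>lborel) = (\<integral>x. (\<integral>y. \<Phi> x y \<partial>lborel) \<partial>lborel)"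
   by (rule lborel_pair.Fubini_integral[OF \<Phi>i])
  have left: "(\<integral>x. (\<integral>y. \<Phi> x y \<partial>lborel) \<partial>lborel) = (\<integral>x. \<phi> x * corep g x $ j \<partial>lebesgue)"
  proof -
   have m: "(\<lambda>x. \<integral>y. \<Phi> x y \<partial>lborel) \<in> borel_measurable lborel"
    by (rule lborel.borel_measurable_lebesgue_integral[OF \<Phi>m])
   have "(\<integral>y. \<Phi> x y \<partial>lborel) = \<phi> x * corep g x $ j" for x
    using corep_j[of x j] K1(2) K1(3)[of x] by (cases "x \<in> K1") (auto simp: \<Phi>_def)
   then show ?thesis using integral_completion[OF m] by simp
  qed
  have repf: "rep f y $ k = (\<integral>x. \<phi> x * Gt x y $ j $ k \<partial>lebesgue)" if y: "y \<in> W" for y k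
  proof -
   have sm: "(\<Sum>i\<in>UNIV. G x y $ i $ k * f x $ i) = \<phi> x * G x y $ j $ k" for x
   proof -
    have "(\<Sum>i\<in>UNIV. G x y $ i $ k * f x $ i) = (\<Sum>i\<in>UNIV. if i = j then \<phi> x * G x y $ j $ k else 0)"
     by (intro sum.cong) (auto simp: f_def axis_def)
    then show ?thesis by simp
   qed
   have cG: "continuous_on (W - {y}) (\<lambda>x. G x y $ j $ k)" by (intro bounded_linear.continuous_on[OF bounded_linear_vec_nth] G_cont_left y)
   have "rep f y $ k = (\<integral>x. indicator W x *\<^sub>R (\<phi> x * G x y $ j $ k) \<partial>lebesgue)"
    by (simp add: rep_def sm set_lebesgue_integral_def)
   also have "... = (\<integral>x. \<phi> x * Gt x y $ j $ k \<partial>lebesgue)"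
   proof (rule integral_cong_AE)
    show "(\<lambda>x. indicator W x *\<^sub>R (\<phi> x * G x y $ j $ k)) \<in> meas_L"
     by (intro indicator_measurable_on[OF sets_W] borel_measurable_times measurable_restrict_space1[OF test_fun_measurable[OF \<phi>]] measurable_off_point[OF cG])
    have "(\<lambda>x. Gt x y) \<in> borel_measurable lborel" using measurable_Pair1[OF Gt_measurable, of y] by simp
    then have "(\<lambda>x. Gt x y $ j $ k) \<in> borel_measurable lborel"
     by (rule measurable_compose) (intro borel_measurable_continuous_onI continuous_intros)
    then show "(\<lambda>x. \<phi> x * Gt x y $ j $ k) \<in> meas_L"
     by (intro borel_measurable_times test_fun_measurable[OF \<phi>] measurable_completion)
    show "AE x in lebesgue. indicator W x *\<^sub>R (\<phi> x * G x y $ j $ k) = \<phi> x * Gt x y $ j $ k"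
     using AE_not_point[of y] by eventually_elim (use y K1 in \<open>auto simp: Gt_def indicator_def\<close>)
   qed
   finally show ?thesis .
  qed
  have Gti: "integrable lborel (\<lambda>x. \<phi> x * Gt x y $ j $ k)" for y k
  proof (rule integrableI_bounded)
   have "(\<lambda>x. Gt x y) \<in> borel_measurable lborel" using measurable_Pair1[OF Gt_measurable, of y] by simp
   then have "(\<lambda>x. Gt x y $ j $ k) \<in> borel_measurable lborel"
    by (rule measurable_compose) (intro borel_measurable_continuous_onI continuous_intros)
   then show "(\<lambda>x. \<phi> x * Gt x y $ j $ k) \<in> borel_measurable lborel" using phim by (intro borel_measurable_times)
   obtain r where r: "r > 0" "K1 \<subseteq> cball y r"
    using bounded_subset_ballD[OF compact_imp_bounded[OF K1(1)], of y] ball_subset_cball by blast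
   have "(\<integral>\<^sup>+x. ennreal (norm (\<phi> x * Gt x y $ j $ k)) \<partial>lborel) = (\<integral>\<^sup>+x. ennreal (norm (\<phi> x * Gt x y $ j $ k)) \<partial>lebesgue)"
    by (rule nn_integral_completion[symmetric])
   also have "... \<le> (\<integral>\<^sup>+x. ennreal (M1 * C1') * (ennreal (dist x y powr (- s)) * indicator (cball y r) x) \<partial>lebesgue)"
   proof (intro nn_integral_mono)
    fix x
    show "ennreal (norm (\<phi> x * Gt x y $ j $ k)) \<le> ennreal (M1 * C1') * (ennreal (dist x y powr (- s)) * indicator (cball y r) x)"
    proof (cases "x \<in> K1")
     case True
     have "norm (\<phi> x * Gt x y $ j $ k) \<le> M1 * (C1' * dist x y powr (- s))"
      unfolding norm_mult using M1 order_trans[OF component_le_norm_cart Gt_row_bound[of x y j], of k] by (intro mult_mono) auto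
     then have "ennreal (norm (\<phi> x * Gt x y $ j $ k)) \<le> ennreal (M1 * C1' * dist x y powr (- s))" by (intro ennreal_leI) (simp add: mult.assoc)
     also have "... = ennreal (M1 * C1') * ennreal (dist x y powr (- s))" using M1 C1'_nonneg by (simp add: ennreal_mult)
     finally show ?thesis using subsetD[OF r(2) True] by simp
    qed (simp add: K1)
   qed
   also have "... = ennreal (M1 * C1') * (\<integral>\<^sup>+x\<in>cball y r. ennreal (dist x y powr (- s)) \<partial>lebesgue)"
    by (intro nn_integral_cmult kernel_measurable) auto
   also have "... < \<infinity>" using kernel_inner[OF r(1), of s y] s_bounds by (auto simp: ennreal_mult_less_top intro: le_less_trans)
   finally show "(\<integral>\<^sup>+x. ennreal (norm (\<phi> x * Gt x y $ j $ k)) \<partial>lborel) < \<infinity>" .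
  qed
  have \<Phi>y: "(\<integral>x. \<Phi> x y \<partial>lborel) = (\<Sum>k\<in>UNIV. h y $ k * (\<integral>x. \<phi> x * Gt x y $ j $ k \<partial>lborel))" for y
  proof -
   have "\<Phi> x y = (\<Sum>k\<in>UNIV. h y $ k * (\<phi> x * Gt x y $ j $ k))" for x
    unfolding \<Phi>_def inner_vec_def by (simp add: sum_distrib_left mult_ac)
   then show ?thesis using Gti by simp
  qed
  have right: "(\<integral>y. (\<integral>x. \<Phi> x y \<partial>lborel) \<partial>lborel) = (LINT y:W|lebesgue. g y \<bullet> rep f y)"
  proof -
   have \<Phi>m': "(\<lambda>(y, x). \<Phi> x y) \<in> borel_measurable (lborel \<Otimes>\<^sub>M lborel)"
    using measurable_compose[OF measurable_pair_swap' \<Phi>m] by (simp add: case_prod_beta')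
   have m: "(\<lambda>y. \<integral>x. \<Phi> x y \<partial>lborel) \<in> borel_measurable lborel"
    by (rule lborel.borel_measurable_lebesgue_integral[OF \<Phi>m'])
   have "(\<integral>y. (\<integral>x. \<Phi> x y \<partial>lborel) \<partial>lborel) = (\<integral>y. (\<integral>x. \<Phi> x y \<partial>lborel) \<partial>lebesgue)"
    by (rule integral_completion[OF m, symmetric])
   also have "... = (\<integral>y. indicator W y *\<^sub>R (g y \<bullet> rep f y) \<partial>lebesgue)"
   proof (rule integral_cong_AE[OF measurable_completion[OF m]])
    show "(\<lambda>y. indicator W y *\<^sub>R (g y \<bullet> rep f y)) \<in> meas_L"
     by (intro indicator_measurable_on[OF sets_W] borel_measurable_inner g' H_measurable(1) rep_H f)
    show "AE y in lebesgue. (\<integral>x. \<Phi> x y \<partial>lborel) = indicator W y *\<^sub>R (g y \<bullet> rep f y)"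
     using hg'
    proof eventually_elim
     case (elim y)
     show ?case
     proof (cases "y \<in> W")
      case True
      have "(\<integral>x. \<phi> x * Gt x y $ j $ k \<partial>lborel) = rep f y $ k" for k
       using repf[OF True, of k] integral_completion[OF borel_measurable_integrable[OF Gti[of y k]]] by simp
      then show ?thesis using True elim \<Phi>y[of y] by (simp add: inner_vec_def)
     next
      case False
      then have "h y = 0" using elim by simp
      then show ?thesis using False by (simp add: \<Phi>y)
     qed
    qed
   qed
   finally show ?thesis by (simp add: set_lebesgue_integral_def)
  qed
  have "B w (rep f) = (LINT y:W|lebesgue. g y \<bullet> rep f y)" by (rule eq[OF rep_H[OF f]])
  moreover have "B w (rep f) = (LINT x:W|lebesgue. f x \<bullet> w x)" by (rule rep_eq[OF f w])
  moreover have "(LINT x:W|lebesgue. f x \<bullet> w x) = (\<integral>x. \<phi> x * w x $ j \<partial>lebesgue)"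
   using test_fun_set_integral[OF \<phi>, of "\<lambda>x. w x $ j"] by (simp add: f_def inner_axis')
  ultimately have main: "(\<integral>x. \<phi> x * corep g x $ j \<partial>lebesgue) = (\<integral>x. \<phi> x * w x $ j \<partial>lebesgue)"
   using left right fub by simp
  have i1: "integrable lebesgue (\<lambda>x. \<phi> x * corep g x $ j)" and i2: "integrable lebesgue (\<lambda>x. \<phi> x * w x $ j)"
   using test_fun_integrable_scaleR[OF \<phi> lc] test_fun_integrable_scaleR[OF \<phi> lw] by simp_all
  show "(\<integral>x. \<phi> x * (corep g x $ j - w x $ j) \<partial>lebesgue) = 0"
   unfolding right_diff_distrib Bochner_Integration.integral_diff[OF i1 i2] using main by simp
 qed
 then have "AE x in lebesgue_on W. \<forall>j\<in>UNIV. corep g x $ j - w x $ j = 0" by (subst AE_ball_countable) auto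
 then show ?thesis by eventually_elim (simp add: vec_eq_iff)
qed

text \<open>The difference of the two representatives has norm zero, and B is bounded.\<close>

lemma B_cong_left:
 assumes "u \<in> H" "v \<in> H" "w \<in> H" and ae: "AE x in lebesgue_on W. u x = w x"
 shows "B u v = B w v"
proof -
 have d: "(\<lambda>x. u x - w x) \<in> H" by (rule H_diff[OF assms(1,3)])
 have "AE x in lebesgue_on W. u x - w x = 0" using ae by eventually_elim simp
 moreover have "\<And>f. f \<in> F W \<Longrightarrow> (N f = 0 \<longleftrightarrow> (AE x in lebesgue_on W. f x = 0))"
  using banach unfolding banach_function_space_def by meson
 ultimately have "N (\<lambda>x. u x - w x) = 0" using H_F[OF d] by blast
 then have "B (\<lambda>x. u x - w x) v = 0" using bnd[OF d assms(2)] by simp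
 then show ?thesis using bilinear_form_on_diff(1)[OF bil assms(1,3,2)] by simp
qed

lemma corep_solution:
 assumes g: "g \<in> Linf_c W"
 shows "corep g \<in> H" "v \<in> H \<Longrightarrow> B (corep g) v = (LINT x:W|lebesgue. g x \<bullet> v x)"
proof -
 obtain a R where a: "g \<in> meas_on W" "L2sq W g \<le> ennreal (a^2)" "a \<ge> 0"
  and supp: "\<forall>x\<in>W. x \<notin> ball 0 R \<longrightarrow> g x = 0" and R: "R > 0"
  using Linf_c_L2[OF g open_W] by metis
 obtain w where w: "w \<in> H" "\<And>v. v \<in> H \<Longrightarrow> B w v = (LINT x:W|lebesgue. g x \<bullet> v x)"
  using solve[OF a supp R] by blast
 have ae: "AE x in lebesgue_on W. corep g x = w x" by (rule corep_AE[OF g w])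
 show c: "corep g \<in> H" by (rule H_cong[OF w(1) ae])
 show "B (corep g) v = (LINT x:W|lebesgue. g x \<bullet> v x)" if "v \<in> H"
  using B_cong_left[OF c that w(1) ae] w(2)[OF that] by simp
qed

text \<open>The setting is symmetric under exchanging the arguments of B, and \<open>corep\<close>
  is the representation formula of the transposed kernel. Everything proved for rows thereby holds
  for columns.\<close>

theorem swapped_kernel:
 "green_kernel W F nF c\<^sub>0 (\<lambda>u v. B v u) \<Gamma> \<gamma> sol K1 K2 \<eta> CH (\<lambda>x y. transpose (G y x))"
proof -
 interpret sw: green_setting W F nF c\<^sub>0 "\<lambda>u v. B v u" \<Gamma> \<gamma> sol K1 K2 \<eta> CH by (rule swapped)
 show ?thesis
 proof (unfold_locales, goal_cases)
  case 1
  let ?D = "{(x, y). x \<in> W \<and> y \<in> W \<and> x \<noteq> y}"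
  have "continuous_on ?D ((\<lambda>p. transpose (case p of (x, y) \<Rightarrow> G x y)) \<circ> (\<lambda>p. (snd p, fst p)))"
  proof (rule continuous_on_compose)
   show "continuous_on ?D (\<lambda>p. (snd p, fst p))" by (intro continuous_intros)
   have "continuous_on ((\<lambda>p. (snd p, fst p)) ` ?D) (\<lambda>p. case p of (x, y) \<Rightarrow> G x y)"
    by (rule continuous_on_subset[OF G_cont]) auto
   then show "continuous_on ((\<lambda>p. (snd p, fst p)) ` ?D) (\<lambda>p. transpose (case p of (x, y) \<Rightarrow> G x y))"
    unfolding transpose_def by (intro continuous_on_vec_lambda bounded_linear.continuous_on[OF bounded_linear_vec_nth])
  qed
  then show ?case by (simp add: o_def case_prod_beta')
 next
  case (2 f)
  have "(\<lambda>y. \<chi> k. LINT x:W|lebesgue. (\<Sum>j\<in>UNIV. transpose (G y x) $ j $ k * f x $ j)) = corep f"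
   by (simp add: corep_def fun_eq_iff vec_eq_iff transpose_def inner_vec_def)
  then show ?case using corep_solution(1)[OF 2] by simp
 next
  case (3 f v)
  have "(\<lambda>y. \<chi> k. LINT x:W|lebesgue. (\<Sum>j\<in>UNIV. transpose (G y x) $ j $ k * f x $ j)) = corep f"
   by (simp add: corep_def fun_eq_iff vec_eq_iff transpose_def inner_vec_def)
  then show ?case using corep_solution(2)[OF 3] by simp
 qed
qed

end

subsection \<open>Functions with a singularity of order n - 2\<close>

text \<open>Pointwise decay and square integrable tails of the gradient are the two facts from which
  all integral estimates follow; rows and columns of G are both instances.\<close>

locale singular_function =
 fixes W :: "(real^'n::finite) set" and x :: "real^'n" and f :: "real^'n \<Rightarrow> 'b::euclidean_space" and A E :: real
 assumes n3: "CARD('n) \<ge> 3" and open_W: "open W" and A: "A \<ge> 0" and E: "E \<ge> 0"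
  and weakly: "weakly_diff W f"
  and decay: "z \<in> W \<Longrightarrow> z \<noteq> x \<Longrightarrow> norm (f z) \<le> A * dist z x powr (2 - real CARD('n))"
  and tail: "t > 0 \<Longrightarrow> L2sq (W - cball x t) (wD W f) \<le> ennreal (E * t powr (2 - real CARD('n)))"
begin

lemma n_ge_3: "real CARD('n) \<ge> 3" using n3 by linarith

lemma deriv: "has_weak_deriv W f (wD W f)" by (rule wD_has_weak_deriv[OF weakly])

lemmas measurable = has_weak_deriv_measurable[OF open_W deriv]

lemma decay': "z \<in> W \<Longrightarrow> z \<noteq> x \<Longrightarrow> norm (f z) \<le> A * dist z x powr (- (real CARD('n) - 2))"
 using decay by simp

lemma measurable_subset:
 assumes "g \<in> meas_on W" "S \<subseteq> W"
 shows "g \<in> meas_on S"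
 using measurable_restrict_mono[OF assms] .

lemma Lp_norm_f:
 assumes S: "S \<subseteq> W \<inter> T" "S \<in> sets lebesgue" "T \<in> sets lebesgue" and q: "q > 0" and k: "k \<ge> 0" and r: "r > 0"
  and b: "(\<integral>\<^sup>+z\<in>T. ennreal (dist z x powr (- ((real CARD('n) - 2) * q))) \<partial>lebesgue)
   \<le> ennreal (k * r powr (real CARD('n) - (real CARD('n) - 2) * q))"
 shows "Lp_norm (ennreal q) S f \<le> ennreal (A * k powr (1 / q) * r powr (2 - real CARD('n) + real CARD('n) / q))"
proof -
 let ?c = "A * k powr (1 / q) * r powr (2 - real CARD('n) + real CARD('n) / q)"
 have "(\<integral>\<^sup>+z\<in>S. ennreal (norm (f z) powr q) \<partial>lebesgue) \<le> (\<integral>\<^sup>+z\<in>W \<inter> T. ennreal (norm (f z) powr q) \<partial>lebesgue)"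
  by (intro nn_integral_mono mult_left_mono) (use S in \<open>auto simp: indicator_def\<close>)
 also have "... \<le> ennreal (A powr q) * ennreal (k * r powr (real CARD('n) - (real CARD('n) - 2) * q))"
  by (rule order_trans[OF kernel_Lq[OF A decay' q S(3)] mult_left_mono[OF b]]) auto
 also have "... = ennreal (A powr q * (k * r powr (real CARD('n) - (real CARD('n) - 2) * q)))" using k by (simp add: ennreal_mult)
 also have "A powr q * (k * r powr (real CARD('n) - (real CARD('n) - 2) * q)) = ?c powr q"
 proof -
  have "(2 - real CARD('n) + real CARD('n) / q) * q = real CARD('n) - (real CARD('n) - 2) * q" using q by (simp add: field_simps)
  then show ?thesis using A k q r by (simp add: powr_mult powr_powr mult.assoc)
 qed
 finally show ?thesis using Lp_norm_le_iff[of q ?c S f] q A k S measurable_subset[OF measurable(1), of S] by simp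
qed

lemma Lp_estimate:
 assumes q: "1 \<le> q" "q < real CARD('n) / (real CARD('n) - 2)" and r: "r > 0"
 shows "Lp_norm (ennreal q) (W \<inter> ball x r) f
  \<le> ennreal (A * kernel_const TYPE('n) ((real CARD('n) - 2) * q) powr (1 / q) * r powr (2 - real CARD('n) + real CARD('n) / q))"
proof (rule Lp_norm_f)
 have sq: "(real CARD('n) - 2) * q < real CARD('n)" using q n_ge_3 by (simp add: field_simps)
 show "W \<inter> ball x r \<subseteq> W \<inter> cball x r" by auto
 show "W \<inter> ball x r \<in> sets lebesgue" using open_W by (simp add: open_Int)
 show "0 \<le> kernel_const TYPE('n) ((real CARD('n) - 2) * q)" using sq by (intro kernel_const_nonneg) simp
 show "(\<integral>\<^sup>+z\<in>cball x r. ennreal (dist z x powr (- ((real CARD('n) - 2) * q))) \<partial>lebesgue)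
   \<le> ennreal (kernel_const TYPE('n) ((real CARD('n) - 2) * q) * r powr (real CARD('n) - (real CARD('n) - 2) * q))"
  using q n_ge_3 sq by (intro kernel_inner[OF r]) auto
qed (use q r in auto)

lemma Y_estimate:
 assumes r: "r > 0"
 shows "Y_norm (W - cball x r) f
  \<le> ennreal ((A * kernel_const TYPE('n) (2 * real CARD('n)) powr (1 / two_star TYPE('n)) + sqrt E) * r powr (1 - real CARD('n) / 2))"
proof -
 let ?U = "W - cball x r" and ?p = "two_star TYPE('n)"
 have U: "open ?U" using open_W by (simp add: open_Diff)
 have p: "?p > 0" using two_star_gt_2[OF n3] by simp
 \<comment> \<open>In the critical norm the kernel appears with power 2n, which is integrable at
   infinity, and the resulting scaling in r is that of the L2 norm of the gradient.\<close>
 have e: "(real CARD('n) - 2) * ?p = 2 * real CARD('n)" "2 - real CARD('n) + real CARD('n) / ?p = 1 - real CARD('n) / 2"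
  using n_ge_3 by (simp_all add: two_star_def field_simps)
 have DU: "has_weak_deriv ?U f (wD W f)" by (rule has_weak_deriv_restrict[OF deriv]) auto
 have k: "kernel_const TYPE('n) (2 * real CARD('n)) \<ge> 0" by (intro kernel_const_nonneg) simp
 have "Lp_norm (ennreal ?p) ?U f \<le> ennreal (A * kernel_const TYPE('n) (2 * real CARD('n)) powr (1 / ?p) * r powr (2 - real CARD('n) + real CARD('n) / ?p))"
 proof (rule Lp_norm_f)
  show "?U \<subseteq> W \<inter> (- cball x r)" "?U \<in> sets lebesgue" using U by auto
  show "(\<integral>\<^sup>+z\<in>- cball x r. ennreal (dist z x powr (- ((real CARD('n) - 2) * ?p))) \<partial>lebesgue)
   \<le> ennreal (kernel_const TYPE('n) (2 * real CARD('n)) * r powr (real CARD('n) - (real CARD('n) - 2) * ?p))"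
   unfolding e using r by (intro kernel_outer) auto
 qed (use p r k in \<open>auto simp: open_Compl\<close>)
 then have 1: "Lp_norm (ennreal ?p) ?U f \<le> ennreal (A * kernel_const TYPE('n) (2 * real CARD('n)) powr (1 / ?p) * r powr (1 - real CARD('n) / 2))"
  unfolding e .
 \<comment> \<open>\<open>Y_norm\<close> on the smaller set refers to the derivative chosen there,
   which equals the one chosen on W only almost everywhere.\<close>
 have ae: "AE z in lebesgue_on ?U. wD ?U f z = wD W f z" by (rule wD_AE[OF U DU])
 have wDU: "wD ?U f \<in> meas_on ?U" using has_weak_deriv_measurable(2)[OF U wD_has_weak_deriv, of f] DU by (auto simp: weakly_diff_def)
 have "L2sq ?U (wD ?U f) = L2sq ?U (wD W f)" using U by (intro L2sq_cong_AE[OF _ ae]) auto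
 also have "... \<le> ennreal ((sqrt E * r powr (1 - real CARD('n) / 2))^2)"
 proof -
  have "(r powr (1 - real CARD('n) / 2))^2 = r powr (2 - real CARD('n))" using r by (simp add: power2_eq_square powr_add[symmetric])
  then show ?thesis using tail[OF r] E by (simp add: power_mult_distrib)
 qed
 finally have 2: "Lp_norm 2 ?U (wD ?U f) \<le> ennreal (sqrt E * r powr (1 - real CARD('n) / 2))" using U E wDU by (subst Lp_norm_2_le_iff) auto
 have "weakly_diff ?U f" using DU by (auto simp: weakly_diff_def)
 from Y_norm_leI[OF this 1 2] show ?thesis using A E k by (simp add: distrib_right)
qed

lemma deriv_Lp_estimate:
 assumes q: "1 \<le> q" "q < real CARD('n) / (real CARD('n) - 1)" and r: "r > 0"
 shows "Lp_norm (ennreal q) (W \<inter> ball x r) (wD W f) \<le>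
  ennreal (((ball_vol TYPE('n) + E * 2 powr (real CARD('n) - 2)) / (1 - 2 powr (- (real CARD('n) - q * (real CARD('n) - 1))))) powr (1 / q) *
   r powr (1 - real CARD('n) + real CARD('n) / q))"
proof -
 let ?S = "W \<inter> ball x r"
 let ?a = "real CARD('n) - q * (real CARD('n) - 1)"
 let ?k = "(ball_vol TYPE('n) + E * 2 powr (real CARD('n) - 2)) / (1 - 2 powr (- ?a))"
 let ?c = "?k powr (1 / q) * r powr (1 - real CARD('n) + real CARD('n) / q)"
 have q2: "q * (real CARD('n) - 1) < real CARD('n)" using q n_ge_3 by (simp add: field_simps)
 have "real CARD('n) / (real CARD('n) - 1) \<le> 2" using n_ge_3 by (simp add: field_simps)
 then have q3: "q \<le> 2" using q by linarith
 have "2 powr (- ?a) < 1" using q2 by (intro two_powr_neg_less_1) simp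
 then have k: "?k \<ge> 0" using E by (intro divide_nonneg_pos add_nonneg_nonneg) auto
 have "(\<integral>\<^sup>+z\<in>?S. ennreal (norm (wD W f z) powr q) \<partial>lebesgue) \<le> (\<integral>\<^sup>+z\<in>W \<inter> cball x r. ennreal (norm (wD W f z) powr q) \<partial>lebesgue)"
  by (intro nn_integral_mono mult_left_mono) (auto simp: indicator_def)
 also have "... \<le> ennreal (?k * r powr ?a)" using open_W measurable(2) E tail q q2 q3 r by (intro tail_Lq) auto
 also have "?k * r powr ?a = ?c powr q"
 proof -
  have e: "(1 - real CARD('n) + real CARD('n) / q) * q = ?a" using q by (simp add: field_simps)
  have "(c powr (1 / q) * r powr a) powr q = c * r powr (a * q)" if "c \<ge> 0" for a c using that q by (simp add: powr_mult powr_powr)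
  from this[OF k] show ?thesis by (simp only: e)
 qed
 finally have b: "(\<integral>\<^sup>+z\<in>?S. ennreal (norm (wD W f z) powr q) \<partial>lebesgue) \<le> ennreal (?c powr q)" .
 have c0: "?c \<ge> 0" by (intro mult_nonneg_nonneg powr_ge_zero)
 have S: "?S \<in> sets lebesgue" using open_W by (simp add: open_Int)
 have q0: "q > 0" using q by simp
 have m: "wD W f \<in> meas_on ?S" by (rule measurable_subset[OF measurable(2)]) auto
 show ?thesis unfolding Lp_norm_le_iff[OF q0 c0 S] using m b by blast
qed

lemma weak_type:
 assumes \<tau>: "\<tau> > 0"
 shows "emeasure lebesgue {z\<in>W. norm (f z) > \<tau>} \<le>
  ennreal (ball_vol TYPE('n) * (A + 1) powr (real CARD('n) / (real CARD('n) - 2)) * \<tau> powr (- real CARD('n) / (real CARD('n) - 2)))"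
proof -
 let ?s = "real CARD('n) - 2"
 \<comment> \<open>By the decay, values above \<tau> occur only within this distance of the pole; A
   + 1 keeps the radius positive when A = 0.\<close>
 define \<rho> where "\<rho> = ((A + 1) / \<tau>) powr (1 / ?s)"
 have s: "?s > 0" using n_ge_3 by simp
 have \<rho>: "\<rho> > 0" using A \<tau> by (simp add: \<rho>_def)
 have "{z\<in>W. norm (f z) > \<tau>} \<subseteq> cball x \<rho>"
 proof
  fix z assume z: "z \<in> {z\<in>W. norm (f z) > \<tau>}"
  show "z \<in> cball x \<rho>"
  proof (cases "z = x")
   case False
   then have d: "dist z x > 0" by simp
   have "\<tau> < A * dist z x powr (- ?s)" using z decay'[of z] False by auto
   also have "... = A / dist z x powr ?s" by (simp only: powr_minus_divide) simp
   also have "... \<le> (A + 1) / dist z x powr ?s" by (simp add: divide_right_mono)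
   finally have "dist z x powr ?s \<le> (A + 1) / \<tau>" using d \<tau> by (simp add: field_simps)
   then have "(dist z x powr ?s) powr (1 / ?s) \<le> \<rho>" unfolding \<rho>_def using s by (intro powr_mono2) auto
   then have "dist z x \<le> \<rho>" using s d by (simp add: powr_powr)
   then show ?thesis by (simp add: dist_commute)
  qed (use \<rho> in simp)
 qed
 then have "emeasure lebesgue {z\<in>W. norm (f z) > \<tau>} \<le> emeasure lebesgue (cball x \<rho>)" by (intro emeasure_mono) auto
 also have "... = ennreal (ball_vol TYPE('n) * \<rho> powr real CARD('n))" by (rule emeasure_cball_powr[OF \<rho>])
 also have "\<rho> powr real CARD('n) = (A + 1) powr (real CARD('n) / ?s) * \<tau> powr (- real CARD('n) / ?s)"
 proof -
  have "\<rho> powr real CARD('n) = ((A + 1) / \<tau>) powr (real CARD('n) / ?s)" by (simp add: \<rho>_def powr_powr)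
  also have "... = (A + 1) powr (real CARD('n) / ?s) / \<tau> powr (real CARD('n) / ?s)" using A \<tau> by (simp add: powr_divide)
  also have "... = (A + 1) powr (real CARD('n) / ?s) * \<tau> powr (- (real CARD('n) / ?s))" by (simp add: powr_minus_divide)
  finally show ?thesis by simp
 qed
 finally show ?thesis by (simp add: mult.assoc)
qed

lemma deriv_weak_type:
 assumes \<tau>: "\<tau> > 0"
 shows "emeasure lebesgue {z\<in>W. norm (wD W f z) > \<tau>} \<le> ennreal ((ball_vol TYPE('n) + E) * \<tau> powr (- real CARD('n) / (real CARD('n) - 1)))"
 using open_W measurable(2) E tail n3 \<tau> by (intro tail_weak_type) auto

end

lemma singular_functionI:
 fixes f :: "real^'n::finite \<Rightarrow> 'b::euclidean_space"
 assumes "CARD('n) \<ge> 3" "open W" "A \<ge> 0" "E \<ge> 0" and D: "has_weak_deriv W f D"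
  and "\<And>z. z \<in> W \<Longrightarrow> z \<noteq> x \<Longrightarrow> norm (f z) \<le> A * dist z x powr (2 - real CARD('n))"
  and t: "\<And>t. t > 0 \<Longrightarrow> L2sq (W - cball x t) D \<le> ennreal (E * t powr (2 - real CARD('n)))"
 shows "singular_function W x f A E"
proof (rule singular_function.intro)
 show "weakly_diff W f" using D by (auto simp: weakly_diff_def)
 show "L2sq (W - cball x t) (wD W f) \<le> ennreal (E * t powr (2 - real CARD('n)))" if "t > 0" for t
  using t[OF that] L2sq_cong_AE[OF _ wD_AE[OF assms(2) D], of "W - cball x t"] assms(2) by simp
qed (use assms in auto)

text \<open>Assembles a function from isometrically embedded pieces. The triangle inequality costs
  the number of pieces; for square integrals Cauchy-Schwarz for sums costs its square.\<close>

lemma singular_function_sum: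
 fixes u :: "'k::finite \<Rightarrow> real^'n::finite \<Rightarrow> 'b::euclidean_space" and T :: "'k \<Rightarrow> 'b \<Rightarrow> 'c::euclidean_space"
 assumes n: "CARD('n) \<ge> 3" "open W" "A \<ge> 0" "E \<ge> 0" and D: "\<And>k. has_weak_deriv W (u k) (D k)"
  and decay: "\<And>k z. z \<in> W \<Longrightarrow> z \<noteq> x \<Longrightarrow> norm (u k z) \<le> A * dist z x powr (2 - real CARD('n))"
  and tail: "\<And>k t. t > 0 \<Longrightarrow> L2sq (W - cball x t) (D k) \<le> ennreal (E * t powr (2 - real CARD('n)))"
  and T: "\<And>k. bounded_linear (T k)" "\<And>k v. norm (T k v) = norm v"
 shows "singular_function W x (\<lambda>z. \<Sum>k\<in>UNIV. T k (u k z)) (real CARD('k) * A) ((real CARD('k))^2 * E)"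
proof (rule singular_functionI[OF n(1,2)])
 let ?D = "\<lambda>k z. \<chi> \<alpha>. T k (D k z $ \<alpha>)"
 show "has_weak_deriv W (\<lambda>z. \<Sum>k\<in>UNIV. T k (u k z)) (\<lambda>z. \<Sum>k\<in>UNIV. ?D k z)"
  by (intro has_weak_deriv_sum has_weak_deriv_linear D T) simp
 show "norm (\<Sum>k\<in>UNIV. T k (u k z)) \<le> real CARD('k) * A * dist z x powr (2 - real CARD('n))" if "z \<in> W" "z \<noteq> x" for z
  using sum_norm_bound[of UNIV "\<lambda>k. T k (u k z)" "A * dist z x powr (2 - real CARD('n))"] decay[OF that] by (simp add: T mult.assoc)
 show "L2sq (W - cball x t) (\<lambda>z. \<Sum>k\<in>UNIV. ?D k z) \<le> ennreal ((real CARD('k))^2 * E * t powr (2 - real CARD('n)))" if t: "t > 0" for t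
 proof -
  have nD: "norm (?D k z) = norm (D k z)" for k z by (simp add: norm_vec_def T)
  have S: "W - cball x t \<in> sets lebesgue" "W \<in> sets lebesgue" using n(2) by auto
  have m: "(\<lambda>z. ennreal ((norm (D k z))^2) * indicator (W - cball x t) z) \<in> meas_L" for k using has_weak_deriv_measurable(2)[OF n(2) D]
   by (intro measurable_indicator_comp[OF S(2) _ _ S(1), where g = "\<lambda>v. ennreal ((norm v)^2)"]) auto
  have pt: "(norm (\<Sum>k\<in>UNIV. ?D k z))^2 \<le> real CARD('k) * (\<Sum>k\<in>UNIV. (norm (D k z))^2)" for z
  proof -
   have "(norm (\<Sum>k\<in>UNIV. ?D k z))^2 \<le> (\<Sum>k\<in>UNIV. norm (D k z))^2"
    by (intro power_mono order_trans[OF norm_sum]) (simp_all add: nD)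
   also have "... \<le> real CARD('k) * (\<Sum>k\<in>UNIV. (norm (D k z))^2)" by (rule order_trans[OF sum_squared_le_sum_of_squares]) (simp_all add: mult.commute)
   finally show ?thesis .
  qed
  have "L2sq (W - cball x t) (\<lambda>z. \<Sum>k\<in>UNIV. ?D k z) \<le>
   (\<integral>\<^sup>+z. ennreal (real CARD('k)) * (\<Sum>k\<in>UNIV. ennreal ((norm (D k z))^2) * indicator (W - cball x t) z) \<partial>lebesgue)"
   unfolding L2sq_def
  proof (intro nn_integral_mono)
   fix z
   have "ennreal ((norm (\<Sum>k\<in>UNIV. ?D k z))^2) \<le> ennreal (real CARD('k)) * (\<Sum>k\<in>UNIV. ennreal ((norm (D k z))^2))"
    using ennreal_leI[OF pt[of z]] by (simp add: ennreal_mult sum_nonneg)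
   then show "ennreal ((norm (\<Sum>k\<in>UNIV. ?D k z))^2) * indicator (W - cball x t) z \<le>
    ennreal (real CARD('k)) * (\<Sum>k\<in>UNIV. ennreal ((norm (D k z))^2) * indicator (W - cball x t) z)"
    by (cases "z \<in> W - cball x t") (simp_all only: indicator_simps mult_1_right mult_zero_right zero_le not_False_eq_True sum.neutral_const order_refl)
  qed
  also have "... = ennreal (real CARD('k)) * (\<Sum>k\<in>UNIV. L2sq (W - cball x t) (D k))" unfolding L2sq_def
   by (subst nn_integral_cmult[OF borel_measurable_sum[OF m]], subst nn_integral_sum[OF m]) (rule refl)
  also have "... \<le> ennreal (real CARD('k)) * (\<Sum>k\<in>(UNIV::'k set). ennreal (E * t powr (2 - real CARD('n))))"
   by (intro mult_left_mono sum_mono tail t) auto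
  also have "... = ennreal ((real CARD('k))^2 * E * t powr (2 - real CARD('n)))"
   using n(4) by (simp add: ennreal_of_nat_eq_real_of_nat ennreal_mult[symmetric] power2_eq_square mult.assoc)
  finally show ?thesis .
 qed
qed (use n in auto)

lemma bounded_linear_axis: "bounded_linear (axis k :: 'b::euclidean_space \<Rightarrow> 'b^'n::finite)"
 by (intro linear_conv_bounded_linear[THEN iffD1] linearI) (simp_all add: axis_def vec_eq_iff)

lemma norm_axis: "norm (axis k v :: 'b::real_normed_vector^'n::finite) = norm v"
proof -
 have "(\<Sum>i\<in>UNIV. (norm ((axis k v :: 'b^'n) $ i))^2) = (\<Sum>i\<in>UNIV. if i = k then (norm v)^2 else 0)"
  by (intro sum.cong) (auto simp: axis_def)
 then have "(norm (axis k v :: 'b^'n))^2 = (norm v)^2" by (simp add: norm_vec_square)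
 then show ?thesis by simp
qed

lemma sum_axis: "(\<Sum>k\<in>UNIV. axis k (v $ k)) = (v :: 'b::real_normed_vector^'n::finite)"
 by (simp add: vec_eq_iff axis_def sum_component if_distrib cong: if_cong)

lemma norm_matrix_transpose: "norm (transpose A) = norm (A :: real^'a::finite^'b::finite)"
proof -
 have "(norm (transpose A))^2 = (\<Sum>i\<in>UNIV. \<Sum>j\<in>UNIV. (A $ j $ i)^2)" by (simp add: norm_vec_square transpose_def)
 also have "... = (\<Sum>j\<in>UNIV. \<Sum>i\<in>UNIV. (A $ j $ i)^2)" by (rule sum.swap)
 also have "... = (norm A)^2" by (simp add: norm_vec_square)
 finally show ?thesis by simp
qed

lemma bounded_linear_transpose: "bounded_linear (transpose :: real^'a::finite^'b::finite \<Rightarrow> real^'b^'a)"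
 by (intro linear_conv_bounded_linear[THEN iffD1] linearI) (simp_all add: transpose_def vec_eq_iff)

section \<open>Rows and columns of the matrix function\<close>

context green_kernel
begin

definition "A_mat = real CARD('b) * C1'"
definition "E_mat = (real CARD('b))^2 * C3"
definition "H_mat = real CARD('b) * C2"

text \<open>T is the identity for the matrix itself and transposition when the swapped kernel is
  turned back.\<close>

lemma rows_singular:
 assumes x: "x \<in> W" and T: "bounded_linear T" "\<And>M. norm (T M) = norm (M :: real^'b^'b)"
 shows "singular_function W x (\<lambda>z. T (G x z) :: real^'b^'b) A_mat E_mat"
proof -
 obtain D where D: "\<And>k. has_weak_deriv W (\<lambda>z. G x z $ k) (D k)"
  "\<And>k t. t > 0 \<Longrightarrow> L2sq (W - cball x t) (D k) \<le> ennreal (C3 * t powr (2 - real CARD('a)))"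
  using row_weak_deriv[OF x] by metis
 have lin: "linear T" by (rule bounded_linear.linear[OF T(1)])
 have eq: "(\<Sum>k\<in>UNIV. T (axis k (M $ k))) = T M" for M by (simp only: linear_sum[OF lin, symmetric] sum_axis)
 have "singular_function W x (\<lambda>z. \<Sum>k\<in>UNIV. T (axis k (G x z $ k))) (real CARD('b) * C1') ((real CARD('b))^2 * C3)"
 proof (rule singular_function_sum[OF n3 open_W C1'_nonneg C3_nonneg D(1) _ D(2)])
  show "norm (G x z $ k) \<le> C1' * dist z x powr (2 - real CARD('a))" if "z \<in> W" "z \<noteq> x" for k z
   using G_row_bound'[of x z k] that x by (simp add: s_def dist_commute)
  show "bounded_linear (\<lambda>v. T (axis k v))" for k
   by (rule bounded_linear_compose[OF T(1) bounded_linear_axis])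
 qed (simp_all add: T norm_axis)
 then show ?thesis unfolding eq A_mat_def E_mat_def .
qed

lemma matrix_hoelder:
 assumes "x \<in> W" "y \<in> W" "0 < R" "R \<le> R\<^sub>0" "ball y (2 * R\<^sub>0) \<subseteq> W" "2 * R\<^sub>0 < dist x y" "norm (y - z) < R / 2"
 shows "norm (G x y - G x z) \<le> CH R\<^sub>0 * H_mat * (norm (y - z) / R) powr \<eta> R\<^sub>0 * R powr (2 - real CARD('a))"
proof -
 have "norm (G x y - G x z) \<le> (\<Sum>k\<in>UNIV. norm (axis k ((G x y - G x z) $ k) :: real^'b^'b))"
  by (subst (1) sum_axis[symmetric]) (rule norm_sum)
 also have "... \<le> (\<Sum>k\<in>(UNIV::'b set). CH R\<^sub>0 * C2 * (norm (y - z) / R) powr \<eta> R\<^sub>0 * R powr (2 - real CARD('a)))"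
  using row_hoelder[OF assms] by (intro sum_mono) (simp add: norm_axis)
 also have "... = CH R\<^sub>0 * H_mat * (norm (y - z) / R) powr \<eta> R\<^sub>0 * R powr (2 - real CARD('a))" by (simp add: H_mat_def mult_ac)
 finally show ?thesis .
qed

text \<open>A column of G is a row of the transposed kernel, to which the row estimate applies with
  the same constants.\<close>

lemma columns_singular:
 assumes y: "y \<in> W"
 shows "singular_function W y (\<lambda>z. G z y) A_mat E_mat"
proof -
 interpret sw: green_kernel W F nF c\<^sub>0 "\<lambda>u v. B v u" \<Gamma> \<gamma> sol K1 K2 \<eta> CH "\<lambda>x y. transpose (G y x)" by (rule swapped_kernel)
 show ?thesis
  using sw.rows_singular[OF y bounded_linear_transpose norm_matrix_transpose] by (simp add: transpose_transpose)
qed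

lemma matrix_hoelder_left:
 assumes "x \<in> W" "y \<in> W" "0 < R" "R \<le> R\<^sub>0" "ball x (2 * R\<^sub>0) \<subseteq> W" "2 * R\<^sub>0 < dist x y" "norm (x - z) < R / 2"
 shows "norm (G x y - G z y) \<le> CH R\<^sub>0 * H_mat * (norm (x - z) / R) powr \<eta> R\<^sub>0 * R powr (2 - real CARD('a))"
proof -
 interpret sw: green_kernel W F nF c\<^sub>0 "\<lambda>u v. B v u" \<Gamma> \<gamma> sol K1 K2 \<eta> CH "\<lambda>x y. transpose (G y x)" by (rule swapped_kernel)
 have "transpose (G x y) - transpose (G z y) = transpose (G x y - G z y)" by (simp add: transpose_def vec_eq_iff)
 then have "norm (transpose (G x y) - transpose (G z y)) = norm (G x y - G z y)" by (simp add: norm_matrix_transpose)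
 then show ?thesis using sw.matrix_hoelder[of y x R R\<^sub>0 z] assms by (simp add: dist_commute)
qed

end

subsection \<open>From the structural hypotheses to the abstract setting\<close>

lemma partial_deriv_1_minus:
 assumes "smooth_fun \<psi>"
 shows "partial_deriv i (\<lambda>x. 1 - \<psi> x) = (\<lambda>x. partial_deriv i \<psi> x * (- 1))"
proof
 fix x
 have "(\<psi> has_derivative frechet_derivative \<psi> (at x)) (at x)" using smooth_fun_differentiable[OF assms] frechet_derivative_works by blast
 then have "((\<lambda>x. 1 - \<psi> x) has_derivative (\<lambda>h. 0 - frechet_derivative \<psi> (at x) h)) (at x)"
  by (intro has_derivative_diff has_derivative_const)
 then show "partial_deriv i (\<lambda>x. 1 - \<psi> x) x = partial_deriv i \<psi> x * (- 1)"
  by (simp add: partial_deriv_eq) (simp add: partial_deriv_def)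
qed

lemma test_vecI:
 fixes \<phi> :: "real^'n::finite \<Rightarrow> 'b::euclidean_space"
 assumes "\<phi> \<in> test_vec V" "compact K" "K \<subseteq> U" "\<And>x. x \<notin> K \<Longrightarrow> \<phi> x = 0"
 shows "\<phi> \<in> test_vec U"
 unfolding test_vec_def
proof (intro CollectI ballI)
 fix e :: 'b assume "e \<in> Basis"
 then show "(\<lambda>x. \<phi> x \<bullet> e) \<in> test_fun U"
  using test_fun_smooth[OF test_vecD[OF assms(1)]] assms by (intro test_funI[of _ K]) auto
qed

text \<open>The concrete hypotheses for one domain. The cutoff constant M is a parameter, fixed
  beforehand, because the Caccioppoli constant derived from it has to be chosen before the
  domain.\<close>

locale green_problem =
 fixes W :: "(real^'n::finite) set" and L :: "('n, 'N::finite) operator" and F :: "('n, 'N) family" and nF :: "('n, 'N) family_norm"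
  and B :: "(real^'n \<Rightarrow> real^'N) \<Rightarrow> (real^'n \<Rightarrow> real^'N) \<Rightarrow> real" and \<eta> CH :: "real \<Rightarrow> real" and G :: "real^'n \<Rightarrow> real^'n \<Rightarrow> real^'N^'N"
  and c\<^sub>0 \<Gamma> \<gamma> Cc :: real and Cb :: "real \<Rightarrow> ennreal \<Rightarrow> real" and M :: real
 assumes n3: "CARD('n) \<ge> 3" and open_W: "open W" and adm: "admissible_coeffs W L"
  and banach: "\<And>U. open U \<Longrightarrow> U \<subseteq> W \<Longrightarrow> banach_function_space U (F U) (nF U)"
  and restr: "restriction_property F nF W" and hilbert: "hilbert_property F nF W"
  and mult: "multiplier_property F nF W" and embed: "embedding_property F nF c\<^sub>0 W"
  and ext: "bounded_form_extension F nF L W \<Gamma> B" and coercive: "coercive_form F nF W \<gamma> B"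
  and cacc: "caccioppoli F nF L W Cc" and bounded: "local_boundedness F nF L W Cb"
  and hoelder: "hoelder_property F L W \<eta> CH" and green: "continuous_green_matrix F nF L W G"
  and M: "M > 0" "\<And>(y::real^'n) r. r > 0 \<Longrightarrow> \<exists>\<psi>\<in>test_fun UNIV.
   (\<forall>x\<in>ball y (3/4*r). \<psi> x = 1) \<and> (\<forall>x. x \<notin> ball y r \<longrightarrow> \<psi> x = 0) \<and> (\<forall>x. 0 \<le> \<psi> x \<and> \<psi> x \<le> 1) \<and>
   (\<forall>i x. \<bar>partial_deriv i \<psi> x\<bar> \<le> M / r)"

sublocale green_problem \<subseteq> E: elliptic_space W F nF c\<^sub>0
 using n3 open_W banach[OF open_W order_refl] hilbert embed by (rule elliptic_space.intro)

context green_problem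
begin

definition sol :: "(real^'n) set \<Rightarrow> (real^'n \<Rightarrow> real^'N) \<Rightarrow> bool" where
 "sol U u \<longleftrightarrow> weak_solution L U u (\<lambda>x. 0) \<or> adjoint_weak_solution L U u (\<lambda>x. 0)"

text \<open>n M^2 bounds r^2 times the squared gradient of the cutoff; the absolute value makes the
  constant nonnegative whatever the sign of the given one.\<close>

definition "K1 = \<bar>Cc\<bar> * (real CARD('n) * M^2)"
text \<open>Local boundedness with q = 2, to match Hardy's inequality, and with exponent \<infinity>
  for the zero right hand side.\<close>

definition "K2 = \<bar>Cb 2 \<infinity>\<bar>"

lemma wD_restrict:
 assumes "open U" "U \<subseteq> W" "u \<in> E.H"
 shows "AE x in lebesgue_on U. wD U u x = wD W u x"
 by (rule wD_AE[OF assms(1) has_weak_deriv_restrict[OF E.H_weak_deriv[OF assms(3)] assms(2)]])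

lemma AE_on_iff: "open (U :: (real^'n) set) \<Longrightarrow> (AE x in lebesgue_on U. P x) \<longleftrightarrow> (AE x in lebesgue. x \<in> U \<longrightarrow> P x)"
 by (simp add: AE_restrict_space_iff)

lemma integral_restrict_support:
 fixes f g :: "real^'n \<Rightarrow> real"
 assumes U: "open U" "U \<subseteq> W" and f: "set_integrable lebesgue W f"
  and eq: "AE x in lebesgue. x \<in> U \<longrightarrow> g x = f x" and z: "AE x in lebesgue. x \<in> W \<longrightarrow> x \<notin> U \<longrightarrow> f x = 0"
 shows "set_integrable lebesgue U g" "(LINT x:U|lebesgue. g x) = (LINT x:W|lebesgue. f x)"
proof -
 have US: "U \<in> sets lebesgue" using U by simp
 have fU: "set_integrable lebesgue U f" by (rule set_integrable_subset[OF f US U(2)])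
 have ae: "AE x in lebesgue_on U. g x = f x" unfolding AE_on_iff[OF U(1)] by (rule eq)
 show "set_integrable lebesgue U g" by (rule set_integrable_cong_AE'(1)[OF US fU ae])
 have "(LINT x:U|lebesgue. g x) = (LINT x:U|lebesgue. f x)" by (rule set_integrable_cong_AE'(2)[OF US fU ae])
 also have "... = (LINT x:W|lebesgue. f x)" unfolding set_lebesgue_integral_def
 proof (rule integral_cong_AE)
  show "(\<lambda>x. indicat_real U x *\<^sub>R f x) \<in> meas_L" "(\<lambda>x. indicat_real W x *\<^sub>R f x) \<in> meas_L"
   using f fU by (auto simp: set_integrable_def dest: borel_measurable_integrable)
  show "AE x in lebesgue. indicat_real U x *\<^sub>R f x = indicat_real W x *\<^sub>R f x"
   using z by eventually_elim (use U(2) in \<open>auto simp: indicator_def\<close>)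
 qed
 finally show "(LINT x:U|lebesgue. g x) = (LINT x:W|lebesgue. f x)" .
qed

text \<open>The equation on U uses weak gradients chosen on U, while B lives on W. For v supported
  in U the two integrands agree almost everywhere on U and the one on W vanishes outside, so both
  integrals equal B.\<close>

lemma form_restrict:
 assumes U: "open U" "U \<subseteq> W" and u: "u \<in> E.H" and v: "v \<in> test_vec U"
 shows "form_integrand L U u v absolutely_integrable_on U" "form L U u v = B u v"
  "form_integrand L U v u absolutely_integrable_on U" "form L U v u = B v u"
proof -
 have vW: "v \<in> test_vec W" using test_vec_mono[OF U(2)] v by blast
 note f = E.form_eq[OF admissible_regular_coeffs[OF n3 open_W adm] ext u vW]
 obtain K where K: "K \<subseteq> U" "\<And>x. x \<notin> K \<Longrightarrow> v x = 0" "\<And>x. x \<notin> K \<Longrightarrow> grad v x = 0" using test_vec_support[OF v] by metis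
 have du: "AE x in lebesgue. x \<in> U \<longrightarrow> wD U u x = wD W u x" using wD_restrict[OF U u] unfolding AE_on_iff[OF U(1)] .
 have dv: "AE x in lebesgue. x \<in> U \<longrightarrow> wD U v x = grad v x"
  using wD_AE[OF U(1) has_weak_deriv_test_vec[OF U(1) v]] unfolding AE_on_iff[OF U(1)] .
 have dvW: "AE x in lebesgue. x \<in> W \<longrightarrow> wD W v x = grad v x"
  using wD_AE[OF open_W has_weak_deriv_test_vec[OF open_W v]] unfolding AE_on_iff[OF open_W] .
 have e: "AE x in lebesgue. x \<in> U \<longrightarrow> form_integrand L U u v x = form_integrand L W u v x"
  "AE x in lebesgue. x \<in> U \<longrightarrow> form_integrand L U v u x = form_integrand L W v u x"
  unfolding form_integrand_form_at using du dv dvW by (eventually_elim; use U(2) in auto)+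
 have z: "AE x in lebesgue. x \<in> W \<longrightarrow> x \<notin> U \<longrightarrow> form_integrand L W u v x = 0"
  "AE x in lebesgue. x \<in> W \<longrightarrow> x \<notin> U \<longrightarrow> form_integrand L W v u x = 0"
  unfolding form_integrand_form_at using dvW by (eventually_elim; use K subsetD[OF K(1)] in \<open>metis form_at_0_left form_at_0_right\<close>)+
 show "form_integrand L U u v absolutely_integrable_on U" "form_integrand L U v u absolutely_integrable_on U"
  by (rule integral_restrict_support(1)[OF U f(1) e(1) z(1)], rule integral_restrict_support(1)[OF U f(3) e(2) z(2)])
 show "form L U u v = B u v" "form L U v u = B v u"
  using integral_restrict_support(2)[OF U f(1) e(1) z(1)] integral_restrict_support(2)[OF U f(3) e(2) z(2)] f(2,4) unfolding form_def by simp_all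
qed

lemma sol_left:
 assumes "open U" "U \<subseteq> W" "u \<in> E.H" "\<And>v. v \<in> test_vec U \<Longrightarrow> B u v = 0"
 shows "sol U u"
proof -
 have "weak_solution L U u (\<lambda>x. 0)" unfolding weak_solution_def
 proof (intro ballI conjI)
  fix v :: "real^'n \<Rightarrow> real^'N" assume v: "v \<in> test_vec U"
  show "form_integrand L U u v absolutely_integrable_on U" by (rule form_restrict(1)[OF assms(1-3) v])
  show "(\<lambda>x. (0::real^'N) \<bullet> v x) absolutely_integrable_on U" by simp
  show "form L U u v = (LINT x:U|lebesgue. 0 \<bullet> v x)" using form_restrict(2)[OF assms(1-3) v] assms(4)[OF v] by simp
 qed
 then show ?thesis by (simp add: sol_def)
qed

lemma sol_right:
 assumes "open U" "U \<subseteq> W" "u \<in> E.H" "\<And>v. v \<in> test_vec U \<Longrightarrow> B v u = 0"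
 shows "sol U u"
proof -
 have "adjoint_weak_solution L U u (\<lambda>x. 0)" unfolding adjoint_weak_solution_def
 proof (intro ballI conjI)
  fix v :: "real^'n \<Rightarrow> real^'N" assume v: "v \<in> test_vec U"
  show "form_integrand L U v u absolutely_integrable_on U" by (rule form_restrict(3)[OF assms(1-3) v])
  show "(\<lambda>x. (0::real^'N) \<bullet> v x) absolutely_integrable_on U" by simp
  show "form L U v u = (LINT x:U|lebesgue. 0 \<bullet> v x)" using form_restrict(4)[OF assms(1-3) v] assms(4)[OF v] by simp
 qed
 then show ?thesis by (simp add: sol_def)
qed

lemma restrict_F: "open U \<Longrightarrow> U \<subseteq> W \<Longrightarrow> u \<in> F W \<Longrightarrow> u \<in> F U \<and> nF U u \<le> nF W u"
 using restr unfolding restriction_property_def by meson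

text \<open>Multiplication by \<zeta> is bounded into \<open>F U\<close> and maps test fields of W
  to test fields of U, so approximating u by test fields also approximates \<zeta> u.\<close>

lemma multiplier_F0:
 assumes b: "\<And>u. u \<in> F W \<Longrightarrow> (\<lambda>x. \<zeta> x *\<^sub>R u x) \<in> F U \<and> nF U (\<lambda>x. \<zeta> x *\<^sub>R u x) \<le> C * nF W u"
  and t: "\<And>\<phi> :: real^'n \<Rightarrow> real^'N. \<phi> \<in> test_vec W \<Longrightarrow> (\<lambda>x. \<zeta> x *\<^sub>R \<phi> x) \<in> test_vec U" and u: "u \<in> E.H"
 shows "(\<lambda>x. \<zeta> x *\<^sub>R u x) \<in> F0 F nF U"
 unfolding F0_def
proof (intro CollectI conjI allI impI)
 show "(\<lambda>x. \<zeta> x *\<^sub>R u x) \<in> F U" using b[OF E.H_F[OF u]] by blast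
 fix \<epsilon> :: real assume \<epsilon>: "\<epsilon> > 0"
 obtain \<phi> where \<phi>: "\<phi> \<in> test_vec W" "nF W (\<lambda>x. u x - \<phi> x) < \<epsilon> / (\<bar>C\<bar> + 1)" using E.H_approx[OF u, of "\<epsilon> / (\<bar>C\<bar> + 1)"] \<epsilon> by auto
 have d: "(\<lambda>x. u x - \<phi> x) \<in> E.H" by (rule E.H_diff[OF u E.test_H[OF \<phi>(1)]])
 have N: "nF W (\<lambda>x. u x - \<phi> x) \<ge> 0" by (rule E.H_nonneg[OF d])
 have "nF U (\<lambda>x. \<zeta> x *\<^sub>R (u x - \<phi> x)) \<le> C * nF W (\<lambda>x. u x - \<phi> x)" using b[OF E.H_F[OF d]] by blast
 also have "... \<le> (\<bar>C\<bar> + 1) * nF W (\<lambda>x. u x - \<phi> x)" using N by (intro mult_right_mono) auto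
 also have "... < \<epsilon>" using \<phi>(2) by (simp add: field_simps)
 finally show "\<exists>\<phi>\<in>test_vec U. nF U (\<lambda>x. \<zeta> x *\<^sub>R u x - \<phi> x) < \<epsilon>"
  using t[OF \<phi>(1)] by (intro bexI[of _ "\<lambda>x. \<zeta> x *\<^sub>R \<phi> x"]) (simp_all add: scaleR_right_diff_distrib)
qed

lemma multiplier_bound:
 assumes "\<xi> \<in> test_fun U" "open U" "connected U"
 shows "\<exists>C. \<forall>u\<in>F W. (\<lambda>x. \<xi> x *\<^sub>R u x) \<in> F (W \<inter> U) \<and> nF (W \<inter> U) (\<lambda>x. \<xi> x *\<^sub>R u x) \<le> C * nF W u"
 using mult assms unfolding multiplier_property_def by meson

lemma test_vec_times:
 assumes \<phi>: "\<phi> \<in> test_vec W" and \<zeta>: "smooth_fun \<zeta>" and S: "closed S" "\<And>x. x \<notin> S \<Longrightarrow> \<zeta> x = 0" "W \<inter> S \<subseteq> U"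
 shows "(\<lambda>x. \<zeta> x *\<^sub>R \<phi> x) \<in> test_vec U"
proof -
 obtain K where K: "compact K" "K \<subseteq> W" "\<And>x. x \<notin> K \<Longrightarrow> \<phi> x = 0" using test_vec_support[OF \<phi>] by metis
 show ?thesis
 proof (rule test_vecI[OF test_vec_mult[OF \<phi> \<zeta>], of "K \<inter> S"])
  show "compact (K \<inter> S)" using K(1) S(1) by (rule compact_Int_closed)
  show "K \<inter> S \<subseteq> U" using K(2) S(3) by blast
  show "\<zeta> x *\<^sub>R \<phi> x = 0" if "x \<notin> K \<inter> S" for x using that K(3) S(2) by auto
 qed
qed

lemma vanishes:
 assumes u: "u \<in> E.H" and R: "R > 0"
 shows "vanishes_in F nF (W \<inter> ball x (2 * R)) (ball x R) u"
 unfolding vanishes_in_def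
proof
 fix \<xi> assume \<xi>: "\<xi> \<in> test_fun (ball x R)"
 \<comment> \<open>The cutoff is regarded as a multiplier on the ball of radius 2R, because the
   vanishing condition refers to the space over the part of W in that ball.\<close>
 then have \<xi>2: "\<xi> \<in> test_fun (ball x (2 * R))" by (rule subsetD[OF test_fun_mono[OF subset_ball], rotated]) (use R in simp)
 obtain C where C: "\<forall>u\<in>F W. (\<lambda>z. \<xi> z *\<^sub>R u z) \<in> F (W \<inter> ball x (2 * R)) \<and> nF (W \<inter> ball x (2 * R)) (\<lambda>z. \<xi> z *\<^sub>R u z) \<le> C * nF W u"
  using multiplier_bound[OF \<xi>2] by auto
 obtain S where S: "compact S" "S \<subseteq> ball x (2 * R)" "\<And>z. z \<notin> S \<Longrightarrow> \<xi> z = 0" using test_fun_support[OF \<xi>2] by metis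
 show "(\<lambda>z. \<xi> z *\<^sub>R u z) \<in> F0 F nF (W \<inter> ball x (2 * R))"
 proof (rule multiplier_F0[OF bspec[OF C] _ u])
  show "(\<lambda>z. \<xi> z *\<^sub>R \<phi> z) \<in> test_vec (W \<inter> ball x (2 * R))" if "\<phi> \<in> test_vec W" for \<phi>
   using test_vec_times[OF that test_fun_smooth[OF \<xi>] compact_imp_closed[OF S(1)] S(3)] S(2) by blast
 qed
qed

lemma boundedness:
 assumes u: "u \<in> E.H" and x: "x \<in> W" and R: "R > 0" and s: "sol (W \<inter> ball x R) u" and a: "a \<ge> 0"
  and b: "L2sq (W \<inter> ball x R) u \<le> ennreal (a^2)"
 shows "AE z in lebesgue. z \<in> W \<inter> ball x (R/2) \<longrightarrow> norm (u z) \<le> K2 * R powr (- real CARD('n) / 2) * a"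
proof -
 let ?U = "W \<inter> ball x R" and ?V = "W \<inter> ball x (R/2)"
 have UV: "open ?U" "open ?V" "?U \<in> sets lebesgue" using open_W by (auto simp: open_Int)
 have z: "Lp_norm \<infinity> ?U (\<lambda>x. 0 :: real^'N) \<le> 0"
 proof -
  have "esssup (lebesgue_on ?U) (\<lambda>x. 0 :: ennreal) \<le> 0" by (rule esssup_I) auto
  then show ?thesis by (simp add: Lp_norm_def)
 qed
 have uF: "u \<in> F (W \<inter> ball x (2 * R))" using restrict_F[OF _ _ E.H_F[OF u]] open_W by (simp add: open_Int)
 have "\<forall>q>0. Lp_norm \<infinity> ?V u \<le> ennreal (Cb q \<infinity>) *
   (ennreal (R powr (- real CARD('n) / q)) * Lp_norm (ennreal q) ?U u
    + ennreal (R powr (2 - real CARD('n) * enn2real (1 / \<infinity>))) * Lp_norm \<infinity> ?U (\<lambda>x. 0 :: real^'N))"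
  and fin: "Lp_norm \<infinity> ?V u < \<infinity>"
 proof -
  have "Lp_norm \<infinity> ?U (\<lambda>x. 0 :: real^'N) < \<infinity>" by (rule le_less_trans[OF z]) simp
  then show "\<forall>q>0. Lp_norm \<infinity> ?V u \<le> ennreal (Cb q \<infinity>) *
   (ennreal (R powr (- real CARD('n) / q)) * Lp_norm (ennreal q) ?U u
    + ennreal (R powr (2 - real CARD('n) * enn2real (1 / \<infinity>))) * Lp_norm \<infinity> ?U (\<lambda>x. 0 :: real^'N))" "Lp_norm \<infinity> ?V u < \<infinity>"
   using bounded[unfolded local_boundedness_def, rule_format, OF x R, of \<infinity> u "\<lambda>x. 0"] uF s vanishes[OF u R] by (auto simp: sol_def)
 qed
 then have "Lp_norm \<infinity> ?V u \<le> ennreal (Cb 2 \<infinity>) * (ennreal (R powr (- real CARD('n) / 2)) * Lp_norm 2 ?U u + ennreal (R powr (2 - real CARD('n) * enn2real (1 / \<infinity>))) * Lp_norm \<infinity> ?U (\<lambda>x. 0 :: real^'N))"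
  by (metis ennreal_numeral zero_less_numeral zero_le_numeral)
 also have "Lp_norm \<infinity> ?U (\<lambda>x. 0 :: real^'N) = 0" using z by simp
 also have "ennreal (Cb 2 \<infinity>) * (ennreal (R powr (- real CARD('n) / 2)) * Lp_norm 2 ?U u + ennreal (R powr (2 - real CARD('n) * enn2real (1 / \<infinity>))) * 0)
  \<le> ennreal K2 * (ennreal (R powr (- real CARD('n) / 2)) * ennreal a)"
 proof -
  have "Lp_norm 2 ?U u \<le> ennreal a" unfolding Lp_norm_2_le_iff[OF a UV(3)]
   using measurable_restrict_mono[OF E.H_measurable(1)[OF u], of ?U] b by auto
  then show ?thesis unfolding K2_def mult_zero_right add_0_right by (intro mult_mono ennreal_leI) auto
 qed
 also have "... = ennreal (K2 * R powr (- real CARD('n) / 2) * a)" using a by (simp add: K2_def ennreal_mult mult.assoc)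
 finally have le: "Lp_norm \<infinity> ?V u \<le> ennreal (K2 * R powr (- real CARD('n) / 2) * a)" .
 have m: "u \<in> meas_on ?V" by (rule measurable_restrict_mono[OF E.H_measurable(1)[OF u]]) auto
 then have es: "esssup (lebesgue_on ?V) (\<lambda>x. ennreal (norm (u x))) \<le> ennreal (K2 * R powr (- real CARD('n) / 2) * a)"
  using le by (simp add: Lp_norm_def)
 have k0: "0 \<le> K2 * R powr (- real CARD('n) / 2) * a" using a by (simp add: K2_def)
 have "AE z in lebesgue_on ?V. ennreal (norm (u z)) \<le> esssup (lebesgue_on ?V) (\<lambda>x. ennreal (norm (u x)))" by (rule esssup_AE)
 then have "AE z in lebesgue_on ?V. norm (u z) \<le> K2 * R powr (- real CARD('n) / 2) * a"
 proof eventually_elim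
  case (elim z)
  then show ?case using order_trans[OF elim es] k0 by (simp add: ennreal_le_iff)
 qed
 then show ?thesis unfolding AE_on_iff[OF UV(2)] .
qed

text \<open>The weight is \<zeta> = 1 - \<psi>: it equals 1 off the ball of radius r, vanishes near
  the ball of radius r/2, and has partial derivatives of size at most M/r in between.\<close>

lemma caccioppoli_annulus:
 assumes u: "u \<in> E.H" and r: "r > 0" and s: "sol (W - cball y (r/2)) u"
 shows "L2sq (W - cball y r) (wD W u) \<le> ennreal (K1 / r^2) * L2sq (W \<inter> cball y r - cball y (r/2)) u"
proof -
 let ?U = "W - cball y (r/2)"
 have U: "open ?U" "?U \<subseteq> W" "?U \<in> sets lebesgue" using open_W by (auto simp: open_Diff)
 obtain \<psi> where \<psi>: "\<psi> \<in> test_fun UNIV" "\<And>x. x \<in> ball y (3/4*r) \<Longrightarrow> \<psi> x = 1" "\<And>x. x \<notin> ball y r \<Longrightarrow> \<psi> x = 0"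
  "\<And>i x. \<bar>partial_deriv i \<psi> x\<bar> \<le> M / r"
  using M(2)[OF r, of y] by metis
 have sm: "smooth_fun \<psi>" by (rule test_fun_smooth[OF \<psi>(1)])
 define \<zeta> where "\<zeta> = (\<lambda>x. 1 - \<psi> x)"
 have pd: "partial_deriv i \<zeta> = (\<lambda>x. partial_deriv i \<psi> x * (- 1))" for i unfolding \<zeta>_def by (rule partial_deriv_1_minus[OF sm])
 have smz: "smooth_fun \<zeta>" unfolding \<zeta>_def by (intro smooth_fun_diff smooth_fun_const sm)
 have pdt: "partial_deriv i \<zeta> \<in> test_fun UNIV" for i
  unfolding pd by (intro test_fun_mult test_fun_partial_deriv \<psi>(1) smooth_fun_const)
 have pd0: "partial_deriv i \<zeta> x = 0" if "x \<notin> cball y r" for i x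
  using partial_deriv_support[of "cball y r" \<psi> x i] \<psi>(3) that by (simp add: pd)
 have pdb: "\<bar>partial_deriv i \<zeta> x\<bar> \<le> M / r" for i x using \<psi>(4) by (simp add: pd)
 \<comment> \<open>\<zeta> is not compactly supported, so the multiplier property is applied to
   \<psi> on the whole space and the result subtracted from the identity.\<close>
 have F0: "(\<lambda>x. \<zeta> x *\<^sub>R u x) \<in> F0 F nF ?U"
 proof -
  obtain C where C: "\<forall>u\<in>F W. (\<lambda>x. \<psi> x *\<^sub>R u x) \<in> F (W \<inter> UNIV) \<and> nF (W \<inter> UNIV) (\<lambda>x. \<psi> x *\<^sub>R u x) \<le> C * nF W u"
   using multiplier_bound[OF \<psi>(1) open_UNIV connected_UNIV] by blast
  have b: "(\<lambda>x. \<zeta> x *\<^sub>R v x) \<in> F ?U \<and> nF ?U (\<lambda>x. \<zeta> x *\<^sub>R v x) \<le> (1 + C) * nF W v" if v: "v \<in> F W" for v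
  proof -
   have p: "(\<lambda>x. \<psi> x *\<^sub>R v x) \<in> F W" "nF W (\<lambda>x. \<psi> x *\<^sub>R v x) \<le> C * nF W v" using bspec[OF C v] by simp_all
   have e: "(\<lambda>x. v x - \<psi> x *\<^sub>R v x) = (\<lambda>x. \<zeta> x *\<^sub>R v x)" by (simp add: \<zeta>_def scaleR_left_diff_distrib)
   have q: "(\<lambda>x. \<zeta> x *\<^sub>R v x) \<in> F W" "nF W (\<lambda>x. \<zeta> x *\<^sub>R v x) \<le> nF W v + nF W (\<lambda>x. \<psi> x *\<^sub>R v x)"
    using E.F_diff[OF v p(1)] unfolding e by simp_all
   show ?thesis using restrict_F[OF U(1,2) q(1)] q(2) p(2) by (simp add: distrib_right)
  qed
  show ?thesis
  proof (rule multiplier_F0[OF b _ u])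
   show "(\<lambda>x. \<zeta> x *\<^sub>R \<phi> x) \<in> test_vec ?U" if "\<phi> \<in> test_vec W" for \<phi>
    by (rule test_vec_times[OF that smz, of "- ball y (3/4*r)"]) (use \<psi>(2) r in \<open>auto simp: \<zeta>_def\<close>)
  qed
 qed
 have um: "u \<in> meas_on ?U" by (rule measurable_restrict_mono[OF E.H_measurable(1)[OF u] U(2)])
 have fin: "Lp_norm 2 ?U (\<lambda>x. partial_deriv i \<zeta> x *\<^sub>R u x) < \<infinity>" for i unfolding Lp_norm_2_finite_iff[OF U(3)]
 proof
  show "(\<lambda>x. partial_deriv i \<zeta> x *\<^sub>R u x) \<in> meas_on ?U"
   by (intro borel_measurable_scaleR um measurable_restrict_space1[OF test_fun_measurable[OF pdt]])
  have m: "(\<lambda>x. ennreal ((norm (u x))^2) * indicator (W \<inter> ball y (2 * r)) x) \<in> meas_L"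
   using open_W by (intro measurable_indicator_comp[OF E.sets_W E.H_measurable(1)[OF u], where g = "\<lambda>v. ennreal ((norm v)^2)"]) (auto simp: open_Int)
  have "L2sq ?U (\<lambda>x. partial_deriv i \<zeta> x *\<^sub>R u x) \<le> (\<integral>\<^sup>+x. ennreal ((M / r)^2) * (ennreal ((norm (u x))^2) * indicator (W \<inter> ball y (2 * r)) x) \<partial>lebesgue)"
   unfolding L2sq_def
  proof (intro nn_integral_mono)
   fix x
   show "ennreal ((norm (partial_deriv i \<zeta> x *\<^sub>R u x))^2) * indicator ?U x \<le> ennreal ((M / r)^2) * (ennreal ((norm (u x))^2) * indicator (W \<inter> ball y (2 * r)) x)"
   proof (cases "x \<in> cball y r \<and> x \<in> W")
    case True
    have "(norm (partial_deriv i \<zeta> x *\<^sub>R u x))^2 \<le> (M / r)^2 * (norm (u x))^2"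
     unfolding norm_scaleR power_mult_distrib using pdb[of i x] by (intro mult_right_mono power_mono) auto
    then have "ennreal ((norm (partial_deriv i \<zeta> x *\<^sub>R u x))^2) \<le> ennreal ((M / r)^2) * ennreal ((norm (u x))^2)"
     by (simp add: ennreal_leI ennreal_mult[symmetric])
    moreover have "x \<in> W \<inter> ball y (2 * r)" using True r by auto
    ultimately show ?thesis by (auto simp: indicator_def)
   next
    case False
    then show ?thesis using pd0[of x i] by (auto simp: indicator_def)
   qed
  qed
  also have "... = ennreal ((M / r)^2) * L2sq (W \<inter> ball y (2 * r)) u" unfolding L2sq_def by (rule nn_integral_cmult[OF m])
  also have "... < \<infinity>" using E.H_hardy[OF u, of "2 * r" y] r by (auto simp: ennreal_mult_less_top intro: le_less_trans)
  finally show "L2sq ?U (\<lambda>x. partial_deriv i \<zeta> x *\<^sub>R u x) < \<infinity>" .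
 qed
 have uF: "u \<in> F ?U" using restrict_F[OF U(1,2) E.H_F[OF u]] by blast
 have main: "(\<integral>\<^sup>+x. ennreal ((norm (wD ?U u x))^2 * (\<zeta> x)^2) \<partial>lebesgue_on ?U)
     \<le> ennreal Cc * (\<integral>\<^sup>+x. ennreal ((norm (u x))^2 * (\<Sum>i\<in>UNIV. (partial_deriv i \<zeta> x)^2)) \<partial>lebesgue_on ?U)"
  using cacc U(1,2) uF s smz pdt F0 fin unfolding caccioppoli_def sol_def by blast
 have "L2sq (W - cball y r) (wD W u) = L2sq (W - cball y r) (wD ?U u)"
  by (rule L2sq_cong_AE[OF U(3)]) (use wD_restrict[OF U(1,2) u] r in \<open>auto elim: eventually_mono\<close>)
 also have "... \<le> (\<integral>\<^sup>+x\<in>?U. ennreal ((norm (wD ?U u x))^2 * (\<zeta> x)^2) \<partial>lebesgue)"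
  unfolding L2sq_def by (intro nn_integral_mono) (use \<psi>(3) r in \<open>auto simp: indicator_def \<zeta>_def\<close>)
 also have "... = (\<integral>\<^sup>+x. ennreal ((norm (wD ?U u x))^2 * (\<zeta> x)^2) \<partial>lebesgue_on ?U)"
  using U(3) by (simp add: nn_integral_restrict_space)
 also note main
 also have "(\<integral>\<^sup>+x. ennreal ((norm (u x))^2 * (\<Sum>i\<in>UNIV. (partial_deriv i \<zeta> x)^2)) \<partial>lebesgue_on ?U)
  = (\<integral>\<^sup>+x\<in>?U. ennreal ((norm (u x))^2 * (\<Sum>i\<in>UNIV. (partial_deriv i \<zeta> x)^2)) \<partial>lebesgue)"
  using U(3) by (simp add: nn_integral_restrict_space)
 also have "... \<le> (\<integral>\<^sup>+x. ennreal (real CARD('n) * (M / r)^2) * (ennreal ((norm (u x))^2) * indicator (W \<inter> cball y r - cball y (r/2)) x) \<partial>lebesgue)"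
 proof (intro nn_integral_mono)
  fix x
  show "ennreal ((norm (u x))^2 * (\<Sum>i\<in>UNIV. (partial_deriv i \<zeta> x)^2)) * indicator ?U x \<le>
   ennreal (real CARD('n) * (M / r)^2) * (ennreal ((norm (u x))^2) * indicator (W \<inter> cball y r - cball y (r/2)) x)"
  proof (cases "x \<in> W \<inter> cball y r - cball y (r/2)")
   case True
   have "(\<Sum>i\<in>UNIV. (partial_deriv i \<zeta> x)^2) \<le> (\<Sum>i\<in>(UNIV::'n set). (M / r)^2)"
    using power_mono[OF pdb[of _ x], of _ 2] by (intro sum_mono) simp
   from mult_left_mono[OF this, of "(norm (u x))^2"]
   have "(norm (u x))^2 * (\<Sum>i\<in>UNIV. (partial_deriv i \<zeta> x)^2) \<le> (real CARD('n) * (M / r)^2) * (norm (u x))^2"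
    by (simp add: mult_ac)
   then have "ennreal ((norm (u x))^2 * (\<Sum>i\<in>UNIV. (partial_deriv i \<zeta> x)^2)) \<le> ennreal (real CARD('n) * (M / r)^2) * ennreal ((norm (u x))^2)"
    by (simp only: ennreal_leI ennreal_mult[symmetric] mult_nonneg_nonneg of_nat_0_le_iff zero_le_power2)
   then show ?thesis using True by simp
  next
   case False
   then show ?thesis using pd0[of x] by (auto simp: indicator_def)
  qed
 qed
 also have "... = ennreal (real CARD('n) * (M / r)^2) * L2sq (W \<inter> cball y r - cball y (r/2)) u" unfolding L2sq_def
 proof (rule nn_integral_cmult, rule measurable_indicator_comp[OF E.sets_W E.H_measurable(1)[OF u], where g = "\<lambda>v. ennreal ((norm v)^2)"])
  show "W \<inter> cball y r - cball y (r/2) \<in> sets lebesgue" using E.sets_W by (intro sets.Diff sets.Int) auto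
 qed auto
 finally have "L2sq (W - cball y r) (wD W u) \<le> ennreal Cc * (ennreal (real CARD('n) * (M / r)^2) * L2sq (W \<inter> cball y r - cball y (r/2)) u)"
  by (simp add: mult_left_mono)
 also have "... \<le> ennreal \<bar>Cc\<bar> * (ennreal (real CARD('n) * (M / r)^2) * L2sq (W \<inter> cball y r - cball y (r/2)) u)"
  by (intro mult_right_mono ennreal_leI) auto
 also have "... = ennreal (K1 / r^2) * L2sq (W \<inter> cball y r - cball y (r/2)) u"
  by (simp add: K1_def power_divide mult.assoc[symmetric] ennreal_mult[symmetric])
 finally show ?thesis .
qed

end

section \<open>Interpretation of the abstract locales\<close>

context green_problem
begin

lemma setting: "green_setting W F nF c\<^sub>0 B \<Gamma> \<gamma> sol K1 K2 \<eta> CH"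
proof (rule green_setting.intro[OF E.elliptic_space_axioms], rule green_setting_axioms.intro, goal_cases)
 case 1
 show ?case using ext by (simp add: bounded_form_extension_def)
next
 case (2 u v)
 then show ?case by (rule E.bounded_form_abs[OF ext])
next
 case 3
 show ?case using coercive by (simp add: coercive_form_def)
next
 case (4 u)
 then show ?case using coercive by (simp add: coercive_form_def)
next
 case (5 U u)
 then show ?case by (rule sol_left)
next
 case (6 U u)
 then show ?case by (rule sol_right)
next
 case 7
 show ?case by (simp add: K1_def)
next
 case 8
 show ?case by (simp add: K2_def)
next
 case (9 u y r)
 then show ?case by (rule caccioppoli_annulus)
next
 case (10 u x R a)
 then show ?case by (rule boundedness)
next
 case (11 R\<^sub>0)
 then show ?case using hoelder unfolding hoelder_property_def by meson
next
 case (12 u x R\<^sub>0)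
 have uF: "u \<in> F (ball x (2 * R\<^sub>0))" using restrict_F[OF open_ball 12(3) E.H_F[OF 12(1)]] by blast
 show ?case
  unfolding AE_on_iff[OF open_ball, symmetric]
  using hoelder[unfolded hoelder_property_def, rule_format, OF 12(2)] 12(3) uF 12(4) unfolding sol_def by meson
qed

text \<open>The Green matrix satisfies the adjoint equation against test fields; density and
  boundedness of both sides extend it to the whole space, which is the form preserved by exchanging
  the arguments of B.\<close>

lemma kernel: "green_kernel W F nF c\<^sub>0 B \<Gamma> \<gamma> sol K1 K2 \<eta> CH G"
proof -
 interpret S: green_setting W F nF c\<^sub>0 B \<Gamma> \<gamma> sol K1 K2 \<eta> CH by (rule setting)
 let ?w = "\<lambda>f y. \<chi> k. LINT x:W|lebesgue. (\<Sum>j\<in>UNIV. G x y $ j $ k * f x $ j)"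
 have w: "?w f \<in> E.H" "adjoint_weak_solution L W (?w f) f" if "f \<in> Linf_c W" for f
  using green that unfolding continuous_green_matrix_def green_matrix_def by meson+
 show ?thesis
 proof (rule green_kernel.intro[OF setting], rule green_kernel_axioms.intro, goal_cases)
  case 1
  show ?case using green by (simp add: continuous_green_matrix_def)
 next
  case (2 f)
  then show ?case by (rule w)
 next
  case (3 f v)
  obtain a R where a: "f \<in> meas_on W" "L2sq W f \<le> ennreal (a^2)" "a \<ge> 0"
   and supp: "\<forall>x\<in>W. x \<notin> ball 0 R \<longrightarrow> f x = 0" and R: "R > 0"
   using Linf_c_L2[OF 3(1) open_W] by metis
  note rb = S.rhs_bound[OF a supp R]
  \<comment> \<open>Bounds the dependence of the defect \<open>?d\<close> on v; the summand 1 makes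
    it positive, so that e / c can serve as accuracy.\<close>
  define c where "c = \<bar>\<Gamma>\<bar> * nF W (?w f) + a * S.\<kappa> * R + 1"
  have c: "c > 0" using E.H_nonneg[OF w(1)[OF 3(1)]] a(3) S.\<kappa>_nonneg R unfolding c_def
   by (intro add_nonneg_pos add_nonneg_nonneg mult_nonneg_nonneg) auto
  let ?d = "B v (?w f) - (LINT x:W|lebesgue. f x \<bullet> v x)"
  have "\<bar>?d\<bar> \<le> e" if e: "e > 0" for e
  proof -
   obtain \<phi> where \<phi>: "\<phi> \<in> test_vec W" "nF W (\<lambda>x. v x - \<phi> x) < e / c" using E.H_approx[OF 3(2), of "e / c"] e c by auto
   have \<phi>H: "\<phi> \<in> E.H" by (rule E.test_H[OF \<phi>(1)])
   have d: "(\<lambda>x. v x - \<phi> x) \<in> E.H" by (rule E.H_diff[OF 3(2) \<phi>H])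
   have N: "nF W (\<lambda>x. v x - \<phi> x) \<ge> 0" by (rule E.H_nonneg[OF d])
   have "B \<phi> (?w f) = (LINT x:W|lebesgue. f x \<bullet> \<phi> x)"
    using form_restrict(4)[OF open_W order_refl w(1)[OF 3(1)] \<phi>(1)] w(2)[OF 3(1), unfolded adjoint_weak_solution_def, rule_format, OF \<phi>(1)]
    by linarith
   moreover have "B (\<lambda>x. v x - \<phi> x) (?w f) = B v (?w f) - B \<phi> (?w f)"
    by (rule E.bilinear_form_on_diff(1)[OF S.bil 3(2) \<phi>H w(1)[OF 3(1)]])
   moreover have "(LINT x:W|lebesgue. f x \<bullet> (v x - \<phi> x)) = (LINT x:W|lebesgue. f x \<bullet> v x) - (LINT x:W|lebesgue. f x \<bullet> \<phi> x)"
    unfolding inner_diff_right by (intro set_integral_diff rb(1) 3(2) \<phi>H)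
   ultimately have "?d = B (\<lambda>x. v x - \<phi> x) (?w f) - (LINT x:W|lebesgue. f x \<bullet> (v x - \<phi> x))" by linarith
   also have "\<bar>...\<bar> \<le> \<Gamma> * nF W (\<lambda>x. v x - \<phi> x) * nF W (?w f) + a * S.\<kappa> * R * nF W (\<lambda>x. v x - \<phi> x)"
    using S.bnd[OF d w(1)[OF 3(1)]] rb(2)[OF d] by linarith
   also have "... \<le> c * nF W (\<lambda>x. v x - \<phi> x)"
   proof -
    have "\<Gamma> * nF W (\<lambda>x. v x - \<phi> x) * nF W (?w f) \<le> \<bar>\<Gamma>\<bar> * nF W (\<lambda>x. v x - \<phi> x) * nF W (?w f)"
     by (intro mult_right_mono N E.H_nonneg w(1) 3(1)) auto
    moreover have "c * nF W (\<lambda>x. v x - \<phi> x) = \<bar>\<Gamma>\<bar> * nF W (\<lambda>x. v x - \<phi> x) * nF W (?w f) + a * S.\<kappa> * R * nF W (\<lambda>x. v x - \<phi> x) + nF W (\<lambda>x. v x - \<phi> x)"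
     unfolding c_def by algebra
    ultimately show ?thesis using N by linarith
   qed
   also have "... \<le> e" using \<phi>(2) c by (simp add: field_simps)
   finally show ?thesis .
  qed
  then have "\<bar>?d\<bar> \<le> 0" by (meson field_le_epsilon le_add_same_cancel2 order_trans order_refl)
  then show ?case by linarith
 qed
qed

text \<open>A ball is connected, so if it met both W and its complement it would meet the frontier,
  which is too far away.\<close>

lemma ball_subset_of_infdist:
 assumes "y \<in> W" "2 * R\<^sub>0 < infdist y (frontier W)"
 shows "ball y (2 * R\<^sub>0) \<subseteq> W"
proof (rule ccontr)
 assume n: "\<not> ball y (2 * R\<^sub>0) \<subseteq> W"
 then obtain z where z: "z \<in> ball y (2 * R\<^sub>0)" "z \<notin> W" by blast
 then have "y \<in> ball y (2 * R\<^sub>0)" by (metis centre_in_ball ball_eq_empty empty_iff not_le)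
 then have "ball y (2 * R\<^sub>0) \<inter> frontier W \<noteq> {}"
  using connected_Int_frontier[OF connected_ball, of y "2 * R\<^sub>0" W] assms(1) z by blast
 then obtain w where w: "w \<in> frontier W" "dist y w < 2 * R\<^sub>0" by auto
 show False using infdist_le[OF w(1), of y] w(2) assms(2) by linarith
qed

end

section \<open>The global estimates with constants chosen in advance\<close>

lemma ennreal_sum_bound:
 assumes "X \<le> ennreal (c * p)" "Y \<le> ennreal (c * p)" "2 * \<bar>c\<bar> \<le> C" "p \<ge> 0"
 shows "X + Y \<le> ennreal (C * p)"
proof -
 have p: "c * p \<le> \<bar>c\<bar> * p" by (intro mult_right_mono assms) simp
 have "X + Y \<le> ennreal (\<bar>c\<bar> * p) + ennreal (\<bar>c\<bar> * p)"
  by (intro add_mono order_trans[OF assms(1)] order_trans[OF assms(2)] ennreal_leI p)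
 also have "... = ennreal (2 * \<bar>c\<bar> * p)" using assms(4) by (subst ennreal_plus[symmetric]) auto
 also have "... \<le> ennreal (C * p)" by (intro ennreal_leI mult_right_mono assms)
 finally show ?thesis .
qed

theorem corollary3p12:
  fixes c\<^sub>0 \<Gamma> \<gamma> C\<^sub>c\<^sub>a\<^sub>c :: real
    and C\<^sub>b\<^sub>b :: "real \<Rightarrow> ennreal \<Rightarrow> real"
  assumes "CARD('n::finite) \<ge> 3"
  shows "\<exists>C>0. \<exists>Cq :: real \<Rightarrow> real.
    \<forall>(\<Omega> :: (real^'n) set) (L :: ('n, 'N::finite) operator)
      (F :: ('n, 'N) family) (nF :: ('n, 'N) family_norm)
      (B :: (real^'n \<Rightarrow> real^'N) \<Rightarrow> (real^'n \<Rightarrow> real^'N) \<Rightarrow> real)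
      (\<eta> :: real \<Rightarrow> real) (C\<^sub>H :: real \<Rightarrow> real)
      (G :: real^'n \<Rightarrow> real^'n \<Rightarrow> real^'N^'N).
      open \<Omega> \<and> connected \<Omega> \<and> \<Omega> \<noteq> UNIV \<and>
      admissible_coeffs \<Omega> L \<and>
      (\<forall>W. open W \<and> W \<subseteq> \<Omega> \<longrightarrow>
         banach_function_space W (F W) (nF W) \<and>
         restriction_property F nF W \<and>
         hilbert_property F nF W \<and>
         (\<exists>c. embedding_property F nF c W) \<and>
         multiplier_property F nF W) \<and>
      embedding_property F nF c\<^sub>0 \<Omega> \<and>
      bounded_form_extension F nF L \<Omega> \<Gamma> B \<and>
      coercive_form F nF \<Omega> \<gamma> B \<and>
      caccioppoli F nF L \<Omega> C\<^sub>c\<^sub>a\<^sub>c \<and>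
      local_boundedness F nF L \<Omega> C\<^sub>b\<^sub>b \<and>
      hoelder_property F L \<Omega> \<eta> C\<^sub>H \<and>
      continuous_green_matrix F nF L \<Omega> G
      \<longrightarrow>
      (\<forall>x\<in>\<Omega>. \<forall>y\<in>\<Omega>. \<forall>r>0.
         Y_norm (\<Omega> - cball y r) (\<lambda>z. G z y) + Y_norm (\<Omega> - cball x r) (\<lambda>z. G x z)
           \<le> ennreal (C * r powr (1 - real CARD('n) / 2))) \<and>
      (\<forall>x\<in>\<Omega>. \<forall>y\<in>\<Omega>. \<forall>r>0. \<forall>q. 1 \<le> q \<and> q < real CARD('n) / (real CARD('n) - 2) \<longrightarrow>
         Lp_norm (ennreal q) (\<Omega> \<inter> ball y r) (\<lambda>z. G z y)
         + Lp_norm (ennreal q) (\<Omega> \<inter> ball x r) (\<lambda>z. G x z)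
           \<le> ennreal (Cq q * r powr (2 - real CARD('n) + real CARD('n) / q))) \<and>
      (\<forall>y\<in>\<Omega>. weakly_diff \<Omega> (\<lambda>z. G z y)) \<and> (\<forall>x\<in>\<Omega>. weakly_diff \<Omega> (\<lambda>z. G x z)) \<and>
      (\<forall>x\<in>\<Omega>. \<forall>y\<in>\<Omega>. \<forall>r>0. \<forall>q. 1 \<le> q \<and> q < real CARD('n) / (real CARD('n) - 1) \<longrightarrow>
         Lp_norm (ennreal q) (\<Omega> \<inter> ball y r) (wD \<Omega> (\<lambda>z. G z y))
         + Lp_norm (ennreal q) (\<Omega> \<inter> ball x r) (wD \<Omega> (\<lambda>z. G x z))
           \<le> ennreal (Cq q * r powr (1 - real CARD('n) + real CARD('n) / q))) \<and>
      (\<forall>x\<in>\<Omega>. \<forall>y\<in>\<Omega>. \<forall>\<tau>>0.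
         emeasure lebesgue {z\<in>\<Omega>. norm (G z y) > \<tau>} + emeasure lebesgue {z\<in>\<Omega>. norm (G x z) > \<tau>}
           \<le> ennreal (C * \<tau> powr (- real CARD('n) / (real CARD('n) - 2)))) \<and>
      (\<forall>x\<in>\<Omega>. \<forall>y\<in>\<Omega>. \<forall>\<tau>>0.
         emeasure lebesgue {z\<in>\<Omega>. norm (wD \<Omega> (\<lambda>z. G z y) z) > \<tau>}
         + emeasure lebesgue {z\<in>\<Omega>. norm (wD \<Omega> (\<lambda>z. G x z) z) > \<tau>}
           \<le> ennreal (C * \<tau> powr (- real CARD('n) / (real CARD('n) - 1)))) \<and>
      (\<forall>x\<in>\<Omega>. \<forall>y\<in>\<Omega>. x \<noteq> y \<longrightarrow> norm (G x y) \<le> C * norm (x - y) powr (2 - real CARD('n))) \<and>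
      (\<forall>x\<in>\<Omega>. \<forall>y\<in>\<Omega>. \<forall>R R\<^sub>0.
         0 < R \<and> R \<le> R\<^sub>0 \<and>
         R\<^sub>0 < Min {infdist x (frontier \<Omega>), infdist y (frontier \<Omega>), norm (x - y)} / 2 \<longrightarrow>
         (\<forall>z. norm (x - z) < R / 2 \<longrightarrow>
            norm (G x y - G z y)
              \<le> C\<^sub>H R\<^sub>0 * C * (norm (x - z) / R) powr \<eta> R\<^sub>0 * R powr (2 - real CARD('n))) \<and>
         (\<forall>z. norm (y - z) < R / 2 \<longrightarrow>
            norm (G x y - G x z)
              \<le> C\<^sub>H R\<^sub>0 * C * (norm (y - z) / R) powr \<eta> R\<^sub>0 * R powr (2 - real CARD('n))))"
proof -
 have n: "real CARD('n) \<ge> 3" using assms by linarith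
 obtain M :: real where M: "M > 0" "\<And>(y::real^'n) r. r > 0 \<Longrightarrow> \<exists>\<psi>\<in>test_fun UNIV.
   (\<forall>x\<in>ball y (3/4*r). \<psi> x = 1) \<and> (\<forall>x. x \<notin> ball y r \<longrightarrow> \<psi> x = 0) \<and> (\<forall>x. 0 \<le> \<psi> x \<and> \<psi> x \<le> 1) \<and>
   (\<forall>i x. \<bar>partial_deriv i \<psi> x\<bar> \<le> M / r)" by (rule cutoff_exists) blast
 define k\<^sub>1 k\<^sub>2 where "k\<^sub>1 = \<bar>C\<^sub>c\<^sub>a\<^sub>c\<bar> * (real CARD('n) * M^2)" and "k\<^sub>2 = \<bar>C\<^sub>b\<^sub>b 2 \<infinity>\<bar>"
 \<comment> \<open>Exported from their locale, these constants are functions of the listed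
   parameters alone, so they can be formed before a domain is given; in the interpretation below
   they become the constants of that instance.\<close>
 define A where "A = green_kernel.A_mat TYPE('n) TYPE('N) c\<^sub>0 \<gamma> k\<^sub>2"
 define E where "E = green_kernel.E_mat TYPE('n) TYPE('N) c\<^sub>0 \<gamma> k\<^sub>1 k\<^sub>2"
 define Hc where "Hc = green_kernel.H_mat TYPE('n) TYPE('N) c\<^sub>0 \<gamma> k\<^sub>2"
 define cY where "cY = A * kernel_const TYPE('n) (2 * real CARD('n)) powr (1 / two_star TYPE('n)) + sqrt E"
 define cW where "cW = ball_vol TYPE('n) * (A + 1) powr (real CARD('n) / (real CARD('n) - 2))"
 define cV where "cV = ball_vol TYPE('n) + E"
 define cq where "cq = (\<lambda>q. A * kernel_const TYPE('n) ((real CARD('n) - 2) * q) powr (1 / q))"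
 define cr where "cr = (\<lambda>q. ((ball_vol TYPE('n) + E * 2 powr (real CARD('n) - 2)) / (1 - 2 powr (- (real CARD('n) - q * (real CARD('n) - 1))))) powr (1 / q))"
 \<comment> \<open>One constant dominates all estimates without q. The 1 makes it positive; absolute
   values appear because no sign is known before the interpretation, and the factor 2 pays for the
   two summands of each estimate.\<close>
 define C where "C = 1 + 2 * \<bar>cY\<bar> + 2 * \<bar>cW\<bar> + 2 * \<bar>cV\<bar> + \<bar>A\<bar> + \<bar>Hc\<bar>"
 define Cq where "Cq = (\<lambda>q. 2 * \<bar>cq q\<bar> + 2 * \<bar>cr q\<bar>)"
 have C: "C > 0" "2 * \<bar>cY\<bar> \<le> C" "2 * \<bar>cW\<bar> \<le> C" "2 * \<bar>cV\<bar> \<le> C" "A \<le> C" "Hc \<le> C" by (auto simp: C_def)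
 have cq: "cq q = A * kernel_const TYPE('n) ((real CARD('n) - 2) * q) powr (1 / q)" for q by (simp only: cq_def)
 have cr: "cr q = ((ball_vol TYPE('n) + E * 2 powr (real CARD('n) - 2)) / (1 - 2 powr (- (real CARD('n) - q * (real CARD('n) - 1))))) powr (1 / q)" for q
  by (simp only: cr_def)
 have Cq: "2 * \<bar>cq q\<bar> \<le> Cq q" "2 * \<bar>cr q\<bar> \<le> Cq q" for q by (auto simp: Cq_def)
 show ?thesis
 proof (rule exI[of _ C], rule conjI[OF C(1)], rule exI[of _ Cq], intro allI, rule impI, goal_cases)
  case hyp: (1 W L F nF B \<eta> C\<^sub>H G)
  interpret green_problem W L F nF B \<eta> C\<^sub>H G c\<^sub>0 \<Gamma> \<gamma> C\<^sub>c\<^sub>a\<^sub>c C\<^sub>b\<^sub>b M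
   by (rule green_problem.intro; (rule assms M; assumption?)?; use hyp order_refl in meson)
  \<comment> \<open>Identifies the constants of the instance with those fixed above, so that A, E
    and Hc are the ones its estimates produce.\<close>
  have K: "green_problem.K1 TYPE('n) C\<^sub>c\<^sub>a\<^sub>c M = k\<^sub>1" "green_problem.K2 C\<^sub>b\<^sub>b = k\<^sub>2" by (simp_all add: k\<^sub>1_def k\<^sub>2_def K1_def K2_def)
  interpret K: green_kernel W F nF c\<^sub>0 B \<Gamma> \<gamma> sol k\<^sub>1 k\<^sub>2 \<eta> C\<^sub>H G using kernel unfolding K .
  have col: "singular_function W y (\<lambda>z. G z y) A E" if "y \<in> W" for y using K.columns_singular[OF that] by (simp only: A_def E_def)
  have row: "singular_function W x (\<lambda>z. G x z) A E" if "x \<in> W" for x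
   using K.rows_singular[OF that bounded_linear_ident] by (simp add: A_def E_def)
  note est = singular_function.Y_estimate singular_function.Lp_estimate singular_function.deriv_Lp_estimate
   singular_function.weak_type singular_function.deriv_weak_type
  have far: "2 * R\<^sub>0 < infdist x (frontier W)" "2 * R\<^sub>0 < infdist y (frontier W)" "2 * R\<^sub>0 < dist x y"
   if "R\<^sub>0 < Min {infdist x (frontier W), infdist y (frontier W), norm (x - y)} / 2" for x y R\<^sub>0 using that by (auto simp: dist_norm)
  have ho: "C\<^sub>H R\<^sub>0 * Hc * t powr a * R powr b \<le> C\<^sub>H R\<^sub>0 * C * t powr a * R powr b" if "R\<^sub>0 > 0" for t a b R R\<^sub>0
   using K.hoelder(1)[OF that] C(6) by (intro mult_right_mono mult_left_mono) auto
  show ?case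
  proof (intro conjI ballI allI impI, goal_cases)
   case (1 x y r)
   show ?case by (rule ennreal_sum_bound[OF est(1)[OF col[OF 1(2)] 1(3), folded cY_def] est(1)[OF row[OF 1(1)] 1(3), folded cY_def] C(2)]) simp
  next
   case (2 x y r q)
   show ?case
    by (rule ennreal_sum_bound[OF est(2)[OF col[OF 2(2)] _ _ 2(3), folded cq] est(2)[OF row[OF 2(1)] _ _ 2(3), folded cq] Cq(1)])
     (use 2(4) in auto)
  next
   case (3 y)
   then show ?case by (rule singular_function.weakly[OF col])
  next
   case (4 x)
   then show ?case by (rule singular_function.weakly[OF row])
  next
   case (5 x y r q)
   show ?case
    by (rule ennreal_sum_bound[OF est(3)[OF col[OF 5(2)] _ _ 5(3), folded cr] est(3)[OF row[OF 5(1)] _ _ 5(3), folded cr] Cq(2)])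
     (use 5(4) in auto)
  next
   case (6 x y \<tau>)
   show ?case by (rule ennreal_sum_bound[OF est(4)[OF col[OF 6(2)] 6(3), folded cW_def] est(4)[OF row[OF 6(1)] 6(3), folded cW_def] C(3)]) simp
  next
   case (7 x y \<tau>)
   show ?case by (rule ennreal_sum_bound[OF est(5)[OF col[OF 7(2)] 7(3), folded cV_def] est(5)[OF row[OF 7(1)] 7(3), folded cV_def] C(4)]) simp
  next
   case (8 x y)
   have "norm (G x y) \<le> A * norm (x - y) powr (2 - real CARD('n))"
    using singular_function.decay[OF col[OF 8(2)] 8(1,3)] by (simp add: dist_norm)
   also have "... \<le> C * norm (x - y) powr (2 - real CARD('n))" by (intro mult_right_mono C) simp
   finally show ?case .
  next
   case (9 x y R R\<^sub>0 z)
   then have f: "2 * R\<^sub>0 < infdist x (frontier W)" "2 * R\<^sub>0 < dist x y" "0 < R" "R \<le> R\<^sub>0" "R\<^sub>0 > 0" using far by auto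
   show ?case
    using K.matrix_hoelder_left[OF 9(1,2) f(3,4) ball_subset_of_infdist[OF 9(1) f(1)] f(2) 9(4)] ho[OF f(5)]
    unfolding Hc_def by (rule order_trans)
  next
   case (10 x y R R\<^sub>0 z)
   then have f: "2 * R\<^sub>0 < infdist y (frontier W)" "2 * R\<^sub>0 < dist x y" "0 < R" "R \<le> R\<^sub>0" "R\<^sub>0 > 0" using far by auto
   show ?case
    using K.matrix_hoelder[OF 10(1,2) f(3,4) ball_subset_of_infdist[OF 10(2) f(1)] f(2) 10(4)] ho[OF f(5)] unfolding Hc_def by (rule order_trans)
  qed
 qed
qed

end
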